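(* Let $d\ge3$ be an integer, $z_0>0$, $\mu\neq0$, and let $a_1,c_1,a_{1/2},c_{1/2}$ be real with $a_1>0$, $c_1\ne0$, $a_{1/2}c_{1/2}>0$. Let $$F(z)=1-m_0z^d+\frac{(d-2)\mu^2}{2(d-1)z_0^{2(d-2)}}z^{2(d-1)}-\frac{a_{1/2}c_{1/2}}{d-1}z-\frac{a_1c_1^2}{d-2}z^2,$$ with $m_0$ fixed by $F(z_0)=0$, and assume $F'(z_0)<0$ (positive temperature). For real $\omega\neq0$ consider on $(0,z_0)$ the system $$z^{d-3}\big(z^{-(d-3)}Fa'\big)'+\frac{\omega^2}{F}a=(d-2)^2\mu^2\frac{z^{2(d-2)}}{z_0^{2(d-2)}}a-i(d-2)\mu\frac{z^{2(d-2)}}{z_0^{d-2}}\big(a_{1/2}\zeta+2a_1c_1\xi\big),$$ $$z^{-d}\big(z^dF\zeta'\big)'+\frac{\omega^2}{F}\zeta=\frac{c_{1/2}}{z}\Big(\frac{i(d-2)\mu}{z_0^{d-2}}a+a_{1/2}\zeta+2a_1c_1\xi\Big),$$ $$z^{-(d-1)}\big(z^{d-1}F\xi'\big)'+\frac{\omega^2}{F}\xi=c_1\Big(\frac{i(d-2)\mu}{z_0^{d-2}}a+a_{1/2}\zeta+2a_1c_1\xi\Big).$$ Suppose that for every sufficiently small real $\omega\ne0$ we are given a solution $(a,\zeta,\xi)=(a^{\omega},\zeta^{\omega},\xi^{\omega})$ that is ingoing at $z=z_0$, has no scalar source at $z=0$, and has nonzero gauge source $a_{(0)}\neq0$. Let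 $\sigma(\omega)=\dfrac{(d-2)\,a_{(d-2)}}{i\omega\,a_{(0)}}$ be its optical conductivity. Then $$\lim_{\omega\to0}\sigma(\omega)=z_0^{-(d-3)}\left(1+\frac{(d-2)^2\mu^2}{2a_1c_1^2+z_0^{-1}a_{1/2}c_{1/2}}\right).$$
   Context: Primes denote $d/dz$; the unknown functions $a,\zeta,\xi$ are complex valued. The system is the linearised homogeneous perturbation problem (for a gauge-field perturbation $a$ and rescaled scalar perturbations $\zeta,\xi$ in one fixed spatial direction) around a charged black brane with blackening function $F$, horizon $z=z_0$ and temperature $T=-F'(z_0)/(4\pi)$; units $16\pi G_{d+1}=1$. Under the stated parameter assumptions $F>0$ on $(0,z_0)$. *Ingoing at $z_0$*: each of $a,\zeta,\xi$ equals $(z_0-z)^{i\omega/F'(z_0)}$ times a function analytic at $z=z_0$. *No scalar source*: near $z=0$ the function $\zeta$ has Frobenius exponents $0$ and $1-d$, and $\xi$ has exponents $0$ and $2-d$; the condition is that the modes $z^{1-d}$ of $\zeta$ and $z^{2-d}$ of $\xi$ are absent, i.e. $\zeta$ and $\xi$ stay bounded as $z\to0$. *Gauge source and response*: under the no-source condition $a$ has near $z=0$ a Frobenius expansion in nonnegative integer powers of $z$ and possibly logarithmic terms; $a_{(0)}$ denotes the coefficient of $z^0$ (i.e. $a_{(0)}=\lim_{z\to0}a(z)$) and $a_{(d-2)}$ the coefficient of $z^{d-2}$ (the term without a logarithm). *)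

theory Defs
  imports "HOL-Analysis.Analysis"
begin

abbreviation ddz :: "(real \<Rightarrow> complex) \<Rightarrow> real \<Rightarrow> complex" where
  "ddz f \<equiv> (\<lambda>z. vector_derivative f (at z))"

(* In all definitions below, ah and ch stand for a_{1/2} and c_{1/2}. *)

definition blackening ::
  "nat \<Rightarrow> real \<Rightarrow> real \<Rightarrow> real \<Rightarrow> real \<Rightarrow> real \<Rightarrow> real \<Rightarrow> real \<Rightarrow> real \<Rightarrow> real" where
  "blackening d z0 \<mu> a1 c1 ah ch m0 z =
     1 - m0 * z ^ d
       + (real d - 2) * \<mu>\<^sup>2 / (2 * (real d - 1) * z0 ^ (2 * (d - 2))) * z ^ (2 * (d - 1))
       - ah * ch / (real d - 1) * z
       - a1 * c1\<^sup>2 / (real d - 2) * z\<^sup>2"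

definition twice_differentiable_on :: "(real \<Rightarrow> complex) \<Rightarrow> real set \<Rightarrow> bool" where
  "twice_differentiable_on f S \<longleftrightarrow>
     (\<forall>z\<in>S. f differentiable (at z) \<and> ddz f differentiable (at z))"

(* The factors z^{-(d-3)}, z^{-d}, z^{-(d-1)} are written as divisions, and d - 3, d - 2, d - 1
   are truncated subtractions on nat; the system is only meant for d \<ge> 3. *)
definition perturbation_solution ::
  "nat \<Rightarrow> real \<Rightarrow> real \<Rightarrow> real \<Rightarrow> real \<Rightarrow> real \<Rightarrow> real \<Rightarrow> (real \<Rightarrow> real) \<Rightarrow> real
     \<Rightarrow> (real \<Rightarrow> complex) \<Rightarrow> (real \<Rightarrow> complex) \<Rightarrow> (real \<Rightarrow> complex) \<Rightarrow> bool" where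
  "perturbation_solution d z0 \<mu> a1 c1 ah ch F \<omega> a \<zeta> \<xi> \<longleftrightarrow>
     twice_differentiable_on a {0<..<z0} \<and>
     twice_differentiable_on \<zeta> {0<..<z0} \<and>
     twice_differentiable_on \<xi> {0<..<z0} \<and>
     (\<forall>z\<in>{0<..<z0}.
        of_real (z ^ (d - 3)) * ddz (\<lambda>x. of_real (F x / x ^ (d - 3)) * ddz a x) z
          + of_real (\<omega>\<^sup>2 / F z) * a z
        = of_real ((real d - 2)\<^sup>2 * \<mu>\<^sup>2 * z ^ (2 * (d - 2)) / z0 ^ (2 * (d - 2))) * a z
          - \<i> * of_real ((real d - 2) * \<mu> * z ^ (2 * (d - 2)) / z0 ^ (d - 2))
              * (of_real ah * \<zeta> z + of_real (2 * a1 * c1) * \<xi> z)) \<and>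
     (\<forall>z\<in>{0<..<z0}.
        ddz (\<lambda>x. of_real (x ^ d * F x) * ddz \<zeta> x) z / of_real (z ^ d)
          + of_real (\<omega>\<^sup>2 / F z) * \<zeta> z
        = of_real (ch / z)
          * (\<i> * of_real ((real d - 2) * \<mu> / z0 ^ (d - 2)) * a z
              + of_real ah * \<zeta> z + of_real (2 * a1 * c1) * \<xi> z)) \<and>
     (\<forall>z\<in>{0<..<z0}.
        ddz (\<lambda>x. of_real (x ^ (d - 1) * F x) * ddz \<xi> x) z / of_real (z ^ (d - 1))
          + of_real (\<omega>\<^sup>2 / F z) * \<xi> z
        = of_real c1
          * (\<i> * of_real ((real d - 2) * \<mu> / z0 ^ (d - 2)) * a z
              + of_real ah * \<zeta> z + of_real (2 * a1 * c1) * \<xi> z))"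

(* A complex-valued function of a real variable is analytic at z0 iff near z0 it is the
   restriction of a function holomorphic near z0. *)
definition ingoing :: "real \<Rightarrow> (real \<Rightarrow> real) \<Rightarrow> real \<Rightarrow> (real \<Rightarrow> complex) \<Rightarrow> bool" where
  "ingoing z0 F \<omega> f \<longleftrightarrow>
     (\<exists>g. g analytic_on {complex_of_real z0} \<and>
          (\<forall>\<^sub>F z in at_left z0.
             f z = complex_of_real (z0 - z) powr (\<i> * of_real (\<omega> / deriv F z0)) * g (of_real z)))"

definition no_scalar_source :: "(real \<Rightarrow> complex) \<Rightarrow> (real \<Rightarrow> complex) \<Rightarrow> bool" where
  "no_scalar_source \<zeta> \<xi> \<longleftrightarrow> Bfun \<zeta> (at_right 0) \<and> Bfun \<xi> (at_right 0)"

(* c k n is the coefficient of (ln z)^k z^n. *)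
definition has_frobenius_expansion :: "(real \<Rightarrow> complex) \<Rightarrow> (nat \<Rightarrow> nat \<Rightarrow> complex) \<Rightarrow> bool" where
  "has_frobenius_expansion f c \<longleftrightarrow>
     (\<exists>K. \<exists>r>0. \<forall>z\<in>{0<..<r}.
        (\<forall>k\<le>K. summable (\<lambda>n. c k n * of_real (z ^ n))) \<and>
        f z = (\<Sum>k\<le>K. of_real (ln z ^ k) * (\<Sum>n. c k n * of_real (z ^ n))))"

(* The coefficient of the log-free term z^n; the expansion of a function, if there is one,
   determines it uniquely. *)
definition frobenius_coeff :: "(real \<Rightarrow> complex) \<Rightarrow> nat \<Rightarrow> complex" where
  "frobenius_coeff f n = (THE x. \<exists>c. has_frobenius_expansion f c \<and> x = c 0 n)"

definition conductivity :: "nat \<Rightarrow> real \<Rightarrow> (real \<Rightarrow> complex) \<Rightarrow> complex" where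
  "conductivity d \<omega> a =
     of_real (real d - 2) * frobenius_coeff a (d - 2) / (\<i> * of_real \<omega> * frobenius_coeff a 0)"

end

(* Write d = N + 3, q = (d-2) mu / z0^(d-2) and B = i q a + a_{1/2} zeta + 2 a_1 c_1 xi. The three
   equations say that the fluxes P1 = F a' / z^N, P2 = z^(N+3) F zeta', P3 = z^(N+2) F xi' have
   derivatives -i q z^(N+2) B, c_{1/2} z^(N+2) B, c_1 z^(N+2) B up to O(omega^2). Hence
   Pi = P1 + (i q / c_1) P3 is constant up to O(omega^2) away from the horizon.

   Splitting off the ingoing phase exp (i omega rho), rho' = 1/F, leaves functions that are bounded up
   to the horizon. For them Q(z) = int_0^z s^(N+2) B(s) ds satisfies F B' = w Q + O(omega) with w > 0,
   so a maximum principle gives Q = O(omega). Then all three functions are nearly constant, with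
   B = 0 and c_1 z0 zeta = c_{1/2} xi at the horizon up to o(1). This expresses the horizon values of
   zeta and xi by that of a, and the ingoing condition there gives
   Pi = i omega (a / z0^N + (i q / c_1) z0^(N+2) xi) up to o(omega).

   At z = 0, a Frobenius construction with majorants uniform in omega produces a solution with
   prescribed boundary values and prescribed Pi, and for it (d-2) a_(d-2) = Pi + O(omega^2). A sup-norm
   contraction shows that the given solution coincides with it, so sigma is Pi / (i omega a_(0)). *)

theory Submission
  imports Defs "HOL-Complex_Analysis.Complex_Analysis"
begin

section \<open>Mean value estimates and a maximum principle\<close>

text \<open>The solutions for different \<omega> are unrelated: nothing fixes their scale or makes
  them depend continuously on \<omega>, so there is no limit solution to work with. Every estimate
  is therefore homogeneous in the sup norm \<open>M\<close> of the phase-free functions, with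
  constants independent of \<omega>; in the end \<open>M\<close> is bounded by a multiple of the
  source, which makes all errors relative to it. Both ends are singular. At the horizon a bound on
  \<open>F * f'\<close> says nothing about \<open>f'\<close>; at the boundary the weights degenerate
  and logarithms appear. So first-order flux identities are integrated from whichever end has a
  known flux limit. The horizon relation between \<zeta> and \<xi> is visible only at order
  \<omega>: it comes from a second source-free combination of fluxes,
  \<open>c1 * P2 - c_{1/2} * P3\<close>, after division by \<omega>. In the series the unknown is
  \<open>z^N * Pi\<close> instead of \<open>F * a'\<close>. The source then drops out of the only
  resonant equation, so the resonance is excited at order \<open>\<omega>^2\<close> only; hence the
  logarithm and the gap between \<open>Pi\<close> and the response coefficient are of that
  order.\<close>

lemma norm_diff_le_by_derivative:
  fixes f :: "real \<Rightarrow> complex" and g g' :: "real \<Rightarrow> real"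
  assumes "x \<le> y"
    and f: "\<And>t. x \<le> t \<Longrightarrow> t \<le> y \<Longrightarrow> (f has_vector_derivative f' t) (at t)"
    and g: "\<And>t. x \<le> t \<Longrightarrow> t \<le> y \<Longrightarrow> (g has_real_derivative g' t) (at t)"
    and le: "\<And>t. x \<le> t \<Longrightarrow> t \<le> y \<Longrightarrow> norm (f' t) \<le> g' t"
  shows "norm (f y - f x) \<le> g y - g x"
proof (cases "x = y")
  case False
  then have "x < y" using assms(1) by simp
  then show ?thesis
  proof (rule differentiable_bound_general[where f' = f' and \<phi>' = g'])
    show "continuous_on {x..y} f"
      using f by (intro continuous_at_imp_continuous_on ballI)
        (auto intro: has_vector_derivative_continuous)
    show "continuous_on {x..y} g"
      using g by (intro continuous_at_imp_continuous_on ballI)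
        (auto intro: DERIV_isCont)
    fix t assume t: "x < t" "t < y"
    show "(f has_vector_derivative f' t) (at t)" using t by (intro f) auto
    show "(g has_vector_derivative g' t) (at t)"
      unfolding has_real_derivative_iff_has_vector_derivative[symmetric] using t by (intro g) auto
    show "norm (f' t) \<le> g' t" using t by (intro le) auto
  qed
qed simp

text \<open>The equations hold on the open interval only, so an endpoint enters through one-sided
  limits. This version serves integration from the boundary, the mirrored one below integration from
  the horizon.\<close>

lemma norm_diff_le_by_derivative_left_end:
  fixes f :: "real \<Rightarrow> complex" and g g' :: "real \<Rightarrow> real"
  assumes "a < y"
    and f: "\<And>t. a < t \<Longrightarrow> t \<le> y \<Longrightarrow> (f has_vector_derivative f' t) (at t)"
    and g: "\<And>t. a < t \<Longrightarrow> t \<le> y \<Longrightarrow> (g has_real_derivative g' t) (at t)"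
    and le: "\<And>t. a < t \<Longrightarrow> t \<le> y \<Longrightarrow> norm (f' t) \<le> g' t"
    and lf: "(f \<longlongrightarrow> l) (at_right a)" and lg: "(g \<longlongrightarrow> m) (at_right a)"
  shows "norm (f y - l) \<le> g y - m"
proof (rule tendsto_le)
  show "((\<lambda>x. g y - g x) \<longlongrightarrow> g y - m) (at_right a)"
    by (intro tendsto_intros lg)
  show "((\<lambda>x. norm (f y - f x)) \<longlongrightarrow> norm (f y - l)) (at_right a)"
    by (intro tendsto_intros lf)
  have "eventually (\<lambda>x. a < x \<and> x < y) (at_right a)"
    using \<open>a < y\<close> eventually_at_right by blast
  then show "eventually (\<lambda>x. norm (f y - f x) \<le> g y - g x) (at_right a)"
  proof eventually_elim
    case (elim x)
    then show ?case
      by (intro norm_diff_le_by_derivative[where f' = f' and g' = g'] f g le) auto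
  qed
qed simp

lemma norm_diff_le_by_derivative_right_end:
  fixes f :: "real \<Rightarrow> complex" and g g' :: "real \<Rightarrow> real"
  assumes "x < b"
    and f: "\<And>t. x \<le> t \<Longrightarrow> t < b \<Longrightarrow> (f has_vector_derivative f' t) (at t)"
    and g: "\<And>t. x \<le> t \<Longrightarrow> t < b \<Longrightarrow> (g has_real_derivative g' t) (at t)"
    and le: "\<And>t. x \<le> t \<Longrightarrow> t < b \<Longrightarrow> norm (f' t) \<le> g' t"
    and lf: "(f \<longlongrightarrow> l) (at_left b)" and lg: "(g \<longlongrightarrow> m) (at_left b)"
  shows "norm (l - f x) \<le> m - g x"
proof (rule tendsto_le)
  show "((\<lambda>y. g y - g x) \<longlongrightarrow> m - g x) (at_left b)"
    by (intro tendsto_intros lg)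
  show "((\<lambda>y. norm (f y - f x)) \<longlongrightarrow> norm (l - f x)) (at_left b)"
    by (intro tendsto_intros lf)
  have "eventually (\<lambda>y. x < y \<and> y < b) (at_left b)"
    using \<open>x < b\<close> eventually_at_left by blast
  then show "eventually (\<lambda>y. norm (f y - f x) \<le> g y - g x) (at_left b)"
  proof eventually_elim
    case (elim y)
    then show ?case
      by (intro norm_diff_le_by_derivative[where f' = f' and g' = g'] f g le) auto
  qed
qed simp

lemma norm_diff_le_lipschitz:
  fixes f :: "real \<Rightarrow> complex"
  assumes f: "\<And>t. a < t \<Longrightarrow> t < b \<Longrightarrow> (f has_vector_derivative f' t) (at t)"
    and le: "\<And>t. a < t \<Longrightarrow> t < b \<Longrightarrow> norm (f' t) \<le> K"
    and xy: "a < x" "x < b" "a < y" "y < b"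
  shows "norm (f y - f x) \<le> K * \<bar>y - x\<bar>"
proof -
  have *: "norm (f v - f u) \<le> K * v - K * u" if "u \<le> v" "a < u" "v < b" for u v
  proof (rule norm_diff_le_by_derivative[where f' = f' and g' = "\<lambda>_. K"])
    show "u \<le> v" by fact
    fix t assume t: "u \<le> t" "t \<le> v"
    show "(f has_vector_derivative f' t) (at t)" using t that by (intro f) auto
    show "((*) K has_real_derivative K) (at t)" by (auto intro!: derivative_eq_intros)
    show "norm (f' t) \<le> K" using t that by (intro le) auto
  qed
  show ?thesis
  proof (cases "x \<le> y")
    case True then show ?thesis using *[of x y] xy by (simp add: algebra_simps)
  next
    case False
    then show ?thesis using *[of y x] xy by (simp add: algebra_simps norm_minus_commute)
  qed
qed

text \<open>A Lipschitz function on the open interval is uniformly continuous. The phase-free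
  functions obtain their values at \<open>0\<close> and \<open>z0\<close> in this way.\<close>

lemma bounded_derivative_extends:
  fixes f :: "real \<Rightarrow> complex"
  assumes "a < b"
    and f: "\<And>t. a < t \<Longrightarrow> t < b \<Longrightarrow> (f has_vector_derivative f' t) (at t)"
    and le: "\<And>t. a < t \<Longrightarrow> t < b \<Longrightarrow> norm (f' t) \<le> K"
  obtains g where "continuous_on {a..b} g" "\<And>t. a < t \<Longrightarrow> t < b \<Longrightarrow> g t = f t"
proof -
  have "norm (f' ((a+b)/2)) \<le> K" using \<open>a < b\<close> by (intro le) auto
  then have "K \<ge> 0" using norm_ge_zero order_trans by blast
  have "uniformly_continuous_on {a<..<b} f"
  proof (rule lipschitz_on_uniformly_continuous)
    show "K-lipschitz_on {a<..<b} f"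
      by (rule lipschitz_onI)
        (auto simp: dist_norm \<open>K \<ge> 0\<close> norm_minus_commute
          intro: norm_diff_le_lipschitz[OF f le, of a b, simplified dist_norm])
  qed
  then obtain g where "uniformly_continuous_on (closure {a<..<b}) g"
      "\<And>x. x \<in> {a<..<b} \<Longrightarrow> f x = g x"
    by (rule uniformly_continuous_on_extension_on_closure) auto
  then show ?thesis using \<open>a < b\<close>
    by (intro that[of g]) (auto dest: uniformly_continuous_imp_continuous)
qed

lemma norm_diff_le_closed:
  fixes f :: "real \<Rightarrow> complex"
  assumes "x \<le> y" "continuous_on {x..y} f"
    and "\<And>t. x < t \<Longrightarrow> t < y \<Longrightarrow> (f has_vector_derivative f' t) (at t)"
    and "\<And>t. x < t \<Longrightarrow> t < y \<Longrightarrow> norm (f' t) \<le> K"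
  shows "norm (f y - f x) \<le> K * (y - x)"
proof (cases "x = y")
  case False
  then have "x < y" using assms(1) by simp
  then have "norm (f y - f x) \<le> K * y - K * x"
  proof (rule differentiable_bound_general[where f' = f' and \<phi>' = "\<lambda>_. K"])
    fix t
    show "((*) K has_vector_derivative K) (at t)"
      unfolding has_real_derivative_iff_has_vector_derivative[symmetric]
      by (auto intro!: derivative_eq_intros)
  qed (use assms in \<open>auto intro!: continuous_intros\<close>)
  then show ?thesis by (simp add: algebra_simps)
qed simp

text \<open>The two derivatives form a second-order equation for \<open>Q\<close> whose zeroth-order
  coefficient \<open>w\<close> has the sign that forbids an interior maximum of
  \<open>norm Q\<close> above \<open>C\<close>. Complex values are handled by rotating: if
  \<open>norm Q\<close> is maximal at \<open>x\<close>, then so is the real function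
  \<open>Re (cnj (Q x) * Q t)\<close>, because its value at \<open>x\<close> is the square of
  \<open>norm (Q x)\<close>.\<close>

lemma max_principle:
  fixes Q S S' e :: "real \<Rightarrow> complex" and w :: "real \<Rightarrow> real"
  assumes "b > 0" and Qc: "continuous_on {0..b} Q" and Q0: "Q 0 = 0" and Qb: "norm (Q b) \<le> C"
    and Q: "\<And>z. 0 < z \<Longrightarrow> z < b \<Longrightarrow> (Q has_vector_derivative of_real (z ^ m) * S z) (at z)"
    and S: "\<And>z. 0 < z \<Longrightarrow> z < b \<Longrightarrow> (S has_vector_derivative of_real (w z) * Q z + e z) (at z)"
    and w: "\<And>z. 0 < z \<Longrightarrow> z < b \<Longrightarrow> 0 < w z"
    and e: "\<And>z. 0 < z \<Longrightarrow> z < b \<Longrightarrow> norm (e z) \<le> C * w z"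
    and z: "z \<in> {0..b}"
  shows "norm (Q z) \<le> C"
proof (rule ccontr)
  assume neg: "\<not> norm (Q z) \<le> C"
  have C: "C \<ge> 0" using Qb norm_ge_zero order_trans by blast
  have "\<exists>x\<in>{0..b}. \<forall>y\<in>{0..b}. norm (Q y) \<le> norm (Q x)"
    using \<open>b > 0\<close> by (intro continuous_attains_sup continuous_intros Qc) auto
  then obtain x where x: "x \<in> {0..b}" "\<And>y. y \<in> {0..b} \<Longrightarrow> norm (Q y) \<le> norm (Q x)" by blast
  have Qx: "norm (Q x) > C" using neg x(2)[OF z] by simp
  then have "x \<noteq> 0" "x \<noteq> b" using Q0 Qb C by auto
  then have xb: "0 < x" "x < b" using x(1) by auto
  define u where "u = cnj (Q x)"
  define f where "f = (\<lambda>t. Re (u * Q t))"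
  define h where "h = (\<lambda>t. Re (u * S t))"
  have fd: "(f has_real_derivative t ^ m * h t) (at t)" if "0 < t" "t < b" for t
  proof -
    have "((\<lambda>t. u * Q t) has_vector_derivative u * (of_real (t ^ m) * S t)) (at t)"
      by (intro has_vector_derivative_mult_right Q that)
    then have "(f has_vector_derivative Re (u * (of_real (t ^ m) * S t))) (at t)"
      unfolding f_def by (auto simp: has_vector_derivative_complex_iff has_real_derivative_iff_has_vector_derivative)
    moreover have "Re (u * (of_real (t ^ m) * S t)) = t ^ m * h t"
      unfolding h_def by (simp add: algebra_simps flip: of_real_power)
    ultimately show ?thesis by (simp add: has_real_derivative_iff_has_vector_derivative)
  qed
  have hd: "(h has_real_derivative Re (u * (of_real (w x) * Q x + e x))) (at x)"
  proof -
    have "((\<lambda>t. u * S t) has_vector_derivative u * (of_real (w x) * Q x + e x)) (at x)"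
      by (intro has_vector_derivative_mult_right S xb)
    then show ?thesis
      unfolding h_def by (auto simp: has_vector_derivative_complex_iff has_real_derivative_iff_has_vector_derivative)
  qed
  have fmax: "f t \<le> f x" if "t \<in> {0..b}" for t
  proof -
    have "f t \<le> norm (u * Q t)" unfolding f_def by (rule complex_Re_le_cmod)
    also have "\<dots> \<le> norm (Q x) * norm (Q x)"
      unfolding norm_mult u_def using x(2)[OF that] by (simp add: mult_left_mono)
    also have "\<dots> = f x" unfolding f_def u_def
      by (simp flip: power2_eq_square add: cmod_power2)
    finally show ?thesis .
  qed
  have "x ^ m * h x = 0"
  proof (rule DERIV_local_max[OF fd[OF xb]])
    show "0 < min x (b - x)" using xb by simp
    show "\<forall>y. \<bar>x - y\<bar> < min x (b - x) \<longrightarrow> f y \<le> f x" by (auto intro!: fmax)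
  qed
  then have hx: "h x = 0" using xb by simp
  \<comment> \<open>The perturbation \<open>e\<close> is at most \<open>C * w\<close>, while the
    main term is \<open>w\<close> times the square of \<open>norm (Q x) > C\<close>. Hence
    \<open>h\<close> grows from \<open>0\<close>, and \<open>f\<close> would exceed its maximum just
    to the right of \<open>x\<close>.\<close>
  have "0 < Re (u * (of_real (w x) * Q x + e x))"
  proof -
    have "Re (u * (of_real (w x) * Q x + e x)) = w x * (norm (Q x))\<^sup>2 + Re (u * e x)"
      unfolding u_def by (simp add: cmod_power2 algebra_simps) (simp add: power2_eq_square)
    moreover have "\<bar>Re (u * e x)\<bar> \<le> norm (Q x) * (C * w x)"
      using abs_Re_le_cmod[of "u * e x"] mult_left_mono[OF e[OF xb], of "norm (Q x)"]
      by (simp add: norm_mult u_def)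
    moreover have "norm (Q x) * (C * w x) < w x * (norm (Q x))\<^sup>2"
    proof -
      have "0 < norm (Q x) * w x" using Qx C w[OF xb] by (intro mult_pos_pos) linarith+
      then have "norm (Q x) * w x * C < norm (Q x) * w x * norm (Q x)"
        using Qx by (rule mult_strict_left_mono[rotated])
      then show ?thesis by (simp add: power2_eq_square algebra_simps)
    qed
    ultimately show ?thesis by linarith
  qed
  from DERIV_pos_inc_right[OF hd this] obtain d where d: "d > 0" "\<And>t. 0 < t \<Longrightarrow> t < d \<Longrightarrow> h x < h (x + t)"
    by blast
  define y where "y = x + min d (b - x) / 2"
  have y: "x < y" "y < b" "y < x + d" using d(1) xb unfolding y_def by (auto simp: min_def field_simps)
  obtain t where t: "x < t" "t < y" "f y - f x = (y - x) * (t ^ m * h t)"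
    using MVT2[OF y(1), of f "\<lambda>t. t ^ m * h t"] fd xb y by (metis less_le_trans le_less_trans less_imp_le)
  have "h t > 0" using d(2)[of "t - x"] t y hx by simp
  then have "f y - f x > 0" using t xb by simp
  then show False using fmax[of y] y xb by simp
qed

section \<open>Uniqueness of logarithmic power series\<close>

lemma tendsto_ln_power_mult_at_0: "((\<lambda>z::real. ln z ^ k * z) \<longlongrightarrow> 0) (at_right 0)"
proof -
  have 1: "filterlim (\<lambda>z::real. - ln z) at_top (at_right 0)"
    using ln_at_0 by (simp add: filterlim_uminus_at_top)
  have "((\<lambda>z::real. (- ln z) ^ k / exp (- ln z)) \<longlongrightarrow> 0) (at_right 0)"
    by (rule filterlim_compose[OF tendsto_power_div_exp_0 1])
  then have "((\<lambda>z::real. (-1) ^ k * ((- ln z) ^ k / exp (- ln z))) \<longlongrightarrow> 0) (at_right 0)"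
    by (rule tendsto_mult_right_zero)
  moreover have "eventually (\<lambda>z::real. (-1) ^ k * ((- ln z) ^ k / exp (- ln z)) = ln z ^ k * z) (at_right 0)"
    using eventually_at_right_less[of "0::real"]
  proof eventually_elim
    case (elim z)
    then have "exp (- ln z) = 1 / z" by (simp add: exp_minus field_simps)
    then show ?case using elim by (simp add: power_mult_distrib[symmetric])
  qed
  ultimately show ?thesis by (rule Lim_transform_eventually)
qed

text \<open>Induction on the order \<open>n\<close>: when all lower orders vanish, division by
  \<open>z^n\<close> leaves a polynomial in \<open>ln z\<close> with coefficients
  \<open>h k n\<close>, equal to a remainder of size \<open>z\<close> times powers of
  \<open>ln z\<close>. It tends to \<open>0\<close> although \<open>ln z\<close> is unbounded, so it
  is the zero polynomial.\<close>

lemma log_power_series_eq_0: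
  fixes h :: "nat \<Rightarrow> nat \<Rightarrow> complex"
  assumes "r > 0"
    and sm: "\<And>z k. 0 < z \<Longrightarrow> z < r \<Longrightarrow> k \<le> K \<Longrightarrow> summable (\<lambda>n. h k n * of_real (z ^ n))"
    and eq: "\<And>z. 0 < z \<Longrightarrow> z < r \<Longrightarrow>
        (\<Sum>k\<le>K. of_real (ln z ^ k) * (\<Sum>n. h k n * of_real (z ^ n))) = 0"
  shows "k \<le> K \<Longrightarrow> h k n = 0"
proof (induction n arbitrary: k rule: less_induct)
  case (less n)
  define R where "R k z = (\<Sum>j. h k (n + 1 + j) * z ^ j)" for k and z :: complex
  \<comment> \<open>Convergence is given at real points only. The point \<open>r / 2\<close> yields
    it on a complex disc, which the limit theorem for power series at \<open>0\<close> asks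
    for.\<close>
  have summ: "summable (\<lambda>j. h k j * x ^ j)" if "k \<le> K" "norm x < r / 2" for k and x :: complex
  proof (rule powser_inside)
    show "summable (\<lambda>j. h k j * of_real (r/2) ^ j)"
      using sm[of "r/2" k] that \<open>r > 0\<close> by simp
    show "norm x < norm (complex_of_real (r/2))" using that \<open>r > 0\<close>
      by (simp add: norm_divide)
  qed
  have summ': "summable (\<lambda>j. h k (m + j) * x ^ j)" if "k \<le> K" "norm x < r / 2" for k m and x :: complex
  proof (cases "x = 0")
    case False
    have "summable (\<lambda>j. h k (j + m) * x ^ (j + m))"
      using summ[OF that] by (subst summable_iff_shift)
    then have "summable (\<lambda>j. h k (j + m) * x ^ (j + m) / x ^ m)"
      by (rule summable_divide)
    moreover have "(\<lambda>j. h k (j + m) * x ^ (j + m) / x ^ m) = (\<lambda>j. h k (m + j) * x ^ j)"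
      using False by (auto simp: power_add add.commute)
    ultimately show ?thesis by simp
  next
    case True
    then show ?thesis using summable_0_powser by simp
  qed
  have Rlim: "(R k \<longlongrightarrow> h k (n+1)) (at 0)" if "k \<le> K" for k
  proof -
    have "(R k \<longlongrightarrow> (\<lambda>j. h k (n + 1 + j)) 0) (at 0)"
    proof (rule powser_limit_0)
      show "0 < r/2" using \<open>r > 0\<close> by simp
      show "(\<lambda>j. h k (n + 1 + j) * x ^ j) sums R k x" if "norm x < r/2" for x
        unfolding R_def using summ'[OF \<open>k \<le> K\<close> that] by (rule summable_sums)
    qed
    then show ?thesis by simp
  qed
  have expand: "(\<Sum>j. h k j * of_real (z ^ j)) = of_real (z^n) * (h k n + of_real z * R k (of_real z))"
    if "k \<le> K" "0 < z" "z < r/2" for k z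
  proof -
    have s: "summable (\<lambda>j. h k j * of_real z ^ j)" using summ[of k "of_real z"] that by simp
    have "(\<Sum>j. h k j * of_real z ^ j) = (\<Sum>j. h k (j + Suc n) * of_real z ^ (j + Suc n)) + (\<Sum>j<Suc n. h k j * of_real z ^ j)"
      by (rule suminf_split_initial_segment[OF s])
    also have "(\<Sum>j<Suc n. h k j * of_real z ^ j) = h k n * of_real z ^ n"
      using less that by simp
    also have "(\<Sum>j. h k (j + Suc n) * of_real z ^ (j + Suc n)) = (\<Sum>j. of_real z ^ Suc n * (h k (n + 1 + j) * of_real z ^ j))"
      by (simp add: power_add algebra_simps)
    also have "\<dots> = of_real z ^ Suc n * R k (of_real z)"
      unfolding R_def using summ'[of k "of_real z" "n+1"] that by (intro suminf_mult) auto
    finally show ?thesis by (simp add: algebra_simps)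
  qed
  have q: "(\<Sum>k\<le>K. h k n * of_real (ln z) ^ k) = - (\<Sum>k\<le>K. of_real (ln z ^ k * z) * R k (of_real z))"
    if "0 < z" "z < r/2" for z
  proof -
    have "0 = (\<Sum>k\<le>K. of_real (ln z ^ k) * (of_real (z^n) * (h k n + of_real z * R k (of_real z))))"
      using eq[of z] expand[OF _ that] that by simp
    also have "\<dots> = of_real (z^n) * (\<Sum>k\<le>K. of_real (ln z ^ k) * (h k n + of_real z * R k (of_real z)))"
      by (simp add: sum_distrib_left algebra_simps)
    finally have "(\<Sum>k\<le>K. of_real (ln z ^ k) * (h k n + of_real z * R k (of_real z))) = 0"
      using that by simp
    then have "(\<Sum>k\<le>K. h k n * of_real (ln z) ^ k) + (\<Sum>k\<le>K. of_real (ln z ^ k * z) * R k (of_real z)) = 0"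
      by (simp add: sum.distrib[symmetric] algebra_simps)
    then show ?thesis by (simp add: eq_neg_iff_add_eq_0)
  qed
  have tend: "((\<lambda>z::real. \<Sum>k\<le>K. h k n * of_real (ln z) ^ k) \<longlongrightarrow> 0) (at_right 0)"
  proof (rule Lim_transform_eventually)
    have "((\<lambda>z::real. of_real (ln z ^ k * z) * R k (of_real z)) \<longlongrightarrow> of_real 0 * h k (n+1)) (at_right 0)"
      if "k \<le> K" for k
    proof (intro tendsto_mult tendsto_of_real tendsto_ln_power_mult_at_0)
      have "filterlim complex_of_real (at 0) (at_right 0)"
        by (rule filterlim_atI) (auto intro!: tendsto_eq_intros eventually_at_rightI[of 0 1])
      then show "((\<lambda>z. R k (complex_of_real z)) \<longlongrightarrow> h k (n + 1)) (at_right 0)"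
        by (rule filterlim_compose[OF Rlim[OF that]])
    qed
    then have "((\<lambda>z::real. - (\<Sum>k\<le>K. of_real (ln z ^ k * z) * R k (of_real z))) \<longlongrightarrow> - (\<Sum>k\<le>K. 0)) (at_right 0)"
      by (intro tendsto_minus tendsto_sum) auto
    then show "((\<lambda>z::real. - (\<Sum>k\<le>K. of_real (ln z ^ k * z) * R k (of_real z))) \<longlongrightarrow> 0) (at_right 0)"
      by simp
    show "\<forall>\<^sub>F z in at_right 0. - (\<Sum>k\<le>K. complex_of_real (ln z ^ k * z) * R k (complex_of_real z)) =
        (\<Sum>k\<le>K. h k n * complex_of_real (ln z) ^ k)"
      using \<open>r > 0\<close> q by (auto intro!: eventually_at_rightI[of 0 "r/2"])
  qed
  have lninf: "filterlim (\<lambda>z::real. complex_of_real (ln z)) at_infinity (at_right 0)"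
  proof (rule filterlim_norm_at_top_imp_at_infinity, rule filterlim_at_top_mono)
    show "filterlim (\<lambda>z::real. - ln z) at_top (at_right 0)"
      using ln_at_0 by (simp add: filterlim_uminus_at_top)
  qed (auto intro!: always_eventually)
  \<comment> \<open>A nonzero coefficient of a positive power of \<open>ln z\<close> would make the
    polynomial at least \<open>1\<close> in norm near \<open>z = 0\<close>, against the limit
    \<open>0\<close>.\<close>
  have hz: "h k n = 0" if "k \<in> {1..K}" for k
  proof (rule ccontr)
    assume "h k n \<noteq> 0"
    then have "eventually (\<lambda>z. norm (\<Sum>i\<le>K. h i n * z ^ i) \<ge> 1) at_infinity"
      using that by (intro polyfun_extremal[of K "\<lambda>i. h i n" 1] exI[of _ k]) auto
    then have "eventually (\<lambda>z::real. norm (\<Sum>i\<le>K. h i n * of_real (ln z) ^ i) \<ge> 1) (at_right 0)"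
      using lninf by (auto simp: filterlim_iff)
    moreover have "eventually (\<lambda>z::real. norm (\<Sum>i\<le>K. h i n * of_real (ln z) ^ i) < 1) (at_right 0)"
      using tendstoD[OF tend, of 1] by simp
    ultimately have "eventually (\<lambda>z::real. False) (at_right 0)"
      by eventually_elim simp
    then show False by simp
  qed
  have "h 0 n = 0"
  proof -
    have "(\<Sum>k\<le>K. h k n * x ^ k) = h 0 n" for x
    proof -
      have "(\<Sum>k\<le>K. h k n * x ^ k) = (\<Sum>k\<in>{0}. h k n * x ^ k)"
        by (rule sum.mono_neutral_right) (auto simp: hz)
      then show ?thesis by simp
    qed
    then have "((\<lambda>z::real. h 0 n) \<longlongrightarrow> 0) (at_right 0)" using tend by simp
    then show ?thesis by (simp add: tendsto_const_iff)
  qed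
  then show ?case using hz[of k] less.prems by (cases "k = 0") auto
qed

text \<open>The two expansions may have different logarithmic degrees, and coefficients above the
  degree of an expansion are arbitrary. They are cut to \<open>0\<close> in \<open>e\<close> and
  \<open>e'\<close> before the difference is taken; the log-free coefficients survive the
  cut.\<close>

lemma has_frobenius_expansion_unique:
  assumes "has_frobenius_expansion f c" "has_frobenius_expansion f c'"
  shows "c 0 n = c' 0 n"
proof -
  obtain K r where K: "r > 0" "\<forall>z\<in>{0<..<r}. (\<forall>k\<le>K. summable (\<lambda>n. c k n * of_real (z ^ n))) \<and>
        f z = (\<Sum>k\<le>K. of_real (ln z ^ k) * (\<Sum>n. c k n * of_real (z ^ n)))"
    using assms(1) unfolding has_frobenius_expansion_def by blast
  obtain K' r' where K': "r' > 0" "\<forall>z\<in>{0<..<r'}. (\<forall>k\<le>K'. summable (\<lambda>n. c' k n * of_real (z ^ n))) \<and>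
        f z = (\<Sum>k\<le>K'. of_real (ln z ^ k) * (\<Sum>n. c' k n * of_real (z ^ n)))"
    using assms(2) unfolding has_frobenius_expansion_def by blast
  define e where "e k n = (if k \<le> K then c k n else 0)" for k n
  define e' where "e' k n = (if k \<le> K' then c' k n else 0)" for k n
  have pad: "(\<Sum>k\<le>max K K'. of_real (ln z ^ k) * (\<Sum>n. (if k \<le> J then b k n else 0) * of_real (z ^ n)))
      = (\<Sum>k\<le>J. of_real (ln z ^ k) * (\<Sum>n. b k n * of_real (z ^ n)))" if "J \<le> max K K'"
    for J :: nat and b :: "nat \<Rightarrow> nat \<Rightarrow> complex" and z :: real
    using that by (intro sum.mono_neutral_cong_right) auto
  have "e 0 n - e' 0 n = 0"
  proof (rule log_power_series_eq_0[where r = "min r r'" and K = "max K K'"])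
    show "min r r' > 0" using K K' by simp
    fix z :: real assume z: "0 < z" "z < min r r'"
    have sm0: "summable (\<lambda>n. e k n * of_real (z ^ n))" "summable (\<lambda>n. e' k n * of_real (z ^ n))" for k
    proof -
      show "summable (\<lambda>n. e k n * of_real (z ^ n))"
        using bspec[OF K(2), of z] z by (cases "k \<le> K") (simp_all add: e_def)
      show "summable (\<lambda>n. e' k n * of_real (z ^ n))"
        using bspec[OF K'(2), of z] z by (cases "k \<le> K'") (simp_all add: e'_def)
    qed
    show sm: "summable (\<lambda>n. (e k n - e' k n) * of_real (z ^ n))" for k
    proof -
      from summable_diff[OF sm0[of k]] show ?thesis by (simp add: algebra_simps)
    qed
    have split: "(\<Sum>n. (e k n - e' k n) * of_real (z ^ n)) =
        (\<Sum>n. e k n * of_real (z ^ n)) - (\<Sum>n. e' k n * of_real (z ^ n))" for k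
    proof -
      from suminf_diff[OF sm0[of k]] show ?thesis by (simp add: algebra_simps)
    qed
    have "(\<Sum>k\<le>max K K'. of_real (ln z ^ k) * (\<Sum>n. (e k n - e' k n) * of_real (z ^ n))) =
       (\<Sum>k\<le>max K K'. of_real (ln z ^ k) * (\<Sum>n. e k n * of_real (z ^ n))) -
       (\<Sum>k\<le>max K K'. of_real (ln z ^ k) * (\<Sum>n. e' k n * of_real (z ^ n)))"
      by (subst split) (simp add: algebra_simps sum_subtractf)
    also have "\<dots> = f z - f z"
      unfolding e_def e'_def using bspec[OF K(2), of z] bspec[OF K'(2), of z] z by (subst (1 2) pad) auto
    finally show "(\<Sum>k\<le>max K K'. of_real (ln z ^ k) * (\<Sum>n. (e k n - e' k n) * of_real (z ^ n))) = 0"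
      by simp
  qed simp
  then show ?thesis by (simp add: e_def e'_def)
qed

lemma frobenius_coeff_eq:
  assumes "has_frobenius_expansion f c"
  shows "frobenius_coeff f n = c 0 n"
  unfolding frobenius_coeff_def
  by (rule the_equality) (use assms has_frobenius_expansion_unique in blast)+

section \<open>Estimates up to the horizon\<close>

text \<open>Here \<open>N = d - 3\<close>, \<open>q = (d - 2) \<mu> / z0 ^ (d - 2)\<close>, \<open>al\<close> and \<open>ga\<close> are \<open>a\<^sub>1\<^sub>/\<^sub>2\<close> and \<open>c\<^sub>1\<^sub>/\<^sub>2\<close>, and
  \<open>p\<close> is the blackening function, which is a polynomial.\<close>

locale brane =
  fixes N :: nat and z0 q al ga a1 c1 :: real and p :: "real poly"
  assumes z0: "0 < z0" and alga: "0 < al * ga" and a1: "0 < a1" and c1: "c1 \<noteq> 0"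
    and p0: "poly p 0 = 1" and pz0: "poly p z0 = 0"
    and ppos: "\<And>z. 0 \<le> z \<Longrightarrow> z < z0 \<Longrightarrow> 0 < poly p z"
    and dp: "poly (pderiv p) z0 < 0"
begin

abbreviation F :: "real \<Rightarrow> real" where "F \<equiv> poly p"

text \<open>The horizon is a simple zero. The first factor gives the linear lower bound on
  \<open>F\<close>; the second isolates \<open>F'(z0)\<close>, which is needed to compare
  \<open>1 / F\<close> with its simple pole.\<close>

lemma F_factor:
  obtains p1 p2 where "\<And>z. F z = (z - z0) * poly p1 z"
    "\<And>z. poly p1 z = poly (pderiv p) z0 + (z - z0) * poly p2 z"
proof -
  obtain p1 where p1: "p = [:- z0, 1:] * p1" using pz0 by (auto simp: poly_eq_0_iff_dvd)
  have "poly p1 z0 = poly (pderiv p) z0"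
    unfolding p1 pderiv_mult by (simp add: pderiv_pCons)
  then have "poly (p1 - [:poly (pderiv p) z0:]) z0 = 0" by simp
  then obtain p2 where p2: "p1 - [:poly (pderiv p) z0:] = [:- z0, 1:] * p2"
    unfolding poly_eq_0_iff_dvd dvd_def by blast
  show ?thesis
  proof (rule that)
    show "F z = (z - z0) * poly p1 z" for z unfolding p1 by (simp add: algebra_simps)
    have "poly (p1 - [:poly (pderiv p) z0:]) z = (z - z0) * poly p2 z" for z
      unfolding p2 by (simp add: algebra_simps)
    then show "poly p1 z = poly (pderiv p) z0 + (z - z0) * poly p2 z" for z
      by (simp add: algebra_simps)
  qed
qed

lemma F_lower_bound: obtains f0 where "f0 > 0" "\<And>z. 0 \<le> z \<Longrightarrow> z \<le> z0 \<Longrightarrow> f0 * (z0 - z) \<le> F z"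
proof -
  obtain p1 p2 where p1: "\<And>z. F z = (z - z0) * poly p1 z"
    and p2: "\<And>z. poly p1 z = poly (pderiv p) z0 + (z - z0) * poly p2 z" by (rule F_factor) blast
  have neg: "poly p1 z < 0" if "0 \<le> z" "z \<le> z0" for z
  proof (cases "z = z0")
    case False
    then have "0 < (z - z0) * poly p1 z" using ppos[of z] p1 that by simp
    then show ?thesis using that by (simp add: zero_less_mult_iff)
  qed (use p2 dp in auto)
  have "\<exists>x\<in>{0..z0}. \<forall>y\<in>{0..z0}. poly p1 y \<le> poly p1 x"
    using z0 by (intro continuous_attains_sup continuous_intros) auto
  then obtain x where x: "x \<in> {0..z0}" "\<And>y. y \<in> {0..z0} \<Longrightarrow> poly p1 y \<le> poly p1 x" by blast
  show ?thesis
  proof (rule that[of "- poly p1 x"])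
    show "- poly p1 x > 0" using neg x(1) by simp
    fix z assume "0 \<le> z" "z \<le> z0"
    then have "- poly p1 x * (z0 - z) \<le> - poly p1 z * (z0 - z)"
      by (intro mult_right_mono) (auto simp: x)
    then show "- poly p1 x * (z0 - z) \<le> F z" by (simp add: p1 algebra_simps)
  qed
qed

lemma F_upper_bound: obtains fm where "fm > 0" "\<And>z. 0 \<le> z \<Longrightarrow> z \<le> z0 \<Longrightarrow> F z \<le> fm"
proof -
  have "\<exists>x\<in>{0..z0}. \<forall>y\<in>{0..z0}. F y \<le> F x"
    using z0 by (intro continuous_attains_sup continuous_intros) auto
  then obtain x where x: "x \<in> {0..z0}" "\<And>y. y \<in> {0..z0} \<Longrightarrow> F y \<le> F x" by blast
  have "F x \<ge> 1" using x(2)[of 0] z0 p0 by simp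
  then show ?thesis using x(2) by (intro that[of "F x"]) auto
qed

definition Bc :: "complex \<Rightarrow> complex \<Rightarrow> complex \<Rightarrow> complex" where
  "Bc x y w = \<i> * of_real q * x + of_real al * y + of_real (2 * a1 * c1) * w"

definition KB :: real where "KB = \<bar>q\<bar> + \<bar>al\<bar> + \<bar>2 * a1 * c1\<bar>"

lemma KB_nonneg: "KB \<ge> 0" by (simp add: KB_def)

lemma norm_Bc_le:
  assumes "norm x \<le> M" "norm y \<le> M" "norm w \<le> M"
  shows "norm (Bc x y w) \<le> KB * M"
proof -
  have "norm (Bc x y w) \<le> norm (\<i> * of_real q * x) + norm (of_real al * y) + norm (of_real (2 * a1 * c1) * w)"
    unfolding Bc_def by (meson norm_triangle_le add_right_mono norm_triangle_ineq)
  also have "\<dots> = \<bar>q\<bar> * norm x + \<bar>al\<bar> * norm y + \<bar>2 * a1 * c1\<bar> * norm w"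
    by (simp add: norm_mult abs_mult)
  also have "\<dots> \<le> \<bar>q\<bar> * M + \<bar>al\<bar> * M + \<bar>2 * a1 * c1\<bar> * M"
    by (intro add_mono mult_left_mono assms) auto
  finally show ?thesis by (simp add: KB_def algebra_simps)
qed

text \<open>One term \<open>\<i> * \<omega> * f\<close> arises when the derivative inside the flux
  hits the phase. The other arises when the outer derivative does: the resulting
  \<open>\<kappa> * f'\<close> is written as the derivative of \<open>\<kappa> * f\<close> minus
  \<open>\<kappa>' * f\<close>.\<close>

definition flux :: "real \<Rightarrow> (real \<Rightarrow> complex) \<Rightarrow> (real \<Rightarrow> complex) \<Rightarrow> real \<Rightarrow> complex" where
  "flux \<omega> f f' z = of_real (F z) * f' z + 2 * \<i> * of_real \<omega> * f z"

text \<open>One component of the system after splitting off the ingoing phase: with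
  \<open>f = exp (i \<omega> \<rho>) g\<close> and \<open>\<rho>' = 1 / F\<close> the singular term \<open>\<omega>\<^sup>2 f / F\<close> disappears, and the
  first-order terms are grouped so that no derivative of \<open>g\<close> remains on the right.\<close>

definition rcomp :: "real \<Rightarrow> (real \<Rightarrow> real) \<Rightarrow> (real \<Rightarrow> real) \<Rightarrow> complex \<Rightarrow> (real \<Rightarrow> complex)
    \<Rightarrow> (real \<Rightarrow> complex) \<Rightarrow> (real \<Rightarrow> complex) \<Rightarrow> bool" where
  "rcomp \<omega> \<kappa> \<kappa>' s S f f' \<longleftrightarrow> (\<forall>z. 0 < z \<longrightarrow> z < z0 \<longrightarrow>
     (f has_vector_derivative f' z) (at z) \<and>
     ((\<lambda>z. of_real (\<kappa> z) * flux \<omega> f f' z) has_vector_derivative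
        \<i> * of_real (\<omega> * \<kappa>' z) * f z + s * of_real (z ^ (N + 2)) * S z) (at z))"

text \<open>Only \<open>M\<close> is quantitative. The bound \<open>D\<close> on the derivative may
  depend on \<omega>; it serves to compute flux limits at the two ends and to know that a supremum
  is finite.\<close>

definition bnd :: "real \<Rightarrow> (real \<Rightarrow> complex) \<Rightarrow> (real \<Rightarrow> complex) \<Rightarrow> bool" where
  "bnd M f f' \<longleftrightarrow> continuous_on {0..z0} f \<and> (\<forall>z\<in>{0..z0}. norm (f z) \<le> M) \<and>
     (\<exists>D. \<forall>z. 0 < z \<longrightarrow> z < z0 \<longrightarrow> norm (f' z) \<le> D)"

definition reg :: "real \<Rightarrow> real \<Rightarrow> (real \<Rightarrow> complex) \<Rightarrow> (real \<Rightarrow> complex) \<Rightarrow> (real \<Rightarrow> complex)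
    \<Rightarrow> (real \<Rightarrow> complex) \<Rightarrow> (real \<Rightarrow> complex) \<Rightarrow> (real \<Rightarrow> complex) \<Rightarrow> bool" where
  "reg \<omega> M A Z X A' Z' X' \<longleftrightarrow> bnd M A A' \<and> bnd M Z Z' \<and> bnd M X X' \<and>
     rcomp \<omega> (\<lambda>z. 1 / z ^ N) (\<lambda>z. - real N / z ^ (N + 1)) (- \<i> * of_real q) (\<lambda>z. Bc (A z) (Z z) (X z)) A A' \<and>
     rcomp \<omega> (\<lambda>z. z ^ (N + 3)) (\<lambda>z. real (N + 3) * z ^ (N + 2)) (of_real ga) (\<lambda>z. Bc (A z) (Z z) (X z)) Z Z' \<and>
     rcomp \<omega> (\<lambda>z. z ^ (N + 2)) (\<lambda>z. real (N + 2) * z ^ (N + 1)) (of_real c1) (\<lambda>z. Bc (A z) (Z z) (X z)) X X'"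

text \<open>This is the boundary condition hidden in the ingoing behaviour: \<open>f'\<close> is
  bounded and \<open>F\<close> vanishes at \<open>z0\<close>, so only the zeroth-order term is
  left.\<close>

lemma flux_tendsto_horizon:
  assumes "bnd M f f'"
  shows "(flux \<omega> f f' \<longlongrightarrow> 2 * \<i> * of_real \<omega> * f z0) (at_left z0)"
proof -
  obtain D where D: "\<And>z. 0 < z \<Longrightarrow> z < z0 \<Longrightarrow> norm (f' z) \<le> D" using assms unfolding bnd_def by blast
  have ev: "eventually (\<lambda>z. 0 < z \<and> z < z0) (at_left z0)"
    using z0 eventually_at_left by blast
  have 1: "((\<lambda>z. of_real (F z) * f' z) \<longlongrightarrow> 0) (at_left z0)"
  proof (rule tendsto_0_le)
    have "(F \<longlongrightarrow> F z0) (at_left z0)" by (intro tendsto_intros)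
    then show "(F \<longlongrightarrow> 0) (at_left z0)" using pz0 by simp
    show "\<forall>\<^sub>F z in at_left z0. norm (of_real (F z) * f' z) \<le> norm (F z) * D"
      using ev by eventually_elim (auto simp: norm_mult intro!: mult_left_mono D)
  qed
  have "continuous_on {0..z0} f" using assms by (simp add: bnd_def)
  then have "(f \<longlongrightarrow> f z0) (at z0 within {0..z0})" using z0 by (auto simp: continuous_on_def)
  then have 2: "(f \<longlongrightarrow> f z0) (at_left z0)"
    by (simp add: at_within_Icc_at_left z0)
  show ?thesis unfolding flux_def
    by (rule tendsto_eq_intros 1 2 refl | simp)+
qed

text \<open>The no-source condition in integrated form: integration of a scalar flux equation from
  \<open>0\<close> produces no boundary term.\<close>

lemma flux_power_tendsto_0:
  assumes "bnd M f f'" "j \<ge> 1"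
  shows "((\<lambda>z. of_real (z ^ j) * flux \<omega> f f' z) \<longlongrightarrow> 0) (at_right 0)"
proof -
  obtain D where D: "\<And>z. 0 < z \<Longrightarrow> z < z0 \<Longrightarrow> norm (f' z) \<le> D" using assms unfolding bnd_def by blast
  obtain fm where fm: "\<And>z. 0 \<le> z \<Longrightarrow> z \<le> z0 \<Longrightarrow> F z \<le> fm" by (rule F_upper_bound) blast
  have ev: "eventually (\<lambda>z. 0 < z \<and> z < z0) (at_right 0)"
    using z0 eventually_at_right by blast
  show ?thesis
  proof (rule tendsto_0_le)
    have "((\<lambda>z::real. z ^ j) \<longlongrightarrow> 0 ^ j) (at_right 0)" by (intro tendsto_intros)
    then show "((\<lambda>z::real. z ^ j) \<longlongrightarrow> 0) (at_right 0)" using assms by (simp add: power_0_left)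
    show "\<forall>\<^sub>F z in at_right 0. norm (of_real (z ^ j) * flux \<omega> f f' z) \<le> norm (z ^ j) * (fm * D + 2 * \<bar>\<omega>\<bar> * M)"
      using ev
    proof eventually_elim
      case (elim z)
      have "norm (flux \<omega> f f' z) \<le> norm (of_real (F z) * f' z) + norm (2 * \<i> * of_real \<omega> * f z)"
        unfolding flux_def by (rule norm_triangle_ineq)
      also have "\<dots> = F z * norm (f' z) + 2 * \<bar>\<omega>\<bar> * norm (f z)"
        using ppos[of z] elim by (simp add: norm_mult)
      also have "\<dots> \<le> fm * D + 2 * \<bar>\<omega>\<bar> * M"
        using fm[of z] ppos[of z] D[of z] elim assms
        by (intro add_mono mult_mono) (auto simp: bnd_def)
      finally show ?case
        using elim by (simp add: norm_mult norm_power mult_left_mono)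
    qed
  qed
qed

definition cumul :: "(real \<Rightarrow> complex) \<Rightarrow> real \<Rightarrow> complex" where
  "cumul S z = integral {0..z} (\<lambda>s. of_real (s ^ (N + 2)) * S s)"

lemma
  assumes "continuous_on {0..z0} S"
  shows continuous_on_cumul: "continuous_on {0..z0} (cumul S)"
    and cumul_derivative: "0 < z \<Longrightarrow> z < z0 \<Longrightarrow>
      (cumul S has_vector_derivative of_real (z ^ (N + 2)) * S z) (at z)"
    and cumul_0: "cumul S 0 = 0"
    and norm_cumul_le: "(\<And>z. z \<in> {0..z0} \<Longrightarrow> norm (S z) \<le> K) \<Longrightarrow> 0 < z \<Longrightarrow> z < z0 \<Longrightarrow>
      norm (cumul S z) \<le> K * z ^ (N + 3)"
proof -
  have c: "continuous_on {0..z0} (\<lambda>s. of_real (s ^ (N + 2)) * S s)"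
    by (intro continuous_intros assms)
  have d: "(cumul S has_vector_derivative of_real (z ^ (N + 2)) * S z) (at z within {0..z0})"
    if "z \<in> {0..z0}" for z
    unfolding cumul_def using integral_has_vector_derivative[OF c that] by simp
  show cont: "continuous_on {0..z0} (cumul S)"
    by (auto simp: continuous_on_eq_continuous_within intro!: has_vector_derivative_continuous d)
  show d': "(cumul S has_vector_derivative of_real (z ^ (N + 2)) * S z) (at z)" if "0 < z" "z < z0" for z
    using d[of z] that at_within_interior[of z "{0..z0}"] by simp
  show 0: "cumul S 0 = 0" by (simp add: cumul_def)
  assume K: "\<And>z. z \<in> {0..z0} \<Longrightarrow> norm (S z) \<le> K" and z: "0 < z" "z < z0"
  have K0: "K \<ge> 0" using K[of z] z norm_ge_zero order_trans by (meson atLeastAtMost_iff less_imp_le)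
  have "(cumul S \<longlongrightarrow> cumul S 0) (at 0 within {0..z0})"
    using cont z0 by (auto simp: continuous_on_def)
  then have lim: "(cumul S \<longlongrightarrow> 0) (at_right 0)" by (simp add: 0 at_within_Icc_at_right z0)
  have "norm (cumul S z - 0) \<le> K * z ^ (N + 3) - 0"
  proof (rule norm_diff_le_by_derivative_left_end[OF z(1) d' _ _ lim])
    fix t assume t: "0 < t" "t \<le> z"
    show "((\<lambda>z. K * z ^ (N + 3)) has_real_derivative K * (real (N + 3) * t ^ (N + 2))) (at t)"
      by (auto intro!: derivative_eq_intros simp: algebra_simps)
    have "norm (of_real (t ^ (N + 2)) * S t) = t ^ (N + 2) * norm (S t)"
      using t by (simp add: norm_mult norm_power)
    also have "\<dots> \<le> t ^ (N + 2) * (real (N + 3) * K)"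
      using K[of t] t z K0 mult_right_mono[of 1 "real (N+3)" K] by (intro mult_left_mono) auto
    finally show "norm (of_real (t ^ (N + 2)) * S t) \<le> K * (real (N + 3) * t ^ (N + 2))"
      by (simp only: mult_ac)
  next
    have "((\<lambda>z. K * z ^ (N + 3)) \<longlongrightarrow> K * 0 ^ (N+3)) (at_right 0)" by (intro tendsto_intros)
    moreover have "K * 0 ^ (N + 3) = 0" by simp
    ultimately show "((\<lambda>z. K * z ^ (N + 3)) \<longlongrightarrow> 0) (at_right 0)" by metis
  qed (use z in auto)
  then show "norm (cumul S z) \<le> K * z ^ (N + 3)" by simp
qed

text \<open>After integration from \<open>0\<close> the source gives exactly
  \<open>s * cumul S\<close>. The remaining derivative is \<open>\<i> * \<omega>\<close> times the
  derivative of \<open>z^j\<close> times \<open>f\<close>, so its integral is at most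
  \<open>\<bar>\<omega>\<bar> * M * z^j\<close>.\<close>

lemma flux_power_near_cumul:
  assumes r: "rcomp \<omega> (\<lambda>z. z ^ j) (\<lambda>z. real j * z ^ (j - 1)) s S f f'" and b: "bnd M f f'"
    and "j \<ge> 1" and S: "continuous_on {0..z0} S" and z: "0 < z" "z < z0"
  shows "norm (of_real (z ^ j) * flux \<omega> f f' z - s * cumul S z) \<le> \<bar>\<omega>\<bar> * M * z ^ j"
proof -
  let ?g = "\<lambda>z. of_real (z ^ j) * flux \<omega> f f' z - s * cumul S z"
  have "norm (?g z - 0) \<le> \<bar>\<omega>\<bar> * M * z ^ j - 0"
  proof (rule norm_diff_le_by_derivative_left_end[OF z(1)])
    fix t assume t: "0 < t" "t \<le> z"
    have "((\<lambda>z. of_real (z ^ j) * flux \<omega> f f' z) has_vector_derivative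
        \<i> * of_real (\<omega> * (real j * t ^ (j - 1))) * f t + s * of_real (t ^ (N + 2)) * S t) (at t)"
      using r t z unfolding rcomp_def by auto
    then have "(?g has_vector_derivative \<i> * of_real (\<omega> * (real j * t ^ (j - 1))) * f t + s * of_real (t ^ (N + 2)) * S t
       - s * (of_real (t ^ (N + 2)) * S t)) (at t)"
      using t z by (intro has_vector_derivative_diff has_vector_derivative_mult_right cumul_derivative S) auto
    then show "(?g has_vector_derivative \<i> * of_real (\<omega> * (real j * t ^ (j - 1))) * f t) (at t)"
      by (simp add: mult.assoc)
    show "((\<lambda>z. \<bar>\<omega>\<bar> * M * z ^ j) has_real_derivative \<bar>\<omega>\<bar> * M * (real j * t ^ (j - 1))) (at t)"
      by (auto intro!: derivative_eq_intros)
    have "norm (f t) \<le> M" using b t z by (auto simp: bnd_def)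
    then show "norm (\<i> * of_real (\<omega> * (real j * t ^ (j - 1))) * f t) \<le> \<bar>\<omega>\<bar> * M * (real j * t ^ (j - 1))"
      using t mult_left_mono[of "norm (f t)" M "\<bar>\<omega>\<bar> * (real j * t ^ (j - 1))"]
      by (simp add: norm_mult norm_power abs_mult mult_ac)
  next
    have "(cumul S \<longlongrightarrow> cumul S 0) (at 0 within {0..z0})"
      using continuous_on_cumul[OF S] z0 by (auto simp: continuous_on_def)
    then have lim: "(cumul S \<longlongrightarrow> 0) (at_right 0)" by (simp add: cumul_0[OF S] at_within_Icc_at_right z0)
    show "(?g \<longlongrightarrow> 0) (at_right 0)"
      using tendsto_diff[OF flux_power_tendsto_0[OF b \<open>j \<ge> 1\<close>, of \<omega>] tendsto_mult_right_zero[OF lim, of s]] by simp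
    have "((\<lambda>z. \<bar>\<omega>\<bar> * M * z ^ j) \<longlongrightarrow> \<bar>\<omega>\<bar> * M * 0 ^ j) (at_right 0)" by (intro tendsto_intros)
    then show "((\<lambda>z. \<bar>\<omega>\<bar> * M * z ^ j) \<longlongrightarrow> 0) (at_right 0)" using \<open>j \<ge> 1\<close> by (simp add: power_0_left)
  qed
  then show ?thesis by simp
qed

text \<open>All three constants are multiplied by \<open>\<bar>\<omega>\<bar> * M\<close>.
  \<open>C1\<close> is the error of the first flux relation, with horizon values included;
  \<open>Ce\<close> is the error in \<open>F * B' = w * Q + e\<close>; \<open>CQ\<close> adds the
  bound for \<open>Q\<close> at the horizon to \<open>Ce\<close> divided by the lower bound
  \<open>al * ga / z0 ^ (N + 3)\<close> of \<open>w\<close>.\<close>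

definition C1 :: real where "C1 = 2 + 3 * \<bar>q\<bar> * z0 ^ (2 * N + 2) / \<bar>c1\<bar>"
definition Ce :: real where "Ce = \<bar>q\<bar> * C1 + \<bar>al\<bar> + \<bar>2 * a1 * c1\<bar> + 2 * KB"
definition CQ :: real where "CQ = 3 * z0 ^ (N + 2) / \<bar>c1\<bar> + Ce * z0 ^ (N + 3) / (al * ga)"

lemma consts_nonneg: "C1 \<ge> 0" "Ce \<ge> 0" "CQ \<ge> 0"
proof -
  show 1: "C1 \<ge> 0" unfolding C1_def using z0 by simp
  then show 2: "Ce \<ge> 0" unfolding Ce_def using KB_nonneg by simp
  then show "CQ \<ge> 0" unfolding CQ_def using z0 alga by (simp add: divide_nonneg_pos)
qed

lemma tendsto_left_z0:
  fixes f :: "real \<Rightarrow> complex"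
  assumes "continuous_on {0..z0} f"
  shows "(f \<longlongrightarrow> f z0) (at_left z0)"
proof -
  have "(f \<longlongrightarrow> f z0) (at z0 within {0..z0})" using assms z0 by (auto simp: continuous_on_def)
  then show ?thesis by (simp add: at_within_Icc_at_left z0)
qed

section \<open>Flux relations of regular solutions and smallness of the integrated source\<close>

context
  fixes \<omega> M :: real and A Z X A' Z' X' :: "real \<Rightarrow> complex"
  assumes reg: "reg \<omega> M A Z X A' Z' X'"
begin

abbreviation (input) B :: "real \<Rightarrow> complex" where "B \<equiv> \<lambda>z. Bc (A z) (Z z) (X z)"

lemma reg_bnd: "bnd M A A'" "bnd M Z Z'" "bnd M X X'"
  using reg by (auto simp: reg_def)

lemma reg_le: "z \<in> {0..z0} \<Longrightarrow> norm (A z) \<le> M" "z \<in> {0..z0} \<Longrightarrow> norm (Z z) \<le> M"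
    "z \<in> {0..z0} \<Longrightarrow> norm (X z) \<le> M"
  using reg_bnd by (auto simp: bnd_def)

lemma reg_M: "M \<ge> 0"
  by (rule order_trans[OF norm_ge_zero reg_le(1)[of 0]]) (use z0 in auto)

lemma reg_cont: "continuous_on {0..z0} A" "continuous_on {0..z0} Z" "continuous_on {0..z0} X"
    "continuous_on {0..z0} B"
proof -
  show "continuous_on {0..z0} A" "continuous_on {0..z0} Z" "continuous_on {0..z0} X"
    using reg_bnd by (auto simp: bnd_def)
  then show "continuous_on {0..z0} B" unfolding Bc_def by (intro continuous_intros)
qed

lemma reg_deriv:
  assumes "0 < z" "z < z0"
  shows "(A has_vector_derivative A' z) (at z)" "(Z has_vector_derivative Z' z) (at z)"
    "(X has_vector_derivative X' z) (at z)"
  using reg assms by (auto simp: reg_def rcomp_def)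

lemma reg_flux2:
  assumes "0 < z" "z < z0"
  shows "norm (flux \<omega> Z Z' z - of_real (ga / z ^ (N + 3)) * cumul B z) \<le> \<bar>\<omega>\<bar> * M"
proof -
  have "norm (of_real (z ^ (N + 3)) * flux \<omega> Z Z' z - of_real ga * cumul B z) \<le> \<bar>\<omega>\<bar> * M * z ^ (N + 3)"
    by (rule flux_power_near_cumul) (use reg assms reg_cont in \<open>auto simp: reg_def\<close>)
  moreover have "of_real (z ^ (N + 3)) * flux \<omega> Z Z' z - of_real ga * cumul B z =
      of_real (z ^ (N + 3)) * (flux \<omega> Z Z' z - of_real (ga / z ^ (N + 3)) * cumul B z)"
    using assms by (simp add: field_simps)
  ultimately have "z ^ (N + 3) * norm (flux \<omega> Z Z' z - of_real (ga / z ^ (N + 3)) * cumul B z) \<le> z ^ (N + 3) * (\<bar>\<omega>\<bar> * M)"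
    using assms by (simp only: norm_mult norm_of_real) (simp add: mult_ac)
  then show ?thesis using assms by simp
qed

lemma reg_flux3:
  assumes "0 < z" "z < z0"
  shows "norm (flux \<omega> X X' z - of_real (c1 / z ^ (N + 2)) * cumul B z) \<le> \<bar>\<omega>\<bar> * M"
proof -
  have "norm (of_real (z ^ (N + 2)) * flux \<omega> X X' z - of_real c1 * cumul B z) \<le> \<bar>\<omega>\<bar> * M * z ^ (N + 2)"
    by (rule flux_power_near_cumul) (use reg assms reg_cont in \<open>auto simp: reg_def\<close>)
  moreover have "of_real (z ^ (N + 2)) * flux \<omega> X X' z - of_real c1 * cumul B z =
      of_real (z ^ (N + 2)) * (flux \<omega> X X' z - of_real (c1 / z ^ (N + 2)) * cumul B z)"
    using assms by (simp add: field_simps)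
  ultimately have "z ^ (N + 2) * norm (flux \<omega> X X' z - of_real (c1 / z ^ (N + 2)) * cumul B z) \<le> z ^ (N + 2) * (\<bar>\<omega>\<bar> * M)"
    using assms by (simp only: norm_mult norm_of_real) (simp add: mult_ac)
  then show ?thesis using assms by simp
qed

text \<open>The third flux relation read at the horizon: the flux tends to
  \<open>2 * \<i> * \<omega> * X z0\<close>, which together with the error of the relation gives the
  factor \<open>3 = 2 + 1\<close>. This is the endpoint bound for the maximum principle.\<close>

lemma reg_cumul_horizon: "norm (cumul B z0) \<le> 3 * \<bar>\<omega>\<bar> * M * z0 ^ (N + 2) / \<bar>c1\<bar>"
proof -
  have ev: "eventually (\<lambda>z. 0 < z \<and> z < z0) (at_left z0)"
    using z0 eventually_at_left by blast
  have "norm (2 * \<i> * of_real \<omega> * X z0 - of_real (c1 / z0 ^ (N + 2)) * cumul B z0) \<le> \<bar>\<omega>\<bar> * M"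
  proof (rule tendsto_upperbound)
    have "((\<lambda>z. c1 / z ^ (N + 2)) \<longlongrightarrow> c1 / z0 ^ (N + 2)) (at_left z0)"
      using z0 by (intro tendsto_intros) auto
    then show "((\<lambda>z. norm (flux \<omega> X X' z - of_real (c1 / z ^ (N + 2)) * cumul B z)) \<longlongrightarrow>
        norm (2 * \<i> * of_real \<omega> * X z0 - of_real (c1 / z0 ^ (N + 2)) * cumul B z0)) (at_left z0)"
      by (intro tendsto_norm tendsto_diff tendsto_mult tendsto_of_real
            flux_tendsto_horizon[OF reg_bnd(3)] tendsto_left_z0 continuous_on_cumul reg_cont)
    show "\<forall>\<^sub>F z in at_left z0. norm (flux \<omega> X X' z - of_real (c1 / z ^ (N + 2)) * cumul B z) \<le> \<bar>\<omega>\<bar> * M"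
      using ev by eventually_elim (rule reg_flux3; simp)
  qed simp
  moreover have "norm (2 * \<i> * of_real \<omega> * X z0) \<le> 2 * \<bar>\<omega>\<bar> * M"
    using reg_le(3)[of z0] z0 by (simp add: norm_mult mult_left_mono)
  ultimately have "norm (of_real (c1 / z0 ^ (N + 2)) * cumul B z0) \<le> 3 * \<bar>\<omega>\<bar> * M"
    using norm_triangle_ineq2[of "of_real (c1 / z0 ^ (N + 2)) * cumul B z0" "2 * \<i> * of_real \<omega> * X z0"]
    by (simp only: norm_minus_commute)
  then have "\<bar>c1\<bar> / z0 ^ (N + 2) * norm (cumul B z0) \<le> 3 * \<bar>\<omega>\<bar> * M"
    using z0 by (simp only: norm_mult norm_of_real) (simp add: abs_mult)
  then show ?thesis using z0 c1 by (simp add: field_simps)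
qed

text \<open>The weight \<open>1 / z ^ N\<close> does not vanish at \<open>0\<close>, so the flux of
  \<open>a\<close> has an undetermined value there. The integration therefore starts at the horizon,
  where the flux limit and \<open>cumul\<close> are both under control.\<close>

lemma reg_flux1:
  assumes z: "0 < z" "z < z0"
  shows "norm (flux \<omega> A A' z + \<i> * of_real (q * z ^ N) * cumul B z) \<le> C1 * (\<bar>\<omega>\<bar> * M)"
proof -
  let ?f = "\<lambda>z. of_real (1 / z ^ N) * flux \<omega> A A' z + \<i> * of_real q * cumul B z"
  let ?l = "of_real (1 / z0 ^ N) * (2 * \<i> * of_real \<omega> * A z0) + \<i> * of_real q * cumul B z0"
  have *: "norm (?l - ?f z) \<le> - (\<bar>\<omega>\<bar> * M / z0 ^ N) - - (\<bar>\<omega>\<bar> * M / z ^ N)"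
  proof (rule norm_diff_le_by_derivative_right_end[OF z(2)])
    fix t assume t: "z \<le> t" "t < z0"
    have "((\<lambda>z. of_real (1 / z ^ N) * flux \<omega> A A' z) has_vector_derivative
        \<i> * of_real (\<omega> * (- real N / t ^ (N + 1))) * A t + - \<i> * of_real q * of_real (t ^ (N + 2)) * B t) (at t)"
      using reg t z unfolding reg_def rcomp_def by auto
    then have "(?f has_vector_derivative \<i> * of_real (\<omega> * (- real N / t ^ (N + 1))) * A t + - \<i> * of_real q * of_real (t ^ (N + 2)) * B t
       + \<i> * of_real q * (of_real (t ^ (N + 2)) * B t)) (at t)"
      using t z by (intro has_vector_derivative_add has_vector_derivative_mult_right cumul_derivative reg_cont) auto
    then show "(?f has_vector_derivative \<i> * of_real (\<omega> * (- real N / t ^ (N + 1))) * A t) (at t)"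
      by (simp add: mult.assoc)
    have "((\<lambda>z. - (\<bar>\<omega>\<bar> * M * inverse (z ^ N))) has_real_derivative
        - (\<bar>\<omega>\<bar> * M * - (inverse (t ^ N) * (real N * t ^ (N - 1)) * inverse (t ^ N)))) (at t)"
      using t z by (auto intro!: derivative_eq_intros)
    moreover have "- (\<bar>\<omega>\<bar> * M * - (inverse (t ^ N) * (real N * t ^ (N - 1)) * inverse (t ^ N))) = \<bar>\<omega>\<bar> * M * (real N / t ^ (N + 1))"
      using t z by (cases N) (auto simp: field_simps)
    ultimately show "((\<lambda>z. - (\<bar>\<omega>\<bar> * M / z ^ N)) has_real_derivative \<bar>\<omega>\<bar> * M * (real N / t ^ (N + 1))) (at t)"
      by (simp only: divide_inverse)
    have "norm (A t) \<le> M" using reg_le(1)[of t] t z by auto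
    then show "norm (\<i> * of_real (\<omega> * (- real N / t ^ (N + 1))) * A t) \<le> \<bar>\<omega>\<bar> * M * (real N / t ^ (N + 1))"
      using t z mult_left_mono[of "norm (A t)" M "\<bar>\<omega>\<bar> * (real N / t ^ (N + 1))"]
      by (simp add: norm_mult norm_power norm_divide abs_mult mult_ac)
  next
    have "((\<lambda>z. 1 / z ^ N) \<longlongrightarrow> 1 / z0 ^ N) (at_left z0)" using z0 by (intro tendsto_intros) auto
    then show "(?f \<longlongrightarrow> ?l) (at_left z0)"
      by (intro tendsto_add tendsto_mult tendsto_of_real tendsto_const
            flux_tendsto_horizon[OF reg_bnd(1)] tendsto_left_z0 continuous_on_cumul reg_cont)
    show "((\<lambda>z. - (\<bar>\<omega>\<bar> * M / z ^ N)) \<longlongrightarrow> - (\<bar>\<omega>\<bar> * M / z0 ^ N)) (at_left z0)"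
      using z0 by (intro tendsto_intros) auto
  qed
  have "norm (of_real (1 / z0 ^ N) * (2 * \<i> * of_real \<omega> * A z0)) \<le> 2 * (\<bar>\<omega>\<bar> * M / z0 ^ N)"
    using reg_le(1)[of z0] z0 by (simp add: norm_mult norm_divide norm_power mult_left_mono divide_right_mono)
  moreover have "norm (\<i> * of_real q * cumul B z0) \<le> \<bar>q\<bar> * (3 * \<bar>\<omega>\<bar> * M * z0 ^ (N + 2) / \<bar>c1\<bar>)"
    unfolding norm_mult using mult_left_mono[OF reg_cumul_horizon, of "\<bar>q\<bar>"] by simp
  ultimately have l: "norm ?l \<le> 2 * (\<bar>\<omega>\<bar> * M / z0 ^ N) + \<bar>q\<bar> * (3 * \<bar>\<omega>\<bar> * M * z0 ^ (N + 2) / \<bar>c1\<bar>)"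
    by (meson norm_triangle_mono)
  have k: "\<bar>\<omega>\<bar> * M / z0 ^ N \<le> \<bar>\<omega>\<bar> * M / z ^ N"
    using z reg_M by (intro divide_left_mono power_mono mult_nonneg_nonneg) auto
  have "norm (?f z) \<le> 2 * (\<bar>\<omega>\<bar> * M / z ^ N) + \<bar>q\<bar> * (3 * \<bar>\<omega>\<bar> * M * z0 ^ (N + 2) / \<bar>c1\<bar>)"
    using norm_triangle_ineq3[of ?l "?f z"] * l k by linarith
  then have "z ^ N * norm (?f z) \<le> z ^ N * (2 * (\<bar>\<omega>\<bar> * M / z ^ N) + \<bar>q\<bar> * (3 * \<bar>\<omega>\<bar> * M * z0 ^ (N + 2) / \<bar>c1\<bar>))"
    using z by (intro mult_left_mono) auto
  also have "\<dots> = 2 * (\<bar>\<omega>\<bar> * M) + z ^ N * (\<bar>q\<bar> * (3 * \<bar>\<omega>\<bar> * M * z0 ^ (N + 2) / \<bar>c1\<bar>))"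
    using z by (simp add: field_simps)
  also have "\<dots> \<le> 2 * (\<bar>\<omega>\<bar> * M) + z0 ^ N * (\<bar>q\<bar> * (3 * \<bar>\<omega>\<bar> * M * z0 ^ (N + 2) / \<bar>c1\<bar>))"
    using z reg_M by (intro add_left_mono mult_right_mono power_mono) auto
  also have "\<dots> = C1 * (\<bar>\<omega>\<bar> * M)"
  proof -
    have "z0 ^ (2 * N + 2) = z0 ^ N * z0 ^ (N + 2)" by (simp add: mult_2 power_add)
    then show ?thesis unfolding C1_def by (simp only:) (simp add: algebra_simps)
  qed
  also have "z ^ N * norm (?f z) = norm (of_real (z ^ N) * ?f z)"
    using z by (simp add: norm_mult norm_power)
  also have "of_real (z ^ N) * ?f z = flux \<omega> A A' z + \<i> * of_real (q * z ^ N) * cumul B z"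
    using z by (simp add: field_simps)
  finally show ?thesis .
qed

text \<open>Adding the three flux relations with the weights of \<open>Bc\<close> gives
  \<open>F * B' = w * Q + e\<close>. The coefficients combine to
  \<open>\<i> * q * (- \<i> * q) = q^2\<close>, \<open>al * ga\<close> and
  \<open>2 * a1 * c1^2\<close>, so each term of \<open>w\<close> is nonnegative and the maximum
  principle applies.\<close>

lemma reg_cumul_le:
  assumes z: "z \<in> {0..z0}"
  shows "norm (cumul B z) \<le> CQ * (\<bar>\<omega>\<bar> * M)"
proof -
  define w where "w = (\<lambda>z. q\<^sup>2 * z ^ N + al * ga / z ^ (N + 3) + 2 * a1 * c1\<^sup>2 / z ^ (N + 2))"
  define e where "e = (\<lambda>z. \<i> * of_real q * (flux \<omega> A A' z + \<i> * of_real (q * z ^ N) * cumul B z)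
    + of_real al * (flux \<omega> Z Z' z - of_real (ga / z ^ (N + 3)) * cumul B z)
    + of_real (2 * a1 * c1) * (flux \<omega> X X' z - of_real (c1 / z ^ (N + 2)) * cumul B z)
    - 2 * \<i> * of_real \<omega> * B z)"
  have eq: "of_real (F z) * Bc (A' z) (Z' z) (X' z) = of_real (w z) * cumul B z + e z" for z
    unfolding w_def e_def flux_def Bc_def
    by (simp add: algebra_simps power2_eq_square divide_inverse flip: of_real_inverse of_real_power)
  have e: "norm (e z) \<le> Ce * (\<bar>\<omega>\<bar> * M)" if "0 < z" "z < z0" for z
  proof -
    have "norm (e z) \<le> \<bar>q\<bar> * (C1 * (\<bar>\<omega>\<bar> * M)) + \<bar>al\<bar> * (\<bar>\<omega>\<bar> * M) + \<bar>2 * a1 * c1\<bar> * (\<bar>\<omega>\<bar> * M) + 2 * \<bar>\<omega>\<bar> * (KB * M)"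
      unfolding e_def
    proof (intro order_trans[OF norm_triangle_ineq4] add_mono order_trans[OF norm_triangle_ineq])
      show "norm (\<i> * of_real q * (flux \<omega> A A' z + \<i> * of_real (q * z ^ N) * cumul B z)) \<le> \<bar>q\<bar> * (C1 * (\<bar>\<omega>\<bar> * M))"
        using mult_left_mono[OF reg_flux1[OF that], of "\<bar>q\<bar>"] by (simp add: norm_mult)
      show "norm (of_real al * (flux \<omega> Z Z' z - of_real (ga / z ^ (N + 3)) * cumul B z)) \<le> \<bar>al\<bar> * (\<bar>\<omega>\<bar> * M)"
        using mult_left_mono[OF reg_flux2[OF that], of "\<bar>al\<bar>"] by (simp add: norm_mult)
      show "norm (of_real (2 * a1 * c1) * (flux \<omega> X X' z - of_real (c1 / z ^ (N + 2)) * cumul B z)) \<le> \<bar>2 * a1 * c1\<bar> * (\<bar>\<omega>\<bar> * M)"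
        using mult_left_mono[OF reg_flux3[OF that], of "\<bar>2 * a1 * c1\<bar>"] by (simp add: norm_mult abs_mult)
      have "norm (B z) \<le> KB * M" using that by (intro norm_Bc_le reg_le) auto
      then show "norm (2 * \<i> * of_real \<omega> * B z) \<le> 2 * \<bar>\<omega>\<bar> * (KB * M)"
        by (simp add: norm_mult mult_left_mono)
    qed
    also have "\<dots> = Ce * (\<bar>\<omega>\<bar> * M)" unfolding Ce_def by (simp add: algebra_simps)
    finally show ?thesis .
  qed
  have wM: "0 \<le> \<bar>\<omega>\<bar> * M" using reg_M by simp
  show ?thesis
  proof (rule max_principle[where w = "\<lambda>z. w z / F z" and e = "\<lambda>z. e z / of_real (F z)" and S = B and m = "N + 2", OF z0])
    show "continuous_on {0..z0} (cumul B)" by (intro continuous_on_cumul reg_cont)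
    show "cumul B 0 = 0" by (intro cumul_0 reg_cont)
    have "norm (cumul B z0) \<le> 3 * z0 ^ (N + 2) / \<bar>c1\<bar> * (\<bar>\<omega>\<bar> * M)"
      using reg_cumul_horizon by (simp add: algebra_simps)
    also have "\<dots> \<le> CQ * (\<bar>\<omega>\<bar> * M)"
      unfolding CQ_def using consts_nonneg z0 alga wM by (intro mult_right_mono) (auto simp: divide_nonneg_pos)
    finally show "norm (cumul B z0) \<le> CQ * (\<bar>\<omega>\<bar> * M)" .
    fix z assume z: "0 < z" "z < z0"
    show "(cumul B has_vector_derivative of_real (z ^ (N + 2)) * B z) (at z)"
      by (intro cumul_derivative reg_cont z)
    have F: "F z > 0" using ppos z by simp
    have "(B has_vector_derivative Bc (A' z) (Z' z) (X' z)) (at z)"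
      unfolding Bc_def by (intro has_vector_derivative_add has_vector_derivative_mult_right reg_deriv z)
    moreover have "Bc (A' z) (Z' z) (X' z) = of_real (w z / F z) * cumul B z + e z / of_real (F z)"
      using eq[of z] F by (simp add: field_simps)
    ultimately show "(B has_vector_derivative of_real (w z / F z) * cumul B z + e z / of_real (F z)) (at z)"
      by simp
    \<comment> \<open>The middle term of \<open>w\<close> alone gives a positive lower bound that is
      uniform in \<open>z\<close>; this bound defines \<open>CQ\<close>.\<close>
    have w1: "al * ga / z0 ^ (N + 3) \<le> al * ga / z ^ (N + 3)"
      using z alga by (intro divide_left_mono power_mono) auto
    have w2: "al * ga / z ^ (N + 3) \<le> w z"
      unfolding w_def using z a1 by (auto simp: divide_nonneg_pos)
    have w3: "0 < al * ga / z0 ^ (N + 3)" using alga z0 by simp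
    show "0 < w z / F z" using w1 w2 w3 F by (intro divide_pos_pos) linarith+
    have "Ce * (\<bar>\<omega>\<bar> * M) = Ce * z0 ^ (N + 3) / (al * ga) * (\<bar>\<omega>\<bar> * M) * (al * ga / z0 ^ (N + 3))"
      using alga z0 by (cases "al = 0"; cases "ga = 0") (simp_all add: field_simps)
    also have "\<dots> \<le> CQ * (\<bar>\<omega>\<bar> * M) * w z"
      unfolding CQ_def using consts_nonneg z0 alga wM w1 w2 w3
      by (intro mult_mono mult_right_mono) (auto simp: divide_nonneg_pos intro!: mult_nonneg_nonneg)
    finally have "norm (e z) \<le> CQ * (\<bar>\<omega>\<bar> * M) * w z" using e[OF z] by linarith
    then show "norm (e z / of_real (F z)) \<le> CQ * (\<bar>\<omega>\<bar> * M) * (w z / F z)"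
      using F by (simp add: norm_divide divide_right_mono)
  qed (use assms in auto)
qed

text \<open>In the two scalar estimates \<open>norm (cumul B z)\<close> is left standing, because it
  is bounded in two ways later: by a multiple of \<open>\<omega>\<close> away from \<open>0\<close>,
  and by a multiple of \<open>z ^ (N + 3)\<close> near \<open>0\<close>.\<close>

lemma reg_F_deriv_le:
  assumes z: "0 < z" "z < z0"
  shows "F z * norm (A' z) \<le> (C1 + \<bar>q\<bar> * z0 ^ N * CQ + 2) * (\<bar>\<omega>\<bar> * M)"
    and "F z * norm (Z' z) \<le> \<bar>ga\<bar> / z ^ (N + 3) * norm (cumul B z) + 3 * (\<bar>\<omega>\<bar> * M)"
    and "F z * norm (X' z) \<le> \<bar>c1\<bar> / z ^ (N + 2) * norm (cumul B z) + 3 * (\<bar>\<omega>\<bar> * M)"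
proof -
  have F: "F z > 0" using ppos z by simp
  have eq: "F z * norm (f' z) \<le> norm (flux \<omega> f f' z + c) + norm c + 2 * (\<bar>\<omega>\<bar> * M)"
    if "norm (f z) \<le> M" for f f' :: "real \<Rightarrow> complex" and c
  proof -
    have "of_real (F z) * f' z = (flux \<omega> f f' z + c) - c - 2 * \<i> * of_real \<omega> * f z"
      by (simp add: flux_def)
    then have "norm (of_real (F z) * f' z) \<le> norm (flux \<omega> f f' z + c) + norm c + norm (2 * \<i> * of_real \<omega> * f z)"
      by (metis norm_triangle_ineq4 order_trans add_right_mono)
    also have "norm (2 * \<i> * of_real \<omega> * f z) \<le> 2 * (\<bar>\<omega>\<bar> * M)"
      using that by (simp add: norm_mult mult_left_mono)
    finally show ?thesis using F by (simp add: norm_mult)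
  qed
  have le: "norm (A z) \<le> M" "norm (Z z) \<le> M" "norm (X z) \<le> M" using reg_le[of z] z by auto
  have "norm (\<i> * of_real (q * z ^ N) * cumul B z) = \<bar>q\<bar> * z ^ N * norm (cumul B z)"
    using z by (simp add: norm_mult norm_power)
  also have "\<dots> \<le> \<bar>q\<bar> * z0 ^ N * (CQ * (\<bar>\<omega>\<bar> * M))"
    using z by (intro mult_mono power_mono mult_left_mono reg_cumul_le) auto
  finally show "F z * norm (A' z) \<le> (C1 + \<bar>q\<bar> * z0 ^ N * CQ + 2) * (\<bar>\<omega>\<bar> * M)"
    using eq[of A A' "\<i> * of_real (q * z ^ N) * cumul B z"] reg_flux1[OF z] le
    by (simp add: algebra_simps)
  have 2: "norm (- (of_real (ga / z ^ (N + 3)) * cumul B z)) = \<bar>ga\<bar> / z ^ (N + 3) * norm (cumul B z)"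
    using z by (simp add: norm_mult norm_divide norm_power)
  show "F z * norm (Z' z) \<le> \<bar>ga\<bar> / z ^ (N + 3) * norm (cumul B z) + 3 * (\<bar>\<omega>\<bar> * M)"
    using eq[of Z Z' "- (of_real (ga / z ^ (N + 3)) * cumul B z)"] reg_flux2[OF z] le
    unfolding 2 by (simp del: of_real_divide of_real_power)
  have 3: "norm (- (of_real (c1 / z ^ (N + 2)) * cumul B z)) = \<bar>c1\<bar> / z ^ (N + 2) * norm (cumul B z)"
    using z by (simp add: norm_mult norm_divide norm_power)
  show "F z * norm (X' z) \<le> \<bar>c1\<bar> / z ^ (N + 2) * norm (cumul B z) + 3 * (\<bar>\<omega>\<bar> * M)"
    using eq[of X X' "- (of_real (c1 / z ^ (N + 2)) * cumul B z)"] reg_flux3[OF z] le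
    unfolding 3 by (simp del: of_real_divide of_real_power)
qed

end

end

lemma inverse_power_derivative:
  fixes z :: real
  assumes "z > 0"
  shows "((\<lambda>z. 1 / z ^ n) has_real_derivative - real n / z ^ (n + 1)) (at z)"
proof -
  have "((\<lambda>z. inverse (z ^ n)) has_real_derivative
      - (inverse (z ^ n) * (real n * z ^ (n - 1)) * inverse (z ^ n))) (at z)"
    using assms by (auto intro!: derivative_eq_intros)
  moreover have "- (inverse (z ^ n) * (real n * z ^ (n - 1)) * inverse (z ^ n)) = - real n / z ^ (n + 1)"
    using assms by (cases n) (auto simp: field_simps)
  ultimately show ?thesis by (simp only: divide_inverse mult_1)
qed

section \<open>Derivative bounds and near constancy on the whole interval\<close>

context brane
begin

text \<open>Dividing by \<open>F\<close> is possible because the right-hand side vanishes at the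
  horizon too. One part of it is bounded by \<open>z0 - z\<close> times the supremum
  \<open>D\<close> of \<open>norm f'\<close> itself, but with a factor \<omega>; for small \<omega>
  it is absorbed on the left. The result bounds \<open>f'\<close> by a multiple of \<open>M\<close>,
  without a factor \<omega>.\<close>

lemma rcomp_deriv_near_horizon:
  fixes \<kappa> \<kappa>' :: "real \<Rightarrow> real" and s :: complex
  assumes d: "\<And>z. 0 < z \<Longrightarrow> (\<kappa> has_real_derivative \<kappa>' z) (at z)"
    and low: "0 < l" "\<And>z. z0 / 2 \<le> z \<Longrightarrow> z \<le> z0 \<Longrightarrow> l \<le> \<kappa> z"
    and high: "\<And>z. z0 / 2 \<le> z \<Longrightarrow> z \<le> z0 \<Longrightarrow> \<kappa> z \<le> h" "\<And>z. z0 / 2 \<le> z \<Longrightarrow> z \<le> z0 \<Longrightarrow> \<bar>\<kappa>' z\<bar> \<le> h"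
  shows "\<exists>L w. 0 < w \<and> 0 \<le> L \<and> (\<forall>\<omega> M S f f'. \<bar>\<omega>\<bar> \<le> w \<longrightarrow> rcomp \<omega> \<kappa> \<kappa>' s S f f' \<longrightarrow> bnd M f f' \<longrightarrow>
    (\<forall>z\<in>{0..z0}. norm (S z) \<le> KB * M) \<longrightarrow> (\<forall>z. z0 / 2 \<le> z \<longrightarrow> z < z0 \<longrightarrow> norm (f' z) \<le> L * M))"
proof -
  obtain f0 where f0: "f0 > 0" "\<And>z. 0 \<le> z \<Longrightarrow> z \<le> z0 \<Longrightarrow> f0 * (z0 - z) \<le> F z"
    by (rule F_lower_bound) blast
  have h: "h > 0" using low(1) low(2)[of z0] high(1)[of z0] z0 by simp
  define K1 where "K1 = h + norm s * z0 ^ (N + 2) * KB"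
  have K1: "K1 \<ge> 0" unfolding K1_def using h z0 KB_nonneg by simp
  define L where "L = 2 * ((K1 + 2 * h) / (l * f0))"
  \<comment> \<open>With \<open>4 * h * \<bar>\<omega>\<bar> \<le> l * f0\<close> the term
    containing \<open>D\<close> becomes at most \<open>D / 2\<close> after division by
    \<open>l * f0\<close>.\<close>
  define w where "w = min 1 (l * f0 / (4 * h))"
  have w: "w > 0" unfolding w_def using low f0 h by simp
  have L: "L \<ge> 0" unfolding L_def using K1 h low f0 by simp
  {
    fix \<omega> M S f f'
    assume om: "\<bar>\<omega>\<bar> \<le> w" and r: "rcomp \<omega> \<kappa> \<kappa>' s S f f'" and b: "bnd M f f'"
      and S: "\<forall>z\<in>{0..z0}. norm (S z) \<le> KB * M"
    have fM: "norm (f z) \<le> M" if "z \<in> {0..z0}" for z using b that by (auto simp: bnd_def)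
    have M: "M \<ge> 0" by (rule order_trans[OF norm_ge_zero fM[of 0]]) (use z0 in auto)
    have fd: "(f has_vector_derivative f' z) (at z)" if "0 < z" "z < z0" for z
      using r that by (auto simp: rcomp_def)
    have fc: "continuous_on {0..z0} f" using b by (simp add: bnd_def)
    have om1: "\<bar>\<omega>\<bar> \<le> 1" and om2: "\<bar>\<omega>\<bar> * (4 * h) \<le> l * f0"
      using om h unfolding w_def by (simp_all add: field_simps)
    \<comment> \<open>The absorption argument needs a finite supremum; the qualitative derivative
      bound in \<open>bnd\<close> provides it.\<close>
    define D where "D = (SUP z\<in>{z0/2..<z0}. norm (f' z))"
    obtain D1 where D1: "\<And>z. 0 < z \<Longrightarrow> z < z0 \<Longrightarrow> norm (f' z) \<le> D1" using b by (auto simp: bnd_def)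
    have bdd: "bdd_above ((\<lambda>z. norm (f' z)) ` {z0/2..<z0})"
      by (rule bdd_aboveI2[where M = D1]) (use z0 D1 in auto)
    have D: "norm (f' z) \<le> D" if "z0 / 2 \<le> z" "z < z0" for z
      unfolding D_def by (rule cSUP_upper[OF _ bdd]) (use that in auto)
    have D0: "D \<ge> 0" by (rule order_trans[OF norm_ge_zero D[of "z0/2"]]) (use z0 in auto)
    have key: "norm (f' z) \<le> (K1 + 2 * h) / (l * f0) * M + D / 2" if z: "z0 / 2 \<le> z" "z < z0" for z
    proof -
      have zp: "0 < z" using z z0 by linarith
      let ?P = "\<lambda>z. of_real (\<kappa> z) * flux \<omega> f f' z"
      let ?l = "of_real (\<kappa> z0) * (2 * \<i> * of_real \<omega> * f z0)"
      have 1: "norm (?l - ?P z) \<le> K1 * M * z0 - K1 * M * z"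
      proof (rule norm_diff_le_by_derivative_right_end[OF z(2)])
        fix t assume t: "z \<le> t" "t < z0"
        show "(?P has_vector_derivative \<i> * of_real (\<omega> * \<kappa>' t) * f t + s * of_real (t ^ (N + 2)) * S t) (at t)"
          using r t zp by (auto simp: rcomp_def)
        show "((*) (K1 * M) has_real_derivative K1 * M) (at t)" by (auto intro!: derivative_eq_intros)
        have "norm (\<i> * of_real (\<omega> * \<kappa>' t) * f t) = \<bar>\<omega>\<bar> * (\<bar>\<kappa>' t\<bar> * norm (f t))"
          by (simp add: norm_mult abs_mult)
        also have "\<dots> \<le> 1 * (h * M)"
          using om1 high(2)[of t] fM[of t] t z zp h by (intro mult_mono) auto
        finally have a: "norm (\<i> * of_real (\<omega> * \<kappa>' t) * f t) \<le> h * M" by simp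
        have "norm (s * of_real (t ^ (N + 2)) * S t) = norm s * t ^ (N + 2) * norm (S t)"
          using t zp by (simp add: norm_mult norm_power)
        also have "\<dots> \<le> norm s * z0 ^ (N + 2) * (KB * M)"
          using S t zp z0 by (intro mult_mono mult_left_mono power_mono) auto
        finally show "norm (\<i> * of_real (\<omega> * \<kappa>' t) * f t + s * of_real (t ^ (N + 2)) * S t) \<le> K1 * M"
          using a unfolding K1_def
          by (intro order_trans[OF norm_triangle_ineq]) (simp add: algebra_simps)
      next
        have "(\<kappa> \<longlongrightarrow> \<kappa> z0) (at_left z0)"
          using DERIV_isCont[OF d[OF z0]] by (simp add: isCont_def filterlim_at_split)
        then show "(?P \<longlongrightarrow> ?l) (at_left z0)"
          by (intro tendsto_mult tendsto_of_real flux_tendsto_horizon[OF b])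
        show "((*) (K1 * M) \<longlongrightarrow> K1 * M * z0) (at_left z0)" by (intro tendsto_intros)
      qed
      have 2: "norm (of_real (\<kappa> z0) * f z0 - of_real (\<kappa> z) * f z) \<le> (h * M + h * D) * (z0 - z)"
      proof (rule norm_diff_le_closed)
        have "continuous_on {z..z0} \<kappa>"
          using zp by (intro continuous_at_imp_continuous_on ballI DERIV_isCont[OF d]) auto
        then show "continuous_on {z..z0} (\<lambda>z. of_real (\<kappa> z) * f z)"
          using fc zp by (intro continuous_intros) (auto intro: continuous_on_subset)
        fix t assume t: "z < t" "t < z0"
        show "((\<lambda>z. of_real (\<kappa> z) * f z) has_vector_derivative of_real (\<kappa> t) * f' t + of_real (\<kappa>' t) * f t) (at t)"
          using t zp by (intro has_vector_derivative_mult has_vector_derivative_of_real fd d) auto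
        have k: "\<bar>\<kappa> t\<bar> \<le> h" "\<bar>\<kappa>' t\<bar> \<le> h" using low high t z by (auto simp: abs_le_iff) (smt (verit))
        have "norm (of_real (\<kappa> t) * f' t + of_real (\<kappa>' t) * f t) \<le> \<bar>\<kappa> t\<bar> * norm (f' t) + \<bar>\<kappa>' t\<bar> * norm (f t)"
          by (intro order_trans[OF norm_triangle_ineq]) (simp add: norm_mult)
        also have "\<dots> \<le> h * D + h * M"
          using k D[of t] fM[of t] t z zp h by (intro add_mono mult_mono) auto
        finally show "norm (of_real (\<kappa> t) * f' t + of_real (\<kappa>' t) * f t) \<le> h * M + h * D" by simp
      qed (use z in auto)
      \<comment> \<open>Subtracting the horizon values makes both terms of order
        \<open>z0 - z\<close>. This factor is then cancelled against
        \<open>F z \<ge> f0 * (z0 - z)\<close>.\<close>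
      have "of_real (\<kappa> z) * (of_real (F z) * f' z) =
          2 * \<i> * of_real \<omega> * (of_real (\<kappa> z0) * f z0 - of_real (\<kappa> z) * f z) - (?l - ?P z)"
        by (simp add: flux_def algebra_simps)
      then have "norm (of_real (\<kappa> z) * (of_real (F z) * f' z)) \<le> 2 * \<bar>\<omega>\<bar> * norm (of_real (\<kappa> z0) * f z0 - of_real (\<kappa> z) * f z) + norm (?l - ?P z)"
        by (metis (no_types, lifting) norm_triangle_ineq4 norm_mult norm_ii norm_numeral norm_of_real mult_1_right mult.assoc)
      also have "\<dots> \<le> 2 * \<bar>\<omega>\<bar> * ((h * M + h * D) * (z0 - z)) + (K1 * M * z0 - K1 * M * z)"
        using 1 2 by (intro add_mono mult_left_mono) auto
      also have "\<dots> = (K1 * M + 2 * \<bar>\<omega>\<bar> * (h * M) + 2 * \<bar>\<omega>\<bar> * (h * D)) * (z0 - z)"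
        by (simp add: algebra_simps)
      also have "\<dots> \<le> (K1 * M + 2 * 1 * (h * M) + l * f0 / 2 * D) * (z0 - z)"
      proof (rule mult_right_mono, intro add_mono)
        show "2 * \<bar>\<omega>\<bar> * (h * M) \<le> 2 * 1 * (h * M)"
          using om1 h M by (intro mult_right_mono mult_left_mono) auto
        show "2 * \<bar>\<omega>\<bar> * (h * D) \<le> l * f0 / 2 * D"
          using mult_right_mono[OF om2 D0] by simp
      qed (use z in auto)
      finally have 3: "norm (of_real (\<kappa> z) * (of_real (F z) * f' z)) \<le> ((K1 + 2 * h) * M + l * f0 / 2 * D) * (z0 - z)"
        by (simp add: algebra_simps)
      have "l * (f0 * (z0 - z)) * norm (f' z) \<le> \<kappa> z * F z * norm (f' z)"
        using low f0(1) f0(2)[of z] z zp ppos[of z] by (intro mult_mono mult_right_mono) (auto intro: order_trans[OF less_imp_le])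
      also have "\<dots> = norm (of_real (\<kappa> z) * (of_real (F z) * f' z))"
        using low(1) low(2)[of z] ppos[of z] z zp by (simp add: norm_mult)
      finally have "l * f0 * norm (f' z) * (z0 - z) \<le> ((K1 + 2 * h) * M + l * f0 / 2 * D) * (z0 - z)"
        using 3 by (simp add: algebra_simps)
      then have "l * f0 * norm (f' z) \<le> (K1 + 2 * h) * M + l * f0 / 2 * D"
        using z by simp
      then show ?thesis using low(1) f0(1) by (simp add: field_simps)
    qed
    have "D \<le> (K1 + 2 * h) / (l * f0) * M + D / 2"
      unfolding D_def by (rule cSUP_least) (use z0 key in \<open>auto simp: D_def\<close>)
    then have "D \<le> 2 * ((K1 + 2 * h) / (l * f0) * M)" by linarith
    then have "D \<le> L * M" by (simp only: L_def mult.assoc)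
    then have "\<forall>z. z0 / 2 \<le> z \<longrightarrow> z < z0 \<longrightarrow> norm (f' z) \<le> L * M" using D by (auto intro: order_trans)
  }
  then show ?thesis using w L by blast
qed

text \<open>Away from both ends \<open>F\<close> and the powers of \<open>z\<close> are bounded
  below, so the smallness of \<open>cumul\<close> passes to the derivatives with its factor
  \<omega>. The constant blows up as \<open>\<epsilon>\<close> tends to \<open>0\<close>.\<close>

lemma reg_deriv_mid:
  assumes "\<epsilon> > 0"
  shows "\<exists>C\<ge>0. \<forall>\<omega> M A Z X A' Z' X'. reg \<omega> M A Z X A' Z' X' \<longrightarrow> (\<forall>z. \<epsilon> \<le> z \<longrightarrow> z \<le> z0 - \<epsilon> \<longrightarrow>
    norm (A' z) \<le> C * (\<bar>\<omega>\<bar> * M) \<and> norm (Z' z) \<le> C * (\<bar>\<omega>\<bar> * M) \<and> norm (X' z) \<le> C * (\<bar>\<omega>\<bar> * M))"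
proof -
  obtain f0 where f0: "f0 > 0" "\<And>z. 0 \<le> z \<Longrightarrow> z \<le> z0 \<Longrightarrow> f0 * (z0 - z) \<le> F z"
    by (rule F_lower_bound) blast
  define K where "K = max (C1 + \<bar>q\<bar> * z0 ^ N * CQ + 2) (max (\<bar>ga\<bar> / \<epsilon> ^ (N + 3) * CQ + 3) (\<bar>c1\<bar> / \<epsilon> ^ (N + 2) * CQ + 3))"
  have K: "K \<ge> 0" unfolding K_def using consts_nonneg z0 by (simp add: le_max_iff_disj)
  define C where "C = K / (f0 * \<epsilon>)"
  {
    fix \<omega> M A Z X A' Z' X' z
    assume r: "reg \<omega> M A Z X A' Z' X'" and z: "\<epsilon> \<le> z" "z \<le> z0 - \<epsilon>"
    have z': "0 < z" "z < z0" using z assms by auto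
    have wM: "0 \<le> \<bar>\<omega>\<bar> * M" using reg_M[OF r] by simp
    have F: "f0 * \<epsilon> \<le> F z"
      using f0(2)[of z] z z' f0(1) mult_left_mono[of \<epsilon> "z0 - z" f0] by linarith
    have cu: "norm (cumul (\<lambda>z. Bc (A z) (Z z) (X z)) z) \<le> CQ * (\<bar>\<omega>\<bar> * M)"
      by (rule reg_cumul_le[OF r]) (use z' in auto)
    have *: "norm x \<le> C * (\<bar>\<omega>\<bar> * M)" if "F z * norm x \<le> c * (\<bar>\<omega>\<bar> * M)" "c \<le> K" for x :: complex and c
    proof -
      have "f0 * \<epsilon> * norm x \<le> F z * norm x" using F by (intro mult_right_mono) auto
      also have "\<dots> \<le> K * (\<bar>\<omega>\<bar> * M)" using that wM by (meson mult_right_mono order_trans)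
      finally show ?thesis unfolding C_def using f0 assms by (simp add: field_simps)
    qed
    have g: "\<bar>g\<bar> / z ^ j * norm (cumul (\<lambda>z. Bc (A z) (Z z) (X z)) z) \<le> \<bar>g\<bar> / \<epsilon> ^ j * (CQ * (\<bar>\<omega>\<bar> * M))" for g :: real and j
      using z z' assms cu by (intro mult_mono divide_left_mono power_mono) auto
    have "norm (A' z) \<le> C * (\<bar>\<omega>\<bar> * M)"
      by (rule *[OF reg_F_deriv_le(1)[OF r z']]) (simp add: K_def)
    moreover have "norm (Z' z) \<le> C * (\<bar>\<omega>\<bar> * M)"
    proof (rule *)
      show "F z * norm (Z' z) \<le> (\<bar>ga\<bar> / \<epsilon> ^ (N + 3) * CQ + 3) * (\<bar>\<omega>\<bar> * M)"
        using reg_F_deriv_le(2)[OF r z'] g[of ga "N + 3"] by (simp add: distrib_right)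
    qed (simp add: K_def)
    moreover have "norm (X' z) \<le> C * (\<bar>\<omega>\<bar> * M)"
    proof (rule *)
      show "F z * norm (X' z) \<le> (\<bar>c1\<bar> / \<epsilon> ^ (N + 2) * CQ + 3) * (\<bar>\<omega>\<bar> * M)"
        using reg_F_deriv_le(3)[OF r z'] g[of c1 "N + 2"] by (simp add: distrib_right)
    qed (simp add: K_def)
    ultimately have "norm (A' z) \<le> C * (\<bar>\<omega>\<bar> * M) \<and> norm (Z' z) \<le> C * (\<bar>\<omega>\<bar> * M) \<and> norm (X' z) \<le> C * (\<bar>\<omega>\<bar> * M)"
      by blast
  }
  then show ?thesis using K f0 assms by (intro exI[of _ C]) (auto simp: C_def)
qed

text \<open>Near \<open>0\<close> the bound of order \<omega> on \<open>cumul\<close> would be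
  divided by \<open>z ^ (N + 3)\<close>. The elementary bound \<open>KB * M * z ^ (N + 3)\<close>
  cancels this power, at the price of the factor \<omega>.\<close>

lemma reg_deriv_zero:
  "\<exists>C\<ge>0. \<forall>\<omega> M A Z X A' Z' X'. \<bar>\<omega>\<bar> \<le> 1 \<longrightarrow> reg \<omega> M A Z X A' Z' X' \<longrightarrow> (\<forall>z. 0 < z \<longrightarrow> z \<le> z0 / 2 \<longrightarrow>
    norm (A' z) \<le> C * M \<and> norm (Z' z) \<le> C * M \<and> norm (X' z) \<le> C * M)"
proof -
  obtain f0 where f0: "f0 > 0" "\<And>z. 0 \<le> z \<Longrightarrow> z \<le> z0 \<Longrightarrow> f0 * (z0 - z) \<le> F z"
    by (rule F_lower_bound) blast
  define K where "K = max (C1 + \<bar>q\<bar> * z0 ^ N * CQ + 2) (max (\<bar>ga\<bar> * KB + 3) (\<bar>c1\<bar> * z0 * KB + 3))"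
  have K: "K \<ge> 0" unfolding K_def using consts_nonneg z0 by (simp add: le_max_iff_disj)
  define C where "C = K / (f0 * (z0 / 2))"
  {
    fix \<omega> M A Z X A' Z' X' z
    assume om: "\<bar>\<omega>\<bar> \<le> 1" and r: "reg \<omega> M A Z X A' Z' X'" and z: "0 < z" "z \<le> z0 / 2"
    have z': "0 < z" "z < z0" using z z0 by auto
    have M: "0 \<le> M" using reg_M[OF r] by simp
    have F: "f0 * (z0 / 2) \<le> F z"
      using f0(2)[of z] z z' f0(1) mult_left_mono[of "z0 / 2" "z0 - z" f0] by linarith
    have wM: "\<bar>\<omega>\<bar> * M \<le> M" using om M mult_right_mono[of "\<bar>\<omega>\<bar>" 1 M] by simp
    have *: "norm x \<le> C * M" if "F z * norm x \<le> c * M" "c \<le> K" for x :: complex and c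
    proof -
      have "f0 * (z0 / 2) * norm x \<le> F z * norm x" using F by (intro mult_right_mono) auto
      also have "\<dots> \<le> K * M" using that M by (meson mult_right_mono order_trans)
      finally show ?thesis unfolding C_def using f0 z0 by (simp add: field_simps)
    qed
    have cu: "norm (cumul (\<lambda>z. Bc (A z) (Z z) (X z)) z) \<le> KB * M * z ^ (N + 3)"
      using norm_cumul_le[OF reg_cont(4)[OF r], of "KB * M" z] reg_le[OF r] z' norm_Bc_le by blast
    have "norm (A' z) \<le> C * M"
    proof (rule *)
      show "F z * norm (A' z) \<le> (C1 + \<bar>q\<bar> * z0 ^ N * CQ + 2) * M"
        by (rule order_trans[OF reg_F_deriv_le(1)[OF r z']], rule mult_left_mono[OF wM])
          (use consts_nonneg z0 in auto)
    qed (simp add: K_def)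
    moreover have "norm (Z' z) \<le> C * M"
    proof (rule *)
      have "\<bar>ga\<bar> / z ^ (N + 3) * norm (cumul (\<lambda>z. Bc (A z) (Z z) (X z)) z) \<le> \<bar>ga\<bar> / z ^ (N + 3) * (KB * M * z ^ (N + 3))"
        using cu z' by (intro mult_left_mono) auto
      also have "\<dots> = \<bar>ga\<bar> * KB * M" using z' by simp
      finally show "F z * norm (Z' z) \<le> (\<bar>ga\<bar> * KB + 3) * M"
        using reg_F_deriv_le(2)[OF r z'] wM by (simp add: distrib_right)
    qed (simp add: K_def)
    moreover have "norm (X' z) \<le> C * M"
    proof (rule *)
      have "\<bar>c1\<bar> / z ^ (N + 2) * norm (cumul (\<lambda>z. Bc (A z) (Z z) (X z)) z) \<le> \<bar>c1\<bar> / z ^ (N + 2) * (KB * M * z ^ (N + 3))"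
        using cu z' by (intro mult_left_mono) auto
      also have "\<dots> = \<bar>c1\<bar> * z * (KB * M)" using z' by (simp add: field_simps power_add eval_nat_numeral)
      also have "\<dots> \<le> \<bar>c1\<bar> * z0 * (KB * M)" using z' KB_nonneg M by (intro mult_right_mono mult_left_mono) auto
      finally show "F z * norm (X' z) \<le> (\<bar>c1\<bar> * z0 * KB + 3) * M"
        using reg_F_deriv_le(3)[OF r z'] wM by (simp add: algebra_simps)
    qed (simp add: K_def)
    ultimately have "norm (A' z) \<le> C * M \<and> norm (Z' z) \<le> C * M \<and> norm (X' z) \<le> C * M"
      by blast
  }
  then show ?thesis using K f0 z0 by (intro exI[of _ C]) (auto simp: C_def)
qed

lemma reg_deriv_horizon:
  "\<exists>L w. 0 < w \<and> 0 \<le> L \<and> (\<forall>\<omega> M A Z X A' Z' X'. \<bar>\<omega>\<bar> \<le> w \<longrightarrow> reg \<omega> M A Z X A' Z' X' \<longrightarrow> (\<forall>z. z0 / 2 \<le> z \<longrightarrow> z < z0 \<longrightarrow>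
    norm (A' z) \<le> L * M \<and> norm (Z' z) \<le> L * M \<and> norm (X' z) \<le> L * M))"
proof -
  have power: "\<exists>L w. 0 < w \<and> 0 \<le> L \<and> (\<forall>\<omega> M S f f'. \<bar>\<omega>\<bar> \<le> w \<longrightarrow> rcomp \<omega> (\<lambda>z. z ^ j) (\<lambda>z. real j * z ^ (j - 1)) s S f f' \<longrightarrow> bnd M f f' \<longrightarrow>
    (\<forall>z\<in>{0..z0}. norm (S z) \<le> KB * M) \<longrightarrow> (\<forall>z. z0 / 2 \<le> z \<longrightarrow> z < z0 \<longrightarrow> norm (f' z) \<le> L * M))" for j s
  proof (rule rcomp_deriv_near_horizon)
    show "((\<lambda>z. z ^ j) has_real_derivative real j * z ^ (j - 1)) (at z)" for z :: real
      by (auto intro!: derivative_eq_intros)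
    show "0 < (z0 / 2) ^ j" using z0 by simp
    fix z :: real assume z: "z0 / 2 \<le> z" "z \<le> z0"
    show "(z0 / 2) ^ j \<le> z ^ j" using z z0 by (intro power_mono) auto
    show "z ^ j \<le> max (z0 ^ j) (real j * z0 ^ (j - 1))"
      using z z0 by (intro max.coboundedI1 power_mono) auto
    have "real j * z ^ (j - 1) \<le> real j * z0 ^ (j - 1)" using z z0 by (intro mult_left_mono power_mono) auto
    then show "\<bar>real j * z ^ (j - 1)\<bar> \<le> max (z0 ^ j) (real j * z0 ^ (j - 1))"
      using z z0 by (intro max.coboundedI2) (simp add: abs_mult)
  qed
  have inv: "\<exists>L w. 0 < w \<and> 0 \<le> L \<and> (\<forall>\<omega> M S f f'. \<bar>\<omega>\<bar> \<le> w \<longrightarrow> rcomp \<omega> (\<lambda>z. 1 / z ^ N) (\<lambda>z. - real N / z ^ (N + 1)) s S f f' \<longrightarrow> bnd M f f' \<longrightarrow>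
    (\<forall>z\<in>{0..z0}. norm (S z) \<le> KB * M) \<longrightarrow> (\<forall>z. z0 / 2 \<le> z \<longrightarrow> z < z0 \<longrightarrow> norm (f' z) \<le> L * M))" for s
  proof (rule rcomp_deriv_near_horizon)
    show "((\<lambda>z. 1 / z ^ N) has_real_derivative - real N / z ^ (N + 1)) (at z)" if "0 < z" for z :: real
      using that by (rule inverse_power_derivative)
    show "0 < 1 / z0 ^ N" using z0 by simp
    fix z :: real assume z: "z0 / 2 \<le> z" "z \<le> z0"
    then have zp: "0 < z" using z0 by linarith
    show "1 / z0 ^ N \<le> 1 / z ^ N" using z zp by (intro divide_left_mono power_mono) auto
    show "1 / z ^ N \<le> max (1 / (z0 / 2) ^ N) (real N / (z0 / 2) ^ (N + 1))"
      using z z0 zp by (intro max.coboundedI1 divide_left_mono power_mono) auto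
    have "real N / z ^ (N + 1) \<le> real N / (z0 / 2) ^ (N + 1)"
      using z z0 zp by (intro divide_left_mono power_mono) auto
    then show "\<bar>- real N / z ^ (N + 1)\<bar> \<le> max (1 / (z0 / 2) ^ N) (real N / (z0 / 2) ^ (N + 1))"
      using z z0 zp by (intro max.coboundedI2) simp
  qed
  obtain L1 w1 where 1: "0 < w1" "0 \<le> L1" "\<forall>\<omega> M S f f'. \<bar>\<omega>\<bar> \<le> w1 \<longrightarrow> rcomp \<omega> (\<lambda>z. 1 / z ^ N) (\<lambda>z. - real N / z ^ (N + 1)) (- \<i> * of_real q) S f f' \<longrightarrow> bnd M f f' \<longrightarrow>
    (\<forall>z\<in>{0..z0}. norm (S z) \<le> KB * M) \<longrightarrow> (\<forall>z. z0 / 2 \<le> z \<longrightarrow> z < z0 \<longrightarrow> norm (f' z) \<le> L1 * M)"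
    using inv by blast
  obtain L2 w2 where 2: "0 < w2" "0 \<le> L2" "\<forall>\<omega> M S f f'. \<bar>\<omega>\<bar> \<le> w2 \<longrightarrow> rcomp \<omega> (\<lambda>z. z ^ (N + 3)) (\<lambda>z. real (N + 3) * z ^ (N + 3 - 1)) (of_real ga) S f f' \<longrightarrow> bnd M f f' \<longrightarrow>
    (\<forall>z\<in>{0..z0}. norm (S z) \<le> KB * M) \<longrightarrow> (\<forall>z. z0 / 2 \<le> z \<longrightarrow> z < z0 \<longrightarrow> norm (f' z) \<le> L2 * M)"
    using power[of "N + 3" "of_real ga"] by blast
  obtain L3 w3 where 3: "0 < w3" "0 \<le> L3" "\<forall>\<omega> M S f f'. \<bar>\<omega>\<bar> \<le> w3 \<longrightarrow> rcomp \<omega> (\<lambda>z. z ^ (N + 2)) (\<lambda>z. real (N + 2) * z ^ (N + 2 - 1)) (of_real c1) S f f' \<longrightarrow> bnd M f f' \<longrightarrow>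
    (\<forall>z\<in>{0..z0}. norm (S z) \<le> KB * M) \<longrightarrow> (\<forall>z. z0 / 2 \<le> z \<longrightarrow> z < z0 \<longrightarrow> norm (f' z) \<le> L3 * M)"
    using power[of "N + 2" "of_real c1"] by blast
  have e: "N + 3 - 1 = N + 2" "N + 2 - 1 = N + 1" by auto
  show ?thesis
  proof (rule exI[of _ "max L1 (max L2 L3)"], rule exI[of _ "min w1 (min w2 w3)"], intro conjI allI impI)
    fix \<omega> M A Z X A' Z' X' z
    assume om: "\<bar>\<omega>\<bar> \<le> min w1 (min w2 w3)" and r: "reg \<omega> M A Z X A' Z' X'" and z: "z0 / 2 \<le> z" "z < z0"
    have M: "M \<ge> 0" by (rule reg_M[OF r])
    have B: "\<forall>z\<in>{0..z0}. norm (Bc (A z) (Z z) (X z)) \<le> KB * M"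
      using reg_le[OF r] norm_Bc_le by blast
    have m: "L1 * M \<le> max L1 (max L2 L3) * M" "L2 * M \<le> max L1 (max L2 L3) * M" "L3 * M \<le> max L1 (max L2 L3) * M"
      using M by (auto intro!: mult_right_mono)
    show "norm (A' z) \<le> max L1 (max L2 L3) * M"
      using 1(3) om r z B m(1) unfolding reg_def by (smt (verit, best))
    show "norm (Z' z) \<le> max L1 (max L2 L3) * M"
      using 2(3) om r z B m(2) unfolding reg_def e by (smt (verit, best))
    show "norm (X' z) \<le> max L1 (max L2 L3) * M"
      using 3(3) om r z B m(3) unfolding reg_def e by (smt (verit, best))
  qed (use 1 2 3 in auto)
qed

text \<open>In the end layers of width \<open>\<epsilon>\<close> the derivative is of order
  \<open>M\<close>, so the variation there is of order \<open>\<epsilon> * M\<close>; in the middle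
  the derivative is of order \<open>\<bar>\<omega>\<bar> * M\<close> with a constant depending on
  \<open>\<epsilon>\<close>. Hence \<open>\<epsilon>\<close> is fixed first, small enough for two
  layers, and \<open>\<delta>\<close> afterwards.\<close>

lemma reg_nearly_constant:
  assumes "\<eta> > 0"
  shows "\<exists>\<delta>>0. \<forall>\<omega> M A Z X A' Z' X'. \<bar>\<omega>\<bar> \<le> \<delta> \<longrightarrow> reg \<omega> M A Z X A' Z' X' \<longrightarrow> (\<forall>z\<in>{0..z0}.
    norm (A z - A z0) \<le> \<eta> * M \<and> norm (Z z - Z z0) \<le> \<eta> * M \<and> norm (X z - X z0) \<le> \<eta> * M)"
proof -
  obtain L1 w where 1: "0 < w" "0 \<le> L1" "\<And>\<omega> M A Z X A' Z' X' z. \<bar>\<omega>\<bar> \<le> w \<Longrightarrow> reg \<omega> M A Z X A' Z' X' \<Longrightarrow> z0 / 2 \<le> z \<Longrightarrow> z < z0 \<Longrightarrow>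
    norm (A' z) \<le> L1 * M \<and> norm (Z' z) \<le> L1 * M \<and> norm (X' z) \<le> L1 * M"
    using reg_deriv_horizon by blast
  obtain L2 where 2: "0 \<le> L2" "\<And>\<omega> M A Z X A' Z' X' z. \<bar>\<omega>\<bar> \<le> 1 \<Longrightarrow> reg \<omega> M A Z X A' Z' X' \<Longrightarrow> 0 < z \<Longrightarrow> z \<le> z0 / 2 \<Longrightarrow>
    norm (A' z) \<le> L2 * M \<and> norm (Z' z) \<le> L2 * M \<and> norm (X' z) \<le> L2 * M"
    using reg_deriv_zero by blast
  define L where "L = max L1 L2 + 1"
  have L: "L > 0" using 1(2) by (auto simp: L_def)
  define \<epsilon> where "\<epsilon> = min (z0 / 3) (\<eta> / (4 * L))"
  have \<epsilon>: "0 < \<epsilon>" "\<epsilon> < z0 - \<epsilon>" "2 * (L * \<epsilon>) \<le> \<eta> / 2"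
  proof -
    show "0 < \<epsilon>" "\<epsilon> < z0 - \<epsilon>" using assms z0 L by (auto simp: \<epsilon>_def min_def)
    have "L * \<epsilon> \<le> L * (\<eta> / (4 * L))" using L by (intro mult_left_mono) (auto simp: \<epsilon>_def)
    then show "2 * (L * \<epsilon>) \<le> \<eta> / 2" using L by simp
  qed
  obtain C where 3: "0 \<le> C" "\<And>\<omega> M A Z X A' Z' X' z. reg \<omega> M A Z X A' Z' X' \<Longrightarrow> \<epsilon> \<le> z \<Longrightarrow> z \<le> z0 - \<epsilon> \<Longrightarrow>
    norm (A' z) \<le> C * (\<bar>\<omega>\<bar> * M) \<and> norm (Z' z) \<le> C * (\<bar>\<omega>\<bar> * M) \<and> norm (X' z) \<le> C * (\<bar>\<omega>\<bar> * M)"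
    using reg_deriv_mid[OF \<epsilon>(1)] by blast
  define \<delta> where "\<delta> = min (min w 1) (\<eta> / (2 * (C * z0 + 1)))"
  have Cz: "C * z0 + 1 > 0" using 3(1) z0 by (simp add: add_nonneg_pos)
  then have \<delta>: "\<delta> > 0" using 1(1) assms by (simp add: \<delta>_def)
  have core: "norm (f z - f z0) \<le> \<eta> * M"
    if om: "\<bar>\<omega>\<bar> \<le> \<delta>" and M: "M \<ge> 0" and c: "continuous_on {0..z0} f"
      and d: "\<And>z. 0 < z \<Longrightarrow> z < z0 \<Longrightarrow> (f has_vector_derivative f' z) (at z)"
      and b1: "\<And>z. 0 < z \<Longrightarrow> z < z0 \<Longrightarrow> norm (f' z) \<le> L * M"
      and b2: "\<And>z. \<epsilon> \<le> z \<Longrightarrow> z \<le> z0 - \<epsilon> \<Longrightarrow> norm (f' z) \<le> C * (\<bar>\<omega>\<bar> * M)"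
      and z: "z \<in> {0..z0}"
    for f f' :: "real \<Rightarrow> complex" and \<omega> M z
  proof -
    have lip: "norm (f y - f x) \<le> L * M * (y - x)" if "0 \<le> x" "x \<le> y" "y \<le> z0" for x y
      using that by (intro norm_diff_le_closed[where f' = f'] d b1 continuous_on_subset[OF c]) auto
    have mid: "norm (f y - f x) \<le> C * (\<bar>\<omega>\<bar> * M) * (y - x)" if "\<epsilon> \<le> x" "x \<le> y" "y \<le> z0 - \<epsilon>" for x y
      using that \<epsilon> by (intro norm_diff_le_closed[where f' = f'] d b2 continuous_on_subset[OF c]) auto
    have mid': "norm (f y - f x) \<le> \<eta> / 2 * M" if "\<epsilon> \<le> x" "x \<le> y" "y \<le> z0 - \<epsilon>" for x y
    proof -
      have "\<bar>\<omega>\<bar> * (C * z0 + 1) \<le> \<eta> / 2"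
        using om Cz by (simp add: \<delta>_def pos_le_divide_eq) (simp add: algebra_simps)
      then have "C * \<bar>\<omega>\<bar> * z0 \<le> \<eta> / 2"
        using abs_ge_zero[of \<omega>] by (simp add: distrib_left mult_ac)
      have "norm (f y - f x) \<le> C * (\<bar>\<omega>\<bar> * M) * z0"
        using mid[OF that] that \<epsilon> 3(1) M by (elim order_trans) (intro mult_left_mono, auto)
      also have "\<dots> = C * \<bar>\<omega>\<bar> * z0 * M" by simp
      also have "\<dots> \<le> \<eta> / 2 * M" by (rule mult_right_mono) fact+
      finally show ?thesis .
    qed
    have lip': "norm (f y - f x) \<le> L * \<epsilon> * M" if "0 \<le> x" "x \<le> y" "y \<le> z0" "y - x \<le> \<epsilon>" for x y
    proof -
      have "L * M * (y - x) \<le> L * M * \<epsilon>" using that L M by (intro mult_left_mono) auto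
      then show ?thesis using lip[OF that(1-3)] by (simp add: mult_ac)
    qed
    have e: "(L * \<epsilon> + L * \<epsilon>) * M \<le> \<eta> / 2 * M" using \<epsilon>(3) M by (intro mult_right_mono) auto
    have Le: "0 \<le> L * \<epsilon> * M" using L \<epsilon> M by simp
    have eM: "0 \<le> \<eta> / 2 * M" using assms M by simp
    have hz: "norm (f z0 - f (z0 - \<epsilon>)) \<le> L * \<epsilon> * M" using \<epsilon> by (intro lip') auto
    consider "z0 - \<epsilon> \<le> z" | "\<epsilon> \<le> z" "z \<le> z0 - \<epsilon>" | "z < \<epsilon>" by linarith
    then show ?thesis
    proof cases
      case 1
      then have "norm (f z0 - f z) \<le> L * \<epsilon> * M" using z by (intro lip') auto
      then show ?thesis using e Le eM by (simp add: norm_minus_commute algebra_simps)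
    next
      case 2
      then have "norm (f (z0 - \<epsilon>) - f z) \<le> \<eta> / 2 * M" by (intro mid') auto
      moreover have "norm (f z0 - f z) \<le> norm (f z0 - f (z0 - \<epsilon>)) + norm (f (z0 - \<epsilon>) - f z)"
        using norm_triangle_ineq[of "f z0 - f (z0 - \<epsilon>)" "f (z0 - \<epsilon>) - f z"] by simp
      ultimately show ?thesis using e Le hz by (simp add: norm_minus_commute algebra_simps)
    next
      case 3
      have "norm (f (z0 - \<epsilon>) - f \<epsilon>) \<le> \<eta> / 2 * M" using \<epsilon> by (intro mid') auto
      moreover have "norm (f \<epsilon> - f z) \<le> L * \<epsilon> * M" using z 3 \<epsilon> by (intro lip') auto
      moreover have "norm (f z0 - f z) \<le> norm (f z0 - f (z0 - \<epsilon>)) + (norm (f (z0 - \<epsilon>) - f \<epsilon>) + norm (f \<epsilon> - f z))"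
        using norm_triangle_ineq[of "f z0 - f (z0 - \<epsilon>)" "f (z0 - \<epsilon>) - f z"]
          norm_triangle_ineq[of "f (z0 - \<epsilon>) - f \<epsilon>" "f \<epsilon> - f z"] by simp
      ultimately show ?thesis using e Le hz by (simp add: norm_minus_commute algebra_simps)
    qed
  qed
  {
    fix \<omega> M A Z X A' Z' X' z
    assume om: "\<bar>\<omega>\<bar> \<le> \<delta>" and r: "reg \<omega> M A Z X A' Z' X'" and z: "z \<in> {0..z0}"
    have M: "M \<ge> 0" by (rule reg_M[OF r])
    have om': "\<bar>\<omega>\<bar> \<le> w" "\<bar>\<omega>\<bar> \<le> 1" using om by (auto simp: \<delta>_def)
    have LM: "L1 * M \<le> L * M" "L2 * M \<le> L * M" using M by (auto simp: L_def intro!: mult_right_mono)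
    have all: "norm (A' z) \<le> L * M \<and> norm (Z' z) \<le> L * M \<and> norm (X' z) \<le> L * M" if "0 < z" "z < z0" for z
    proof (cases "z0 / 2 \<le> z")
      case True
      show ?thesis using 1(3)[OF om'(1) r True that(2)] LM(1) by auto
    next
      case False
      then show ?thesis using 2(2)[OF om'(2) r that(1)] LM(2) by auto
    qed
    have "norm (A z - A z0) \<le> \<eta> * M"
      by (rule core[OF om M reg_cont(1)[OF r] reg_deriv(1)[OF r]]) (use all 3(2)[OF r] z in auto)
    moreover have "norm (Z z - Z z0) \<le> \<eta> * M"
      by (rule core[OF om M reg_cont(2)[OF r] reg_deriv(2)[OF r]]) (use all 3(2)[OF r] z in auto)
    moreover have "norm (X z - X z0) \<le> \<eta> * M"
      by (rule core[OF om M reg_cont(3)[OF r] reg_deriv(3)[OF r]]) (use all 3(2)[OF r] z in auto)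
    ultimately have "norm (A z - A z0) \<le> \<eta> * M \<and> norm (Z z - Z z0) \<le> \<eta> * M \<and> norm (X z - X z0) \<le> \<eta> * M"
      by blast
  }
  then show ?thesis using \<delta> by blast
qed

end

lemma power_derivative:
  fixes t :: real
  assumes "m = n + 1"
  shows "((\<lambda>z. z ^ m) has_real_derivative real m * t ^ n) (at t)"
  using DERIV_pow[of m t] assms by simp

lemma cmult_power_derivative:
  fixes t :: real
  assumes "m = n + 1"
  shows "((\<lambda>z. c * z ^ m) has_real_derivative c * (real m * t ^ n)) (at t)"
  by (rule DERIV_cmult[OF power_derivative[OF assms]])

section \<open>Relations between the horizon values, and the conserved flux in terms of them\<close>

context brane
begin

definition rr :: complex where "rr = \<i> * of_real (q / c1)"

lemma Bc_diff: "Bc x y w - Bc x' y' w' = Bc (x - x') (y - y') (w - w')"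
  by (simp add: Bc_def algebra_simps)

text \<open>The flux of \<open>a\<close> plus \<open>rr\<close> times the flux of \<open>\<xi>\<close>: the source terms cancel, and in the regular
  functions only an \<open>O(\<omega>)\<close> multiple of their variation remains.\<close>

definition flux_const :: "real \<Rightarrow> (real \<Rightarrow> complex) \<Rightarrow> (real \<Rightarrow> complex) \<Rightarrow> (real \<Rightarrow> complex) \<Rightarrow> (real \<Rightarrow> complex) \<Rightarrow> real \<Rightarrow> complex" where
  "flux_const \<omega> A X A' X' r = of_real (1 / r ^ N) * (flux \<omega> A A' r - \<i> * of_real \<omega> * A r)
     + rr * (of_real (r ^ (N + 2)) * (flux \<omega> X X' r - \<i> * of_real \<omega> * X r))"

context
  fixes \<omega> M \<eta> :: real and A Z X A' Z' X' :: "real \<Rightarrow> complex"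
  assumes reg: "reg \<omega> M A Z X A' Z' X'"
    and near: "\<And>z. z \<in> {0..z0} \<Longrightarrow> norm (A z - A z0) \<le> \<eta> * M \<and> norm (Z z - Z z0) \<le> \<eta> * M \<and> norm (X z - X z0) \<le> \<eta> * M"
begin

abbreviation (input) B' :: "real \<Rightarrow> complex" where "B' \<equiv> \<lambda>z. Bc (A z) (Z z) (X z)"

lemma near_M: "0 \<le> \<eta> * M"
  by (rule order_trans[OF norm_ge_zero, of "A z0 - A z0"]) (use near[of z0] z0 in auto)

text \<open>Since \<open>B\<close> is nearly constant, \<open>cumul\<close> at the horizon is nearly
  \<open>z0 ^ (N + 3) / (N + 3)\<close> times the horizon value of \<open>B\<close>. As
  \<open>cumul\<close> is small, so is this value.\<close>

lemma near_Bc: "norm (B' z0) \<le> real (N + 3) * (CQ / z0 ^ (N + 3) * \<bar>\<omega>\<bar> * M + KB * (\<eta> * M))"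
proof -
  let ?g = "\<lambda>z. cumul B' z - of_real (z ^ (N + 3) / real (N + 3)) * B' z0"
  have "norm (?g z0 - ?g 0) \<le> z0 ^ (N + 2) * (KB * (\<eta> * M)) * (z0 - 0)"
  proof (rule norm_diff_le_closed)
    show "continuous_on {0..z0} ?g"
      by (intro continuous_intros continuous_on_cumul reg_cont[OF reg]) auto
    fix t assume t: "0 < t" "t < z0"
    have "((\<lambda>z. z ^ (N + 3) / real (N + 3)) has_real_derivative real (N + 3) * t ^ (N + 2) / real (N + 3)) (at t)"
      by (intro DERIV_cdivide power_derivative) simp
    then have "((\<lambda>z. z ^ (N + 3) / real (N + 3)) has_real_derivative t ^ (N + 2)) (at t)"
      by (simp del: of_nat_add)
    then have "(?g has_vector_derivative of_real (t ^ (N + 2)) * B' t - of_real (t ^ (N + 2)) * B' z0) (at t)"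
      by (intro has_vector_derivative_diff cumul_derivative reg_cont[OF reg] t
            has_vector_derivative_mult_left has_vector_derivative_of_real)
    then show "(?g has_vector_derivative of_real (t ^ (N + 2)) * (B' t - B' z0)) (at t)"
      by (simp only: right_diff_distrib)
    have "norm (B' t - B' z0) \<le> KB * (\<eta> * M)"
      unfolding Bc_diff by (intro norm_Bc_le) (use near[of t] t in auto)
    then show "norm (of_real (t ^ (N + 2)) * (B' t - B' z0)) \<le> z0 ^ (N + 2) * (KB * (\<eta> * M))"
      unfolding norm_mult norm_of_real using t
      by (intro mult_mono) (auto intro!: mult_mono power_mono simp: abs_mult)
  qed (use z0 in auto)
  then have 1: "norm (cumul B' z0 - of_real (z0 ^ (N + 3) / real (N + 3)) * B' z0) \<le> z0 ^ (N + 3) * (KB * (\<eta> * M))"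
    by (simp add: cumul_0[OF reg_cont(4)[OF reg]] eval_nat_numeral mult_ac)
  have "norm (of_real (z0 ^ (N + 3) / real (N + 3)) * B' z0) \<le> CQ * (\<bar>\<omega>\<bar> * M) + z0 ^ (N + 3) * (KB * (\<eta> * M))"
    using 1 reg_cumul_le[OF reg, of z0] z0
      norm_triangle_ineq2[of "of_real (z0 ^ (N + 3) / real (N + 3)) * B' z0" "cumul B' z0"]
    by (simp only: norm_minus_commute) auto
  then have "z0 ^ (N + 3) / real (N + 3) * norm (B' z0) \<le> CQ * (\<bar>\<omega>\<bar> * M) + z0 ^ (N + 3) * (KB * (\<eta> * M))"
    unfolding norm_mult norm_of_real using z0 by simp
  then have "norm (B' z0) \<le> real (N + 3) / z0 ^ (N + 3) * (CQ * (\<bar>\<omega>\<bar> * M) + z0 ^ (N + 3) * (KB * (\<eta> * M)))"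
    using z0 by (simp add: field_simps del: of_nat_add)
  also have "\<dots> = real (N + 3) * (CQ / z0 ^ (N + 3) * \<bar>\<omega>\<bar> * M + KB * (\<eta> * M))"
    using z0 by (simp add: field_simps del: of_nat_add)
  finally show ?thesis .
qed

text \<open>The combination \<open>c1 * P2 - ga * P3\<close> of the two scalar fluxes has no source
  and vanishes at \<open>0\<close>. Its derivative is \<open>\<i> * \<omega>\<close> times a
  combination of \<open>Z\<close> and \<open>X\<close>; with both frozen at their horizon values the
  integral is known. Comparison with the flux limit at the horizon leaves \<omega> times the claimed
  relation, and \<omega> is divided out.\<close>

lemma near_axions:
  assumes "\<omega> \<noteq> 0"
  shows "norm (of_real (c1 * z0) * Z z0 - of_real ga * X z0) \<le>
    (\<bar>c1\<bar> * real (N + 3) * z0 + \<bar>ga\<bar> * real (N + 2)) * (\<eta> * M)"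
proof -
  define K where "K = \<bar>c1\<bar> * real (N + 3) * z0 ^ (N + 2) + \<bar>ga\<bar> * real (N + 2) * z0 ^ (N + 1)"
  have K: "K \<ge> 0" unfolding K_def using z0 by simp
  let ?u = "\<lambda>z. of_real c1 * (of_real (z ^ (N + 3)) * flux \<omega> Z Z' z) - of_real ga * (of_real (z ^ (N + 2)) * flux \<omega> X X' z)"
  \<comment> \<open>The exact integral when \<open>Z\<close> and \<open>X\<close> are replaced by
    their horizon values. At the horizon \<open>?u\<close> tends to \<open>2 * ?l\<close> and
    \<open>?v\<close> to \<open>?l\<close>, so the difference tends to \<open>?l\<close>.\<close>
  let ?v = "\<lambda>z. \<i> * of_real \<omega> * (of_real (c1 * z ^ (N + 3)) * Z z0 - of_real (ga * z ^ (N + 2)) * X z0)"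
  let ?g = "\<lambda>z. ?u z - ?v z"
  let ?g' = "\<lambda>t. \<i> * of_real \<omega> * (of_real (c1 * (real (N + 3) * t ^ (N + 2))) * (Z t - Z z0)
        - of_real (ga * (real (N + 2) * t ^ (N + 1))) * (X t - X z0))"
  let ?l = "\<i> * of_real \<omega> * (of_real (c1 * z0 ^ (N + 3)) * Z z0 - of_real (ga * z0 ^ (N + 2)) * X z0)"
  have d: "(?g has_vector_derivative ?g' t) (at t)" if t: "0 < t" "t < z0" for t
  proof -
    have "(?g has_vector_derivative
       (of_real c1 * (\<i> * of_real (\<omega> * (real (N + 3) * t ^ (N + 2))) * Z t + of_real ga * of_real (t ^ (N + 2)) * B' t)
        - of_real ga * (\<i> * of_real (\<omega> * (real (N + 2) * t ^ (N + 1))) * X t + of_real c1 * of_real (t ^ (N + 2)) * B' t))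
       - \<i> * of_real \<omega> * (of_real (c1 * (real (N + 3) * t ^ (N + 2))) * Z z0 - of_real (ga * (real (N + 2) * t ^ (N + 1))) * X z0)) (at t)"
      using reg t unfolding reg_def rcomp_def
      by (intro has_vector_derivative_diff has_vector_derivative_mult_right has_vector_derivative_mult_left
          has_vector_derivative_of_real cmult_power_derivative) auto
    then show ?thesis by (rule has_vector_derivative_eq_rhs) (simp add: algebra_simps)
  qed
  have b: "norm (?g' t) \<le> \<bar>\<omega>\<bar> * (K * (\<eta> * M))" if t: "0 < t" "t < z0" for t
  proof -
    have "norm (of_real (c1 * (real (N + 3) * t ^ (N + 2))) * (Z t - Z z0)) \<le> \<bar>c1\<bar> * real (N + 3) * z0 ^ (N + 2) * (\<eta> * M)"
      unfolding norm_mult norm_of_real using t near[of t]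
      by (intro mult_mono) (auto simp: abs_mult mult.assoc intro!: mult_mono power_mono)
    moreover have "norm (of_real (ga * (real (N + 2) * t ^ (N + 1))) * (X t - X z0)) \<le> \<bar>ga\<bar> * real (N + 2) * z0 ^ (N + 1) * (\<eta> * M)"
      unfolding norm_mult norm_of_real using t near[of t]
      by (intro mult_mono) (auto simp: abs_mult mult.assoc intro!: mult_mono power_mono)
    ultimately have "norm (of_real (c1 * (real (N + 3) * t ^ (N + 2))) * (Z t - Z z0)
        - of_real (ga * (real (N + 2) * t ^ (N + 1))) * (X t - X z0)) \<le> K * (\<eta> * M)"
      unfolding K_def by (intro order_trans[OF norm_triangle_ineq4]) (simp add: distrib_right)
    then show ?thesis by (simp only: norm_mult norm_ii norm_of_real mult_1) (auto intro: mult_left_mono)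
  qed
  have lim: "((\<lambda>z. \<bar>\<omega>\<bar> * (K * (\<eta> * M)) * z) \<longlongrightarrow> \<bar>\<omega>\<bar> * (K * (\<eta> * M)) * u) F" if "((\<lambda>z. z) \<longlongrightarrow> u) F" for u :: real and F
    by (intro tendsto_intros that)
  \<comment> \<open>Both ends of the interval are reached only as limits, and each mean value
    estimate admits one such end; so the interval is split at \<open>z0 / 2\<close>.\<close>
  have glue: "norm l \<le> a * z" if "norm (x - 0) \<le> a * h - a * 0" "norm (l - x) \<le> a * z - a * h"
    for l x :: complex and a h z :: real
    using that norm_triangle_ineq[of "l - x" x] by simp
  have "norm (?g (z0 / 2) - 0) \<le> \<bar>\<omega>\<bar> * (K * (\<eta> * M)) * (z0 / 2) - \<bar>\<omega>\<bar> * (K * (\<eta> * M)) * 0"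
  proof (rule norm_diff_le_by_derivative_left_end[where f = ?g and f' = ?g' and g = "\<lambda>z. \<bar>\<omega>\<bar> * (K * (\<eta> * M)) * z" and g' = "\<lambda>_. \<bar>\<omega>\<bar> * (K * (\<eta> * M))"])
    have "((\<lambda>z. z ^ (j + 1)) \<longlongrightarrow> 0 ^ (j + 1)) (at_right (0::real))" for j by (intro tendsto_intros)
    then have pw: "((\<lambda>z. z ^ (j + 1)) \<longlongrightarrow> 0) (at_right (0::real))" for j by simp
    have p3: "((\<lambda>z. z ^ (N + 3)) \<longlongrightarrow> 0) (at_right (0::real))" and p2: "((\<lambda>z. z ^ (N + 2)) \<longlongrightarrow> 0) (at_right (0::real))"
      using pw[of "N + 2"] pw[of "N + 1"] by (simp_all add: eval_nat_numeral)
    have 1: "(?u \<longlongrightarrow> of_real c1 * 0 - of_real ga * 0) (at_right 0)"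
      by (rule tendsto_diff[OF tendsto_mult_left[OF flux_power_tendsto_0[OF reg_bnd(2)[OF reg]]]
            tendsto_mult_left[OF flux_power_tendsto_0[OF reg_bnd(3)[OF reg]]]]) simp_all
    have 2: "(?v \<longlongrightarrow> \<i> * of_real \<omega> * (of_real (c1 * 0) * Z z0 - of_real (ga * 0) * X z0)) (at_right 0)"
      by (intro tendsto_diff tendsto_mult tendsto_const tendsto_of_real p2 p3)
    have "(?g \<longlongrightarrow> (of_real c1 * 0 - of_real ga * 0)
        - \<i> * of_real \<omega> * (of_real (c1 * 0) * Z z0 - of_real (ga * 0) * X z0)) (at_right 0)"
      by (rule tendsto_diff[OF 1 2])
    moreover have "(of_real c1 * 0 - of_real ga * 0)
        - \<i> * of_real \<omega> * (of_real (c1 * 0) * Z z0 - of_real (ga * 0) * X z0) = 0" by simp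
    ultimately show "(?g \<longlongrightarrow> 0) (at_right 0)" by metis
    show "((\<lambda>z. \<bar>\<omega>\<bar> * (K * (\<eta> * M)) * z) \<longlongrightarrow> \<bar>\<omega>\<bar> * (K * (\<eta> * M)) * 0) (at_right 0)"
      by (intro lim tendsto_intros)
  qed (use z0 d b in \<open>auto intro!: derivative_eq_intros simp del: of_real_mult of_real_power of_nat_add\<close>)
  moreover have "norm (?l - ?g (z0 / 2)) \<le> \<bar>\<omega>\<bar> * (K * (\<eta> * M)) * z0 - \<bar>\<omega>\<bar> * (K * (\<eta> * M)) * (z0 / 2)"
  proof (rule norm_diff_le_by_derivative_right_end[where f = ?g and f' = ?g' and g = "\<lambda>z. \<bar>\<omega>\<bar> * (K * (\<eta> * M)) * z" and g' = "\<lambda>_. \<bar>\<omega>\<bar> * (K * (\<eta> * M))"])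
    have p: "((\<lambda>z. z ^ j) \<longlongrightarrow> z0 ^ j) (at_left z0)" for j by (intro tendsto_intros)
    have 1: "(?u \<longlongrightarrow> of_real c1 * (of_real (z0 ^ (N + 3)) * (2 * \<i> * of_real \<omega> * Z z0)) - of_real ga * (of_real (z0 ^ (N + 2)) * (2 * \<i> * of_real \<omega> * X z0))) (at_left z0)"
      by (intro tendsto_diff tendsto_mult tendsto_const tendsto_of_real p flux_tendsto_horizon[OF reg_bnd(2)[OF reg]] flux_tendsto_horizon[OF reg_bnd(3)[OF reg]])
    have 2: "(?v \<longlongrightarrow> \<i> * of_real \<omega> * (of_real (c1 * z0 ^ (N + 3)) * Z z0 - of_real (ga * z0 ^ (N + 2)) * X z0)) (at_left z0)"
      by (intro tendsto_diff tendsto_mult tendsto_const tendsto_of_real p)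
    show "(?g \<longlongrightarrow> ?l) (at_left z0)" using tendsto_diff[OF 1 2] by (simp add: algebra_simps)
    show "((\<lambda>z. \<bar>\<omega>\<bar> * (K * (\<eta> * M)) * z) \<longlongrightarrow> \<bar>\<omega>\<bar> * (K * (\<eta> * M)) * z0) (at_left z0)"
      by (intro lim tendsto_intros)
  qed (use z0 d b in \<open>auto intro!: derivative_eq_intros simp del: of_real_mult of_real_power of_nat_add\<close>)
  ultimately have "norm ?l \<le> \<bar>\<omega>\<bar> * (K * (\<eta> * M)) * z0"
    by (rule glue)
  moreover have "?l = of_real (\<omega> * z0 ^ (N + 2)) * (\<i> * (of_real (c1 * z0) * Z z0 - of_real ga * X z0))"
    by (simp add: algebra_simps eval_nat_numeral)
  ultimately have "\<bar>\<omega>\<bar> * z0 ^ (N + 2) * norm (of_real (c1 * z0) * Z z0 - of_real ga * X z0) \<le> \<bar>\<omega>\<bar> * (K * (\<eta> * M)) * z0"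
    using z0 by (simp only: norm_mult norm_of_real norm_ii) (simp add: abs_mult)
  also have "\<dots> = \<bar>\<omega>\<bar> * z0 ^ (N + 2) * ((\<bar>c1\<bar> * real (N + 3) * z0 + \<bar>ga\<bar> * real (N + 2)) * (\<eta> * M))"
    unfolding K_def by (simp add: algebra_simps eval_nat_numeral)
  finally show ?thesis using z0 assms by simp
qed

text \<open>The combined flux without source is integrated from \<open>r\<close> to the horizon with
  \<open>A\<close> and \<open>X\<close> frozen. The doubled phase term of \<open>flux\<close> at the
  horizon loses one copy through \<open>?v\<close>, as \<open>flux_const\<close> does at
  \<open>r\<close>; all other terms involve only the variation of \<open>A\<close> and
  \<open>X\<close> and carry the factor \<omega>.\<close>

lemma near_flux_const:
  assumes r: "0 < r" "r < z0"
  shows "norm (flux_const \<omega> A X A' X' r - \<i> * of_real \<omega> * (of_real (1 / z0 ^ N) * A z0 + rr * (of_real (z0 ^ (N + 2)) * X z0)))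
    \<le> ((real N / r ^ (N + 1) + norm rr * (real (N + 2) * z0 ^ (N + 1))) * z0 + 1 / r ^ N + norm rr * z0 ^ (N + 2))
        * (\<bar>\<omega>\<bar> * (\<eta> * M))"
proof -
  define K where "K = real N / r ^ (N + 1) + norm rr * (real (N + 2) * z0 ^ (N + 1))"
  have K: "K \<ge> 0" unfolding K_def using z0 r by simp
  let ?u = "\<lambda>z. of_real (1 / z ^ N) * flux \<omega> A A' z + rr * (of_real (z ^ (N + 2)) * flux \<omega> X X' z)"
  let ?v = "\<lambda>z. \<i> * of_real \<omega> * (of_real (1 / z ^ N) * A z0 + rr * (of_real (z ^ (N + 2)) * X z0))"
  let ?g = "\<lambda>z. ?u z - ?v z"
  let ?g' = "\<lambda>t. \<i> * of_real \<omega> * (of_real (- real N / t ^ (N + 1)) * (A t - A z0)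
        + rr * (of_real (real (N + 2) * t ^ (N + 1)) * (X t - X z0)))"
  let ?l = "\<i> * of_real \<omega> * (of_real (1 / z0 ^ N) * A z0 + rr * (of_real (z0 ^ (N + 2)) * X z0))"
  have 1: "norm (?l - ?g r) \<le> \<bar>\<omega>\<bar> * (K * (\<eta> * M)) * z0 - \<bar>\<omega>\<bar> * (K * (\<eta> * M)) * r"
  proof (rule norm_diff_le_by_derivative_right_end[where f' = ?g' and g' = "\<lambda>_. \<bar>\<omega>\<bar> * (K * (\<eta> * M))", OF r(2)])
    fix t assume t: "r \<le> t" "t < z0"
    have tp: "0 < t" using t r by simp
    have "(?g has_vector_derivative
       ((\<i> * of_real (\<omega> * (- real N / t ^ (N + 1))) * A t + - \<i> * of_real q * of_real (t ^ (N + 2)) * B' t)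
        + rr * (\<i> * of_real (\<omega> * (real (N + 2) * t ^ (N + 1))) * X t + of_real c1 * of_real (t ^ (N + 2)) * B' t))
       - \<i> * of_real \<omega> * (of_real (- real N / t ^ (N + 1)) * A z0 + rr * (of_real (real (N + 2) * t ^ (N + 1)) * X z0))) (at t)"
      using reg t tp inverse_power_derivative[OF tp] unfolding reg_def rcomp_def
      by (intro has_vector_derivative_diff has_vector_derivative_add has_vector_derivative_mult_right has_vector_derivative_mult_left
          has_vector_derivative_of_real power_derivative) auto
    \<comment> \<open>The defining property of \<open>rr\<close>: with it the sources of the two
      fluxes cancel.\<close>
    moreover have q: "- \<i> * of_real q = - (rr * of_real c1)" using c1 by (simp add: rr_def)
    ultimately show "(?g has_vector_derivative ?g' t) (at t)"
      unfolding q by (elim has_vector_derivative_eq_rhs) (simp add: algebra_simps diff_divide_distrib)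
    have "norm (of_real (- real N / t ^ (N + 1)) * (A t - A z0)) \<le> real N / r ^ (N + 1) * (\<eta> * M)"
      unfolding norm_mult norm_of_real using t tp r near[of t]
      by (intro mult_mono) (auto intro!: divide_left_mono mult_mono power_mono simp: abs_mult)
    note a = this
    have b: "norm (rr * (of_real (real (N + 2) * t ^ (N + 1)) * (X t - X z0))) \<le> norm rr * (real (N + 2) * z0 ^ (N + 1) * (\<eta> * M))"
      unfolding norm_mult norm_of_real using t tp r near[of t]
      by (intro mult_left_mono mult_mono) (auto intro!: mult_mono power_mono simp: abs_mult)
    have "norm (of_real (- real N / t ^ (N + 1)) * (A t - A z0) + rr * (of_real (real (N + 2) * t ^ (N + 1)) * (X t - X z0))) \<le> K * (\<eta> * M)"
      using order_trans[OF norm_triangle_ineq add_mono[OF a b]] unfolding K_def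
      by (simp only: distrib_right mult.assoc)
    then show "norm (?g' t) \<le> \<bar>\<omega>\<bar> * (K * (\<eta> * M))"
      by (simp only: norm_mult norm_ii norm_of_real mult_1) (auto intro: mult_left_mono)
    show "((*) (\<bar>\<omega>\<bar> * (K * (\<eta> * M))) has_real_derivative \<bar>\<omega>\<bar> * (K * (\<eta> * M))) (at t)"
      by (auto intro!: derivative_eq_intros)
  next
    have p: "((\<lambda>z. z ^ j) \<longlongrightarrow> z0 ^ j) (at_left z0)" for j by (intro tendsto_intros)
    have p': "((\<lambda>z. 1 / z ^ N) \<longlongrightarrow> 1 / z0 ^ N) (at_left z0)" using z0 by (intro tendsto_intros) auto
    have 1: "(?u \<longlongrightarrow> of_real (1 / z0 ^ N) * (2 * \<i> * of_real \<omega> * A z0) + rr * (of_real (z0 ^ (N + 2)) * (2 * \<i> * of_real \<omega> * X z0))) (at_left z0)"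
      by (intro tendsto_add tendsto_mult tendsto_const tendsto_of_real p p' flux_tendsto_horizon[OF reg_bnd(1)[OF reg]] flux_tendsto_horizon[OF reg_bnd(3)[OF reg]])
    have 2: "(?v \<longlongrightarrow> ?l) (at_left z0)"
      by (intro tendsto_add tendsto_mult tendsto_const tendsto_of_real p p')
    show "(?g \<longlongrightarrow> ?l) (at_left z0)" using tendsto_diff[OF 1 2] by (simp add: algebra_simps)
    show "((*) (\<bar>\<omega>\<bar> * (K * (\<eta> * M))) \<longlongrightarrow> \<bar>\<omega>\<bar> * (K * (\<eta> * M)) * z0) (at_left z0)"
      by (intro tendsto_intros)
  qed
  have "norm (of_real (1 / r ^ N) * (A z0 - A r)) \<le> 1 / r ^ N * (\<eta> * M)"
    unfolding norm_mult norm_of_real using r near[of r]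
    by (intro mult_mono) (auto simp: norm_minus_commute)
  moreover have "norm (rr * (of_real (r ^ (N + 2)) * (X z0 - X r))) \<le> norm rr * (z0 ^ (N + 2) * (\<eta> * M))"
    unfolding norm_mult norm_of_real using r near[of r]
    by (intro mult_left_mono mult_mono) (auto intro!: mult_mono power_mono simp: norm_minus_commute abs_mult)
  ultimately have "norm (of_real (1 / r ^ N) * (A z0 - A r) + rr * (of_real (r ^ (N + 2)) * (X z0 - X r))) \<le> (1 / r ^ N + norm rr * z0 ^ (N + 2)) * (\<eta> * M)"
    by (intro order_trans[OF norm_triangle_ineq]) (simp add: distrib_right)
  then have 2: "norm (\<i> * of_real \<omega> * (of_real (1 / r ^ N) * (A z0 - A r) + rr * (of_real (r ^ (N + 2)) * (X z0 - X r)))) \<le> \<bar>\<omega>\<bar> * ((1 / r ^ N + norm rr * z0 ^ (N + 2)) * (\<eta> * M))"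
    by (simp only: norm_mult norm_ii norm_of_real mult_1) (auto intro: mult_left_mono)
  have "flux_const \<omega> A X A' X' r - ?l = - (?l - ?g r) + \<i> * of_real \<omega> * (of_real (1 / r ^ N) * (A z0 - A r) + rr * (of_real (r ^ (N + 2)) * (X z0 - X r)))"
    unfolding flux_const_def by (simp add: algebra_simps diff_divide_distrib)
  then have "norm (flux_const \<omega> A X A' X' r - ?l) \<le> norm (?l - ?g r) + norm (\<i> * of_real \<omega> * (of_real (1 / r ^ N) * (A z0 - A r) + rr * (of_real (r ^ (N + 2)) * (X z0 - X r))))"
    by (metis norm_triangle_ineq norm_minus_cancel)
  also have "\<dots> \<le> (\<bar>\<omega>\<bar> * (K * (\<eta> * M)) * z0) + \<bar>\<omega>\<bar> * ((1 / r ^ N + norm rr * z0 ^ (N + 2)) * (\<eta> * M))"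
    using 1 2 K near_M r by (intro add_mono) (auto intro: order_trans)
  also have "\<dots> = (K * z0 + 1 / r ^ N + norm rr * z0 ^ (N + 2)) * (\<bar>\<omega>\<bar> * (\<eta> * M))"
    by (simp add: algebra_simps)
  finally show ?thesis unfolding K_def .
qed

end

end

section \<open>Series solutions at the boundary\<close>

text \<open>Well-founded recursion in a form that lets \<open>H\<close> take a whole sequence, so
  that power series products of the unknown can appear in the recursion step as long as only lower
  coefficients matter.\<close>

lemma causal_recursion:
  fixes H :: "(nat \<Rightarrow> 'a) \<Rightarrow> nat \<Rightarrow> 'a"
  assumes "\<And>f g m. (\<And>j. j < m \<Longrightarrow> f j = g j) \<Longrightarrow> H f m = H g m"
  shows "\<exists>f. \<forall>m. f m = H f m"
proof -
  have "adm_wf less_than H"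
    unfolding adm_wf_def
  proof (intro allI impI)
    fix f g :: "nat \<Rightarrow> 'a" and m
    assume "\<forall>z. (z, m) \<in> less_than \<longrightarrow> f z = g z"
    then show "H f m = H g m" by (intro assms) simp
  qed
  then have "wfrec less_than H = H (wfrec less_than H)"
    by (intro wfrec_fixpoint) auto
  then show ?thesis by (intro exI allI) (rule fun_cong)
qed

lemma fps_mult_nth_cong_below:
  fixes H U V :: "complex fps"
  assumes "fps_nth H 0 = 0" "\<And>i. i < m \<Longrightarrow> fps_nth U i = fps_nth V i"
  shows "fps_nth (H * U) m = fps_nth (H * V) m"
  unfolding fps_mult_nth
proof (rule sum.cong)
  fix i assume "i \<in> {0..m}"
  then show "fps_nth H i * fps_nth U (m - i) = fps_nth H i * fps_nth V (m - i)"
    using assms by (cases "i = 0") auto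
qed simp

lemma fps_coeffs_geometric:
  fixes f :: "complex fps"
  assumes "fps_conv_radius f > 0"
  obtains K \<rho> where "K > 0" "\<rho> > 0" "\<And>n. norm (fps_nth f n) \<le> K * \<rho> ^ n"
proof -
  obtain \<delta> :: real where d: "0 < \<delta>" "ereal \<delta> < fps_conv_radius f"
    using ereal_dense2[OF assms] by auto
  have s: "summable (\<lambda>n. norm (fps_nth f n * of_real \<delta> ^ n))"
    by (rule norm_summable_fps) (use d in auto)
  define K where "K = (\<Sum>n. norm (fps_nth f n * of_real \<delta> ^ n)) + 1"
  have K: "K > 0" unfolding K_def using suminf_nonneg[OF s] by simp
  show ?thesis
  proof (rule that[OF K, of "1 / \<delta>"])
    fix n
    have "norm (fps_nth f n * of_real \<delta> ^ n) \<le> K"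
      unfolding K_def using sum_le_suminf[OF s, of "{n}"] by simp
    then show "norm (fps_nth f n) \<le> K * (1 / \<delta>) ^ n"
      using d by (simp add: norm_mult norm_power power_one_over field_simps)
  qed (use d in auto)
qed

text \<open>With \<open>2 * \<rho> \<le> R\<close> the convolution is dominated by a geometric
  series of ratio \<open>1 / 2\<close>. The loss \<open>2 * K\<close> does not depend on
  \<open>R\<close>, so \<open>R\<close> can still be enlarged afterwards.\<close>

lemma norm_fps_mult_nth_le:
  fixes G U :: "complex fps"
  assumes G: "\<And>n. norm (fps_nth G n) \<le> K * \<rho> ^ n" and "0 < K" "0 < \<rho>" "2 * \<rho> \<le> R"
    and U: "\<And>j. j \<le> m \<Longrightarrow> norm (fps_nth U j) \<le> D * R ^ j"
  shows "norm (fps_nth (G * U) m) \<le> 2 * K * D * R ^ m"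
proof -
  have R: "R > 0" using assms by linarith
  have D: "D \<ge> 0" using order_trans[OF norm_ge_zero U[of 0]] by simp
  have "norm (fps_nth (G * U) m) \<le> (\<Sum>i=0..m. norm (fps_nth G i * fps_nth U (m - i)))"
    unfolding fps_mult_nth by (rule norm_sum)
  also have "\<dots> \<le> (\<Sum>i=0..m. K * D * R ^ m * (1 / 2) ^ i)"
  proof (rule sum_mono)
    fix i assume i: "i \<in> {0..m}"
    have "\<rho> ^ i \<le> (R / 2) ^ i" using assms by (intro power_mono) auto
    then have "norm (fps_nth G i) \<le> K * (R / 2) ^ i" using G[of i] \<open>0 < K\<close>
      by (meson mult_left_mono order_trans less_imp_le)
    then have "norm (fps_nth G i * fps_nth U (m - i)) \<le> K * (R / 2) ^ i * (D * R ^ (m - i))"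
      unfolding norm_mult using U[of "m - i"] R \<open>0 < K\<close> by (intro mult_mono) auto
    also have "\<dots> = K * D * (R ^ i * R ^ (m - i)) * (1 / 2) ^ i"
      by (simp add: power_divide)
    also have "R ^ i * R ^ (m - i) = R ^ m" using i by (simp flip: power_add)
    finally show "norm (fps_nth G i * fps_nth U (m - i)) \<le> K * D * R ^ m * (1 / 2) ^ i" .
  qed
  also have "\<dots> = K * D * R ^ m * (\<Sum>i=0..m. (1 / 2) ^ i)" by (simp add: sum_distrib_left)
  also have "\<dots> \<le> K * D * R ^ m * 2"
  proof (rule mult_left_mono)
    have "(\<Sum>i=0..m. (1 / 2 :: real) ^ i) \<le> (\<Sum>i. (1 / 2) ^ i)"
      by (rule sum_le_suminf) (auto intro: summable_geometric)
    then show "(\<Sum>i=0..m. (1 / 2 :: real) ^ i) \<le> 2" by (simp add: suminf_geometric)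
  qed (use R D \<open>0 < K\<close> in auto)
  finally show ?thesis by (simp add: mult_ac)
qed

lemma norm_fps_X_power_mult_nth_le:
  fixes U :: "complex fps"
  assumes "1 \<le> R" "0 \<le> D" "\<And>j. j \<le> m \<Longrightarrow> norm (fps_nth U j) \<le> D * R ^ j"
  shows "norm (fps_nth (fps_X ^ k * U) m) \<le> D * R ^ m"
proof (cases "m < k")
  case False
  then have "norm (fps_nth (fps_X ^ k * U) m) \<le> D * R ^ (m - k)"
    using assms(3)[of "m - k"] by (simp add: fps_X_power_mult_nth)
  also have "\<dots> \<le> D * R ^ m" using assms by (intro mult_left_mono power_increasing) auto
  finally show ?thesis .
qed (use assms in \<open>simp add: fps_X_power_mult_nth\<close>)

context brane
begin

definition Fps :: "complex fps" where "Fps = fps_of_poly (map_poly of_real p)"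
definition G :: "complex fps" where "G = inverse Fps"

lemma poly_map_of_real: "poly (map_poly of_real p) (of_real z) = (of_real (F z) :: complex)"
  by (induction p) (simp_all add: map_poly_pCons)

lemma Fps_0: "fps_nth Fps 0 = 1"
proof -
  have "coeff p 0 = 1" using p0 by (simp only: poly_0_coeff_0)
  then show ?thesis by (simp add: Fps_def coeff_map_poly)
qed

lemma G_0: "fps_nth G 0 = 1" by (simp add: G_def Fps_0)

lemma G_mult_Fps: "G * Fps = 1"
  unfolding G_def by (rule inverse_mult_eq_1) (simp add: Fps_0)

lemma G_conv: "fps_conv_radius G > 0"
  unfolding G_def
proof (rule fps_conv_radius_inverse_pos)
  show "fps_nth Fps 0 \<noteq> 0" by (simp add: Fps_0)
  show "fps_conv_radius Fps > 0" by (simp add: Fps_def)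
qed

definition Bf :: "complex fps \<Rightarrow> complex fps \<Rightarrow> complex fps \<Rightarrow> complex fps" where
  "Bf A Z Y = fps_const (\<i> * of_real q) * A + fps_const (of_real al) * Z + fps_const (of_real (2 * a1 * c1)) * Y"

abbreviation "XG \<equiv> fps_X * G"

text \<open>The system for \<open>A, Z, Y\<close> (the series of \<open>a, \<zeta>, \<xi>\<close>) and the fluxes
  \<open>x = F a' + rr z^(2N+2) F \<xi>'\<close>, \<open>y = F \<zeta>'\<close>, \<open>t = F \<xi>'\<close> (series \<open>P, Q, T\<close>); the Euler operator \<open>z d/dz\<close> is
  \<open>fps_X * fps_deriv\<close>. The inhomogeneities \<open>h\<close> come from differentiating a factor \<open>ln z\<close>, and
  \<open>\<kappa>\<close> is the obstruction to a logarithm-free solution at the resonance \<open>z^N\<close> of the first flux.\<close>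

definition fsys where
  "fsys \<omega> \<kappa> A Z Y P Q T hA hZ hY hP hQ hT \<longleftrightarrow>
     fps_X * fps_deriv A + hA = XG * (P - fps_const rr * (fps_X ^ (2 * N + 2) * T)) \<and>
     fps_X * fps_deriv Z + hZ = XG * Q \<and>
     fps_X * fps_deriv Y + hY = XG * T \<and>
     fps_X * fps_deriv P + hP = of_nat N * P
       - fps_const (of_real (\<omega>\<^sup>2)) * (XG * (A + fps_const rr * (fps_X ^ (2 * N + 2) * Y))) + fps_const \<kappa> * fps_X ^ N \<and>
     fps_X * fps_deriv Q + hQ = - of_nat (N + 3) * Q
       - fps_const (of_real (\<omega>\<^sup>2)) * (XG * Z) + fps_const (of_real ga) * Bf A Z Y \<and>
     fps_X * fps_deriv T + hT = - of_nat (N + 2) * T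
       - fps_const (of_real (\<omega>\<^sup>2)) * (XG * Y) + fps_const (of_real c1) * (fps_X * Bf A Z Y)"

lemma fps_X_deriv_nth: "fps_nth (fps_X * fps_deriv A) m = of_nat m * (fps_nth A m :: complex)"
  by (cases m) simp_all

lemma fps_of_nat_mult_nth: "fps_nth (of_nat k * U) m = of_nat k * (fps_nth U m :: complex)"
  by (simp add: fps_of_nat[symmetric])

lemma norm_Bf_nth_le:
  assumes "norm (fps_nth A m) \<le> M" "norm (fps_nth Z m) \<le> M" "norm (fps_nth Y m) \<le> M"
  shows "norm (fps_nth (Bf A Z Y) m) \<le> KB * M"
  using norm_Bc_le[OF assms] by (simp add: Bf_def Bc_def)

text \<open>The majorants \<open>D * R^m\<close> have constants that do not depend on \<omega> or
  the data. The flux equations lose a constant \<open>CC\<close> at each order; the other three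
  equations contain the factor \<open>z / F\<close>, which shifts the order by one and gains
  \<open>1 / R\<close>. Only the first flux is resonant, at order \<open>N\<close>: there its
  coefficient \<open>lam\<close> is free and \<open>\<kappa>\<close> absorbs the
  obstruction.\<close>

lemma fsys_solvable:
  obtains R CC where "1 \<le> R" "2 \<le> CC" "\<And>n. norm (fps_nth G n) \<le> CC * R ^ n"
    "\<And>m D U. (\<And>j. j \<le> m \<Longrightarrow> norm (fps_nth U j) \<le> D * R ^ j) \<Longrightarrow> norm (fps_nth (G * U) m) \<le> CC * D * R ^ m"
    "\<And>\<omega> a0 \<zeta>0 \<xi>0 lam D hA hZ hY hP hQ hT. \<bar>\<omega>\<bar> \<le> 1 \<Longrightarrow>
      norm a0 \<le> D \<Longrightarrow> norm \<zeta>0 \<le> D \<Longrightarrow> norm \<xi>0 \<le> D \<Longrightarrow> norm lam \<le> D \<Longrightarrow>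
      (\<And>m. norm (fps_nth hA m) \<le> D * R ^ m \<and> norm (fps_nth hZ m) \<le> D * R ^ m \<and> norm (fps_nth hY m) \<le> D * R ^ m \<and>
        norm (fps_nth hP m) \<le> D * R ^ m \<and> norm (fps_nth hQ m) \<le> D * R ^ m \<and> norm (fps_nth hT m) \<le> D * R ^ m) \<Longrightarrow>
      fps_nth hA 0 = 0 \<Longrightarrow> fps_nth hZ 0 = 0 \<Longrightarrow> fps_nth hY 0 = 0 \<Longrightarrow>
      \<exists>\<kappa> A Z Y P Q T. fsys \<omega> \<kappa> A Z Y P Q T hA hZ hY hP hQ hT \<and>
        fps_nth A 0 = a0 \<and> fps_nth Z 0 = \<zeta>0 \<and> fps_nth Y 0 = \<xi>0 \<and> fps_nth P N = lam \<and>
        (\<forall>m. norm (fps_nth A m) \<le> CC * D * R ^ m \<and> norm (fps_nth Z m) \<le> CC * D * R ^ m \<and> norm (fps_nth Y m) \<le> CC * D * R ^ m \<and>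
        norm (fps_nth P m) \<le> CC * D * R ^ m \<and> norm (fps_nth Q m) \<le> CC * D * R ^ m \<and> norm (fps_nth T m) \<le> CC * D * R ^ m)"
proof -
  obtain Kg \<rho> where Kg: "Kg > 0" "\<rho> > 0" "\<And>n. norm (fps_nth G n) \<le> Kg * \<rho> ^ n"
    using fps_coeffs_geometric[OF G_conv] by blast
  define k where "k = 2 * Kg"
  have k: "k > 0" using Kg by (simp add: k_def)
  define CC where "CC = 2 + k + 2 * k * (1 + norm rr) + 2 * (\<bar>ga\<bar> + \<bar>c1\<bar>) * KB"
  have kr: "0 \<le> 2 * k * (1 + norm rr)" "0 \<le> 2 * (\<bar>ga\<bar> + \<bar>c1\<bar>) * KB" using k KB_nonneg by auto
  have CC: "2 \<le> CC" "k \<le> CC" using k kr unfolding CC_def by linarith+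
  \<comment> \<open>\<open>2 * \<rho>\<close> is for the majorant of \<open>G\<close>; the last
    entry lets the gain \<open>1 / R\<close> outweigh the constants \<open>k\<close>,
    \<open>CC\<close> and \<open>1 + norm rr\<close> lost in one round of the recursion.\<close>
  define R where "R = max 1 (max (2 * \<rho>) (k * CC * (1 + norm rr)))"
  have R: "1 \<le> R" "2 * \<rho> \<le> R" "k * CC * (1 + norm rr) \<le> R" by (auto simp: R_def)
  have Gm: "norm (fps_nth (G * U) m) \<le> k * D * R ^ m" if "\<And>j. j \<le> m \<Longrightarrow> norm (fps_nth U j) \<le> D * R ^ j" for m D U
    using norm_fps_mult_nth_le[OF Kg(3) Kg(1,2) R(2) that] by (simp add: k_def)
  \<comment> \<open>The factor \<open>z\<close> makes coefficient \<open>m\<close> depend on orders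
    below \<open>m\<close> only, and the missing power of \<open>R\<close> is the gain used
    below.\<close>
  have XG: "norm (fps_nth (XG * U) m) * R \<le> k * D * R ^ m"
    if "\<And>j. j < m \<Longrightarrow> norm (fps_nth U j) \<le> D * R ^ j" "D \<ge> 0" for m D U
  proof (cases m)
    case 0 then show ?thesis using k that(2) by (simp add: mult.assoc)
  next
    case (Suc n)
    then have "norm (fps_nth (G * U) n) \<le> k * D * R ^ n" by (intro Gm that) auto
    then show ?thesis using Suc R(1) by (simp add: mult.assoc mult_right_mono)
  qed
  have XG': "norm (fps_nth (XG * U) m) \<le> k * D * R ^ m"
    if "\<And>j. j < m \<Longrightarrow> norm (fps_nth U j) \<le> D * R ^ j" "D \<ge> 0" for m D U
    using order_trans[OF _ XG[of m U D, OF that]] mult_left_mono[OF R(1), of "norm (fps_nth (XG * U) m)"] by simp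
  show ?thesis
  proof (rule that[OF R(1) CC(1)])
    show "norm (fps_nth G n) \<le> CC * R ^ n" for n
    proof -
      have "\<rho> ^ n \<le> R ^ n" using Kg R by (intro power_mono) auto
      then have "Kg * \<rho> ^ n \<le> CC * R ^ n" using Kg k_def CC by (intro mult_mono) auto
      then show ?thesis using Kg(3)[of n] by linarith
    qed
    show "norm (fps_nth (G * U) m) \<le> CC * D * R ^ m" if "\<And>j. j \<le> m \<Longrightarrow> norm (fps_nth U j) \<le> D * R ^ j" for m D U
    proof -
      have D: "D \<ge> 0" using order_trans[OF norm_ge_zero that[of 0]] by simp
      have "k * D * R ^ m \<le> CC * D * R ^ m" using CC D R by (intro mult_right_mono) auto
      then show ?thesis using Gm[of m U D, OF that] by simp
    qed
    fix \<omega> :: real and a0 \<zeta>0 \<xi>0 lam :: complex and D and hA hZ hY hP hQ hT :: "complex fps"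
    assume om: "\<bar>\<omega>\<bar> \<le> 1"
      and data: "norm a0 \<le> D" "norm \<zeta>0 \<le> D" "norm \<xi>0 \<le> D" "norm lam \<le> D"
      and h: "\<And>m. norm (fps_nth hA m) \<le> D * R ^ m \<and> norm (fps_nth hZ m) \<le> D * R ^ m \<and> norm (fps_nth hY m) \<le> D * R ^ m \<and>
        norm (fps_nth hP m) \<le> D * R ^ m \<and> norm (fps_nth hQ m) \<le> D * R ^ m \<and> norm (fps_nth hT m) \<le> D * R ^ m"
      and h0: "fps_nth hA 0 = 0" "fps_nth hZ 0 = 0" "fps_nth hY 0 = 0"
    have D: "D \<ge> 0" using data(1) norm_ge_zero order_trans by blast
    have om2: "\<omega>\<^sup>2 \<le> 1" using om by (simp add: abs_square_le_1)
    define rX :: "complex fps \<Rightarrow> complex fps" where "rX U = fps_const rr * (fps_X ^ (2 * N + 2) * U)" for U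
    \<comment> \<open>The coefficient \<open>m - N\<close> of the recursion vanishes at
      \<open>m = N\<close>, so the free value \<open>lam\<close> is put there. The denominators of
      \<open>Qop\<close> and \<open>Top\<close> are never zero.\<close>
    define Pop where "Pop A Y = Abs_fps (\<lambda>m. if m = N then lam else
        (- fps_nth hP m - of_real (\<omega>\<^sup>2) * fps_nth (XG * (A + rX Y)) m) / (of_nat m - of_nat N))" for A Y
    define Qop where "Qop A Z Y = Abs_fps (\<lambda>m.
        (- fps_nth hQ m - of_real (\<omega>\<^sup>2) * fps_nth (XG * Z) m + of_real ga * fps_nth (Bf A Z Y) m) / of_nat (m + (N + 3)))" for A Z Y
    define Top where "Top A Z Y = Abs_fps (\<lambda>m.
        (- fps_nth hT m - of_real (\<omega>\<^sup>2) * fps_nth (XG * Y) m + of_real c1 * fps_nth (fps_X * Bf A Z Y) m) / of_nat (m + (N + 2)))" for A Z Y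
    define fA fZ fY :: "(nat \<Rightarrow> complex \<times> complex \<times> complex) \<Rightarrow> complex fps" where
      "fA f = Abs_fps (\<lambda>m. fst (f m))" and "fZ f = Abs_fps (\<lambda>m. fst (snd (f m)))" and "fY f = Abs_fps (\<lambda>m. snd (snd (f m)))" for f
    \<comment> \<open>The recursion state consists of the series of \<open>A\<close>,
      \<open>Z\<close>, \<open>Y\<close> only; the fluxes are explicit in them up to the same order,
      and \<open>XG\<close> makes the step causal.\<close>
    define H where "H f m = (if m = 0 then (a0, \<zeta>0, \<xi>0) else
       ((fps_nth (XG * (Pop (fA f) (fY f) - rX (Top (fA f) (fZ f) (fY f)))) m - fps_nth hA m) / of_nat m,
        (fps_nth (XG * Qop (fA f) (fZ f) (fY f)) m - fps_nth hZ m) / of_nat m,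
        (fps_nth (XG * Top (fA f) (fZ f) (fY f)) m - fps_nth hY m) / of_nat m))" for f m
    have "\<exists>f. \<forall>m. f m = H f m"
    proof (rule causal_recursion)
      fix f g :: "nat \<Rightarrow> complex \<times> complex \<times> complex" and m
      assume eq: "\<And>j. j < m \<Longrightarrow> f j = g j"
      have U: "fps_nth (fA f) j = fps_nth (fA g) j" "fps_nth (fZ f) j = fps_nth (fZ g) j" "fps_nth (fY f) j = fps_nth (fY g) j"
        if "j < m" for j using eq[OF that] by (simp_all add: fA_def fZ_def fY_def)
      have B: "fps_nth (Bf (fA f) (fZ f) (fY f)) j = fps_nth (Bf (fA g) (fZ g) (fY g)) j" if "j < m" for j
        using U[OF that] by (simp add: Bf_def)
      have XGc: "fps_nth (XG * V) j = fps_nth (XG * W) j" if "\<And>i. i < j \<Longrightarrow> fps_nth V i = fps_nth W i" for V W j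
        using that by (intro fps_mult_nth_cong_below) auto
      have rXc: "fps_nth (rX V) j = fps_nth (rX W) j" if "\<And>i. i \<le> j \<Longrightarrow> fps_nth V i = fps_nth W i" for V W j
        unfolding rX_def fps_mult_left_const_nth fps_X_power_mult_nth using that by simp
      have P: "fps_nth (Pop (fA f) (fY f)) j = fps_nth (Pop (fA g) (fY g)) j" if j: "j < m" for j
      proof -
        have "fps_nth (XG * (fA f + rX (fY f))) j = fps_nth (XG * (fA g + rX (fY g))) j"
        proof (rule XGc)
          fix i assume "i < j"
          then show "fps_nth (fA f + rX (fY f)) i = fps_nth (fA g + rX (fY g)) i"
            using U[of i] rXc[of i "fY f" "fY g"] U(3) j by simp
        qed
        then show ?thesis by (simp add: Pop_def)
      qed
      have Q: "fps_nth (Qop (fA f) (fZ f) (fY f)) j = fps_nth (Qop (fA g) (fZ g) (fY g)) j" if j: "j < m" for j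
        using XGc[of j "fZ f" "fZ g"] U(2) B[OF j] j by (simp add: Qop_def)
      have T: "fps_nth (Top (fA f) (fZ f) (fY f)) j = fps_nth (Top (fA g) (fZ g) (fY g)) j" if j: "j < m" for j
        using XGc[of j "fY f" "fY g"] U(3) B[of "j - 1"] j by (simp add: Top_def)
      have "fps_nth (XG * (Pop (fA f) (fY f) - rX (Top (fA f) (fZ f) (fY f)))) m = fps_nth (XG * (Pop (fA g) (fY g) - rX (Top (fA g) (fZ g) (fY g)))) m"
        by (rule XGc) (simp add: P rXc[of _ "Top (fA f) (fZ f) (fY f)" "Top (fA g) (fZ g) (fY g)"] T)
      moreover have "fps_nth (XG * Qop (fA f) (fZ f) (fY f)) m = fps_nth (XG * Qop (fA g) (fZ g) (fY g)) m"
        by (rule XGc) (rule Q)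
      moreover have "fps_nth (XG * Top (fA f) (fZ f) (fY f)) m = fps_nth (XG * Top (fA g) (fZ g) (fY g)) m"
        by (rule XGc) (rule T)
      ultimately show "H f m = H g m" by (simp add: H_def)
    qed
    then obtain f where f: "\<And>m. f m = H f m" by blast
    define A where "A = fA f"
    define Z where "Z = fZ f"
    define Y where "Y = fY f"
    define P where "P = Pop A Y"
    define Q where "Q = Qop A Z Y"
    define T where "T = Top A Z Y"
    have A0: "fps_nth A 0 = a0" "fps_nth Z 0 = \<zeta>0" "fps_nth Y 0 = \<xi>0"
      using f[of 0] by (simp_all add: H_def A_def Z_def Y_def fA_def fZ_def fY_def)
    have An: "fps_nth A m = (fps_nth (XG * (P - rX T)) m - fps_nth hA m) / of_nat m"
      and Zn: "fps_nth Z m = (fps_nth (XG * Q) m - fps_nth hZ m) / of_nat m"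
      and Yn: "fps_nth Y m = (fps_nth (XG * T) m - fps_nth hY m) / of_nat m" if "m > 0" for m
      using f[of m] that by (simp_all add: H_def A_def Z_def Y_def P_def Q_def T_def fA_def fZ_def fY_def)
    have Pn: "fps_nth P m = (if m = N then lam else
        (- fps_nth hP m - of_real (\<omega>\<^sup>2) * fps_nth (XG * (A + rX Y)) m) / (of_nat m - of_nat N))" for m
      by (simp add: P_def Pop_def)
    have Qn: "fps_nth Q m = (- fps_nth hQ m - of_real (\<omega>\<^sup>2) * fps_nth (XG * Z) m + of_real ga * fps_nth (Bf A Z Y) m) / of_nat (m + (N + 3))" for m
      by (simp add: Q_def Qop_def)
    have Tn: "fps_nth T m = (- fps_nth hT m - of_real (\<omega>\<^sup>2) * fps_nth (XG * Y) m + of_real c1 * fps_nth (fps_X * Bf A Z Y) m) / of_nat (m + (N + 2))" for m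
      by (simp add: T_def Top_def)
    have div: "norm (x / y) \<le> c" if "norm x \<le> c" "norm y \<ge> 1" for x y :: complex and c
    proof -
      have "norm x / norm y \<le> norm x / 1" using that by (intro divide_left_mono) auto
      then show ?thesis using that by (simp add: norm_divide)
    qed
    have div': "norm (x / of_nat n) \<le> c" if "norm x \<le> c" "n > 0" for x :: complex and n c
      using that by (intro div) auto
    \<comment> \<open>One half of the induction: bounds with constant \<open>2\<close> for the
      functions give bounds with constant \<open>CC\<close> for the fluxes at the same
      order.\<close>
    have PQT: "norm (fps_nth P m) \<le> CC * D * R ^ m \<and> norm (fps_nth Q m) \<le> CC * D * R ^ m \<and> norm (fps_nth T m) \<le> CC * D * R ^ m"
      if A: "\<And>j. j \<le> m \<Longrightarrow> norm (fps_nth A j) \<le> 2 * D * R ^ j \<and> norm (fps_nth Z j) \<le> 2 * D * R ^ j \<and> norm (fps_nth Y j) \<le> 2 * D * R ^ j" for m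
    proof -
      have DR: "0 \<le> D * R ^ m" using D R by simp
      have rXY: "norm (fps_nth (A + rX Y) j) \<le> (1 + norm rr) * (2 * D) * R ^ j" if "j \<le> m" for j
      proof -
        have "norm (fps_nth (fps_X ^ (2 * N + 2) * Y) j) \<le> 2 * D * R ^ j"
          using A that R D by (intro norm_fps_X_power_mult_nth_le) auto
        then have "norm (fps_nth (rX Y) j) \<le> norm rr * (2 * D * R ^ j)"
          unfolding rX_def fps_mult_left_const_nth norm_mult by (intro mult_left_mono) auto
        then have "norm (fps_nth A j + fps_nth (rX Y) j) \<le> 2 * D * R ^ j + norm rr * (2 * D * R ^ j)"
          using A[OF that] by (intro norm_triangle_mono) auto
        then show ?thesis by (simp add: algebra_simps)
      qed
      have w: "norm (of_real (\<omega>\<^sup>2) * x) \<le> c" if "norm x \<le> c" for x :: complex and c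
      proof -
        have "\<omega>\<^sup>2 * norm x \<le> 1 * c" using that om2 norm_ge_zero[of x] by (intro mult_mono) auto
        then show ?thesis by (simp add: norm_mult norm_power)
      qed
      have B: "norm (fps_nth (Bf A Z Y) j) \<le> KB * (2 * D * R ^ j)" if "j \<le> m" for j
        using A[OF that] by (intro norm_Bf_nth_le) auto
      have 1: "norm (fps_nth (XG * (A + rX Y)) m) \<le> k * ((1 + norm rr) * (2 * D)) * R ^ m"
        using rXY D by (intro XG') auto
      have 2: "norm (fps_nth (XG * Z) m) \<le> k * (2 * D) * R ^ m" "norm (fps_nth (XG * Y) m) \<le> k * (2 * D) * R ^ m"
        using A D by (auto intro!: XG')
      have "norm (fps_nth P m) \<le> D * R ^ m + k * ((1 + norm rr) * (2 * D)) * R ^ m"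
      proof (cases "m = N")
        case True
        have "D * 1 \<le> D * R ^ m" using R D by (intro mult_left_mono) auto
        moreover have "0 \<le> k * ((1 + norm rr) * (2 * D)) * R ^ m" using k D R by simp
        moreover have "fps_nth P m = lam" using True by (simp add: Pn)
        ultimately show ?thesis using data(4) by (simp only: mult_1_right)
      next
        case False
        have "norm (of_nat m - of_nat N :: complex) = \<bar>real m - real N\<bar>"
          by (metis norm_of_real of_real_diff of_real_of_nat_eq)
        then have "norm (of_nat m - of_nat N :: complex) \<ge> 1" using False by linarith
        then show ?thesis using False unfolding Pn
          by (simp only: if_False) (rule div[OF order_trans[OF norm_triangle_ineq4 add_mono[OF _ w[OF 1]]]], use h in auto)
      qed
      also have "\<dots> = (1 + 2 * k * (1 + norm rr)) * (D * R ^ m)" by (simp add: algebra_simps)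
      also have "\<dots> \<le> CC * (D * R ^ m)" using k kr DR by (intro mult_right_mono) (auto simp: CC_def)
      finally have P: "norm (fps_nth P m) \<le> CC * D * R ^ m" by simp
      have "norm (fps_nth Q m) \<le> D * R ^ m + k * (2 * D) * R ^ m + \<bar>ga\<bar> * (KB * (2 * D * R ^ m))"
        unfolding Qn
      proof (rule div'[OF order_trans[OF norm_triangle_ineq add_mono[OF order_trans[OF norm_triangle_ineq4 add_mono[OF _ w[OF 2(1)]]]]]])
        show "norm (of_real ga * fps_nth (Bf A Z Y) m) \<le> \<bar>ga\<bar> * (KB * (2 * D * R ^ m))"
          using B[of m] by (simp add: norm_mult mult_left_mono)
      qed (use h in auto)
      also have "\<dots> = (1 + 2 * k + 2 * \<bar>ga\<bar> * KB) * (D * R ^ m)" by (simp add: algebra_simps)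
      also have "\<dots> \<le> CC * (D * R ^ m)"
        using k DR KB_nonneg by (intro mult_right_mono) (auto simp: CC_def algebra_simps)
      finally have Q: "norm (fps_nth Q m) \<le> CC * D * R ^ m" by simp
      have "norm (fps_nth T m) \<le> D * R ^ m + k * (2 * D) * R ^ m + \<bar>c1\<bar> * (KB * (2 * D) * R ^ m)"
        unfolding Tn
      proof (rule div'[OF order_trans[OF norm_triangle_ineq add_mono[OF order_trans[OF norm_triangle_ineq4 add_mono[OF _ w[OF 2(2)]]]]]])
        have "norm (fps_nth (fps_X ^ 1 * Bf A Z Y) m) \<le> KB * (2 * D) * R ^ m"
          using B KB_nonneg D R by (intro norm_fps_X_power_mult_nth_le) (auto simp: mult.assoc)
        then show "norm (of_real c1 * fps_nth (fps_X * Bf A Z Y) m) \<le> \<bar>c1\<bar> * (KB * (2 * D) * R ^ m)"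
          unfolding norm_mult norm_of_real by (intro mult_left_mono) auto
      qed (use h in auto)
      also have "\<dots> = (1 + 2 * k + 2 * \<bar>c1\<bar> * KB) * (D * R ^ m)" by (simp add: algebra_simps)
      also have "\<dots> \<le> CC * (D * R ^ m)"
        using k DR KB_nonneg by (intro mult_right_mono) (auto simp: CC_def algebra_simps)
      finally have "norm (fps_nth T m) \<le> CC * D * R ^ m" by simp
      with P Q show ?thesis by blast
    qed
    \<comment> \<open>The other half: the choice of \<open>R\<close> brings the flux contribution
      down to \<open>D * R^m\<close>, and the inhomogeneity adds another \<open>D * R^m\<close>,
      which explains the constant \<open>2\<close>.\<close>
    have A: "norm (fps_nth A m) \<le> 2 * D * R ^ m \<and> norm (fps_nth Z m) \<le> 2 * D * R ^ m \<and> norm (fps_nth Y m) \<le> 2 * D * R ^ m" for m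
    proof (induction m rule: less_induct)
      case (less m)
      show ?case
      proof (cases "m = 0")
        case True
        then show ?thesis using A0 data D by auto
      next
        case False
        have pqt: "norm (fps_nth P j) \<le> CC * D * R ^ j \<and> norm (fps_nth Q j) \<le> CC * D * R ^ j \<and> norm (fps_nth T j) \<le> CC * D * R ^ j" if "j < m" for j
          by (rule PQT) (use less that in auto)
        have CD: "0 \<le> CC * D" using CC D by simp
        have RR: "x \<le> D * R ^ m" if "x * R \<le> k * (c * (CC * D)) * R ^ m" "c \<le> 1 + norm rr" for x c
        proof -
          have "k * (c * (CC * D)) * R ^ m = k * CC * c * (D * R ^ m)" by simp
          also have "\<dots> \<le> k * CC * (1 + norm rr) * (D * R ^ m)"
            using that(2) k CC D R by (intro mult_right_mono mult_left_mono) auto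
          also have "\<dots> \<le> R * (D * R ^ m)" using R D by (intro mult_right_mono) auto
          finally have "x * R \<le> D * R ^ m * R" using that(1) by (simp add: mult_ac)
          then show ?thesis using R(1) by simp
        qed
        have "norm (fps_nth (P - rX T) j) \<le> (1 + norm rr) * (CC * D) * R ^ j" if "j < m" for j
        proof -
          have "norm (fps_nth (fps_X ^ (2 * N + 2) * T) j) \<le> CC * D * R ^ j"
            using pqt that R CD by (intro norm_fps_X_power_mult_nth_le) auto
          then have "norm (fps_nth (rX T) j) \<le> norm rr * (CC * D * R ^ j)"
            unfolding rX_def fps_mult_left_const_nth norm_mult by (intro mult_left_mono) auto
          then have "norm (fps_nth P j - fps_nth (rX T) j) \<le> CC * D * R ^ j + norm rr * (CC * D * R ^ j)"
            using pqt[OF that] by (intro order_trans[OF norm_triangle_ineq4] add_mono) auto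
          then show ?thesis by (simp add: algebra_simps)
        qed
        then have 1: "norm (fps_nth (XG * (P - rX T)) m) \<le> D * R ^ m"
          using CD by (intro RR[OF XG]) auto
        have "norm (fps_nth (XG * U) m) * R \<le> k * (1 * (CC * D)) * R ^ m" if "\<And>j. j < m \<Longrightarrow> norm (fps_nth U j) \<le> CC * D * R ^ j" for U
          using XG[OF that CD] by simp
        then have 2: "norm (fps_nth (XG * U) m) \<le> D * R ^ m" if "\<And>j. j < m \<Longrightarrow> norm (fps_nth U j) \<le> CC * D * R ^ j" for U
          using that by (intro RR[of _ 1]) auto
        have QT: "norm (fps_nth (XG * Q) m) \<le> D * R ^ m" "norm (fps_nth (XG * T) m) \<le> D * R ^ m"
          by (rule 2; use pqt in blast)+
        have m2: "norm (x / of_nat m) \<le> 2 * D * R ^ m" if "norm x \<le> D * R ^ m + D * R ^ m" for x :: complex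
          using div'[OF that, of m] False by simp
        have m0: "m > 0" using False by simp
        have "norm (fps_nth A m) \<le> 2 * D * R ^ m"
          unfolding An[OF m0] by (rule m2[OF order_trans[OF norm_triangle_ineq4 add_mono[OF 1]]]) (use h in auto)
        moreover have "norm (fps_nth Z m) \<le> 2 * D * R ^ m"
          unfolding Zn[OF m0] by (rule m2[OF order_trans[OF norm_triangle_ineq4 add_mono[OF QT(1)]]]) (use h in auto)
        moreover have "norm (fps_nth Y m) \<le> 2 * D * R ^ m"
          unfolding Yn[OF m0] by (rule m2[OF order_trans[OF norm_triangle_ineq4 add_mono[OF QT(2)]]]) (use h in auto)
        ultimately show ?thesis by blast
      qed
    qed
    have rearr: "x + h = - y - w + g" if "x + y = - h - w + g" for x y h w g :: complex
      using that by algebra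
    have rearr': "x * u + h = y * u - w + 0" if "(x - y) * u = - h - w" for x y u h w :: complex
      using that by algebra
    \<comment> \<open>The value forced by the coefficient of \<open>z^N\<close>, where the free
      coefficient \<open>lam\<close> cancels from both sides.\<close>
    define \<kappa> where "\<kappa> = fps_nth hP N + of_real (\<omega>\<^sup>2) * fps_nth (XG * (A + rX Y)) N"
    have sys: "fsys \<omega> \<kappa> A Z Y P Q T hA hZ hY hP hQ hT"
      unfolding fsys_def rX_def[symmetric]
    proof (intro conjI fps_ext)
      fix m
      show "fps_nth (fps_X * fps_deriv A + hA) m = fps_nth (XG * (P - rX T)) m"
        unfolding fps_add_nth fps_X_deriv_nth using h0 by (cases "m = 0") (simp_all add: An)
      show "fps_nth (fps_X * fps_deriv Z + hZ) m = fps_nth (XG * Q) m"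
        unfolding fps_add_nth fps_X_deriv_nth using h0 by (cases "m = 0") (simp_all add: Zn)
      show "fps_nth (fps_X * fps_deriv Y + hY) m = fps_nth (XG * T) m"
        unfolding fps_add_nth fps_X_deriv_nth using h0 by (cases "m = 0") (simp_all add: Yn)
      show "fps_nth (fps_X * fps_deriv P + hP) m = fps_nth (of_nat N * P - fps_const (of_real (\<omega>\<^sup>2)) * (XG * (A + rX Y)) + fps_const \<kappa> * fps_X ^ N) m"
      proof (cases "m = N")
        case True
        then show ?thesis
          unfolding fps_add_nth fps_sub_nth fps_X_deriv_nth fps_of_nat_mult_nth fps_mult_left_const_nth
          by (simp add: \<kappa>_def)
      next
        case False
        then have "(of_nat m - of_nat N :: complex) \<noteq> 0" by simp
        then have "(of_nat m - of_nat N) * fps_nth P m = - fps_nth hP m - of_real (\<omega>\<^sup>2) * fps_nth (XG * (A + rX Y)) m"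
          using False unfolding Pn by simp
        then show ?thesis using False
          unfolding fps_add_nth fps_sub_nth fps_X_deriv_nth fps_of_nat_mult_nth fps_mult_left_const_nth
          by (simp only: fps_X_power_nth if_False mult_zero_right) (rule rearr')
      qed
      have "of_nat (m + (N + 3)) * fps_nth Q m = - fps_nth hQ m - of_real (\<omega>\<^sup>2) * fps_nth (XG * Z) m + of_real ga * fps_nth (Bf A Z Y) m"
        unfolding Qn times_divide_eq_right by (rule nonzero_mult_div_cancel_left) (unfold of_nat_eq_0_iff, simp)
      then have "of_nat m * fps_nth Q m + of_nat (N + 3) * fps_nth Q m = - fps_nth hQ m - of_real (\<omega>\<^sup>2) * fps_nth (XG * Z) m + of_real ga * fps_nth (Bf A Z Y) m"
        by (simp only: of_nat_add distrib_right)
      then show "fps_nth (fps_X * fps_deriv Q + hQ) m = fps_nth (- of_nat (N + 3) * Q - fps_const (of_real (\<omega>\<^sup>2)) * (XG * Z) + fps_const (of_real ga) * Bf A Z Y) m"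
        unfolding fps_add_nth fps_sub_nth fps_X_deriv_nth mult_minus_left fps_neg_nth fps_of_nat_mult_nth fps_mult_left_const_nth
        by (rule rearr)
      have "of_nat (m + (N + 2)) * fps_nth T m = - fps_nth hT m - of_real (\<omega>\<^sup>2) * fps_nth (XG * Y) m + of_real c1 * fps_nth (fps_X * Bf A Z Y) m"
        unfolding Tn times_divide_eq_right by (rule nonzero_mult_div_cancel_left) (unfold of_nat_eq_0_iff, simp)
      then have "of_nat m * fps_nth T m + of_nat (N + 2) * fps_nth T m = - fps_nth hT m - of_real (\<omega>\<^sup>2) * fps_nth (XG * Y) m + of_real c1 * fps_nth (fps_X * Bf A Z Y) m"
        by (simp only: of_nat_add distrib_right)
      then show "fps_nth (fps_X * fps_deriv T + hT) m = fps_nth (- of_nat (N + 2) * T - fps_const (of_real (\<omega>\<^sup>2)) * (XG * Y) + fps_const (of_real c1) * (fps_X * Bf A Z Y)) m"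
        unfolding fps_add_nth fps_sub_nth fps_X_deriv_nth mult_minus_left fps_neg_nth fps_of_nat_mult_nth fps_mult_left_const_nth
        by (rule rearr)
    qed
    have "2 * D * R ^ m \<le> CC * D * R ^ m" for m using CC D R by (intro mult_right_mono) auto
    then have "\<forall>m. norm (fps_nth A m) \<le> CC * D * R ^ m \<and> norm (fps_nth Z m) \<le> CC * D * R ^ m \<and> norm (fps_nth Y m) \<le> CC * D * R ^ m \<and>
        norm (fps_nth P m) \<le> CC * D * R ^ m \<and> norm (fps_nth Q m) \<le> CC * D * R ^ m \<and> norm (fps_nth T m) \<le> CC * D * R ^ m"
      using A PQT by (meson order_trans)
    moreover have "fps_nth P N = lam" by (simp add: Pn)
    ultimately show "\<exists>\<kappa> A Z Y P Q T. fsys \<omega> \<kappa> A Z Y P Q T hA hZ hY hP hQ hT \<and>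
        fps_nth A 0 = a0 \<and> fps_nth Z 0 = \<zeta>0 \<and> fps_nth Y 0 = \<xi>0 \<and> fps_nth P N = lam \<and>
        (\<forall>m. norm (fps_nth A m) \<le> CC * D * R ^ m \<and> norm (fps_nth Z m) \<le> CC * D * R ^ m \<and> norm (fps_nth Y m) \<le> CC * D * R ^ m \<and>
        norm (fps_nth P m) \<le> CC * D * R ^ m \<and> norm (fps_nth Q m) \<le> CC * D * R ^ m \<and> norm (fps_nth T m) \<le> CC * D * R ^ m)"
      using sys A0 by blast
  qed
qed

end

section \<open>Evaluation of power series on the real axis\<close>

definition conv_ge :: "real \<Rightarrow> complex fps \<Rightarrow> bool" where
  "conv_ge r U \<longleftrightarrow> ereal r \<le> fps_conv_radius U"

lemma conv_ge_intros [simp, intro]: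
  "conv_ge r U \<Longrightarrow> conv_ge r V \<Longrightarrow> conv_ge r (U + V)"
  "conv_ge r U \<Longrightarrow> conv_ge r V \<Longrightarrow> conv_ge r (U - V)"
  "conv_ge r U \<Longrightarrow> conv_ge r V \<Longrightarrow> conv_ge r (U * V)"
  "conv_ge r U \<Longrightarrow> conv_ge r (- U)"
  "conv_ge r (fps_const c)" "conv_ge r fps_X" "conv_ge r (fps_X ^ k)" "conv_ge r (of_nat k)"
  "conv_ge r 0" "conv_ge r U \<Longrightarrow> conv_ge r (fps_shift k U)"
  "conv_ge r U \<Longrightarrow> conv_ge r (fps_deriv U)"
  unfolding conv_ge_def
  using fps_conv_radius_add[of U V] fps_conv_radius_diff[of U V] fps_conv_radius_mult[of U V]
    fps_conv_radius_deriv[of U]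
  by (auto simp: min_def fps_of_nat[symmetric] split: if_splits intro: order_trans)

lemma conv_ge_geometric:
  assumes "\<And>n. norm (fps_nth U n) \<le> C * R ^ n" "R > 0"
  shows "conv_ge (1 / (2 * R)) U"
proof -
  have "ereal (norm (of_real (1 / (2 * R)) :: complex)) \<le> conv_radius (fps_nth U)"
  proof (rule conv_radius_geI)
    show "summable (\<lambda>n. fps_nth U n * of_real (1 / (2 * R)) ^ n)"
    proof (rule summable_comparison_test')
      show "summable (\<lambda>n. C * (1 / 2) ^ n)" by (intro summable_mult summable_geometric) simp
      fix n
      have "norm (fps_nth U n * of_real (1 / (2 * R)) ^ n) = norm (fps_nth U n) * (1 / (2 * R)) ^ n"
        using assms by (simp add: norm_mult norm_power norm_divide)
      also have "\<dots> \<le> C * R ^ n * (1 / (2 * R)) ^ n" using assms by (intro mult_right_mono) auto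
      also have "\<dots> = C * (R * (1 / (2 * R))) ^ n" by (simp only: power_mult_distrib mult.assoc)
      also have "R * (1 / (2 * R)) = 1 / 2" using assms by simp
      finally show "norm (fps_nth U n * of_real (1 / (2 * R)) ^ n) \<le> C * (1 / 2) ^ n" .
    qed
  qed
  then show ?thesis using assms(2) by (simp add: conv_ge_def fps_conv_radius_def norm_divide)
qed

definition ev :: "complex fps \<Rightarrow> real \<Rightarrow> complex" where "ev U z = eval_fps U (of_real z)"

lemma ev_simps:
  assumes "0 < z" "z < r"
  shows "conv_ge r U \<Longrightarrow> conv_ge r V \<Longrightarrow> ev (U + V) z = ev U z + ev V z"
    "conv_ge r U \<Longrightarrow> conv_ge r V \<Longrightarrow> ev (U - V) z = ev U z - ev V z"
    "conv_ge r U \<Longrightarrow> conv_ge r V \<Longrightarrow> ev (U * V) z = ev U z * ev V z"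
    "conv_ge r U \<Longrightarrow> ev (- U) z = - ev U z"
    "ev (fps_const c) z = c" "ev fps_X z = of_real z" "ev (fps_X ^ k) z = of_real (z ^ k)" "ev (of_nat k) z = of_nat k"
proof -
  have *: "ereal (norm (complex_of_real z)) < fps_conv_radius W" if "conv_ge r W" for W
    using that assms by (auto simp: conv_ge_def intro: less_le_trans[of _ "ereal r"])
  show "conv_ge r U \<Longrightarrow> conv_ge r V \<Longrightarrow> ev (U + V) z = ev U z + ev V z"
    unfolding ev_def by (rule eval_fps_add; rule *; assumption)
  show "conv_ge r U \<Longrightarrow> conv_ge r V \<Longrightarrow> ev (U - V) z = ev U z - ev V z"
    unfolding ev_def by (rule eval_fps_diff; rule *; assumption)
  show "conv_ge r U \<Longrightarrow> conv_ge r V \<Longrightarrow> ev (U * V) z = ev U z * ev V z"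
    unfolding ev_def by (rule eval_fps_mult; rule *; assumption)
  show "conv_ge r U \<Longrightarrow> ev (- U) z = - ev U z"
    unfolding ev_def by (rule eval_fps_minus; rule *; assumption)
  show "ev (fps_const c) z = c" "ev fps_X z = of_real z" "ev (fps_X ^ k) z = of_real (z ^ k)" "ev (of_nat k) z = of_nat k"
    by (simp_all add: ev_def fps_of_nat[symmetric])
qed

lemma ev_derivative:
  assumes "conv_ge r U" "0 < z" "z < r"
  shows "(ev U has_vector_derivative ev (fps_deriv U) z) (at z)"
proof -
  have *: "ereal (norm (complex_of_real z)) < fps_conv_radius U"
    using assms by (auto simp: conv_ge_def intro: less_le_trans[of _ "ereal r"])
  show ?thesis unfolding ev_def
    by (intro has_vector_derivative_real_field has_field_derivative_eval_fps) (use * in auto)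
qed

lemma ev_tendsto_0:
  assumes "conv_ge r U" "0 < r"
  shows "(ev U \<longlongrightarrow> fps_nth U 0) (at_right 0)"
proof -
  have "0 < ereal r" using assms by simp
  then have "0 < fps_conv_radius U" using assms(1) unfolding conv_ge_def by (rule less_le_trans)
  then have "isCont (eval_fps U) 0"
    by (intro continuous_eval_fps) (auto simp: zero_ereal_def)
  then have "(eval_fps U \<longlongrightarrow> eval_fps U 0) (at 0)" by (simp add: isCont_def)
  moreover have "filterlim complex_of_real (at 0) (at_right 0)"
    by (rule filterlim_atI) (auto intro!: tendsto_eq_intros eventually_at_rightI[of 0 1])
  ultimately show ?thesis unfolding ev_def
    by (metis filterlim_compose eval_fps_at_0)
qed

lemma norm_ev_le:
  assumes "\<And>n. norm (fps_nth U n) \<le> C * R ^ n" "R > 0" "0 < z" "2 * R * z \<le> 1"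
  shows "norm (ev U z) \<le> 2 * C"
proof -
  have C: "C \<ge> 0" using order_trans[OF norm_ge_zero assms(1)[of 0]] by simp
  have b: "norm (fps_nth U n * of_real z ^ n) \<le> C * (1 / 2) ^ n" for n
  proof -
    have "norm (fps_nth U n * of_real z ^ n) = norm (fps_nth U n) * z ^ n"
      using assms by (simp add: norm_mult norm_power)
    also have "\<dots> \<le> C * R ^ n * z ^ n" using assms by (intro mult_right_mono) auto
    also have "\<dots> = C * (R * z) ^ n" by (simp add: power_mult_distrib mult.assoc)
    also have "\<dots> \<le> C * (1 / 2) ^ n" using assms C by (intro mult_left_mono power_mono) auto
    finally show ?thesis .
  qed
  have s: "(\<lambda>n. C * (1 / 2) ^ n) sums (C * 2)"
    using sums_mult[OF geometric_sums[of "1 / 2 :: real"], of C] by simp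
  have "norm (ev U z) \<le> (\<Sum>n. C * (1 / 2) ^ n)"
    unfolding ev_def eval_fps_def using s b by (intro norm_suminf_le) (auto simp: sums_iff)
  then show ?thesis using s by (simp add: sums_iff)
qed

section \<open>From power series to solutions of the equations near the boundary\<close>

context brane
begin

text \<open>The same component as in \<open>rcomp\<close>, before the ingoing phase is split off;
  the interval \<open>(0, r)\<close> is a parameter because series solutions exist near
  \<open>0\<close> only.\<close>

definition comp :: "real \<Rightarrow> (real \<Rightarrow> real) \<Rightarrow> complex \<Rightarrow> (real \<Rightarrow> complex) \<Rightarrow> real
    \<Rightarrow> (real \<Rightarrow> complex) \<Rightarrow> (real \<Rightarrow> complex) \<Rightarrow> bool" where
  "comp \<omega> \<kappa> s S r f f' \<longleftrightarrow> (\<forall>z. 0 < z \<longrightarrow> z < r \<longrightarrow>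
     (f has_vector_derivative f' z) (at z) \<and>
     ((\<lambda>z. of_real (\<kappa> z * F z) * f' z) has_vector_derivative
        - of_real (\<omega>\<^sup>2 * \<kappa> z / F z) * f z + s * of_real (z ^ (N + 2)) * S z) (at z))"

text \<open>The perturbation equations on \<open>(0, r)\<close>, with the derivatives passed as separate functions.\<close>

definition psol :: "real \<Rightarrow> real \<Rightarrow> (real \<Rightarrow> complex) \<Rightarrow> (real \<Rightarrow> complex) \<Rightarrow> (real \<Rightarrow> complex)
    \<Rightarrow> (real \<Rightarrow> complex) \<Rightarrow> (real \<Rightarrow> complex) \<Rightarrow> (real \<Rightarrow> complex) \<Rightarrow> bool" where
  "psol \<omega> r a \<zeta> \<xi> a' \<zeta>' \<xi>' \<longleftrightarrow>
     comp \<omega> (\<lambda>z. 1 / z ^ N) (- \<i> * of_real q) (\<lambda>z. Bc (a z) (\<zeta> z) (\<xi> z)) r a a' \<and>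
     comp \<omega> (\<lambda>z. z ^ (N + 3)) (of_real ga) (\<lambda>z. Bc (a z) (\<zeta> z) (\<xi> z)) r \<zeta> \<zeta>' \<and>
     comp \<omega> (\<lambda>z. z ^ (N + 2)) (of_real c1) (\<lambda>z. Bc (a z) (\<zeta> z) (\<xi> z)) r \<xi> \<xi>'"

definition Pif :: "(real \<Rightarrow> complex) \<Rightarrow> (real \<Rightarrow> complex) \<Rightarrow> real \<Rightarrow> complex" where
  "Pif a' \<xi>' z = of_real (1 / z ^ N * F z) * a' z + rr * (of_real (z ^ (N + 2) * F z) * \<xi>' z)"

lemma rr_c1: "rr * of_real c1 = \<i> * of_real q"
  using c1 by (simp add: rr_def)

text \<open>The terms \<open>(N + 3) * y\<close> and \<open>(N + 2) * t\<close> are what the product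
  rule yields when the weights are pulled into the derivative. The unknown \<open>x\<close> is
  \<open>z^N\<close> times the source-free combination \<open>Pif\<close>, so the flux of
  \<open>a\<close> is recovered by subtracting the \<xi> part, and the source reappears from
  there.\<close>

lemma psol_of_first_order:
  fixes a \<zeta> \<xi> x y t x' y' t' :: "real \<Rightarrow> complex"
  assumes r: "r \<le> z0"
    and d: "\<And>z. 0 < z \<Longrightarrow> z < r \<Longrightarrow> (a has_vector_derivative (x z - rr * (of_real (z ^ (2 * N + 2)) * t z)) / of_real (F z)) (at z)"
      "\<And>z. 0 < z \<Longrightarrow> z < r \<Longrightarrow> (\<zeta> has_vector_derivative y z / of_real (F z)) (at z)"
      "\<And>z. 0 < z \<Longrightarrow> z < r \<Longrightarrow> (\<xi> has_vector_derivative t z / of_real (F z)) (at z)"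
      "\<And>z. 0 < z \<Longrightarrow> z < r \<Longrightarrow> (x has_vector_derivative x' z) (at z)"
      "\<And>z. 0 < z \<Longrightarrow> z < r \<Longrightarrow> (y has_vector_derivative y' z) (at z)"
      "\<And>z. 0 < z \<Longrightarrow> z < r \<Longrightarrow> (t has_vector_derivative t' z) (at z)"
    and e: "\<And>z. 0 < z \<Longrightarrow> z < r \<Longrightarrow> of_real z * x' z = of_nat N * x z - of_real (\<omega>\<^sup>2) * (of_real z / of_real (F z) * (a z + rr * (of_real (z ^ (2 * N + 2)) * \<xi> z)))"
      "\<And>z. 0 < z \<Longrightarrow> z < r \<Longrightarrow> of_real z * y' z = - of_nat (N + 3) * y z - of_real (\<omega>\<^sup>2) * (of_real z / of_real (F z) * \<zeta> z) + of_real ga * Bc (a z) (\<zeta> z) (\<xi> z)"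
      "\<And>z. 0 < z \<Longrightarrow> z < r \<Longrightarrow> of_real z * t' z = - of_nat (N + 2) * t z - of_real (\<omega>\<^sup>2) * (of_real z / of_real (F z) * \<xi> z) + of_real c1 * (of_real z * Bc (a z) (\<zeta> z) (\<xi> z))"
  shows "psol \<omega> r a \<zeta> \<xi> (\<lambda>z. (x z - rr * (of_real (z ^ (2 * N + 2)) * t z)) / of_real (F z)) (\<lambda>z. y z / of_real (F z)) (\<lambda>z. t z / of_real (F z))"
    and "\<And>z. 0 < z \<Longrightarrow> z < r \<Longrightarrow> Pif (\<lambda>z. (x z - rr * (of_real (z ^ (2 * N + 2)) * t z)) / of_real (F z)) (\<lambda>z. t z / of_real (F z)) z = x z / of_real (z ^ N)"
proof -
  have eqv: "X + n * T = - w + c" if "X = - n * T - w + c" for X n T w c :: complex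
    using that by simp
  have Fne: "F z \<noteq> 0" if "0 < z" "z < r" for z using ppos[of z] that r by simp
  have pw: "((\<lambda>z. of_real (z ^ m) * f z) has_vector_derivative of_real (z ^ m) * f' z + of_real (real m * z ^ n) * f z) (at z)"
    if "m = n + 1" "(f has_vector_derivative f' z) (at z)" for m n and f f' :: "real \<Rightarrow> complex" and z :: real
    by (intro has_vector_derivative_mult has_vector_derivative_of_real power_derivative that)
  have ev: "eventually (\<lambda>u. 0 < u \<and> u < r) (nhds z)" if "0 < z" "z < r" for z
    using that by (intro eventually_nhds_in_open[of "{0<..<r}" z, simplified]) auto
  have tr: "(g has_vector_derivative D) (at z)" if "(f has_vector_derivative D) (at z)" "0 < z" "z < r"
    "\<And>u. 0 < u \<Longrightarrow> u < r \<Longrightarrow> f u = g u" for f g :: "real \<Rightarrow> complex" and D z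
    by (rule has_vector_derivative_transform_within_open[OF that(1), of "{0<..<r}"]) (use that in auto)
  have Pi: "of_real (1 / z ^ N * F z) * ((x z - rr * (of_real (z ^ (2 * N + 2)) * t z)) / of_real (F z))
      = of_real (1 / z ^ N) * x z - rr * (of_real (z ^ (N + 2)) * t z)" if "0 < z" "z < r" for z
  proof -
    have "z ^ (2 * N + 2) = z ^ N * z ^ (N + 2)" by (simp add: power_add[symmetric] mult_2)
    then show ?thesis using Fne[OF that] that by (simp only:) (simp add: field_simps)
  qed
  show "psol \<omega> r a \<zeta> \<xi> (\<lambda>z. (x z - rr * (of_real (z ^ (2 * N + 2)) * t z)) / of_real (F z)) (\<lambda>z. y z / of_real (F z)) (\<lambda>z. t z / of_real (F z))"
    unfolding psol_def comp_def
  proof (intro conjI allI impI)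
    fix z assume z: "0 < z" "z < r"
    have z': "complex_of_real z \<noteq> 0" "complex_of_real (F z) \<noteq> 0" using z Fne[OF z] by auto
    let ?B = "Bc (a z) (\<zeta> z) (\<xi> z)"
    have T: "((\<lambda>z. of_real (z ^ (N + 2)) * t z) has_vector_derivative
        - of_real (\<omega>\<^sup>2 * z ^ (N + 2) / F z) * \<xi> z + of_real c1 * of_real (z ^ (N + 2)) * ?B) (at z)"
    proof -
      have "of_real (z ^ (N + 2)) * t' z + of_real (real (N + 2) * z ^ (N + 1)) * t z
          = of_real (z ^ (N + 1)) * (of_real z * t' z + of_nat (N + 2) * t z)"
        by (simp add: algebra_simps)
      also have "\<dots> = of_real (z ^ (N + 1)) * (- (of_real (\<omega>\<^sup>2) * (of_real z / of_real (F z) * \<xi> z)) + of_real c1 * (of_real z * ?B))"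
        unfolding eqv[OF e(3)[OF z]] ..
      also have "\<dots> = - of_real (\<omega>\<^sup>2 * z ^ (N + 2) / F z) * \<xi> z + of_real c1 * of_real (z ^ (N + 2)) * ?B"
        by (simp add: algebra_simps)
      finally show ?thesis using pw[of "N + 2" "N + 1" t t' z] d(6)[OF z] by simp
    qed
    show "((\<lambda>z. of_real (z ^ (N + 2) * F z) * (t z / of_real (F z))) has_vector_derivative
        - of_real (\<omega>\<^sup>2 * z ^ (N + 2) / F z) * \<xi> z + of_real c1 * of_real (z ^ (N + 2)) * ?B) (at z)"
      by (rule tr[OF T z]) (simp add: Fne)
    have Y: "((\<lambda>z. of_real (z ^ (N + 3)) * y z) has_vector_derivative
        - of_real (\<omega>\<^sup>2 * z ^ (N + 3) / F z) * \<zeta> z + of_real ga * of_real (z ^ (N + 2)) * ?B) (at z)"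
    proof -
      have "of_real (z ^ (N + 3)) * y' z + of_real (real (N + 3) * z ^ (N + 2)) * y z
          = of_real (z ^ (N + 2)) * (of_real z * y' z + of_nat (N + 3) * y z)"
        by (simp add: algebra_simps eval_nat_numeral)
      also have "\<dots> = of_real (z ^ (N + 2)) * (- (of_real (\<omega>\<^sup>2) * (of_real z / of_real (F z) * \<zeta> z)) + of_real ga * ?B)"
        unfolding eqv[OF e(2)[OF z]] ..
      also have "\<dots> = - of_real (\<omega>\<^sup>2 * z ^ (N + 3) / F z) * \<zeta> z + of_real ga * of_real (z ^ (N + 2)) * ?B"
        by (simp add: algebra_simps eval_nat_numeral)
      finally show ?thesis using pw[of "N + 3" "N + 2" y y' z] d(5)[OF z] by simp
    qed
    show "((\<lambda>z. of_real (z ^ (N + 3) * F z) * (y z / of_real (F z))) has_vector_derivative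
        - of_real (\<omega>\<^sup>2 * z ^ (N + 3) / F z) * \<zeta> z + of_real ga * of_real (z ^ (N + 2)) * ?B) (at z)"
      by (rule tr[OF Y z]) (simp add: Fne)
    have X: "((\<lambda>z. of_real (1 / z ^ N) * x z) has_vector_derivative
        - of_real (\<omega>\<^sup>2) * ((a z + rr * (of_real (z ^ (2 * N + 2)) * \<xi> z)) / of_real (z ^ N * F z))) (at z)"
    proof -
      have "((\<lambda>z. of_real (1 / z ^ N) * x z) has_vector_derivative of_real (1 / z ^ N) * x' z + of_real (- real N / z ^ (N + 1)) * x z) (at z)"
        by (intro has_vector_derivative_mult has_vector_derivative_of_real inverse_power_derivative z d(4))
      moreover have "of_real (1 / z ^ N) * x' z + of_real (- real N / z ^ (N + 1)) * x z
          = (of_real z * x' z - of_nat N * x z) / of_real (z ^ (N + 1))"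
        using z by (simp add: field_simps)
      also have "\<dots> = - of_real (\<omega>\<^sup>2) * ((a z + rr * (of_real (z ^ (2 * N + 2)) * \<xi> z)) / of_real (z ^ N * F z))"
        unfolding e(1)[OF z] using z z' by (simp add: field_simps)
      finally show ?thesis by simp
    qed
    have "((\<lambda>z. of_real (1 / z ^ N) * x z - rr * (of_real (z ^ (N + 2)) * t z)) has_vector_derivative
        - of_real (\<omega>\<^sup>2) * ((a z + rr * (of_real (z ^ (2 * N + 2)) * \<xi> z)) / of_real (z ^ N * F z))
        - rr * (- of_real (\<omega>\<^sup>2 * z ^ (N + 2) / F z) * \<xi> z + of_real c1 * of_real (z ^ (N + 2)) * ?B)) (at z)"
      by (intro has_vector_derivative_diff X has_vector_derivative_mult_right T)
    moreover have "- of_real (\<omega>\<^sup>2) * ((a z + rr * (of_real (z ^ (2 * N + 2)) * \<xi> z)) / of_real (z ^ N * F z))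
        - rr * (- of_real (\<omega>\<^sup>2 * z ^ (N + 2) / F z) * \<xi> z + of_real c1 * of_real (z ^ (N + 2)) * ?B)
        = - of_real (\<omega>\<^sup>2 * (1 / z ^ N) / F z) * a z + - \<i> * of_real q * of_real (z ^ (N + 2)) * ?B"
    proof -
      have 1: "z ^ (2 * N + 2) = z ^ N * z ^ (N + 2)" by (simp add: power_add[symmetric] mult_2)
      have 2: "- \<i> * of_real q = - (rr * of_real c1)" by (simp add: rr_c1)
      show ?thesis unfolding 1 2 using z z' by (simp add: field_simps)
    qed
    ultimately have "((\<lambda>z. of_real (1 / z ^ N) * x z - rr * (of_real (z ^ (N + 2)) * t z)) has_vector_derivative
        - of_real (\<omega>\<^sup>2 * (1 / z ^ N) / F z) * a z + - \<i> * of_real q * of_real (z ^ (N + 2)) * ?B) (at z)"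
      by simp
    then show "((\<lambda>z. of_real (1 / z ^ N * F z) * ((x z - rr * (of_real (z ^ (2 * N + 2)) * t z)) / of_real (F z))) has_vector_derivative
        - of_real (\<omega>\<^sup>2 * (1 / z ^ N) / F z) * a z + - \<i> * of_real q * of_real (z ^ (N + 2)) * ?B) (at z)"
      using z by (rule tr) (simp only: Pi)
  qed (use d in auto)
  fix z assume z: "0 < z" "z < r"
  have "of_real (z ^ (N + 2) * F z) * (t z / of_real (F z)) = of_real (z ^ (N + 2)) * t z"
    using Fne[OF z] by simp
  then show "Pif (\<lambda>z. (x z - rr * (of_real (z ^ (2 * N + 2)) * t z)) / of_real (F z)) (\<lambda>z. t z / of_real (F z)) z = x z / of_real (z ^ N)"
    unfolding Pif_def Pi[OF z] by simp
qed

lemma ev_G: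
  assumes "conv_ge r G" "0 < z" "z < r" "r \<le> z0"
  shows "ev G z = 1 / of_real (F z)"
proof -
  have "ev (G * Fps) z = ev G z * ev Fps z"
    using assms by (intro ev_simps) (auto simp: conv_ge_def Fps_def)
  moreover have "ev Fps z = of_real (F z)" by (simp add: ev_def Fps_def poly_map_of_real)
  ultimately have "ev G z * of_real (F z) = 1" by (simp add: G_mult_Fps ev_def)
  moreover have "F z \<noteq> 0" using ppos[of z] assms by simp
  ultimately show ?thesis by (simp add: field_simps)
qed

lemma ev_fsys:
  assumes s: "fsys \<omega> \<kappa> A Z Y P Q T hA hZ hY hP hQ hT"
    and c [simp]: "conv_ge r A" "conv_ge r Z" "conv_ge r Y" "conv_ge r P" "conv_ge r Q" "conv_ge r T"
      "conv_ge r hA" "conv_ge r hZ" "conv_ge r hY" "conv_ge r hP" "conv_ge r hQ" "conv_ge r hT" "conv_ge r G"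
    and z: "0 < z" "z < r" "r \<le> z0"
  defines "w \<equiv> complex_of_real z"
  shows "w * ev (fps_deriv A) z + ev hA z = w / of_real (F z) * (ev P z - rr * (of_real (z ^ (2 * N + 2)) * ev T z))"
    and "w * ev (fps_deriv Z) z + ev hZ z = w / of_real (F z) * ev Q z"
    and "w * ev (fps_deriv Y) z + ev hY z = w / of_real (F z) * ev T z"
    and "w * ev (fps_deriv P) z + ev hP z = of_nat N * ev P z
      - of_real (\<omega>\<^sup>2) * (w / of_real (F z) * (ev A z + rr * (of_real (z ^ (2 * N + 2)) * ev Y z))) + \<kappa> * of_real (z ^ N)"
    and "w * ev (fps_deriv Q) z + ev hQ z = - of_nat (N + 3) * ev Q z - of_real (\<omega>\<^sup>2) * (w / of_real (F z) * ev Z z)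
      + of_real ga * Bc (ev A z) (ev Z z) (ev Y z)"
    and "w * ev (fps_deriv T) z + ev hT z = - of_nat (N + 2) * ev T z - of_real (\<omega>\<^sup>2) * (w / of_real (F z) * ev Y z)
      + of_real c1 * (w * Bc (ev A z) (ev Z z) (ev Y z))"
proof -
  note E = ev_simps[OF z(1,2)]
  have g: "ev G z = 1 / of_real (F z)" by (rule ev_G) (use z in auto)
  have B [simp]: "conv_ge r (Bf A Z Y)" by (simp add: Bf_def)
  have Be: "ev (Bf A Z Y) z = Bc (ev A z) (ev Z z) (ev Y z)"
    by (simp add: Bf_def Bc_def E del: of_real_mult)
  have D: "ev (fps_X * fps_deriv U + h) z = w * ev (fps_deriv U) z + ev h z" if "conv_ge r U" "conv_ge r h" for U h
    using that by (simp add: E w_def)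
  have X: "ev (XG * U) z = w / of_real (F z) * ev U z" if "conv_ge r U" for U
    using that by (simp add: E w_def g)
  note S = s[unfolded fsys_def]
  show "w * ev (fps_deriv A) z + ev hA z = w / of_real (F z) * (ev P z - rr * (of_real (z ^ (2 * N + 2)) * ev T z))"
    by (subst D[symmetric], simp, simp, subst conjunct1[OF S], subst X, simp) (simp only: E c conv_ge_intros)
  show "w * ev (fps_deriv Z) z + ev hZ z = w / of_real (F z) * ev Q z"
    by (subst D[symmetric], simp, simp, subst S[THEN conjunct2, THEN conjunct1], subst X, simp, simp)
  show "w * ev (fps_deriv Y) z + ev hY z = w / of_real (F z) * ev T z"
    by (subst D[symmetric], simp, simp, subst S[THEN conjunct2, THEN conjunct2, THEN conjunct1], subst X, simp, simp)
  show "w * ev (fps_deriv P) z + ev hP z = of_nat N * ev P z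
      - of_real (\<omega>\<^sup>2) * (w / of_real (F z) * (ev A z + rr * (of_real (z ^ (2 * N + 2)) * ev Y z))) + \<kappa> * of_real (z ^ N)"
    by (subst D[symmetric], simp, simp, subst S[THEN conjunct2, THEN conjunct2, THEN conjunct2, THEN conjunct1])
      (simp only: E c conv_ge_intros g w_def times_divide_eq_right mult_1_right)
  show "w * ev (fps_deriv Q) z + ev hQ z = - of_nat (N + 3) * ev Q z - of_real (\<omega>\<^sup>2) * (w / of_real (F z) * ev Z z)
      + of_real ga * Bc (ev A z) (ev Z z) (ev Y z)"
    by (subst D[symmetric], simp, simp, subst S[THEN conjunct2, THEN conjunct2, THEN conjunct2, THEN conjunct2, THEN conjunct1])
      (simp only: E Be B c conv_ge_intros g w_def times_divide_eq_right mult_1_right)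
  show "w * ev (fps_deriv T) z + ev hT z = - of_nat (N + 2) * ev T z - of_real (\<omega>\<^sup>2) * (w / of_real (F z) * ev Y z)
      + of_real c1 * (w * Bc (ev A z) (ev Z z) (ev Y z))"
    by (subst D[symmetric], simp, simp, subst S[THEN conjunct2, THEN conjunct2, THEN conjunct2, THEN conjunct2, THEN conjunct2])
      (simp only: E Be B c conv_ge_intros g w_def times_divide_eq_right mult_1_right)
qed

text \<open>At order \<open>N\<close> the Euler operator and \<open>of_nat N * P\<close> cancel, so
  the equation contains no unknown flux coefficient. Without inhomogeneity \<open>\<kappa>\<close>
  carries a factor \<open>\<omega>^2\<close>.\<close>

lemma fsys_kappa:
  assumes "fsys \<omega> \<kappa> A Z Y P Q T hA hZ hY hP hQ hT"
  shows "\<kappa> = fps_nth hP N + of_real (\<omega>\<^sup>2) * fps_nth (XG * (A + fps_const rr * (fps_X ^ (2 * N + 2) * Y))) N"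
proof -
  have "fps_nth (fps_X * fps_deriv P + hP) N = fps_nth (of_nat N * P
       - fps_const (of_real (\<omega>\<^sup>2)) * (XG * (A + fps_const rr * (fps_X ^ (2 * N + 2) * Y))) + fps_const \<kappa> * fps_X ^ N) N"
    using assms by (simp add: fsys_def)
  then have "of_nat N * fps_nth P N + fps_nth hP N = of_nat N * fps_nth P N
       - of_real (\<omega>\<^sup>2) * fps_nth (XG * (A + fps_const rr * (fps_X ^ (2 * N + 2) * Y))) N + \<kappa>"
    unfolding fps_add_nth fps_sub_nth fps_X_deriv_nth fps_of_nat_mult_nth fps_mult_left_const_nth
    by (simp only: fps_X_power_nth if_True mult_1_right refl)
  then show ?thesis by (simp add: algebra_simps)
qed

text \<open>For solutions with zero boundary values nothing starts below the resonant order.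
  Inserted into \<open>fsys_kappa\<close>, this evaluates \<open>\<kappa>\<close> exactly for the
  two auxiliary solutions of the logarithmic construction.\<close>

lemma fsys_low_order_zero:
  assumes s: "fsys \<omega> \<kappa> A Z Y P Q T hA hZ hY hP hQ hT"
    and A0: "fps_nth A 0 = 0" "fps_nth Z 0 = 0" "fps_nth Y 0 = 0"
    and h: "\<And>m. m \<le> N \<Longrightarrow> fps_nth hA m = 0 \<and> fps_nth hZ m = 0 \<and> fps_nth hY m = 0 \<and> fps_nth hQ m = 0 \<and> fps_nth hT m = 0 \<and> (m < N \<longrightarrow> fps_nth hP m = 0)"
  shows "m \<le> N \<Longrightarrow> fps_nth A m = 0 \<and> fps_nth Z m = 0 \<and> fps_nth Y m = 0 \<and> fps_nth Q m = 0 \<and> fps_nth T m = 0 \<and> (m < N \<longrightarrow> fps_nth P m = 0)"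
proof (induction m rule: less_induct)
  case (less m)
  have XG0: "fps_nth (XG * U) m = 0" if "\<And>j. j < m \<Longrightarrow> fps_nth U j = 0" for U
    using fps_mult_nth_cong_below[of XG m U 0] that by simp
  have rX0: "fps_nth (fps_const rr * (fps_X ^ (2 * N + 2) * U)) j = 0" if "j < m" for U j
    unfolding fps_mult_left_const_nth fps_X_power_mult_nth using that less.prems by simp
  note h' = h[OF less.prems]
  note S = s[unfolded fsys_def]
  have eqs: "of_nat m * fps_nth A m + fps_nth hA m = fps_nth (XG * (P - fps_const rr * (fps_X ^ (2 * N + 2) * T))) m"
    "of_nat m * fps_nth Z m + fps_nth hZ m = fps_nth (XG * Q) m"
    "of_nat m * fps_nth Y m + fps_nth hY m = fps_nth (XG * T) m"
    using S unfolding fps_X_deriv_nth[symmetric] fps_add_nth[symmetric] by simp_all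
  have IH: "fps_nth A j = 0" "fps_nth Z j = 0" "fps_nth Y j = 0" "fps_nth P j = 0" "fps_nth Q j = 0" "fps_nth T j = 0" if "j < m" for j
    using less.IH[OF that] that less.prems by auto
  have a: "fps_nth A m = 0" "fps_nth Z m = 0" "fps_nth Y m = 0"
  proof -
    have "fps_nth (XG * (P - fps_const rr * (fps_X ^ (2 * N + 2) * T))) m = 0"
      by (rule XG0) (simp only: fps_sub_nth IH rX0 diff_zero)
    moreover have "fps_nth (XG * Q) m = 0" "fps_nth (XG * T) m = 0" by (rule XG0; simp add: IH)+
    ultimately show "fps_nth A m = 0" "fps_nth Z m = 0" "fps_nth Y m = 0"
      using eqs h' A0 by (cases "m = 0"; simp)+
  qed
  have B: "fps_nth (Bf A Z Y) m = 0" using a by (simp add: Bf_def)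
  have XB: "fps_nth (fps_X * Bf A Z Y) m = 0" using IH[of "m - 1"] by (simp add: Bf_def)
  have Zs: "fps_nth (XG * Z) m = 0" "fps_nth (XG * Y) m = 0" by (rule XG0; simp add: IH)+
  have "fps_nth (fps_X * fps_deriv Q + hQ) m = fps_nth (- of_nat (N + 3) * Q
       - fps_const (of_real (\<omega>\<^sup>2)) * (XG * Z) + fps_const (of_real ga) * Bf A Z Y) m"
    using S by simp
  then have "of_nat m * fps_nth Q m = - (of_nat (N + 3) * fps_nth Q m)"
    unfolding fps_add_nth fps_sub_nth fps_X_deriv_nth mult_minus_left fps_neg_nth fps_of_nat_mult_nth fps_mult_left_const_nth
      B Zs using h' by simp
  then have "of_nat (m + (N + 3)) * fps_nth Q m = 0" by (simp only: of_nat_add distrib_right) simp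
  moreover have "(of_nat (m + (N + 3)) :: complex) \<noteq> 0" by (unfold of_nat_eq_0_iff, simp)
  ultimately have Q: "fps_nth Q m = 0" using mult_eq_0_iff by blast
  have "fps_nth (fps_X * fps_deriv T + hT) m = fps_nth (- of_nat (N + 2) * T
       - fps_const (of_real (\<omega>\<^sup>2)) * (XG * Y) + fps_const (of_real c1) * (fps_X * Bf A Z Y)) m"
    using S by simp
  then have "of_nat m * fps_nth T m = - (of_nat (N + 2) * fps_nth T m)"
    unfolding fps_add_nth fps_sub_nth fps_X_deriv_nth mult_minus_left fps_neg_nth fps_of_nat_mult_nth fps_mult_left_const_nth
      XB Zs using h' by simp
  then have "of_nat (m + (N + 2)) * fps_nth T m = 0" by (simp only: of_nat_add distrib_right) simp
  moreover have "(of_nat (m + (N + 2)) :: complex) \<noteq> 0" by (unfold of_nat_eq_0_iff, simp)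
  ultimately have T: "fps_nth T m = 0" using mult_eq_0_iff by blast
  have "fps_nth P m = 0" if "m < N"
  proof -
    have AY: "fps_nth (XG * (A + fps_const rr * (fps_X ^ (2 * N + 2) * Y))) m = 0"
      by (rule XG0) (simp only: fps_add_nth IH rX0 add_0)
    have "fps_nth (fps_X * fps_deriv P + hP) m = fps_nth (of_nat N * P
       - fps_const (of_real (\<omega>\<^sup>2)) * (XG * (A + fps_const rr * (fps_X ^ (2 * N + 2) * Y))) + fps_const \<kappa> * fps_X ^ N) m"
      using S by simp
    then have "of_nat m * fps_nth P m = of_nat N * fps_nth P m"
      unfolding fps_add_nth fps_sub_nth fps_X_deriv_nth fps_of_nat_mult_nth fps_mult_left_const_nth AY
      using h' that by (simp add: fps_X_power_nth)
    then show ?thesis using that by auto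
  qed
  then show ?case using a Q T by blast
qed

end

section \<open>Logarithmic terms, and decay of fluxes of bounded functions\<close>

lemma conv_ge_mono: "conv_ge r U \<Longrightarrow> s \<le> r \<Longrightarrow> conv_ge s U"
  unfolding conv_ge_def by (meson ereal_less_eq(3) order_trans)

lemma ln_mult_ev_tendsto_0:
  assumes c: "conv_ge r U" and r: "0 < r" and U0: "fps_nth U 0 = 0"
  shows "((\<lambda>z. of_real (ln z) * ev U z) \<longlongrightarrow> 0) (at_right 0)"
proof (rule Lim_transform_eventually)
  have "((\<lambda>z. of_real (ln z ^ 1 * z) * ev (fps_shift 1 U) z) \<longlongrightarrow> of_real 0 * fps_nth (fps_shift 1 U) 0) (at_right 0)"
    using c r by (intro tendsto_mult tendsto_of_real tendsto_ln_power_mult_at_0 ev_tendsto_0[of r]) auto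
  then show "((\<lambda>z. of_real (ln z ^ 1 * z) * ev (fps_shift 1 U) z) \<longlongrightarrow> 0) (at_right 0)" by simp
  have U: "fps_shift 1 U * fps_X = U"
  proof (rule fps_ext)
    show "fps_nth (fps_shift 1 U * fps_X) n = fps_nth U n" for n
      using U0 by (cases n) simp_all
  qed
  have "ev U z = ev (fps_shift 1 U) z * of_real z" if "0 < z" "z < r" for z
    by (subst U[symmetric]) (use c that in \<open>simp add: ev_simps[OF that]\<close>)
  then show "\<forall>\<^sub>F z in at_right 0. of_real (ln z ^ 1 * z) * ev (fps_shift 1 U) z = of_real (ln z) * ev U z"
    using r by (intro eventually_at_rightI[of 0 r]) auto
qed

text \<open>The Euler operator applied to \<open>ln z\<close> times \<open>Us\<close> yields an
  extra \<open>Us\<close>. The triple is built to match this: \<open>Us\<close> solves the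
  homogeneous system, and \<open>U1\<close> the system with the series \<open>Us\<close> as
  inhomogeneity.\<close>

definition logcomb :: "complex \<Rightarrow> complex fps \<Rightarrow> complex fps \<Rightarrow> complex fps \<Rightarrow> real \<Rightarrow> complex" where
  "logcomb \<beta> U0 U1 Us z = ev U0 z + \<beta> * ev U1 z + \<beta> * (of_real (ln z) * ev Us z)"

definition logcomb' :: "complex \<Rightarrow> complex fps \<Rightarrow> complex fps \<Rightarrow> complex fps \<Rightarrow> real \<Rightarrow> complex" where
  "logcomb' \<beta> U0 U1 Us z = ev (fps_deriv U0) z + \<beta> * ev (fps_deriv U1) z
     + \<beta> * (of_real (ln z) * ev (fps_deriv Us) z + of_real (1 / z) * ev Us z)"

lemma logcomb_derivative:
  assumes "conv_ge r U0" "conv_ge r U1" "conv_ge r Us" "0 < z" "z < r"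
  shows "(logcomb \<beta> U0 U1 Us has_vector_derivative logcomb' \<beta> U0 U1 Us z) (at z)"
  unfolding logcomb_def logcomb'_def using assms
  by (intro has_vector_derivative_add has_vector_derivative_mult_right has_vector_derivative_mult
      has_vector_derivative_of_real ev_derivative[of r]) (auto intro!: derivative_eq_intros)

lemma z_logcomb':
  assumes "z > 0"
  shows "of_real z * logcomb' \<beta> U0 U1 Us z = of_real z * ev (fps_deriv U0) z
    + \<beta> * (of_real z * ev (fps_deriv U1) z + ev Us z) + \<beta> * (of_real (ln z) * (of_real z * ev (fps_deriv Us) z))"
  using assms by (simp add: logcomb'_def field_simps)

lemma logcomb_tendsto:
  assumes "conv_ge r U0" "conv_ge r U1" "conv_ge r Us" "0 < r" "fps_nth U1 0 = 0" "fps_nth Us 0 = 0"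
  shows "(logcomb \<beta> U0 U1 Us \<longlongrightarrow> fps_nth U0 0) (at_right 0)"
proof -
  have "(logcomb \<beta> U0 U1 Us \<longlongrightarrow> fps_nth U0 0 + \<beta> * fps_nth U1 0 + \<beta> * 0) (at_right 0)"
    unfolding logcomb_def using assms
    by (intro tendsto_add tendsto_mult tendsto_const ev_tendsto_0[of r] ln_mult_ev_tendsto_0[of r]) auto
  then show ?thesis using assms by simp
qed

text \<open>A flux \<open>P\<close> whose size at one point exceeded \<open>K y\<^sup>j\<^sup>+\<^sup>1\<close> would stay bounded away from \<open>0\<close>
  down to \<open>z = 0\<close>, and then \<open>h' \<sim> z\<^sup>-\<^sup>i\<close> would make \<open>h\<close> unbounded.\<close>

lemma bounded_potential_flux_le:
  fixes P P' h h' :: "real \<Rightarrow> complex" and f :: "real \<Rightarrow> real"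
  assumes "r \<le> 1" "i \<ge> 2" "K \<ge> 0"
    and f: "\<And>z. 0 < z \<Longrightarrow> z < r \<Longrightarrow> 0 < f z \<and> f z \<le> fm"
    and P: "\<And>z. 0 < z \<Longrightarrow> z < r \<Longrightarrow> (P has_vector_derivative P' z) (at z)"
    and P': "\<And>z. 0 < z \<Longrightarrow> z < r \<Longrightarrow> norm (P' z) \<le> K * z ^ j"
    and h: "\<And>z. 0 < z \<Longrightarrow> z < r \<Longrightarrow> (h has_vector_derivative h' z) (at z)"
    and Ph: "\<And>z. 0 < z \<Longrightarrow> z < r \<Longrightarrow> P z = of_real (z ^ i * f z) * h' z"
    and H: "\<And>z. 0 < z \<Longrightarrow> z < r \<Longrightarrow> norm (h z) \<le> H"
    and y: "0 < y" "y < r"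
  shows "norm (P y) \<le> K * y ^ (j + 1)"
proof (rule ccontr)
  assume neg: "\<not> norm (P y) \<le> K * y ^ (j + 1)"
  define \<delta> where "\<delta> = norm (P y) - K * y ^ (j + 1)"
  have \<delta>: "\<delta> > 0" using neg by (simp add: \<delta>_def)
  have fm: "fm > 0" using f[OF y] by simp
  have Py: "norm (P y) > 0" using neg \<open>K \<ge> 0\<close> y by (smt (verit) mult_nonneg_nonneg zero_le_power)
  \<comment> \<open>A unit factor that makes \<open>P y\<close> real and positive; below it,
    \<open>Re (u * P x)\<close> stays at least \<open>\<delta>\<close> all the way down to
    \<open>0\<close>.\<close>
  define u where "u = cnj (P y) / of_real (norm (P y))"
  have u1: "norm u = 1" using Py by (simp add: u_def norm_divide)
  have uP: "Re (u * P y) = norm (P y)"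
  proof -
    have "u * P y = of_real ((norm (P y))\<^sup>2 / norm (P y))"
      by (simp add: u_def complex_norm_square[symmetric] mult.commute flip: of_real_power)
    then show ?thesis using Py by (simp add: power2_eq_square)
  qed
  have H0: "H \<ge> 0" using order_trans[OF norm_ge_zero H[OF y]] .
  have low: "\<delta> \<le> Re (u * P x)" if x: "0 < x" "x \<le> y" for x
  proof -
    have "norm (P y - P x) \<le> K * y ^ (j + 1) - K * x ^ (j + 1)"
    proof (rule norm_diff_le_by_derivative[OF x(2)])
      fix t assume t: "x \<le> t" "t \<le> y"
      show "(P has_vector_derivative P' t) (at t)" using t x y by (intro P) auto
      show "((\<lambda>z. K * z ^ (j + 1)) has_real_derivative K * (real (j + 1) * t ^ j)) (at t)"
        by (rule cmult_power_derivative) simp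
      have "K * t ^ j \<le> K * (real (j + 1) * t ^ j)"
        using t x \<open>K \<ge> 0\<close> by (intro mult_left_mono) auto
      then show "norm (P' t) \<le> K * (real (j + 1) * t ^ j)" using P'[of t] t x y by simp
    qed
    also have "\<dots> \<le> K * y ^ (j + 1)" using x \<open>K \<ge> 0\<close> by simp
    finally have "Re (u * (P y - P x)) \<le> K * y ^ (j + 1)"
      using complex_Re_le_cmod[of "u * (P y - P x)"] by (simp add: norm_mult u1)
    moreover have "Re (u * (P y - P x)) = norm (P y) - Re (u * P x)"
      using uP by (simp add: right_diff_distrib)
    ultimately show ?thesis by (simp add: \<delta>_def)
  qed
  \<comment> \<open>Since \<open>Re (u * h')\<close> is at least
    \<open>\<delta> / (fm * x^2)\<close>, the function \<open>g\<close> is nondecreasing although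
    \<open>1 / x\<close> tends to infinity at \<open>0\<close>; so \<open>Re (u * h)\<close> has to
    tend to minus infinity there.\<close>
  define g where "g = (\<lambda>x. Re (u * h x) + \<delta> / fm * (1 / x))"
  have gd: "(g has_real_derivative Re (u * h' x) + \<delta> / fm * (- (1 / x ^ 2))) (at x)" if x: "0 < x" "x \<le> y" for x
  proof -
    have "((\<lambda>x. u * h x) has_vector_derivative u * h' x) (at x)"
      using x y by (intro has_vector_derivative_mult_right h) auto
    then have "((\<lambda>x. Re (u * h x)) has_real_derivative Re (u * h' x)) (at x)"
      by (auto simp: has_vector_derivative_complex_iff)
    moreover have "((\<lambda>x. 1 / x) has_real_derivative - (1 / x ^ 2)) (at x)"
      using x by (auto intro!: derivative_eq_intros simp: power2_eq_square)
    ultimately show ?thesis unfolding g_def by (intro DERIV_add DERIV_cmult)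
  qed
  have gpos: "0 \<le> Re (u * h' x) + \<delta> / fm * (- (1 / x ^ 2))" if x: "0 < x" "x \<le> y" for x
  proof -
    have xr: "0 < x" "x < r" using x y by auto
    have "u * P x = of_real (x ^ i * f x) * (u * h' x)" unfolding Ph[OF xr] by simp
    moreover have "Re (of_real c * v) = c * Re v" for c v by simp
    ultimately have "Re (u * P x) = x ^ i * f x * Re (u * h' x)" by (simp only:)
    then have 1: "\<delta> \<le> x ^ i * f x * Re (u * h' x)" using low[OF x] by simp
    have xi: "x ^ i * f x \<le> x ^ 2 * fm"
      using f[OF xr] xr \<open>r \<le> 1\<close> \<open>i \<ge> 2\<close> by (intro mult_mono power_decreasing) auto
    have "0 < x ^ i * f x" using f[OF xr] xr by simp
    then have "0 \<le> Re (u * h' x)" using 1 \<delta> by (smt (verit) mult_pos_neg)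
    then have "\<delta> \<le> x ^ 2 * fm * Re (u * h' x)" using 1 mult_right_mono[OF xi, of "Re (u * h' x)"] by linarith
    then have "\<delta> / fm * (1 / x ^ 2) \<le> Re (u * h' x)" using fm xr by (simp add: field_simps)
    then show ?thesis by simp
  qed
  have mono: "g x \<le> g y" if "0 < x" "x \<le> y" for x
  proof (rule DERIV_nonneg_imp_nondecreasing[OF that(2)])
    fix t assume "x \<le> t" "t \<le> y"
    then have t: "0 < t" "t \<le> y" using that by auto
    show "\<exists>D. (g has_real_derivative D) (at t) \<and> 0 \<le> D" using gd[OF t] gpos[OF t] by blast
  qed
  have hb: "\<bar>Re (u * h x)\<bar> \<le> H" if "0 < x" "x \<le> y" for x
    using abs_Re_le_cmod[of "u * h x"] H[of x] that y by (simp add: norm_mult u1)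
  define c where "c = \<delta> / fm"
  have c: "c > 0" using \<delta> fm by (simp add: c_def)
  \<comment> \<open>Chosen such that \<open>c / x\<close> exceeds \<open>2 * H + c / y\<close> by
    \<open>1\<close>, which contradicts monotonicity with \<open>norm h \<le> H\<close> at both
    points.\<close>
  define x where "x = c / (2 * H + c / y + 1)"
  have den: "2 * H + c / y + 1 > 0" using H0 c y by (intro add_nonneg_pos add_nonneg_nonneg) auto
  have x0: "x > 0" using c den by (simp add: x_def)
  have "c \<le> y * (2 * H + c / y + 1)" using H0 y c by (simp add: distrib_left)
  then have xy: "x \<le> y" unfolding x_def using den by (simp add: pos_divide_le_eq)
  have "c * (1 / x) = 2 * H + c / y + 1" unfolding x_def using c den by simp
  moreover have "Re (u * h x) + c * (1 / x) \<le> Re (u * h y) + c * (1 / y)"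
    using mono[OF x0 xy] by (simp only: g_def c_def)
  ultimately show False using hb[OF x0 xy] hb[of y] y by (simp add: abs_le_iff)
qed

section \<open>Solutions with prescribed boundary data and their uniqueness\<close>

context brane
begin

lemma F_near_0:
  obtains r where "0 < r" "r \<le> 1" "r \<le> z0 / 2" "\<And>z. 0 \<le> z \<Longrightarrow> z \<le> r \<Longrightarrow> 1 / 2 \<le> F z \<and> F z \<le> 2"
proof -
  have "isCont F 0" by (intro continuous_intros)
  then obtain d where d: "d > 0" "\<And>z. \<bar>z\<bar> < d \<Longrightarrow> \<bar>F z - 1\<bar> < 1 / 2"
    using iffD1[OF continuous_at_eps_delta, rule_format, of 0 F "1/2"] p0 by (auto simp: dist_real_def)
  show ?thesis
  proof (rule that[of "min 1 (min (z0 / 2) (d / 2))"])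
    fix z assume "0 \<le> z" "z \<le> min 1 (min (z0 / 2) (d / 2))"
    then show "1 / 2 \<le> F z \<and> F z \<le> 2" using d(2)[of z] d(1) by (auto simp: abs_if split: if_splits)
  qed (use z0 d in auto)
qed

text \<open>A log-free series with the prescribed data leaves an obstruction
  \<open>\<kappa>0\<close> at the resonance. It is removed by adding a multiple of a logarithmic
  solution with zero boundary values, whose obstruction is exactly \<open>1\<close>. As
  \<open>\<kappa>0\<close> is of order \<open>\<omega>^2\<close>, both the response coefficient and
  \<open>Pif\<close> at \<open>r / 2\<close> differ from \<open>lam\<close> by that order
  only.\<close>

lemma series_solution:
  assumes "rmax > 0"
  obtains r C where "0 < r" "r \<le> rmax" "r \<le> z0 / 2" "0 \<le> C"
    "\<And>\<omega> a0 \<zeta>0 \<xi>0 lam. \<bar>\<omega>\<bar> \<le> 1 \<Longrightarrow> \<exists>a \<zeta> \<xi> a' \<zeta>' \<xi>' V W. psol \<omega> r a \<zeta> \<xi> a' \<zeta>' \<xi>' \<and>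
      (a \<longlongrightarrow> a0) (at_right 0) \<and> (\<zeta> \<longlongrightarrow> \<zeta>0) (at_right 0) \<and> (\<xi> \<longlongrightarrow> \<xi>0) (at_right 0) \<and>
      conv_ge r V \<and> conv_ge r W \<and> (\<forall>z. 0 < z \<longrightarrow> z < r \<longrightarrow> a z = ev V z + of_real (ln z) * ev W z) \<and>
      fps_nth V 0 = a0 \<and>
      norm (of_nat (N + 1) * fps_nth V (N + 1) - lam) \<le> C * \<omega>\<^sup>2 * (norm a0 + norm \<zeta>0 + norm \<xi>0 + norm lam) \<and>
      norm (Pif a' \<xi>' (r / 2) - lam) \<le> C * \<omega>\<^sup>2 * (norm a0 + norm \<zeta>0 + norm \<xi>0 + norm lam)"
proof -
  obtain R CC where R: "1 \<le> R" and CC: "2 \<le> CC" and Gn: "\<And>n. norm (fps_nth G n) \<le> CC * R ^ n"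
    and Gm: "\<And>m D U. (\<And>j. j \<le> m \<Longrightarrow> norm (fps_nth U j) \<le> D * R ^ j) \<Longrightarrow> norm (fps_nth (G * U) m) \<le> CC * D * R ^ m"
    and solve: "\<And>\<omega> a0 \<zeta>0 \<xi>0 lam D hA hZ hY hP hQ hT. \<bar>\<omega>\<bar> \<le> 1 \<Longrightarrow>
      norm a0 \<le> D \<Longrightarrow> norm \<zeta>0 \<le> D \<Longrightarrow> norm \<xi>0 \<le> D \<Longrightarrow> norm lam \<le> D \<Longrightarrow>
      (\<And>m. norm (fps_nth hA m) \<le> D * R ^ m \<and> norm (fps_nth hZ m) \<le> D * R ^ m \<and> norm (fps_nth hY m) \<le> D * R ^ m \<and>
        norm (fps_nth hP m) \<le> D * R ^ m \<and> norm (fps_nth hQ m) \<le> D * R ^ m \<and> norm (fps_nth hT m) \<le> D * R ^ m) \<Longrightarrow>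
      fps_nth hA 0 = 0 \<Longrightarrow> fps_nth hZ 0 = 0 \<Longrightarrow> fps_nth hY 0 = 0 \<Longrightarrow>
      \<exists>\<kappa> A Z Y P Q T. fsys \<omega> \<kappa> A Z Y P Q T hA hZ hY hP hQ hT \<and>
        fps_nth A 0 = a0 \<and> fps_nth Z 0 = \<zeta>0 \<and> fps_nth Y 0 = \<xi>0 \<and> fps_nth P N = lam \<and>
        (\<forall>m. norm (fps_nth A m) \<le> CC * D * R ^ m \<and> norm (fps_nth Z m) \<le> CC * D * R ^ m \<and> norm (fps_nth Y m) \<le> CC * D * R ^ m \<and>
        norm (fps_nth P m) \<le> CC * D * R ^ m \<and> norm (fps_nth Q m) \<le> CC * D * R ^ m \<and> norm (fps_nth T m) \<le> CC * D * R ^ m)"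
    by (rule fsys_solvable) blast
  have R0: "R > 0" using R by simp
  define r where "r = min rmax (min (z0 / 2) (1 / (2 * R)))"
  have r: "0 < r" "r \<le> rmax" "r \<le> z0 / 2" "r \<le> 1 / (2 * R)" "r \<le> z0"
    using assms z0 R0 by (auto simp: r_def)
  have cg: "conv_ge r U" if "\<And>n. norm (fps_nth U n) \<le> K * R ^ n" for U K
    using conv_ge_mono[OF conv_ge_geometric[OF that R0] r(4)] .
  have cG: "conv_ge r G" using Gn by (rule cg)
  define K2 where "K2 = CC * ((1 + norm rr) * CC)"
  define K1 where "K1 = K2 * R ^ N"
  have K: "0 \<le> K1" "0 \<le> K2" unfolding K1_def K2_def using CC R0 by auto
  define Ca where "Ca = CC * K2 * R ^ N + real (N + 1) * (K1 * (CC * CC * R ^ (N + 1)))"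
  define Cb where "Cb = (2 * K2 + K1 * (2 * (CC * CC)) + K1 * (\<bar>ln (r / 2)\<bar> * (2 * CC))) / (r / 2) ^ N"
  have Cab: "0 \<le> Ca" "0 \<le> Cb" unfolding Ca_def Cb_def using K CC R0 r by auto
  define rX where "rX U = fps_const rr * (fps_X ^ (2 * N + 2) * U)" for U :: "complex fps"
  have rXY: "norm (fps_nth (A + rX Y) j) \<le> (1 + norm rr) * CC * D * R ^ j"
    if "\<And>m. norm (fps_nth A m) \<le> CC * D * R ^ m" "\<And>m. norm (fps_nth Y m) \<le> CC * D * R ^ m" for A Y j D
  proof -
    have D: "0 \<le> CC * D" using order_trans[OF norm_ge_zero that(1)[of 0]] by simp
    have "norm (fps_nth (fps_X ^ (2 * N + 2) * Y) j) \<le> CC * D * R ^ j"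
      using that R D by (intro norm_fps_X_power_mult_nth_le) auto
    then have "norm (fps_nth (rX Y) j) \<le> norm rr * (CC * D * R ^ j)"
      unfolding rX_def fps_mult_left_const_nth norm_mult by (intro mult_left_mono) auto
    then have "norm (fps_nth A j + fps_nth (rX Y) j) \<le> CC * D * R ^ j + norm rr * (CC * D * R ^ j)"
      using that by (intro norm_triangle_mono) auto
    then show ?thesis by (simp add: algebra_simps)
  qed
  have XGb: "norm (fps_nth (XG * (A + rX Y)) m) \<le> K2 * D * R ^ m"
    if "\<And>m. norm (fps_nth A m) \<le> CC * D * R ^ m" "\<And>m. norm (fps_nth Y m) \<le> CC * D * R ^ m" for A Y m D
  proof -
    have D: "0 \<le> CC * D" using order_trans[OF norm_ge_zero that(1)[of 0]] by simp
    have D': "0 \<le> CC * ((1 + norm rr) * CC * D)"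
      using mult_nonneg_nonneg[of "CC * (1 + norm rr)" "CC * D"] D CC by (simp add: mult_ac)
    have "norm (fps_nth (fps_X ^ 1 * (G * (A + rX Y))) m) \<le> CC * ((1 + norm rr) * CC * D) * R ^ m"
      by (intro norm_fps_X_power_mult_nth_le R Gm D' rXY that)
    then show ?thesis by (simp add: K2_def mult_ac)
  qed
  {
    fix \<omega> :: real and a0 \<zeta>0 \<xi>0 lam :: complex
    assume om: "\<bar>\<omega>\<bar> \<le> 1"
    define D where "D = norm a0 + norm \<zeta>0 + norm \<xi>0 + norm lam"
    have D: "norm a0 \<le> D" "norm \<zeta>0 \<le> D" "norm \<xi>0 \<le> D" "norm lam \<le> D" "0 \<le> D"
      by (auto simp: D_def)
    \<comment> \<open>The response mode: zero boundary values and \<open>1\<close> at the resonant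
      flux coefficient. All of its functions start above order \<open>N\<close>, so its own
      obstruction is \<open>0\<close>.\<close>
    have "\<exists>\<kappa> A Z Y P Q T. fsys \<omega> \<kappa> A Z Y P Q T 0 0 0 0 0 0 \<and>
        fps_nth A 0 = 0 \<and> fps_nth Z 0 = 0 \<and> fps_nth Y 0 = 0 \<and> fps_nth P N = 1 \<and>
        (\<forall>m. norm (fps_nth A m) \<le> CC * 1 * R ^ m \<and> norm (fps_nth Z m) \<le> CC * 1 * R ^ m \<and> norm (fps_nth Y m) \<le> CC * 1 * R ^ m \<and>
        norm (fps_nth P m) \<le> CC * 1 * R ^ m \<and> norm (fps_nth Q m) \<le> CC * 1 * R ^ m \<and> norm (fps_nth T m) \<le> CC * 1 * R ^ m)"
      using R0 by (intro solve om) auto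
    then obtain \<kappa>s As Zs Ys Ps Qs Ts where s: "fsys \<omega> \<kappa>s As Zs Ys Ps Qs Ts 0 0 0 0 0 0"
      and s0: "fps_nth As 0 = 0" "fps_nth Zs 0 = 0" "fps_nth Ys 0 = 0" "fps_nth Ps N = 1"
      and sb: "\<And>m. norm (fps_nth As m) \<le> CC * R ^ m" "\<And>m. norm (fps_nth Zs m) \<le> CC * R ^ m"
        "\<And>m. norm (fps_nth Ys m) \<le> CC * R ^ m" "\<And>m. norm (fps_nth Ps m) \<le> CC * R ^ m"
        "\<And>m. norm (fps_nth Qs m) \<le> CC * R ^ m" "\<And>m. norm (fps_nth Ts m) \<le> CC * R ^ m"
      by (simp only: mult_1_right) blast
    have sz: "fps_nth As m = 0 \<and> fps_nth Zs m = 0 \<and> fps_nth Ys m = 0 \<and> fps_nth Qs m = 0 \<and> fps_nth Ts m = 0 \<and> (m < N \<longrightarrow> fps_nth Ps m = 0)" if "m \<le> N" for m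
      by (rule fsys_low_order_zero[OF s s0(1-3) _ that]) simp
    have XG_low: "fps_nth (XG * (A + rX Y)) N = 0" if "\<And>j. j < N \<Longrightarrow> fps_nth A j = 0" for A Y
    proof -
      have "fps_nth (XG * (A + rX Y)) N = fps_nth (XG * 0) N"
      proof (rule fps_mult_nth_cong_below)
        fix j assume j: "j < N"
        show "fps_nth (A + rX Y) j = fps_nth 0 j"
          unfolding fps_add_nth rX_def fps_mult_left_const_nth fps_X_power_mult_nth using that j by simp
      qed simp
      then show ?thesis by simp
    qed
    have \<kappa>s: "\<kappa>s = 0"
      using fsys_kappa[OF s] XG_low[of As Ys] sz unfolding rX_def by simp
    \<comment> \<open>The companion of \<open>ln z\<close> times the response mode; the
      inhomogeneity comes from differentiating the logarithm. Its obstruction is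
      \<open>fps_nth Ps N = 1\<close>.\<close>
    have "\<exists>\<kappa> A Z Y P Q T. fsys \<omega> \<kappa> A Z Y P Q T As Zs Ys Ps Qs Ts \<and>
        fps_nth A 0 = 0 \<and> fps_nth Z 0 = 0 \<and> fps_nth Y 0 = 0 \<and> fps_nth P N = 0 \<and>
        (\<forall>m. norm (fps_nth A m) \<le> CC * CC * R ^ m \<and> norm (fps_nth Z m) \<le> CC * CC * R ^ m \<and> norm (fps_nth Y m) \<le> CC * CC * R ^ m \<and>
        norm (fps_nth P m) \<le> CC * CC * R ^ m \<and> norm (fps_nth Q m) \<le> CC * CC * R ^ m \<and> norm (fps_nth T m) \<le> CC * CC * R ^ m)"
      using CC sb by (intro solve om) (auto simp: s0)
    then obtain \<kappa>1 A1 Z1 Y1 P1 Q1 T1 where v1: "fsys \<omega> \<kappa>1 A1 Z1 Y1 P1 Q1 T1 As Zs Ys Ps Qs Ts"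
      and v10: "fps_nth A1 0 = 0" "fps_nth Z1 0 = 0" "fps_nth Y1 0 = 0"
      and v1b: "\<And>m. norm (fps_nth A1 m) \<le> CC * CC * R ^ m" "\<And>m. norm (fps_nth Z1 m) \<le> CC * CC * R ^ m"
        "\<And>m. norm (fps_nth Y1 m) \<le> CC * CC * R ^ m" "\<And>m. norm (fps_nth P1 m) \<le> CC * CC * R ^ m"
        "\<And>m. norm (fps_nth Q1 m) \<le> CC * CC * R ^ m" "\<And>m. norm (fps_nth T1 m) \<le> CC * CC * R ^ m"
      by blast
    have v1z: "fps_nth A1 m = 0" if "m \<le> N" for m
      using fsys_low_order_zero[OF v1 v10 sz that] by simp
    have \<kappa>1: "\<kappa>1 = 1"
      using fsys_kappa[OF v1] XG_low[of A1 Y1] v1z s0(4) unfolding rX_def by simp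
    have "\<exists>\<kappa> A Z Y P Q T. fsys \<omega> \<kappa> A Z Y P Q T 0 0 0 0 0 0 \<and>
        fps_nth A 0 = a0 \<and> fps_nth Z 0 = \<zeta>0 \<and> fps_nth Y 0 = \<xi>0 \<and> fps_nth P N = lam \<and>
        (\<forall>m. norm (fps_nth A m) \<le> CC * D * R ^ m \<and> norm (fps_nth Z m) \<le> CC * D * R ^ m \<and> norm (fps_nth Y m) \<le> CC * D * R ^ m \<and>
        norm (fps_nth P m) \<le> CC * D * R ^ m \<and> norm (fps_nth Q m) \<le> CC * D * R ^ m \<and> norm (fps_nth T m) \<le> CC * D * R ^ m)"
      using R0 D by (intro solve om) auto
    then obtain \<kappa>0 A0 Z0 Y0 P0 Q0 T0 where v0: "fsys \<omega> \<kappa>0 A0 Z0 Y0 P0 Q0 T0 0 0 0 0 0 0"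
      and v00: "fps_nth A0 0 = a0" "fps_nth Z0 0 = \<zeta>0" "fps_nth Y0 0 = \<xi>0" "fps_nth P0 N = lam"
      and v0b: "\<And>m. norm (fps_nth A0 m) \<le> CC * D * R ^ m" "\<And>m. norm (fps_nth Z0 m) \<le> CC * D * R ^ m"
        "\<And>m. norm (fps_nth Y0 m) \<le> CC * D * R ^ m" "\<And>m. norm (fps_nth P0 m) \<le> CC * D * R ^ m"
        "\<And>m. norm (fps_nth Q0 m) \<le> CC * D * R ^ m" "\<And>m. norm (fps_nth T0 m) \<le> CC * D * R ^ m"
      by blast
    \<comment> \<open>The total obstruction is
      \<open>\<kappa>0 + \<beta> * 1 + \<beta> * ln z * 0\<close>, which vanishes for this
      choice.\<close>
    define \<beta> where "\<beta> = - \<kappa>0"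
    have XG0: "norm (fps_nth (XG * (A0 + rX Y0)) m) \<le> K2 * D * R ^ m" for m
      by (rule XGb[OF v0b(1,3)])
    have \<beta>: "norm \<beta> \<le> \<omega>\<^sup>2 * (K1 * D)"
    proof -
      have "norm \<beta> = \<omega>\<^sup>2 * norm (fps_nth (XG * (A0 + rX Y0)) N)"
        using fsys_kappa[OF v0] unfolding \<beta>_def rX_def by (simp add: norm_mult norm_power)
      also have "\<dots> \<le> \<omega>\<^sup>2 * (K2 * D * R ^ N)" by (intro mult_left_mono XG0) simp
      finally show ?thesis by (simp add: K1_def mult_ac)
    qed
    have c: "conv_ge r A0" "conv_ge r Z0" "conv_ge r Y0" "conv_ge r P0" "conv_ge r Q0" "conv_ge r T0"
      "conv_ge r A1" "conv_ge r Z1" "conv_ge r Y1" "conv_ge r P1" "conv_ge r Q1" "conv_ge r T1"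
      "conv_ge r As" "conv_ge r Zs" "conv_ge r Ys" "conv_ge r Ps" "conv_ge r Qs" "conv_ge r Ts"
      by (rule cg, rule v0b v1b sb)+
    define a where "a = logcomb \<beta> A0 A1 As"
    define \<zeta> where "\<zeta> = logcomb \<beta> Z0 Z1 Zs"
    define \<xi> where "\<xi> = logcomb \<beta> Y0 Y1 Ys"
    define x where "x = logcomb \<beta> P0 P1 Ps"
    define y where "y = logcomb \<beta> Q0 Q1 Qs"
    define t where "t = logcomb \<beta> T0 T1 Ts"
    have lin1: "g * (p0 - rr * (W * t0)) + \<beta> * (g * (p1 - rr * (W * t1))) + \<beta> * (l * (g * (ps - rr * (W * ts))))
        = g * (p0 + \<beta> * p1 + \<beta> * (l * ps) - rr * (W * (t0 + \<beta> * t1 + \<beta> * (l * ts))))"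
      for g p0 p1 ps t0 t1 ts W l by (simp add: algebra_simps)
    have lin2: "g * p0 + \<beta> * (g * p1) + \<beta> * (l * (g * ps)) = g * (p0 + \<beta> * p1 + \<beta> * (l * ps))"
      for g p0 p1 ps l by (simp add: algebra_simps)
    have lin3: "n * p0 - w * (g * (u0 + rr * (W * y0))) + k * e
        + \<beta> * (n * p1 - w * (g * (u1 + rr * (W * y1))) + 1 * e)
        + \<beta> * (l * (n * ps - w * (g * (us + rr * (W * ys))) + 0 * e))
        = n * (p0 + \<beta> * p1 + \<beta> * (l * ps)) - w * (g * (u0 + \<beta> * u1 + \<beta> * (l * us) + rr * (W * (y0 + \<beta> * y1 + \<beta> * (l * ys)))))"
      if "k = - \<beta>" for n p0 p1 ps w g u0 u1 us W y0 y1 ys k e l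
      unfolding that by (simp add: algebra_simps)
    have lin4: "- n * p0 - w * (g * y0) + b * Bc u0 v0 w0
        + \<beta> * (- n * p1 - w * (g * y1) + b * Bc u1 v1 w1)
        + \<beta> * (l * (- n * ps - w * (g * ys) + b * Bc us vs ws))
        = - n * (p0 + \<beta> * p1 + \<beta> * (l * ps)) - w * (g * (y0 + \<beta> * y1 + \<beta> * (l * ys)))
          + b * Bc (u0 + \<beta> * u1 + \<beta> * (l * us)) (v0 + \<beta> * v1 + \<beta> * (l * vs)) (w0 + \<beta> * w1 + \<beta> * (l * ws))"
      for n p0 p1 ps w g y0 y1 ys b u0 u1 us v0 v1 vs w0 w1 ws l
      unfolding Bc_def by (simp add: algebra_simps)
    have lin5: "- n * p0 - w * (g * y0) + b * (z * Bc u0 v0 w0)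
        + \<beta> * (- n * p1 - w * (g * y1) + b * (z * Bc u1 v1 w1))
        + \<beta> * (l * (- n * ps - w * (g * ys) + b * (z * Bc us vs ws)))
        = - n * (p0 + \<beta> * p1 + \<beta> * (l * ps)) - w * (g * (y0 + \<beta> * y1 + \<beta> * (l * ys)))
          + b * (z * Bc (u0 + \<beta> * u1 + \<beta> * (l * us)) (v0 + \<beta> * v1 + \<beta> * (l * vs)) (w0 + \<beta> * w1 + \<beta> * (l * ws)))"
      for n p0 p1 ps w g y0 y1 ys b z u0 u1 us v0 v1 vs w0 w1 ws l
      unfolding Bc_def by (simp add: algebra_simps)
    have ev0: "ev 0 z = 0" for z by (simp add: ev_def)
    note defs = a_def \<zeta>_def \<xi>_def x_def y_def t_def logcomb_def
    {
      fix z assume z: "0 < z" "z < r"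
      note E0 = ev_fsys[OF v0 c(1-6) conv_ge_intros(9) conv_ge_intros(9) conv_ge_intros(9) conv_ge_intros(9) conv_ge_intros(9) conv_ge_intros(9) cG z r(5), unfolded ev0 add_0_right]
      note E1 = ev_fsys[OF v1 c(7-18) cG z r(5)]
      note Es = ev_fsys[OF s c(13-18) conv_ge_intros(9) conv_ge_intros(9) conv_ge_intros(9) conv_ge_intros(9) conv_ge_intros(9) conv_ge_intros(9) cG z r(5), unfolded ev0 add_0_right]
      have "complex_of_real z \<noteq> 0" using z by simp
      then have div: "u = v / of_real (F z)" if "of_real z * u = of_real z / of_real (F z) * v" for u v :: complex
        using that by (metis times_divide_eq_left times_divide_eq_right mult_left_cancel)
      have "logcomb' \<beta> A0 A1 As z = (x z - rr * (of_real (z ^ (2 * N + 2)) * t z)) / of_real (F z)"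
        by (rule div) (simp only: z_logcomb'[OF z(1)] E0 E1 Es defs lin1)
      moreover have "logcomb' \<beta> Z0 Z1 Zs z = y z / of_real (F z)"
        by (rule div) (simp only: z_logcomb'[OF z(1)] E0 E1 Es defs lin2)
      moreover have "logcomb' \<beta> Y0 Y1 Ys z = t z / of_real (F z)"
        by (rule div) (simp only: z_logcomb'[OF z(1)] E0 E1 Es defs lin2)
      moreover have "of_real z * logcomb' \<beta> P0 P1 Ps z = of_nat N * x z - of_real (\<omega>\<^sup>2) * (of_real z / of_real (F z) * (a z + rr * (of_real (z ^ (2 * N + 2)) * \<xi> z)))"
        unfolding z_logcomb'[OF z(1)] E0 E1 Es defs \<kappa>1 \<kappa>s by (rule lin3) (simp add: \<beta>_def)
      moreover have "of_real z * logcomb' \<beta> Q0 Q1 Qs z = - of_nat (N + 3) * y z - of_real (\<omega>\<^sup>2) * (of_real z / of_real (F z) * \<zeta> z) + of_real ga * Bc (a z) (\<zeta> z) (\<xi> z)"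
        unfolding z_logcomb'[OF z(1)] E0 E1 Es defs by (rule lin4)
      moreover have "of_real z * logcomb' \<beta> T0 T1 Ts z = - of_nat (N + 2) * t z - of_real (\<omega>\<^sup>2) * (of_real z / of_real (F z) * \<xi> z) + of_real c1 * (of_real z * Bc (a z) (\<zeta> z) (\<xi> z))"
        unfolding z_logcomb'[OF z(1)] E0 E1 Es defs by (rule lin5)
      ultimately have "logcomb' \<beta> A0 A1 As z = (x z - rr * (of_real (z ^ (2 * N + 2)) * t z)) / of_real (F z)"
        "logcomb' \<beta> Z0 Z1 Zs z = y z / of_real (F z)" "logcomb' \<beta> Y0 Y1 Ys z = t z / of_real (F z)"
        "of_real z * logcomb' \<beta> P0 P1 Ps z = of_nat N * x z - of_real (\<omega>\<^sup>2) * (of_real z / of_real (F z) * (a z + rr * (of_real (z ^ (2 * N + 2)) * \<xi> z)))"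
        "of_real z * logcomb' \<beta> Q0 Q1 Qs z = - of_nat (N + 3) * y z - of_real (\<omega>\<^sup>2) * (of_real z / of_real (F z) * \<zeta> z) + of_real ga * Bc (a z) (\<zeta> z) (\<xi> z)"
        "of_real z * logcomb' \<beta> T0 T1 Ts z = - of_nat (N + 2) * t z - of_real (\<omega>\<^sup>2) * (of_real z / of_real (F z) * \<xi> z) + of_real c1 * (of_real z * Bc (a z) (\<zeta> z) (\<xi> z))"
        by blast+
    } note eqs = this
    have da: "(a has_vector_derivative (x z - rr * (of_real (z ^ (2 * N + 2)) * t z)) / of_real (F z)) (at z)"
      "(\<zeta> has_vector_derivative y z / of_real (F z)) (at z)"
      "(\<xi> has_vector_derivative t z / of_real (F z)) (at z)"
      "(x has_vector_derivative logcomb' \<beta> P0 P1 Ps z) (at z)"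
      "(y has_vector_derivative logcomb' \<beta> Q0 Q1 Qs z) (at z)"
      "(t has_vector_derivative logcomb' \<beta> T0 T1 Ts z) (at z)" if "0 < z" "z < r" for z
      using logcomb_derivative[OF c(1,7,13) that, of \<beta>] logcomb_derivative[OF c(2,8,14) that, of \<beta>]
        logcomb_derivative[OF c(3,9,15) that, of \<beta>] logcomb_derivative[OF c(4,10,16) that, of \<beta>]
        logcomb_derivative[OF c(5,11,17) that, of \<beta>] logcomb_derivative[OF c(6,12,18) that, of \<beta>]
      unfolding eqs(1-3)[OF that] a_def[symmetric] \<zeta>_def[symmetric] \<xi>_def[symmetric] x_def[symmetric] y_def[symmetric] t_def[symmetric] .
    define a' where "a' = (\<lambda>z. (x z - rr * (of_real (z ^ (2 * N + 2)) * t z)) / of_real (F z))"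
    define \<zeta>' where "\<zeta>' = (\<lambda>z. y z / of_real (F z))"
    define \<xi>' where "\<xi>' = (\<lambda>z. t z / of_real (F z))"
    have ps: "psol \<omega> r a \<zeta> \<xi> a' \<zeta>' \<xi>'"
      unfolding a'_def \<zeta>'_def \<xi>'_def
      by (rule psol_of_first_order(1)[OF r(5) da eqs(4-6)])
    have Pi: "Pif a' \<xi>' z = x z / of_real (z ^ N)" if "0 < z" "z < r" for z
      unfolding a'_def \<xi>'_def
      by (rule psol_of_first_order(2)[OF r(5) da eqs(4-6) that])
    have lim: "(a \<longlongrightarrow> a0) (at_right 0)" "(\<zeta> \<longlongrightarrow> \<zeta>0) (at_right 0)" "(\<xi> \<longlongrightarrow> \<xi>0) (at_right 0)"
      unfolding a_def \<zeta>_def \<xi>_def v00(1-3)[symmetric]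
      by (rule logcomb_tendsto[OF c(1,7,13) r(1) v10(1) s0(1)], rule logcomb_tendsto[OF c(2,8,14) r(1) v10(2) s0(2)],
          rule logcomb_tendsto[OF c(3,9,15) r(1) v10(3) s0(3)])
    define V where "V = A0 + fps_const \<beta> * A1"
    define W where "W = fps_const \<beta> * As"
    have cVW: "conv_ge r V" "conv_ge r W" using c by (auto simp: V_def W_def)
    have aVW: "a z = ev V z + of_real (ln z) * ev W z" if "0 < z" "z < r" for z
      unfolding a_def logcomb_def V_def W_def using c by (simp add: ev_simps[OF that])
    have V0: "fps_nth V 0 = a0" by (simp add: V_def v00 v10)
    \<comment> \<open>The flux series minus its resonant term. At every other order
      \<open>(m - N)\<close> times the coefficient of \<open>P0\<close> equals the
      \<open>\<omega>^2\<close> term, so all coefficients of \<open>U\<close> are of that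
      order.\<close>
    define U where "U = P0 - fps_const lam * fps_X ^ N"
    have Ub: "norm (fps_nth U m) \<le> \<omega>\<^sup>2 * (K2 * D) * R ^ m" for m
    proof (cases "m = N")
      case True
      then show ?thesis using K D(5) R0 by (simp add: U_def v00)
    next
      case False
      have "fps_nth (fps_X * fps_deriv P0 + 0) m = fps_nth (of_nat N * P0
         - fps_const (of_real (\<omega>\<^sup>2)) * (XG * (A0 + rX Y0)) + fps_const \<kappa>0 * fps_X ^ N) m"
        using v0 unfolding fsys_def rX_def by simp
      then have "of_nat m * fps_nth P0 m = of_nat N * fps_nth P0 m - of_real (\<omega>\<^sup>2) * fps_nth (XG * (A0 + rX Y0)) m"
        unfolding fps_add_nth fps_sub_nth fps_X_deriv_nth fps_of_nat_mult_nth fps_mult_left_const_nth fps_X_power_nth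
        using False by simp
      then have "(of_nat m - of_nat N) * fps_nth P0 m = - (of_real (\<omega>\<^sup>2) * fps_nth (XG * (A0 + rX Y0)) m)"
        by (simp only: left_diff_distrib) simp
      then have "norm ((of_nat m - of_nat N) * fps_nth P0 m) = \<omega>\<^sup>2 * norm (fps_nth (XG * (A0 + rX Y0)) m)"
        by (simp only: norm_minus_cancel norm_mult norm_of_real) simp
      also have "\<dots> \<le> \<omega>\<^sup>2 * (K2 * D * R ^ m)" by (intro mult_left_mono XG0) simp
      finally have 1: "norm (of_nat m - of_nat N :: complex) * norm (fps_nth P0 m) \<le> \<omega>\<^sup>2 * (K2 * D) * R ^ m"
        by (simp add: norm_mult mult_ac)
      have "norm (of_nat m - of_nat N :: complex) = \<bar>real m - real N\<bar>"
        by (metis norm_of_real of_real_diff of_real_of_nat_eq)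
      then have "1 \<le> norm (of_nat m - of_nat N :: complex)" using False by linarith
      then have "1 * norm (fps_nth P0 m) \<le> norm (of_nat m - of_nat N :: complex) * norm (fps_nth P0 m)"
        by (intro mult_right_mono) auto
      then have "norm (fps_nth P0 m) \<le> \<omega>\<^sup>2 * (K2 * D) * R ^ m" using 1 by simp
      then show ?thesis using False by (simp add: U_def)
    qed
    have P0U: "P0 = U + fps_const lam * fps_X ^ N" by (simp add: U_def)
    \<comment> \<open>Order \<open>N + 1\<close> of the first equation. As \<open>G\<close> has
      constant term \<open>1\<close>, the resonant term contributes exactly \<open>lam\<close>; the
      \<xi> flux is shifted by \<open>2 * N + 2\<close> orders and does not contribute.\<close>
    have coeffN: "norm (of_nat (N + 1) * fps_nth V (N + 1) - lam) \<le> Ca * \<omega>\<^sup>2 * D"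
    proof -
      have "of_nat (N + 1) * fps_nth A0 (N + 1) = fps_nth (XG * (P0 - rX T0)) (N + 1)"
        using v0 unfolding fsys_def rX_def fps_X_deriv_nth[symmetric] by (simp only: add_0_right) 
      also have "\<dots> = fps_nth (G * (P0 - rX T0)) N" by (simp add: mult.assoc)
      also have "G * (P0 - rX T0) = G * U + fps_const lam * (fps_X ^ N * G) - fps_const rr * (fps_X ^ (2 * N + 2) * (G * T0))"
        unfolding P0U rX_def by (simp add: algebra_simps)
      also have "fps_nth \<dots> N = fps_nth (G * U) N + lam"
        unfolding fps_sub_nth fps_add_nth fps_mult_left_const_nth fps_X_power_mult_nth by (simp add: G_0)
      finally have 1: "of_nat (N + 1) * fps_nth V (N + 1) - lam = fps_nth (G * U) N + of_nat (N + 1) * (\<beta> * fps_nth A1 (N + 1))"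
        by (simp only: V_def fps_add_nth fps_mult_left_const_nth distrib_left) simp
      have 2: "norm (fps_nth (G * U) N) \<le> CC * (\<omega>\<^sup>2 * (K2 * D)) * R ^ N" by (rule Gm[OF Ub])
      have "norm (\<beta> * fps_nth A1 (N + 1)) \<le> \<omega>\<^sup>2 * (K1 * D) * (CC * CC * R ^ (N + 1))"
        unfolding norm_mult by (rule mult_mono[OF \<beta> v1b(1)]) (use K D in auto)
      then have 3: "norm (of_nat (N + 1) * (\<beta> * fps_nth A1 (N + 1))) \<le> real (N + 1) * (\<omega>\<^sup>2 * (K1 * D) * (CC * CC * R ^ (N + 1)))"
        unfolding norm_mult[of "of_nat (N + 1)"] norm_of_nat by (rule mult_left_mono) simp
      have "norm (fps_nth (G * U) N + of_nat (N + 1) * (\<beta> * fps_nth A1 (N + 1))) \<le>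
        CC * (\<omega>\<^sup>2 * (K2 * D)) * R ^ N + real (N + 1) * (\<omega>\<^sup>2 * (K1 * D) * (CC * CC * R ^ (N + 1)))"
        by (rule norm_triangle_mono[OF 2 3])
      also have "\<dots> = Ca * \<omega>\<^sup>2 * D" unfolding Ca_def by (simp add: algebra_simps)
      finally show ?thesis unfolding 1 .
    qed
    have Pir: "norm (Pif a' \<xi>' (r / 2) - lam) \<le> Cb * \<omega>\<^sup>2 * D"
    proof -
      define z where "z = r / 2"
      have z: "0 < z" "z < r" using r by (auto simp: z_def)
      have zR: "2 * R * z \<le> 1" using r(4) R0 z(1) unfolding z_def by (simp add: field_simps)
      have cU: "conv_ge r U" by (rule cg[OF Ub])
      have "ev P0 z = ev U z + lam * of_real (z ^ N)"
        unfolding P0U using cU by (simp add: ev_simps[OF z] del: of_real_power)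
      then have xz: "x z - lam * of_real (z ^ N) = ev U z + \<beta> * ev P1 z + \<beta> * (of_real (ln z) * ev Ps z)"
        by (simp add: x_def logcomb_def)
      have 1: "norm (ev U z) \<le> 2 * (\<omega>\<^sup>2 * (K2 * D))" by (rule norm_ev_le[OF Ub R0 z(1) zR])
      have "norm (ev P1 z) \<le> 2 * (CC * CC)" by (rule norm_ev_le[OF v1b(4) R0 z(1) zR])
      then have 2: "norm (\<beta> * ev P1 z) \<le> \<omega>\<^sup>2 * (K1 * D) * (2 * (CC * CC))"
        unfolding norm_mult by (intro mult_mono \<beta>) (use K D in auto)
      have "norm (ev Ps z) \<le> 2 * CC" by (rule norm_ev_le[OF sb(4) R0 z(1) zR])
      then have "norm (of_real (ln z) * ev Ps z) \<le> \<bar>ln z\<bar> * (2 * CC)"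
        unfolding norm_mult norm_of_real by (intro mult_left_mono) auto
      then have 3: "norm (\<beta> * (of_real (ln z) * ev Ps z)) \<le> \<omega>\<^sup>2 * (K1 * D) * (\<bar>ln z\<bar> * (2 * CC))"
        unfolding norm_mult[of \<beta>] by (intro mult_mono \<beta>) (use K D in auto)
      have "norm (x z - lam * of_real (z ^ N)) \<le> 2 * (\<omega>\<^sup>2 * (K2 * D)) + \<omega>\<^sup>2 * (K1 * D) * (2 * (CC * CC)) + \<omega>\<^sup>2 * (K1 * D) * (\<bar>ln z\<bar> * (2 * CC))"
        unfolding xz by (intro norm_triangle_mono 1 2 3)
      also have "\<dots> = Cb * \<omega>\<^sup>2 * D * z ^ N"
        unfolding Cb_def z_def[symmetric] using z by (simp add: field_simps)
      finally have 4: "norm (x z - lam * of_real (z ^ N)) / z ^ N \<le> Cb * \<omega>\<^sup>2 * D"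
        using z by (simp add: pos_divide_le_eq)
      have "Pif a' \<xi>' z - lam = (x z - lam * of_real (z ^ N)) / of_real (z ^ N)"
        unfolding Pi[OF z] using z by (simp add: field_simps)
      then have "norm (Pif a' \<xi>' z - lam) = norm (x z - lam * of_real (z ^ N)) / z ^ N"
        using z by (simp only: norm_divide norm_of_real) simp
      then show ?thesis using 4 by (simp only: z_def)
    qed
    have "Ca * \<omega>\<^sup>2 * D \<le> (Ca + Cb) * \<omega>\<^sup>2 * D" "Cb * \<omega>\<^sup>2 * D \<le> (Ca + Cb) * \<omega>\<^sup>2 * D"
      using Cab D(5) by (auto intro!: mult_right_mono)
    then have "norm (of_nat (N + 1) * fps_nth V (N + 1) - lam) \<le> (Ca + Cb) * \<omega>\<^sup>2 * D"
      "norm (Pif a' \<xi>' (r / 2) - lam) \<le> (Ca + Cb) * \<omega>\<^sup>2 * D"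
      using coeffN Pir by linarith+
    then have "\<exists>a \<zeta> \<xi> a' \<zeta>' \<xi>' V W. psol \<omega> r a \<zeta> \<xi> a' \<zeta>' \<xi>' \<and>
      (a \<longlongrightarrow> a0) (at_right 0) \<and> (\<zeta> \<longlongrightarrow> \<zeta>0) (at_right 0) \<and> (\<xi> \<longlongrightarrow> \<xi>0) (at_right 0) \<and>
      conv_ge r V \<and> conv_ge r W \<and> (\<forall>z. 0 < z \<longrightarrow> z < r \<longrightarrow> a z = ev V z + of_real (ln z) * ev W z) \<and>
      fps_nth V 0 = a0 \<and>
      norm (of_nat (N + 1) * fps_nth V (N + 1) - lam) \<le> (Ca + Cb) * \<omega>\<^sup>2 * (norm a0 + norm \<zeta>0 + norm \<xi>0 + norm lam) \<and>
      norm (Pif a' \<xi>' (r / 2) - lam) \<le> (Ca + Cb) * \<omega>\<^sup>2 * (norm a0 + norm \<zeta>0 + norm \<xi>0 + norm lam)"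
      unfolding D_def[symmetric] using ps lim cVW aVW V0 by blast
  }
  note solution = this
  show ?thesis by (rule that[OF r(1-3) _ solution]) (use Cab in auto)
qed

section \<open>Linearity, decay of the scalar fluxes and uniqueness at the boundary\<close>

lemma Bc_lin: "Bc (x - c * x') (y - c * y') (w - c * w') = Bc x y w - c * Bc x' y' w'"
  by (simp add: Bc_def algebra_simps)

lemma comp_lin:
  assumes "comp \<omega> \<kappa> s S r f f'" "comp \<omega> \<kappa> s T r g g'"
  shows "comp \<omega> \<kappa> s (\<lambda>z. S z - c * T z) r (\<lambda>z. f z - c * g z) (\<lambda>z. f' z - c * g' z)"
  unfolding comp_def
proof (intro allI impI conjI)
  fix z assume z: "0 < z" "z < r"
  have f: "(f has_vector_derivative f' z) (at z)" "((\<lambda>z. of_real (\<kappa> z * F z) * f' z) has_vector_derivative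
        - of_real (\<omega>\<^sup>2 * \<kappa> z / F z) * f z + s * of_real (z ^ (N + 2)) * S z) (at z)"
    and g: "(g has_vector_derivative g' z) (at z)" "((\<lambda>z. of_real (\<kappa> z * F z) * g' z) has_vector_derivative
        - of_real (\<omega>\<^sup>2 * \<kappa> z / F z) * g z + s * of_real (z ^ (N + 2)) * T z) (at z)"
    using assms z unfolding comp_def by blast+
  show "((\<lambda>z. f z - c * g z) has_vector_derivative f' z - c * g' z) (at z)"
    by (intro has_vector_derivative_diff has_vector_derivative_mult_right f g)
  have eq: "(\<lambda>z. of_real (\<kappa> z * F z) * (f' z - c * g' z)) =
      (\<lambda>z. of_real (\<kappa> z * F z) * f' z - c * (of_real (\<kappa> z * F z) * g' z))"
    by (simp only: right_diff_distrib mult.left_commute)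
  have "((\<lambda>z. of_real (\<kappa> z * F z) * f' z - c * (of_real (\<kappa> z * F z) * g' z)) has_vector_derivative
       (- of_real (\<omega>\<^sup>2 * \<kappa> z / F z) * f z + s * of_real (z ^ (N + 2)) * S z)
       - c * (- of_real (\<omega>\<^sup>2 * \<kappa> z / F z) * g z + s * of_real (z ^ (N + 2)) * T z)) (at z)"
    by (intro has_vector_derivative_diff has_vector_derivative_mult_right f g)
  moreover have lin: "(- k * x + s * w * u) - c * (- k * y + s * w * v) = - k * (x - c * y) + s * w * (u - c * v)"
    for k x y w u v by (simp add: algebra_simps)
  ultimately show "((\<lambda>z. of_real (\<kappa> z * F z) * (f' z - c * g' z)) has_vector_derivative
        - of_real (\<omega>\<^sup>2 * \<kappa> z / F z) * (f z - c * g z) + s * of_real (z ^ (N + 2)) * (S z - c * T z)) (at z)"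
    unfolding eq by (elim has_vector_derivative_eq_rhs) (rule lin)
qed

lemma psol_lin:
  assumes "psol \<omega> r a \<zeta> \<xi> a' \<zeta>' \<xi>'" "psol \<omega> r u v w u' v' w'"
  shows "psol \<omega> r (\<lambda>z. a z - c * u z) (\<lambda>z. \<zeta> z - c * v z) (\<lambda>z. \<xi> z - c * w z)
     (\<lambda>z. a' z - c * u' z) (\<lambda>z. \<zeta>' z - c * v' z) (\<lambda>z. \<xi>' z - c * w' z)"
  using assms unfolding psol_def Bc_lin by (intro conjI comp_lin) auto

lemma Pif_lin: "Pif (\<lambda>z. a' z - c * u' z) (\<lambda>z. \<xi>' z - c * w' z) z = Pif a' \<xi>' z - c * Pif u' w' z"
proof -
  have "k * (x - c * u) + rr * (m * (y - c * w)) = (k * x + rr * (m * y)) - c * (k * u + rr * (m * w))"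
    for k x u m y w by (simp add: algebra_simps)
  then show ?thesis unfolding Pif_def .
qed

lemma comp_mono: "comp \<omega> \<kappa> s S r f f' \<Longrightarrow> r' \<le> r \<Longrightarrow> comp \<omega> \<kappa> s S r' f f'"
  unfolding comp_def by auto

lemma psol_mono: "psol \<omega> r a \<zeta> \<xi> a' \<zeta>' \<xi>' \<Longrightarrow> r' \<le> r \<Longrightarrow> psol \<omega> r' a \<zeta> \<xi> a' \<zeta>' \<xi>'"
  unfolding psol_def using comp_mono by blast

lemma psol_D:
  assumes "psol \<omega> r a \<zeta> \<xi> a' \<zeta>' \<xi>'" "0 < z" "z < r"
  shows "(a has_vector_derivative a' z) (at z)" "(\<zeta> has_vector_derivative \<zeta>' z) (at z)" "(\<xi> has_vector_derivative \<xi>' z) (at z)"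
    "((\<lambda>z. of_real (1 / z ^ N * F z) * a' z) has_vector_derivative
        - of_real (\<omega>\<^sup>2 * (1 / z ^ N) / F z) * a z + - \<i> * of_real q * of_real (z ^ (N + 2)) * Bc (a z) (\<zeta> z) (\<xi> z)) (at z)"
    "((\<lambda>z. of_real (z ^ (N + 3) * F z) * \<zeta>' z) has_vector_derivative
        - of_real (\<omega>\<^sup>2 * z ^ (N + 3) / F z) * \<zeta> z + of_real ga * of_real (z ^ (N + 2)) * Bc (a z) (\<zeta> z) (\<xi> z)) (at z)"
    "((\<lambda>z. of_real (z ^ (N + 2) * F z) * \<xi>' z) has_vector_derivative
        - of_real (\<omega>\<^sup>2 * z ^ (N + 2) / F z) * \<xi> z + of_real c1 * of_real (z ^ (N + 2)) * Bc (a z) (\<zeta> z) (\<xi> z)) (at z)"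
  using assms unfolding psol_def comp_def by blast+

lemma Pif_derivative:
  assumes "psol \<omega> r a \<zeta> \<xi> a' \<zeta>' \<xi>'" "0 < z" "z < r"
  shows "(Pif a' \<xi>' has_vector_derivative
    - of_real (\<omega>\<^sup>2 / F z) * (of_real (1 / z ^ N) * a z + rr * (of_real (z ^ (N + 2)) * \<xi> z))) (at z)"
proof -
  have "(Pif a' \<xi>' has_vector_derivative
     (- of_real (\<omega>\<^sup>2 * (1 / z ^ N) / F z) * a z + - \<i> * of_real q * of_real (z ^ (N + 2)) * Bc (a z) (\<zeta> z) (\<xi> z))
     + rr * (- of_real (\<omega>\<^sup>2 * z ^ (N + 2) / F z) * \<xi> z + of_real c1 * of_real (z ^ (N + 2)) * Bc (a z) (\<zeta> z) (\<xi> z))) (at z)"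
    unfolding Pif_def by (intro has_vector_derivative_add has_vector_derivative_mult_right psol_D[OF assms])
  moreover have 2: "- \<i> * of_real q = - (rr * of_real c1)" by (simp add: rr_c1)
  ultimately show ?thesis unfolding 2
    by (elim has_vector_derivative_eq_rhs) (simp add: algebra_simps)
qed

text \<open>Boundedness excludes the singular scalar modes: by
  \<open>bounded_potential_flux_le\<close> both weighted fluxes are of order
  \<open>z ^ (N + 3)\<close>. After division by the weights the derivatives of \<zeta> and \<xi> are
  bounded up to \<open>0\<close>.\<close>

lemma psol_flux_decay:
  assumes ps: "psol \<omega> r a \<zeta> \<xi> a' \<zeta>' \<xi>'" and om: "\<bar>\<omega>\<bar> \<le> 1" and r: "r \<le> 1"
    and F: "\<And>z. 0 < z \<Longrightarrow> z < r \<Longrightarrow> 1 / 2 \<le> F z \<and> F z \<le> 2"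
    and S: "\<And>z. 0 < z \<Longrightarrow> z < r \<Longrightarrow> norm (a z) \<le> S \<and> norm (\<zeta> z) \<le> S \<and> norm (\<xi> z) \<le> S"
    and z: "0 < z" "z < r"
  shows "norm (\<zeta>' z) \<le> 2 * ((2 + (\<bar>ga\<bar> + \<bar>c1\<bar>) * KB) * S)" "norm (\<xi>' z) \<le> 2 * ((2 + (\<bar>ga\<bar> + \<bar>c1\<bar>) * KB) * S)"
    "norm (of_real (z ^ (N + 2) * F z) * \<xi>' z) \<le> (2 + (\<bar>ga\<bar> + \<bar>c1\<bar>) * KB) * S"
proof -
  define K where "K = (2 + (\<bar>ga\<bar> + \<bar>c1\<bar>) * KB) * S"
  have S0: "S \<ge> 0" using S[OF z] norm_ge_zero order_trans by blast
  have om2: "\<omega>\<^sup>2 \<le> 1" using om by (simp add: abs_square_le_1)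
  have K: "K \<ge> 0" unfolding K_def using S0 KB_nonneg by simp
  have bound: "norm (- of_real (\<omega>\<^sup>2 * t ^ i / F t) * x + of_real g * of_real (t ^ (N + 2)) * Bc (a t) (\<zeta> t) (\<xi> t)) \<le> K * t ^ (N + 2)"
    if "0 < t" "t < r" "i \<ge> N + 2" "norm x \<le> S" "\<bar>g\<bar> \<le> \<bar>ga\<bar> + \<bar>c1\<bar>" for t i x and g :: real
  proof -
    have t: "0 < t" "t < 1" using that r by auto
    have Ft: "1 / 2 \<le> F t" using F that by blast
    have "\<omega>\<^sup>2 * t ^ i / F t \<le> 1 * t ^ (N + 2) / (1 / 2)"
      using om2 t that(3) Ft by (intro frac_le mult_mono power_decreasing) auto
    then have "norm (- of_real (\<omega>\<^sup>2 * t ^ i / F t) * x) \<le> 2 * t ^ (N + 2) * S"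
      unfolding norm_mult norm_minus_cancel norm_of_real using t Ft that(4)
      by (intro mult_mono) (auto simp: abs_mult)
    moreover have "norm (of_real g * of_real (t ^ (N + 2)) * Bc (a t) (\<zeta> t) (\<xi> t)) \<le> (\<bar>ga\<bar> + \<bar>c1\<bar>) * t ^ (N + 2) * (KB * S)"
      unfolding norm_mult norm_of_real using t that S[OF that(1,2)] KB_nonneg S0
      by (intro mult_mono norm_Bc_le) (auto simp: abs_mult)
    ultimately have "norm (- of_real (\<omega>\<^sup>2 * t ^ i / F t) * x + of_real g * of_real (t ^ (N + 2)) * Bc (a t) (\<zeta> t) (\<xi> t))
      \<le> 2 * t ^ (N + 2) * S + (\<bar>ga\<bar> + \<bar>c1\<bar>) * t ^ (N + 2) * (KB * S)" by (rule norm_triangle_mono)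
    then show ?thesis by (simp add: K_def algebra_simps)
  qed
  have Fp: "0 < F t \<and> F t \<le> 2" if "0 < t" "t < r" for t using F[OF that] by linarith
  have z3: "z ^ (N + 2 + 1) \<le> z ^ (N + 2)" using z r by (intro power_decreasing) auto
  have Fz: "1 / 2 \<le> F z" using F z by blast
  have 1: "norm (of_real (z ^ (N + 3) * F z) * \<zeta>' z) \<le> K * z ^ (N + 2 + 1)"
    by (rule bounded_potential_flux_le[OF r _ K Fp psol_D(5)[OF ps] bound psol_D(2)[OF ps] refl _ z]) (use S in auto)
  then have "z ^ (N + 3) * (F z * norm (\<zeta>' z)) \<le> z ^ (N + 3) * K"
    using z Fz by (simp only: norm_mult norm_of_real) (simp add: eval_nat_numeral mult_ac)
  then have "F z * norm (\<zeta>' z) \<le> K" using z by simp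
  moreover have "1 / 2 * norm (\<zeta>' z) \<le> F z * norm (\<zeta>' z)" using Fz by (intro mult_right_mono) auto
  ultimately show "norm (\<zeta>' z) \<le> 2 * ((2 + (\<bar>ga\<bar> + \<bar>c1\<bar>) * KB) * S)" unfolding K_def by linarith
  have 2: "norm (of_real (z ^ (N + 2) * F z) * \<xi>' z) \<le> K * z ^ (N + 2 + 1)"
    by (rule bounded_potential_flux_le[OF r _ K Fp psol_D(6)[OF ps] bound psol_D(3)[OF ps] refl _ z]) (use S in auto)
  have "K * z ^ (N + 2 + 1) \<le> K * 1" using z r K by (intro mult_left_mono power_le_one) auto
  then show "norm (of_real (z ^ (N + 2) * F z) * \<xi>' z) \<le> (2 + (\<bar>ga\<bar> + \<bar>c1\<bar>) * KB) * S"
    using 2 unfolding K_def by linarith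
  have "K * z ^ (N + 2 + 1) \<le> K * z ^ (N + 2)" using z3 K by (intro mult_left_mono) auto
  then have "norm (of_real (z ^ (N + 2) * F z) * \<xi>' z) \<le> K * z ^ (N + 2)" using 2 by linarith
  then have "z ^ (N + 2) * (F z * norm (\<xi>' z)) \<le> z ^ (N + 2) * K"
    using z Fz by (simp only: norm_mult norm_of_real) (simp add: abs_mult mult_ac)
  then have "F z * norm (\<xi>' z) \<le> K" using z by simp
  moreover have "1 / 2 * norm (\<xi>' z) \<le> F z * norm (\<xi>' z)" using Fz by (intro mult_right_mono) auto
  ultimately show "norm (\<xi>' z) \<le> 2 * ((2 + (\<bar>ga\<bar> + \<bar>c1\<bar>) * KB) * S)" unfolding K_def by linarith
qed

lemma norm_le_of_tendsto_0:
  fixes f :: "real \<Rightarrow> complex"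
  assumes "(f \<longlongrightarrow> 0) (at_right 0)" "\<And>t. 0 < t \<Longrightarrow> t < r \<Longrightarrow> (f has_vector_derivative f' t) (at t)"
    "\<And>t. 0 < t \<Longrightarrow> t < r \<Longrightarrow> norm (f' t) \<le> K" "0 < z" "z < r"
  shows "norm (f z) \<le> K * z"
proof -
  have "norm (f z - 0) \<le> K * z - K * 0"
  proof (rule norm_diff_le_by_derivative_left_end[where f' = f' and g = "\<lambda>z. K * z" and g' = "\<lambda>_. K"])
    show "((\<lambda>z. K * z) has_real_derivative K) (at t)" for t by (auto intro!: derivative_eq_intros)
    show "((\<lambda>z. K * z) \<longlongrightarrow> K * 0) (at_right 0)" by (intro tendsto_intros)
  qed (use assms in auto)
  then show ?thesis by simp
qed

text \<open>The boundary values and one value of \<open>Pif\<close> determine a bounded solution.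
  For zero data, each function vanishes at \<open>0\<close> and has a derivative bounded by a
  constant times its sup bound \<open>S\<close>; on a short interval this replaces \<open>S\<close>
  by \<open>S / 2\<close>, and iteration gives \<open>0\<close>.\<close>

lemma psol_unique_near_0:
  obtains ru where "0 < ru" "ru \<le> z0 / 2"
    "\<And>\<omega> r0 r a \<zeta> \<xi> a' \<zeta>' \<xi>' S z. \<bar>\<omega>\<bar> \<le> 1 \<Longrightarrow> 0 < r0 \<Longrightarrow> r0 < r \<Longrightarrow> r \<le> ru \<Longrightarrow> psol \<omega> r a \<zeta> \<xi> a' \<zeta>' \<xi>' \<Longrightarrow>
      (\<And>z. 0 < z \<Longrightarrow> z \<le> r0 \<Longrightarrow> norm (a z) \<le> S \<and> norm (\<zeta> z) \<le> S \<and> norm (\<xi> z) \<le> S) \<Longrightarrow>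
      (a \<longlongrightarrow> 0) (at_right 0) \<Longrightarrow> (\<zeta> \<longlongrightarrow> 0) (at_right 0) \<Longrightarrow> (\<xi> \<longlongrightarrow> 0) (at_right 0) \<Longrightarrow>
      Pif a' \<xi>' r0 = 0 \<Longrightarrow> 0 < z \<Longrightarrow> z < r0 \<Longrightarrow> a z = 0"
proof -
  obtain rF where rF: "0 < rF" "rF \<le> 1" "rF \<le> z0 / 2" "\<And>z. 0 \<le> z \<Longrightarrow> z \<le> rF \<Longrightarrow> 1 / 2 \<le> F z \<and> F z \<le> 2"
    by (rule F_near_0) blast
  define K where "K = 2 + (\<bar>ga\<bar> + \<bar>c1\<bar>) * KB"
  define K' where "K' = 4 * (1 + norm rr) + 2 * norm rr * K"
  have K: "K \<ge> 2" unfolding K_def using KB_nonneg by simp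
  have K': "K' \<ge> 4" unfolding K'_def using K by (simp add: add_increasing2)
  \<comment> \<open>The derivative bounds are \<open>2 * K * S\<close> for the scalars and
    \<open>K' * S\<close> for \<open>a\<close>; \<open>ru\<close> makes their sum times the interval
    length at most \<open>S / 2\<close>.\<close>
  define ru where "ru = min rF (1 / (2 * (2 * K + K')))"
  have den: "0 < 2 * K + K'" using K K' by linarith
  have ru: "0 < ru" "ru \<le> rF" "ru * (2 * K + K') \<le> 1 / 2"
  proof -
    show "0 < ru" "ru \<le> rF" using rF den by (auto simp: ru_def)
    have "ru \<le> 1 / (2 * (2 * K + K'))" by (simp add: ru_def)
    then show "ru * (2 * K + K') \<le> 1 / 2" using den by (simp add: field_simps)
  qed
  show ?thesis
  proof (rule that[OF ru(1)])
    show "ru \<le> z0 / 2" using ru rF by linarith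
    fix \<omega> r0 r S z and a \<zeta> \<xi> a' \<zeta>' \<xi>' :: "real \<Rightarrow> complex"
    assume om: "\<bar>\<omega>\<bar> \<le> 1" and r0: "0 < r0" "r0 < r" "r \<le> ru" and ps: "psol \<omega> r a \<zeta> \<xi> a' \<zeta>' \<xi>'"
      and S: "\<And>z. 0 < z \<Longrightarrow> z \<le> r0 \<Longrightarrow> norm (a z) \<le> S \<and> norm (\<zeta> z) \<le> S \<and> norm (\<xi> z) \<le> S"
      and lim: "(a \<longlongrightarrow> 0) (at_right 0)" "(\<zeta> \<longlongrightarrow> 0) (at_right 0)" "(\<xi> \<longlongrightarrow> 0) (at_right 0)"
      and Pi: "Pif a' \<xi>' r0 = 0" and z: "0 < z" "z < r0"
    have ps0: "psol \<omega> r0 a \<zeta> \<xi> a' \<zeta>' \<xi>'" by (rule psol_mono[OF ps]) (use r0 in auto)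
    have r1: "r0 \<le> 1" "r0 \<le> rF" using r0 ru rF by auto
    have F: "1 / 2 \<le> F z \<and> F z \<le> 2" if "0 < z" "z \<le> r0" for z using rF(4)[of z] that r1 by auto
    have om2: "\<omega>\<^sup>2 \<le> 1" using om by (simp add: abs_square_le_1)
    have halve: "norm (a z) \<le> S / 2 \<and> norm (\<zeta> z) \<le> S / 2 \<and> norm (\<xi> z) \<le> S / 2"
      if S: "\<And>z. 0 < z \<Longrightarrow> z < r0 \<Longrightarrow> norm (a z) \<le> S \<and> norm (\<zeta> z) \<le> S \<and> norm (\<xi> z) \<le> S"
        and z: "0 < z" "z < r0" for S z
    proof -
      have S0: "S \<ge> 0" using S[OF z] norm_ge_zero order_trans by blast
      have fd: "norm (\<zeta>' t) \<le> 2 * (K * S)" "norm (\<xi>' t) \<le> 2 * (K * S)"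
          "norm (of_real (t ^ (N + 2) * F t) * \<xi>' t) \<le> K * S" if "0 < t" "t < r0" for t
        unfolding K_def by (rule psol_flux_decay[OF ps0 om r1(1) F S that]; simp)+
      have small: "c * S * z \<le> S / 2" if "0 \<le> c" "c \<le> 2 * K + K'" for c
      proof -
        have "c * z \<le> (2 * K + K') * ru" using that z r0 den by (intro mult_mono) auto
        then have "c * z \<le> 1 / 2" using ru(3) by (simp add: mult.commute)
        then have "c * z * S \<le> 1 / 2 * S" using S0 by (intro mult_right_mono) auto
        then show ?thesis by (simp add: mult_ac)
      qed
      have "norm (\<zeta> z) \<le> 2 * (K * S) * z"
        by (rule norm_le_of_tendsto_0[OF lim(2) psol_D(2)[OF ps0] fd(1) z])
      then have 1: "norm (\<zeta> z) \<le> S / 2" using small[of "2 * K"] K K' by (simp add: mult.assoc)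
      have "norm (\<xi> z) \<le> 2 * (K * S) * z"
        by (rule norm_le_of_tendsto_0[OF lim(3) psol_D(3)[OF ps0] fd(2) z])
      then have 2: "norm (\<xi> z) \<le> S / 2" using small[of "2 * K"] K K' by (simp add: mult.assoc)
      have "norm (a' t) \<le> K' * S" if t: "0 < t" "t < r0" for t
      proof -
        let ?k = "2 * (1 + norm rr) * S / t ^ N"
        have Sr: "norm (a u) \<le> S \<and> norm (\<xi> u) \<le> S" if "0 < u" "u \<le> r0" for u
        proof (cases "u = r0")
          case True
          have "continuous (at r0) a" "continuous (at r0) \<xi>"
            using psol_D(1,3)[OF ps r0(1,2)] has_vector_derivative_continuous by blast+
          then have "(a \<longlongrightarrow> a r0) (at_left r0)" "(\<xi> \<longlongrightarrow> \<xi> r0) (at_left r0)"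
            by (auto simp: isCont_def filterlim_at_split)
          moreover have "eventually (\<lambda>u. 0 < u \<and> u < r0) (at_left r0)"
            using r0 eventually_at_left by blast
          then have "eventually (\<lambda>u. norm (a u) \<le> S) (at_left r0)" "eventually (\<lambda>u. norm (\<xi> u) \<le> S) (at_left r0)"
            using S by (auto elim!: eventually_mono)
          ultimately show ?thesis unfolding True
            using tendsto_upperbound[OF tendsto_norm _ trivial_limit_at_left_real] by blast
        qed (use S that in auto)
        \<comment> \<open>The flux of \<open>a\<close> has no known limit at \<open>0\<close>, so
          \<open>Pif\<close> is integrated downwards from its zero at \<open>r0\<close>. The factor
          \<open>1 / t ^ N\<close> lost here is the weight of \<open>a'\<close> in
          \<open>Pif\<close> and cancels below.\<close>
        have "norm (Pif a' \<xi>' r0 - Pif a' \<xi>' t) \<le> ?k * (r0 - t)"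
        proof (rule norm_diff_le_closed)
          show "continuous_on {t..r0} (Pif a' \<xi>')"
            using t r0 by (intro continuous_at_imp_continuous_on ballI has_vector_derivative_continuous[OF Pif_derivative[OF ps]]) auto
          fix u assume u: "t < u" "u < r0"
          show "(Pif a' \<xi>' has_vector_derivative - of_real (\<omega>\<^sup>2 / F u) * (of_real (1 / u ^ N) * a u + rr * (of_real (u ^ (N + 2)) * \<xi> u))) (at u)"
            using u t r0 by (intro Pif_derivative[OF ps]) auto
          have Fu: "1 / 2 \<le> F u" using F[of u] u t by auto
          have uN: "1 / u ^ N \<le> 1 / t ^ N" using u t by (intro divide_left_mono power_mono) auto
          have u1: "u ^ (N + 2) \<le> 1" "t ^ N \<le> 1" by (rule power_le_one; use u t r1 in simp)+
          have t1: "1 \<le> 1 / t ^ N" using u1(2) t by simp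
          have uN2: "u ^ (N + 2) \<le> 1 / t ^ N" using u1(1) t1 by linarith
          have "norm (of_real (1 / u ^ N) * a u) \<le> 1 / t ^ N * S"
            unfolding norm_mult norm_of_real using uN u t S0 Sr[of u] by (intro mult_mono) auto
          moreover have "norm (rr * (of_real (u ^ (N + 2)) * \<xi> u)) \<le> norm rr * (1 / t ^ N * S)"
            unfolding norm_mult norm_of_real
            by (intro mult_left_mono mult_mono) (use uN2 u t S0 Sr[of u] in \<open>auto simp del: power_Suc add_2_eq_Suc'\<close>)
          ultimately have 1: "norm (of_real (1 / u ^ N) * a u + rr * (of_real (u ^ (N + 2)) * \<xi> u)) \<le> 1 / t ^ N * S + norm rr * (1 / t ^ N * S)"
            by (rule norm_triangle_mono)
          have "\<omega>\<^sup>2 / F u \<le> 1 / (1 / 2)" using om2 Fu by (intro frac_le) auto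
          then have 2: "\<bar>\<omega>\<^sup>2 / F u\<bar> \<le> 2" using Fu by simp
          have "norm (- of_real (\<omega>\<^sup>2 / F u) * (of_real (1 / u ^ N) * a u + rr * (of_real (u ^ (N + 2)) * \<xi> u)))
            \<le> 2 * (1 / t ^ N * S + norm rr * (1 / t ^ N * S))"
            using mult_mono[OF 2 1] by (simp only: norm_mult norm_minus_cancel norm_of_real) simp
          then show "norm (- of_real (\<omega>\<^sup>2 / F u) * (of_real (1 / u ^ N) * a u + rr * (of_real (u ^ (N + 2)) * \<xi> u))) \<le> ?k"
            by (rule order_trans) (simp add: field_simps add_divide_distrib)
        qed (use t in auto)
        also have "?k * (r0 - t) \<le> ?k * 1" using t r1 S0 by (intro mult_left_mono) auto
        finally have P: "norm (Pif a' \<xi>' t) \<le> ?k" using Pi by simp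
        have "of_real (1 / t ^ N * F t) * a' t = Pif a' \<xi>' t - rr * (of_real (t ^ (N + 2) * F t) * \<xi>' t)"
          by (simp add: Pif_def)
        then have "norm (of_real (1 / t ^ N * F t) * a' t) = norm (Pif a' \<xi>' t - rr * (of_real (t ^ (N + 2) * F t) * \<xi>' t))"
          by (rule arg_cong)
        also have "\<dots> \<le> norm (Pif a' \<xi>' t) + norm (rr * (of_real (t ^ (N + 2) * F t) * \<xi>' t))"
          by (rule norm_triangle_ineq4)
        also have "\<dots> \<le> ?k + norm rr * (K * S)"
          unfolding norm_mult[of rr] by (intro add_mono P mult_left_mono fd(3)[OF t]) simp
        finally have "norm (of_real (1 / t ^ N * F t) * a' t) \<le> ?k + norm rr * (K * S)" .
        then have "t ^ N * norm (of_real (1 / t ^ N * F t) * a' t) \<le> t ^ N * (?k + norm rr * (K * S))"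
          using t by (intro mult_left_mono) auto
        also have "t ^ N * norm (of_real (1 / t ^ N * F t) * a' t) = F t * norm (a' t)"
          using t F[of t] by (simp only: norm_mult norm_of_real) (simp add: abs_mult)
        also have "t ^ N * (?k + norm rr * (K * S)) = 2 * (1 + norm rr) * S + t ^ N * (norm rr * (K * S))"
          using t by (simp add: field_simps)
        also have "\<dots> \<le> 2 * (1 + norm rr) * S + 1 * (norm rr * (K * S))"
          using t r1 S0 K by (intro add_left_mono mult_right_mono power_le_one) auto
        finally have "F t * norm (a' t) \<le> 2 * (1 + norm rr) * S + norm rr * (K * S)" by simp
        moreover have "1 / 2 * norm (a' t) \<le> F t * norm (a' t)" using F[of t] t by (intro mult_right_mono) auto
        moreover have "x \<le> 2 * y" if "u \<le> y" "1 / 2 * x \<le> u" for x u y :: real using that by linarith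
        ultimately have "norm (a' t) \<le> 2 * (2 * (1 + norm rr) * S + norm rr * (K * S))" by blast
        then show ?thesis by (simp add: K'_def algebra_simps)
      qed
      then have "norm (a z) \<le> K' * S * z"
        by (intro norm_le_of_tendsto_0[OF lim(1) psol_D(1)[OF ps0] _ z])
      then have 3: "norm (a z) \<le> S / 2" using small[of K'] K K' by simp
      show ?thesis using 1 2 3 by blast
    qed
    have "\<forall>z. 0 < z \<longrightarrow> z < r0 \<longrightarrow> norm (a z) \<le> S / 2 ^ k \<and> norm (\<zeta> z) \<le> S / 2 ^ k \<and> norm (\<xi> z) \<le> S / 2 ^ k" for k
    proof (induction k)
      case 0
      then show ?case using S by auto
    next
      case (Suc k)
      show ?case
      proof (intro allI impI)
        fix z assume "0 < z" "z < r0"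
        then show "norm (a z) \<le> S / 2 ^ Suc k \<and> norm (\<zeta> z) \<le> S / 2 ^ Suc k \<and> norm (\<xi> z) \<le> S / 2 ^ Suc k"
          using halve[of "S / 2 ^ k" z] Suc by simp
      qed
    qed
    then have b: "norm (a z) \<le> S * (1 / 2) ^ k" for k using z by (simp add: power_one_over)
    have lim0: "(\<lambda>k. S * (1 / 2) ^ k) \<longlonglongrightarrow> S * 0"
      by (intro tendsto_mult tendsto_const LIMSEQ_realpow_zero) auto
    have "norm (a z) \<le> S * 0" by (rule LIMSEQ_le_const[OF lim0]) (use b in auto)
    then show "a z = 0" by simp
  qed
qed

end

section \<open>The ingoing phase\<close>

lemma analytic_at_bounds:
  assumes "g analytic_on {w}"
  obtains e K where "e > 0" "\<And>z. z \<in> ball w e \<Longrightarrow>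
    (g has_field_derivative deriv g z) (at z) \<and> norm (g z) \<le> K \<and> norm (deriv g z) \<le> (K :: real)"
proof -
  obtain e where e: "e > 0" "g holomorphic_on ball w e"
    using assms by (auto simp: analytic_on_def)
  have "continuous_on (cball w (e/2)) g" "continuous_on (cball w (e/2)) (deriv g)"
    using e holomorphic_deriv[OF e(2) open_ball]
    by (auto intro!: continuous_on_subset[OF holomorphic_on_imp_continuous_on])
  then have "bounded (g ` cball w (e/2))" "bounded (deriv g ` cball w (e/2))"
    by (auto intro!: compact_imp_bounded compact_continuous_image)
  then obtain K1 K2 where K1: "\<forall>x\<in>g ` cball w (e/2). norm x \<le> K1"
    and K2: "\<forall>x\<in>deriv g ` cball w (e/2). norm x \<le> K2"
    unfolding bounded_iff by blast
  have K: "norm (g z) \<le> K1" "norm (deriv g z) \<le> K2" if "z \<in> cball w (e/2)" for z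
    using K1 K2 that by auto
  show ?thesis
  proof (rule that[of "e / 2" "max K1 K2"])
    fix z assume z: "z \<in> ball w (e / 2)"
    have "(g has_field_derivative deriv g z) (at z)"
      using e z by (intro holomorphic_derivI[of g "ball w e"]) auto
    then show "(g has_field_derivative deriv g z) (at z) \<and> norm (g z) \<le> max K1 K2 \<and> norm (deriv g z) \<le> max K1 K2"
      using K[of z] z by (auto simp: le_max_iff_disj)
  qed (use e in auto)
qed

lemma norm_exp_i_minus_1_le: "norm (exp (\<i> * of_real x) - 1) \<le> \<bar>x\<bar>"
proof -
  have "norm (exp (\<i> * of_real x) - exp (\<i> * of_real 0)) \<le> 1 * \<bar>x - 0\<bar>"
  proof (rule norm_diff_le_lipschitz[where a = "- \<bar>x\<bar> - 1" and b = "\<bar>x\<bar> + 1"])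
    fix t :: real
    have "((\<lambda>t. \<i> * of_real t) has_vector_derivative \<i> * of_real 1) (at t)"
      by (intro has_vector_derivative_mult_right has_vector_derivative_of_real DERIV_ident)
    from field_vector_diff_chain_at[OF this DERIV_exp]
    show "((\<lambda>t. exp (\<i> * of_real t)) has_vector_derivative \<i> * exp (\<i> * of_real t)) (at t)"
      by (simp add: o_def)
    show "norm (\<i> * exp (\<i> * of_real t)) \<le> 1" by (simp add: norm_mult)
  qed auto
  then show ?thesis by simp
qed

lemma continuous_bounded_on_open_interval:
  fixes f :: "real \<Rightarrow> complex"
  assumes c: "\<And>z. a < z \<Longrightarrow> z < b \<Longrightarrow> isCont f z"
    and l: "eventually (\<lambda>z. norm (f z) \<le> K1) (at_right a)" and r: "eventually (\<lambda>z. norm (f z) \<le> K2) (at_left b)"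
    and "a < b"
  obtains D where "\<And>z. a < z \<Longrightarrow> z < b \<Longrightarrow> norm (f z) \<le> D"
proof -
  obtain a' where a': "a < a'" "\<And>z. a < z \<Longrightarrow> z < a' \<Longrightarrow> norm (f z) \<le> K1"
    using l \<open>a < b\<close> unfolding eventually_at_right[OF \<open>a < b\<close>] by blast
  obtain b' where b': "b' < b" "\<And>z. b' < z \<Longrightarrow> z < b \<Longrightarrow> norm (f z) \<le> K2"
    using r \<open>a < b\<close> unfolding eventually_at_left[OF \<open>a < b\<close>] by blast
  have "continuous_on {a'..b'} f"
    using a' b' by (intro continuous_at_imp_continuous_on ballI c) auto
  then have "bounded (f ` {a'..b'})" by (intro compact_imp_bounded compact_continuous_image) auto
  then obtain K3 where K3: "\<forall>x\<in>f ` {a'..b'}. norm x \<le> K3" unfolding bounded_iff by blast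
  show ?thesis
  proof (rule that[of "max K1 (max K2 K3)"])
    fix z assume z: "a < z" "z < b"
    consider "z < a'" | "b' < z" | "z \<in> {a'..b'}" by fastforce
    then show "norm (f z) \<le> max K1 (max K2 K3)"
      using a'(2)[OF z(1)] b'(2)[OF _ z(2)] K3 by cases (auto simp: le_max_iff_disj)
  qed
qed

section \<open>Boundedness near the boundary and removal of the ingoing phase\<close>

context brane
begin

text \<open>The no-source condition speaks about \<zeta> and \<xi> only; boundedness of
  \<open>a\<close> is derived. The maximum of \<open>norm a\<close> on \<open>[z, z1]\<close>
  reappears in the bound for its variation with a factor at most \<open>1 / 2\<close> because
  \<open>z1\<close> is short, so it is bounded independently of \<open>z\<close>.\<close>

lemma psol_bounded_near_0:
  obtains z1 where "0 < z1" "z1 \<le> z0 / 2"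
    "\<And>\<omega> r a \<zeta> \<xi> a' \<zeta>' \<xi>' H. \<bar>\<omega>\<bar> \<le> 1 \<Longrightarrow> z1 < r \<Longrightarrow> psol \<omega> r a \<zeta> \<xi> a' \<zeta>' \<xi>' \<Longrightarrow>
      (\<And>z. 0 < z \<Longrightarrow> z < z1 \<Longrightarrow> norm (\<zeta> z) \<le> H \<and> norm (\<xi> z) \<le> H) \<Longrightarrow>
      \<exists>D. \<forall>z. 0 < z \<longrightarrow> z < z1 \<longrightarrow> norm (a z) \<le> D \<and> norm (a' z) \<le> D \<and> norm (\<zeta>' z) \<le> D \<and> norm (\<xi>' z) \<le> D"
proof -
  obtain rF where rF: "0 < rF" "rF \<le> 1" "rF \<le> z0 / 2" "\<And>z. 0 \<le> z \<Longrightarrow> z \<le> rF \<Longrightarrow> 1 / 2 \<le> F z \<and> F z \<le> 2"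
    by (rule F_near_0) blast
  define C where "C = 2 + \<bar>q\<bar> * KB"
  have C: "C \<ge> 2" unfolding C_def using KB_nonneg by simp
  define z1 where "z1 = min rF (1 / (4 * C))"
  have z1: "0 < z1" "z1 \<le> rF" "2 * C * z1 \<le> 1 / 2"
  proof -
    show "0 < z1" "z1 \<le> rF" using rF C by (auto simp: z1_def)
    have "z1 \<le> 1 / (4 * C)" by (simp add: z1_def)
    then show "2 * C * z1 \<le> 1 / 2" using C by (simp add: field_simps)
  qed
  have F: "1 / 2 \<le> F z \<and> F z \<le> 2" if "0 < z" "z \<le> z1" for z using rF(4)[of z] that z1 by auto
  have z11: "z1 \<le> 1" using z1 rF by simp
  show ?thesis
  proof (rule that[OF z1(1)])
    show "z1 \<le> z0 / 2" using z1 rF by linarith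
    fix \<omega> r H and a \<zeta> \<xi> a' \<zeta>' \<xi>' :: "real \<Rightarrow> complex"
    assume om: "\<bar>\<omega>\<bar> \<le> 1" and r: "z1 < r" and ps: "psol \<omega> r a \<zeta> \<xi> a' \<zeta>' \<xi>'"
      and H: "\<And>z. 0 < z \<Longrightarrow> z < z1 \<Longrightarrow> norm (\<zeta> z) \<le> H \<and> norm (\<xi> z) \<le> H"
    have om2: "\<omega>\<^sup>2 \<le> 1" using om by (simp add: abs_square_le_1)
    let ?P = "\<lambda>z. of_real (1 / z ^ N * F z) * a' z"
    define c where "c = norm (?P z1)"
    have "norm (\<zeta> (z1 / 2)) \<le> H" using H[of "z1 / 2"] z1(1) by simp
    then have H0: "H \<ge> 0" using norm_ge_zero order_trans by blast
    \<comment> \<open>Integration of the flux of \<open>a\<close> down from \<open>z1\<close> costs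
      \<open>1 / s ^ N\<close>, which is the weight of the flux itself; the resulting bound on
      \<open>a'\<close> does not degenerate at \<open>0\<close>.\<close>
    have deriv_le: "norm (a' s) \<le> 2 * (c + C * (m + H) * z1)"
      if s: "0 < s" "s < z1" and m: "\<And>t. s \<le> t \<Longrightarrow> t < z1 \<Longrightarrow> norm (a t) \<le> m" for s m
    proof -
      have m0: "m \<ge> 0" using order_trans[OF norm_ge_zero m[of s]] s by simp
      have "norm (?P z1 - ?P s) \<le> C * (m + H) / s ^ N * (z1 - s)"
      proof (rule norm_diff_le_closed)
        show "continuous_on {s..z1} ?P"
          using s r by (intro continuous_at_imp_continuous_on ballI has_vector_derivative_continuous[OF psol_D(4)[OF ps]]) auto
        fix t assume t: "s < t" "t < z1"
        show "(?P has_vector_derivative - of_real (\<omega>\<^sup>2 * (1 / t ^ N) / F t) * a t + - \<i> * of_real q * of_real (t ^ (N + 2)) * Bc (a t) (\<zeta> t) (\<xi> t)) (at t)"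
          using s t r by (intro psol_D(4)[OF ps]) auto
        have Ft: "1 / 2 \<le> F t" using F[of t] s t by simp
        have ts: "1 / t ^ N \<le> 1 / s ^ N" using s t by (intro divide_left_mono power_mono) auto
        have tN: "t ^ (N + 2) \<le> 1" "s ^ N \<le> 1" by (rule power_le_one; use s t z11 in simp)+
        have s1: "1 \<le> 1 / s ^ N" using tN(2) s by simp
        have tN': "t ^ (N + 2) \<le> 1 / s ^ N" using tN(1) s1 by linarith
        have "\<omega>\<^sup>2 * (1 / t ^ N) / F t \<le> 1 * (1 / s ^ N) / (1 / 2)"
          by (rule frac_le[OF _ mult_mono[OF om2 ts]]) (use Ft s t in auto)
        then have "norm (- of_real (\<omega>\<^sup>2 * (1 / t ^ N) / F t) * a t) \<le> 2 / s ^ N * (m + H)"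
          unfolding norm_mult norm_minus_cancel norm_of_real using m[of t] s t H0 Ft
          by (intro mult_mono) auto
        moreover have "norm (- \<i> * of_real q * of_real (t ^ (N + 2)) * Bc (a t) (\<zeta> t) (\<xi> t)) \<le> \<bar>q\<bar> * (1 / s ^ N) * (KB * (m + H))"
        proof -
          have "norm (Bc (a t) (\<zeta> t) (\<xi> t)) \<le> KB * (m + H)"
            using m[of t] H[of t] s t H0 m0 by (intro norm_Bc_le) auto
          moreover have "norm (- \<i> * of_real q * of_real (t ^ (N + 2))) \<le> \<bar>q\<bar> * (1 / s ^ N)"
            unfolding norm_mult norm_of_real using tN' s t
            by (simp only: norm_minus_cancel norm_ii mult_1) (intro mult_left_mono, auto simp: abs_mult)
          ultimately show ?thesis unfolding norm_mult[of _ "Bc _ _ _"]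
            using s by (intro mult_mono) auto
        qed
        ultimately have "norm (- of_real (\<omega>\<^sup>2 * (1 / t ^ N) / F t) * a t + - \<i> * of_real q * of_real (t ^ (N + 2)) * Bc (a t) (\<zeta> t) (\<xi> t))
          \<le> 2 / s ^ N * (m + H) + \<bar>q\<bar> * (1 / s ^ N) * (KB * (m + H))" by (rule norm_triangle_mono)
        also have "\<dots> = C * (m + H) / s ^ N" by (simp add: C_def add_divide_distrib algebra_simps)
        finally show "norm (- of_real (\<omega>\<^sup>2 * (1 / t ^ N) / F t) * a t + - \<i> * of_real q * of_real (t ^ (N + 2)) * Bc (a t) (\<zeta> t) (\<xi> t)) \<le> C * (m + H) / s ^ N" .
      qed (use s in auto)
      also have "\<dots> \<le> C * (m + H) / s ^ N * z1" using s C m0 H0 by (intro mult_left_mono) auto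
      finally have "norm (?P s) \<le> c + C * (m + H) / s ^ N * z1"
        unfolding c_def using norm_triangle_ineq3[of "?P z1" "?P s"] by linarith
      then have "s ^ N * norm (?P s) \<le> s ^ N * (c + C * (m + H) / s ^ N * z1)"
        using s by (intro mult_left_mono) auto
      also have "s ^ N * norm (?P s) = F s * norm (a' s)"
        using s F[of s] by (simp only: norm_mult norm_of_real) (simp add: abs_mult)
      also have "s ^ N * (c + C * (m + H) / s ^ N * z1) = s ^ N * c + C * (m + H) * z1"
        using s by (simp add: field_simps)
      also have "\<dots> \<le> 1 * c + C * (m + H) * z1"
        using s z11 by (intro add_right_mono mult_right_mono power_le_one) (auto simp: c_def)
      finally have "F s * norm (a' s) \<le> c + C * (m + H) * z1" by simp
      moreover have "1 / 2 * norm (a' s) \<le> F s * norm (a' s)" using F[of s] s by (intro mult_right_mono) auto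
      moreover have "x \<le> 2 * y" if "u \<le> y" "1 / 2 * x \<le> u" for x u y :: real using that by linarith
      ultimately show ?thesis by blast
    qed
    \<comment> \<open>Dominates the solution of
      \<open>m \<le> norm (a z1) + 2 * c + (m + H) / 2\<close>.\<close>
    define A where "A = 2 * (norm (a z1) + 2 * c + H)"
    have aA: "norm (a z) \<le> A" if z: "0 < z" "z < z1" for z
    proof -
      have cont: "continuous_on {z..z1} a"
        using z r by (intro continuous_at_imp_continuous_on ballI has_vector_derivative_continuous[OF psol_D(1)[OF ps]]) auto
      have "\<exists>y\<in>{z..z1}. \<forall>t\<in>{z..z1}. norm (a t) \<le> norm (a y)"
        using z by (intro continuous_attains_sup continuous_intros cont) auto
      then obtain y where y: "y \<in> {z..z1}" "\<And>t. t \<in> {z..z1} \<Longrightarrow> norm (a t) \<le> norm (a y)" by blast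
      define m where "m = norm (a y)"
      have "norm (a z1 - a y) \<le> 2 * (c + C * (m + H) * z1) * (z1 - y)"
      proof (rule norm_diff_le_closed)
        show "continuous_on {y..z1} a" using cont y by (rule_tac continuous_on_subset) auto
        fix t assume t: "y < t" "t < z1"
        show "(a has_vector_derivative a' t) (at t)" using t y z r by (intro psol_D(1)[OF ps]) auto
        show "norm (a' t) \<le> 2 * (c + C * (m + H) * z1)"
          using t y z by (intro deriv_le) (auto simp: m_def)
      qed (use y in auto)
      also have "\<dots> \<le> 2 * (c + C * (m + H) * z1) * 1"
        using y z z11 C H0 by (intro mult_left_mono) (auto simp: m_def c_def)
      also have "\<dots> = 2 * c + 2 * C * z1 * (m + H)" by (simp add: algebra_simps)
      also have "\<dots> \<le> 2 * c + 1 / 2 * (m + H)"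
        using z1(3) H0 by (intro add_left_mono mult_right_mono) (auto simp: m_def)
      finally have "m \<le> norm (a z1) + 2 * c + 1 / 2 * (m + H)"
        using norm_triangle_ineq3[of "a z1" "a y"] unfolding m_def by linarith
      moreover have "u \<le> 2 * (x + 2 * y + w)" if "u \<le> x + 2 * y + 1 / 2 * (u + w)" "0 \<le> w" for u x y w :: real
        using that by argo
      ultimately have "m \<le> A" unfolding A_def using H0 by blast
      moreover have "norm (a z) \<le> m" using y(2)[of z] z by (simp add: m_def)
      ultimately show ?thesis by linarith
    qed
    have psz: "psol \<omega> z1 a \<zeta> \<xi> a' \<zeta>' \<xi>'" by (rule psol_mono[OF ps]) (use r in auto)
    define S where "S = max A H"
    define D where "D = max S (max (2 * (c + C * (A + H) * z1)) (2 * ((2 + (\<bar>ga\<bar> + \<bar>c1\<bar>) * KB) * S)))"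
    have "norm (a z) \<le> D \<and> norm (a' z) \<le> D \<and> norm (\<zeta>' z) \<le> D \<and> norm (\<xi>' z) \<le> D" if z: "0 < z" "z < z1" for z
    proof -
      have S: "norm (a t) \<le> S \<and> norm (\<zeta> t) \<le> S \<and> norm (\<xi> t) \<le> S" if "0 < t" "t < z1" for t
        using aA[OF that] H[OF that] by (auto simp: S_def)
      have F': "1 / 2 \<le> F t \<and> F t \<le> 2" if "0 < t" "t < z1" for t using F[of t] that by simp
      have "norm (a' z) \<le> 2 * (c + C * (A + H) * z1)" by (rule deriv_le[OF z]) (use aA z in auto)
      moreover have "norm (\<zeta>' z) \<le> 2 * ((2 + (\<bar>ga\<bar> + \<bar>c1\<bar>) * KB) * S)" "norm (\<xi>' z) \<le> 2 * ((2 + (\<bar>ga\<bar> + \<bar>c1\<bar>) * KB) * S)"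
        by (rule psol_flux_decay[OF psz om z11 F' S z]; assumption)+
      moreover have "norm (a z) \<le> S" using S[OF z] by blast
      ultimately show ?thesis unfolding D_def by (simp add: le_max_iff_disj)
    qed
    then show "\<exists>D. \<forall>z. 0 < z \<longrightarrow> z < z1 \<longrightarrow> norm (a z) \<le> D \<and> norm (a' z) \<le> D \<and> norm (\<zeta>' z) \<le> D \<and> norm (\<xi>' z) \<le> D"
      by blast
  qed
qed

text \<open>The tortoise coordinate, normalised to vanish at the boundary.\<close>

definition tort :: "real \<Rightarrow> real" where "tort z = integral {0..z} (\<lambda>s. 1 / F s)"

lemma tort_derivative:
  assumes "0 < z" "z < z0"
  shows "(tort has_real_derivative 1 / F z) (at z)"
proof -
  define b where "b = (z + z0) / 2"
  have b: "z < b" "b < z0" using assms by (auto simp: b_def)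
  have "F s \<noteq> 0" if "s \<in> {0..b}" for s using ppos[of s] that b by auto
  then have "continuous_on {0..b} (\<lambda>s. 1 / F s)" by (intro continuous_intros) auto
  then have "((\<lambda>x. integral {0..x} (\<lambda>s. 1 / F s)) has_real_derivative 1 / F z) (at z within {0..b})"
    by (rule integral_has_real_derivative) (use assms b in auto)
  then show ?thesis unfolding tort_def using assms b at_within_interior[of z "{0..b}"] by simp
qed

lemma tort_tendsto_0: "(tort \<longlongrightarrow> 0) (at_right 0)"
proof -
  have z: "0 < z0 / 2" "z0 / 2 < z0" using z0 by auto
  have "F s \<noteq> 0" if "s \<in> {0..z0 / 2}" for s using ppos[of s] that z by auto
  then have "continuous_on {0..z0 / 2} (\<lambda>s. 1 / F s)" by (intro continuous_intros) auto
  then have "((\<lambda>x. integral {0..x} (\<lambda>s. 1 / F s)) has_real_derivative 1 / F 0) (at 0 within {0..z0 / 2})"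
    by (rule integral_has_real_derivative) (use z in auto)
  then have "(tort has_real_derivative 1 / F 0) (at_right 0)"
    unfolding tort_def using z by (simp add: at_within_Icc_at_right)
  then have "(tort \<longlongrightarrow> tort 0) (at_right 0)"
    by (auto dest!: DERIV_continuous simp: continuous_within)
  then show ?thesis by (simp add: tort_def)
qed

text \<open>The inverse of the ingoing factor. It has modulus \<open>1\<close> and tends to
  \<open>1\<close> at the boundary, so removing the ingoing behaviour changes neither norms nor
  boundary values.\<close>

definition phase :: "real \<Rightarrow> real \<Rightarrow> complex" where "phase \<omega> z = exp (- (\<i> * of_real (\<omega> * tort z)))"

lemma norm_phase [simp]: "norm (phase \<omega> z) = 1"
  by (simp add: phase_def norm_exp_eq_Re)

lemma phase_derivative:
  assumes "0 < z" "z < z0"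
  shows "(phase \<omega> has_vector_derivative - (\<i> * of_real (\<omega> / F z)) * phase \<omega> z) (at z)"
proof -
  have "((\<lambda>z. - (\<i> * of_real (\<omega> * tort z))) has_vector_derivative - (\<i> * of_real (\<omega> * (1 / F z)))) (at z)"
    by (intro has_vector_derivative_minus has_vector_derivative_mult_right has_vector_derivative_of_real
        DERIV_cmult tort_derivative assms)
  from field_vector_diff_chain_at[OF this DERIV_exp]
  show ?thesis by (simp add: phase_def[abs_def] o_def)
qed

lemma phase_tendsto_1: "(phase \<omega> \<longlongrightarrow> 1) (at_right 0)"
proof -
  have "(phase \<omega> \<longlongrightarrow> exp (- (\<i> * of_real (\<omega> * 0)))) (at_right 0)"
    unfolding phase_def by (intro tendsto_intros tort_tendsto_0)
  then show ?thesis by simp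
qed

lemma norm_phase_minus_1_le: "norm (phase \<omega> z - 1) \<le> \<bar>\<omega>\<bar> * \<bar>tort z\<bar>"
proof -
  have "norm (exp (\<i> * of_real (- (\<omega> * tort z))) - 1) \<le> \<bar>- (\<omega> * tort z)\<bar>"
    by (rule norm_exp_i_minus_1_le)
  then show ?thesis by (simp add: phase_def abs_mult)
qed

text \<open>The derivative of \<open>phase \<omega>\<close> times \<open>f\<close>, as an explicit
  expression in \<open>f\<close> and \<open>f'\<close>.\<close>

definition dph :: "real \<Rightarrow> (real \<Rightarrow> complex) \<Rightarrow> (real \<Rightarrow> complex) \<Rightarrow> real \<Rightarrow> complex" where
  "dph \<omega> f f' z = phase \<omega> z * (f' z - \<i> * of_real (\<omega> / F z) * f z)"

lemma phase_mult_derivative: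
  assumes "0 < z" "z < z0" "(f has_vector_derivative f' z) (at z)"
  shows "((\<lambda>z. phase \<omega> z * f z) has_vector_derivative dph \<omega> f f' z) (at z)"
  using has_vector_derivative_mult[OF phase_derivative[OF assms(1,2), of \<omega>] assms(3)]
  by (rule has_vector_derivative_eq_rhs) (simp add: dph_def algebra_simps)

lemma flux_phase:
  assumes "0 < z" "z < z0" "g z = phase \<omega> z * f z"
  shows "flux \<omega> g (dph \<omega> f f') z = phase \<omega> z * (of_real (F z) * f' z + \<i> * of_real \<omega> * f z)"
  using ppos[of z] assms by (simp add: flux_def dph_def field_simps)

lemma rcomp_of_comp:
  assumes c: "comp \<omega> \<kappa> s S z0 f f'" and k: "\<And>z. 0 < z \<Longrightarrow> (\<kappa> has_real_derivative \<kappa>' z) (at z)"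
    and g: "\<And>z. 0 < z \<Longrightarrow> z < z0 \<Longrightarrow> g z = phase \<omega> z * f z"
    and T: "\<And>z. 0 < z \<Longrightarrow> z < z0 \<Longrightarrow> T z = phase \<omega> z * S z"
  shows "rcomp \<omega> \<kappa> \<kappa>' s T g (dph \<omega> f f')"
  unfolding rcomp_def
proof (intro allI impI conjI)
  fix z assume z: "0 < z" "z < z0"
  have tr: "(v has_vector_derivative D) (at z)" if "(u has_vector_derivative D) (at z)"
    "\<And>t. 0 < t \<Longrightarrow> t < z0 \<Longrightarrow> u t = v t" for u v :: "real \<Rightarrow> complex" and D
    by (rule has_vector_derivative_transform_within_open[OF that(1), of "{0<..<z0}"]) (use that z in auto)
  have f: "(f has_vector_derivative f' z) (at z)"
    "((\<lambda>z. of_real (\<kappa> z * F z) * f' z) has_vector_derivative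
        - of_real (\<omega>\<^sup>2 * \<kappa> z / F z) * f z + s * of_real (z ^ (N + 2)) * S z) (at z)"
    using c z unfolding comp_def by blast+
  show "(g has_vector_derivative dph \<omega> f f' z) (at z)"
    by (rule tr[OF phase_mult_derivative[of z f f' \<omega>, OF z f(1)]]) (simp add: g)
  have F: "complex_of_real (F z) \<noteq> 0" using ppos[of z] z by simp
  have "((\<lambda>z. phase \<omega> z * (of_real (\<kappa> z * F z) * f' z + \<i> * of_real \<omega> * (of_real (\<kappa> z) * f z))) has_vector_derivative
     phase \<omega> z * ((- of_real (\<omega>\<^sup>2 * \<kappa> z / F z) * f z + s * of_real (z ^ (N + 2)) * S z)
        + \<i> * of_real \<omega> * (of_real (\<kappa> z) * f' z + of_real (\<kappa>' z) * f z))
     + (- (\<i> * of_real (\<omega> / F z)) * phase \<omega> z) * (of_real (\<kappa> z * F z) * f' z + \<i> * of_real \<omega> * (of_real (\<kappa> z) * f z))) (at z)"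
    by (intro has_vector_derivative_mult has_vector_derivative_add has_vector_derivative_mult_right
        has_vector_derivative_of_real f k phase_derivative z)
  moreover have "phase \<omega> z * ((- of_real (\<omega>\<^sup>2 * \<kappa> z / F z) * f z + s * of_real (z ^ (N + 2)) * S z)
        + \<i> * of_real \<omega> * (of_real (\<kappa> z) * f' z + of_real (\<kappa>' z) * f z))
     + (- (\<i> * of_real (\<omega> / F z)) * phase \<omega> z) * (of_real (\<kappa> z * F z) * f' z + \<i> * of_real \<omega> * (of_real (\<kappa> z) * f z))
     = \<i> * of_real (\<omega> * \<kappa>' z) * g z + s * of_real (z ^ (N + 2)) * T z"
    unfolding g[OF z] T[OF z] using F
    by (simp add: field_simps power2_eq_square del: of_real_power) 
  ultimately have d: "((\<lambda>z. phase \<omega> z * (of_real (\<kappa> z * F z) * f' z + \<i> * of_real \<omega> * (of_real (\<kappa> z) * f z))) has_vector_derivative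
      \<i> * of_real (\<omega> * \<kappa>' z) * g z + s * of_real (z ^ (N + 2)) * T z) (at z)" by simp
  show "((\<lambda>z. of_real (\<kappa> z) * flux \<omega> g (dph \<omega> f f') z) has_vector_derivative
        \<i> * of_real (\<omega> * \<kappa>' z) * g z + s * of_real (z ^ (N + 2)) * T z) (at z)"
    by (rule tr[OF d]) (simp add: flux_phase[OF _ _ g] algebra_simps)
qed

lemma comp_isCont:
  assumes c: "comp \<omega> \<kappa> s S r f f'" and k: "\<And>z. 0 < z \<Longrightarrow> isCont \<kappa> z \<and> \<kappa> z \<noteq> 0" and r: "r \<le> z0"
    and z: "0 < z" "z < r"
  shows "isCont f z" "isCont f' z"
proof -
  have f: "(f has_vector_derivative f' z) (at z)"
    "((\<lambda>z. of_real (\<kappa> z * F z) * f' z) has_vector_derivative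
        - of_real (\<omega>\<^sup>2 * \<kappa> z / F z) * f z + s * of_real (z ^ (N + 2)) * S z) (at z)"
    using c z unfolding comp_def by blast+
  show "isCont f z" using f(1) has_vector_derivative_continuous by blast
  have ne: "\<kappa> t * F t \<noteq> 0" if "0 < t" "t < r" for t using k[of t] ppos[of t] that r by auto
  have "isCont (\<lambda>z. of_real (\<kappa> z * F z) * f' z) z" using f(2) has_vector_derivative_continuous by blast
  moreover have "isCont (\<lambda>z. complex_of_real (\<kappa> z * F z)) z" using k[OF z(1)] by (intro continuous_intros) auto
  ultimately have c: "isCont (\<lambda>z. of_real (\<kappa> z * F z) * f' z / of_real (\<kappa> z * F z)) z"
    using ne[OF z] by (intro continuous_divide) auto
  show "isCont f' z"
  proof (rule iffD1[OF isCont_cong c])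
    have "eventually (\<lambda>t. t \<in> {0<..<r}) (nhds z)" using z by (intro eventually_nhds_in_open) auto
    then show "\<forall>\<^sub>F t in nhds z. of_real (\<kappa> t * F t) * f' t / of_real (\<kappa> t * F t) = f' t"
      by eventually_elim (use ne in \<open>auto simp del: of_real_mult\<close>)
  qed
qed

text \<open>The given ingoing factor and the inverse of \<open>phase\<close> differ by a factor
  \<open>E\<close> of modulus \<open>1\<close>. Its logarithmic derivative is bounded, because
  \<open>1 / F\<close> and its principal part at the simple zero \<open>z0\<close> differ by a
  bounded function. So the phase-free function is \<open>E\<close> times an analytic
  function.\<close>

lemma ingoing_dph_bounded:
  assumes ing: "ingoing z0 F \<omega> f" and f: "\<And>z. 0 < z \<Longrightarrow> z < z0 \<Longrightarrow> (f has_vector_derivative f' z) (at z)"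
  shows "\<exists>D. eventually (\<lambda>z. norm (dph \<omega> f f' z) \<le> D) (at_left z0)"
proof -
  define F1 where "F1 = poly (pderiv p) z0"
  have F1: "F1 < 0" "deriv F z0 = F1" using dp by (simp_all add: F1_def DERIV_imp_deriv)
  obtain g where g: "g analytic_on {complex_of_real z0}"
    and fg: "\<forall>\<^sub>F z in at_left z0. f z = complex_of_real (z0 - z) powr (\<i> * of_real (\<omega> / F1)) * g (of_real z)"
    using ing unfolding ingoing_def F1 by blast
  obtain e K where e: "e > 0" and K: "\<And>z. z \<in> ball (complex_of_real z0) e \<Longrightarrow>
    (g has_field_derivative deriv g z) (at z) \<and> norm (g z) \<le> K \<and> norm (deriv g z) \<le> K"
    by (rule analytic_at_bounds[OF g]) blast
  obtain p1 p2 where p1: "\<And>z. F z = (z - z0) * poly p1 z" and p2: "\<And>z. poly p1 z = F1 + (z - z0) * poly p2 z"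
    unfolding F1_def by (rule F_factor) blast
  obtain f0 where f0: "f0 > 0" "\<And>z. 0 \<le> z \<Longrightarrow> z \<le> z0 \<Longrightarrow> f0 * (z0 - z) \<le> F z"
    by (rule F_lower_bound) blast
  have "bounded (poly p2 ` {0..z0})"
    by (intro compact_imp_bounded compact_continuous_image continuous_intros) auto
  then obtain K2 where "\<forall>x\<in>poly p2 ` {0..z0}. norm x \<le> K2" unfolding bounded_iff by blast
  then have K2: "\<bar>poly p2 z\<bar> \<le> K2" if "z \<in> {0..z0}" for z using that by auto
  \<comment> \<open>The derivative of \<open>ln (z0 - z) / F1 - tort z\<close>. The two poles
    cancel: over the common denominator the numerator vanishes to second order at \<open>z0\<close>,
    as \<open>p2\<close> makes explicit.\<close>
  define \<chi>' where "\<chi>' z = - (1 / ((z0 - z) * F1)) - 1 / F z" for z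
  have chi: "\<bar>\<chi>' z\<bar> \<le> K2 / (- F1 * f0)" if z: "0 < z" "z < z0" for z
  proof -
    have Fz: "F z > 0" using ppos[of z] z by simp
    have "\<chi>' z = - (F z + (z0 - z) * F1) / ((z0 - z) * F1 * F z)"
      unfolding \<chi>'_def using z F1 Fz by (simp add: field_simps)
    also have "F z + (z0 - z) * F1 = (z0 - z) * (z0 - z) * poly p2 z"
      unfolding p1 p2 by (simp add: algebra_simps)
    also have "- ((z0 - z) * (z0 - z) * poly p2 z) / ((z0 - z) * F1 * F z) = (z0 - z) * poly p2 z / (- F1 * F z)"
      using z F1 Fz by (simp add: field_simps)
    finally have "\<bar>\<chi>' z\<bar> = (z0 - z) * \<bar>poly p2 z\<bar> / (- F1 * F z)"
      using z F1 Fz by (simp add: abs_mult)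
    also have "\<dots> \<le> (z0 - z) * K2 / (- F1 * (f0 * (z0 - z)))"
      using z F1 Fz f0(1) f0(2)[of z] K2[of z] by (intro frac_le mult_left_mono mult_pos_pos mult_nonneg_nonneg) auto
    also have "\<dots> = K2 / (- F1 * f0)" using z F1 f0 by (simp add: field_simps)
    finally show ?thesis .
  qed
  define E where "E z = exp (\<i> * of_real (\<omega> * (ln (z0 - z) / F1 - tort z)))" for z
  have Ed: "(E has_vector_derivative \<i> * of_real (\<omega> * \<chi>' z) * E z) (at z)" if z: "0 < z" "z < z0" for z
  proof -
    have "((\<lambda>z. ln (z0 - z) / F1 - tort z) has_real_derivative \<chi>' z) (at z)"
    proof -
      have "((\<lambda>z. ln (z0 - z)) has_real_derivative - (1 / (z0 - z))) (at z)"
        using z by (auto intro!: derivative_eq_intros)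
      then have "((\<lambda>z. ln (z0 - z) / F1 - tort z) has_real_derivative - (1 / (z0 - z)) / F1 - 1 / F z) (at z)"
        by (intro DERIV_diff DERIV_cdivide tort_derivative z)
      then show ?thesis unfolding \<chi>'_def by simp
    qed
    then have "((\<lambda>z. \<i> * of_real (\<omega> * (ln (z0 - z) / F1 - tort z))) has_vector_derivative \<i> * of_real (\<omega> * \<chi>' z)) (at z)"
      by (intro has_vector_derivative_mult_right has_vector_derivative_of_real DERIV_cmult)
    from field_vector_diff_chain_at[OF this DERIV_exp]
    show ?thesis by (simp add: E_def[abs_def] o_def)
  qed
  have ev1: "eventually (\<lambda>z. 0 < z \<and> z < z0 \<and> z0 - e < z) (at_left z0)"
    using eventually_at_left[of "max 0 (z0 - e)" z0] z0 e
    by (auto intro!: exI[of _ "max 0 (z0 - e)"])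
  have ev: "\<forall>\<^sub>F z in at_left z0. 0 < z \<and> z < z0 \<and> z0 - e < z \<and> f z = complex_of_real (z0 - z) powr (\<i> * of_real (\<omega> / F1)) * g (of_real z)"
    using ev1 fg by eventually_elim auto
  obtain b where b: "b < z0" "\<And>z. b < z \<Longrightarrow> z < z0 \<Longrightarrow> 0 < z \<and> z < z0 \<and> z0 - e < z \<and> f z = complex_of_real (z0 - z) powr (\<i> * of_real (\<omega> / F1)) * g (of_real z)"
    using ev unfolding eventually_at_left[OF z0] by blast
  have eq: "phase \<omega> z * f z = E z * g (of_real z)" if z: "b < z" "z < z0" for z
  proof -
    have "complex_of_real (z0 - z) powr (\<i> * of_real (\<omega> / F1)) = exp (\<i> * of_real (\<omega> / F1) * of_real (ln (z0 - z)))"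
      using z by (simp add: powr_def Ln_of_real del: of_real_diff)
    then have "phase \<omega> z * f z = exp (- (\<i> * of_real (\<omega> * tort z))) * exp (\<i> * of_real (\<omega> / F1) * of_real (ln (z0 - z))) * g (of_real z)"
      using b(2)[OF z] by (simp add: phase_def)
    also have "exp (- (\<i> * of_real (\<omega> * tort z))) * exp (\<i> * of_real (\<omega> / F1) * of_real (ln (z0 - z))) = E z"
      unfolding exp_add[symmetric] E_def by (rule arg_cong[where f = exp]) (simp add: algebra_simps)
    finally show ?thesis .
  qed
  have "norm (dph \<omega> f f' z) \<le> \<bar>\<omega>\<bar> * (K2 / (- F1 * f0)) * K + K" if z: "b < z" "z < z0" for z
  proof -
    have z': "0 < z" "z < z0" "z0 - e < z" using b(2)[OF z] by auto
    have inb: "complex_of_real z \<in> ball (complex_of_real z0) e"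
      using z' by (simp add: dist_complex_def flip: of_real_diff)
    have "((\<lambda>z. g (of_real z)) has_vector_derivative deriv g (of_real z)) (at z)"
      using K[OF inb] by (intro has_vector_derivative_real_field) auto
    then have d1: "((\<lambda>z. E z * g (of_real z)) has_vector_derivative E z * deriv g (of_real z) + \<i> * of_real (\<omega> * \<chi>' z) * E z * g (of_real z)) (at z)"
      by (intro has_vector_derivative_mult Ed z')
    have d2: "((\<lambda>z. phase \<omega> z * f z) has_vector_derivative dph \<omega> f f' z) (at z)"
      by (intro phase_mult_derivative f z')
    have "((\<lambda>z. E z * g (of_real z)) has_vector_derivative dph \<omega> f f' z) (at z)"
      by (rule has_vector_derivative_transform_within_open[OF d2, of "{b<..<z0}"]) (use z eq in auto)
    then have "dph \<omega> f f' z = E z * deriv g (of_real z) + \<i> * of_real (\<omega> * \<chi>' z) * E z * g (of_real z)"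
      using d1 vector_derivative_unique_at by blast
    then have "norm (dph \<omega> f f' z) \<le> norm (E z * deriv g (of_real z)) + norm (\<i> * of_real (\<omega> * \<chi>' z) * E z * g (of_real z))"
      by (simp only: norm_triangle_ineq)
    also have "\<dots> = norm (deriv g (of_real z)) + \<bar>\<omega>\<bar> * \<bar>\<chi>' z\<bar> * norm (g (of_real z))"
      by (simp add: norm_mult E_def norm_exp_eq_Re abs_mult)
    also have "\<dots> \<le> K + \<bar>\<omega>\<bar> * (K2 / (- F1 * f0)) * K"
      using K[OF inb] chi[OF z'(1,2)] order_trans[OF abs_ge_zero chi[OF z'(1,2)]]
      by (intro add_mono mult_mono mult_left_mono mult_nonneg_nonneg) auto
    finally show ?thesis by simp
  qed
  then show ?thesis unfolding eventually_at_left[OF z0] using b(1) by blast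
qed

text \<open>The derivative of the phase-free function is bounded near \<open>0\<close> by
  hypothesis, near \<open>z0\<close> by the ingoing condition, and in between by continuity; a
  bounded derivative gives a continuous extension to the closed interval.\<close>

lemma comp_phase_extends:
  assumes c: "comp \<omega> \<kappa> s S z0 f f'" and k: "\<And>z. 0 < z \<Longrightarrow> isCont \<kappa> z \<and> \<kappa> z \<noteq> 0"
    and ing: "ingoing z0 F \<omega> f"
    and z1: "0 < z1" "z1 < z0" "\<And>z. 0 < z \<Longrightarrow> z < z1 \<Longrightarrow> norm (f z) \<le> D \<and> norm (f' z) \<le> D"
  obtains g K where "continuous_on {0..z0} g" "\<And>z. 0 < z \<Longrightarrow> z < z0 \<Longrightarrow> g z = phase \<omega> z * f z"
    "\<And>z. 0 < z \<Longrightarrow> z < z0 \<Longrightarrow> norm (dph \<omega> f f' z) \<le> K"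
proof -
  have fd: "(f has_vector_derivative f' z) (at z)" if "0 < z" "z < z0" for z
    using c that unfolding comp_def by blast
  obtain K2 where K2: "eventually (\<lambda>z. norm (dph \<omega> f f' z) \<le> K2) (at_left z0)"
    using ingoing_dph_bounded[OF ing fd] by blast
  obtain f0 where f0: "f0 > 0" "\<And>z. 0 \<le> z \<Longrightarrow> z \<le> z0 \<Longrightarrow> f0 * (z0 - z) \<le> F z"
    by (rule F_lower_bound) blast
  have near: "norm (dph \<omega> f f' z) \<le> D + \<bar>\<omega>\<bar> / (f0 * (z0 - z1)) * D" if z: "0 < z" "z < z1" for z
  proof -
    have "f0 * (z0 - z1) \<le> f0 * (z0 - z)" using f0 z by (intro mult_left_mono) auto
    then have F: "f0 * (z0 - z1) \<le> F z" using f0(2)[of z] z z1 by linarith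
    have Fp: "0 < f0 * (z0 - z1)" using f0 z1 by simp
    have "norm (dph \<omega> f f' z) \<le> norm (f' z) + norm (\<i> * of_real (\<omega> / F z) * f z)"
      by (simp only: dph_def norm_mult[of "phase \<omega> z"] norm_phase mult_1 norm_triangle_ineq4)
    also have "\<dots> = norm (f' z) + \<bar>\<omega>\<bar> / F z * norm (f z)"
      using F Fp by (simp add: norm_mult norm_divide)
    also have "\<dots> \<le> D + \<bar>\<omega>\<bar> / (f0 * (z0 - z1)) * D"
      using z1(3)[OF z] F Fp by (intro add_mono mult_mono divide_left_mono) auto
    finally show ?thesis .
  qed
  have cont: "isCont (dph \<omega> f f') z" if "0 < z" "z < z0" for z
  proof -
    have "isCont f z" "isCont f' z" by (rule comp_isCont[OF c k order_refl that]; assumption)+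
    moreover have "isCont (phase \<omega>) z" using phase_derivative[OF that] has_vector_derivative_continuous by blast
    moreover have "F z \<noteq> 0" using ppos[of z] that by simp
    ultimately show ?thesis unfolding dph_def by (intro continuous_intros) auto
  qed
  have "eventually (\<lambda>z. norm (dph \<omega> f f' z) \<le> D + \<bar>\<omega>\<bar> / (f0 * (z0 - z1)) * D) (at_right 0)"
    using near z1 by (intro eventually_at_rightI[of 0 z1]) auto
  then obtain K where K: "\<And>z. 0 < z \<Longrightarrow> z < z0 \<Longrightarrow> norm (dph \<omega> f f' z) \<le> K"
    using continuous_bounded_on_open_interval[OF cont _ K2 z0] by blast
  obtain g where "continuous_on {0..z0} g" "\<And>z. 0 < z \<Longrightarrow> z < z0 \<Longrightarrow> g z = phase \<omega> z * f z"
    using bounded_derivative_extends[OF z0 phase_mult_derivative[OF _ _ fd] K] by blast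
  then show ?thesis using K that by blast
qed

end

lemma tendsto_bounded_initial_segment:
  fixes f :: "real \<Rightarrow> complex"
  assumes c: "\<And>z. 0 < z \<Longrightarrow> z < r \<Longrightarrow> isCont f z" and b: "eventually (\<lambda>z. norm (f z) \<le> K) (at_right 0)"
    and r0: "0 < r0" "r0 < r"
  obtains S where "\<And>z. 0 < z \<Longrightarrow> z \<le> r0 \<Longrightarrow> norm (f z) \<le> S"
proof -
  define m where "m = (r0 + r) / 2"
  have m: "r0 < m" "m < r" "0 < m" using r0 by (auto simp: m_def)
  have "isCont f m" using m r0 by (intro c) auto
  then have "((\<lambda>z. norm (f z)) \<longlongrightarrow> norm (f m)) (at_left m)"
    by (intro tendsto_norm) (simp add: isCont_def filterlim_at_split)
  then have "eventually (\<lambda>z. norm (f z) < norm (f m) + 1) (at_left m)"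
    by (rule order_tendstoD) simp
  then have e: "eventually (\<lambda>z. norm (f z) \<le> norm (f m) + 1) (at_left m)"
    by eventually_elim simp
  have cm: "isCont f z" if "0 < z" "z < m" for z using c[of z] that m by simp
  obtain D where D: "\<And>z. 0 < z \<Longrightarrow> z < m \<Longrightarrow> norm (f z) \<le> D"
    by (rule continuous_bounded_on_open_interval[OF cm b e m(3)]) auto
  show ?thesis by (rule that[of D], rule D) (use m in auto)
qed

section \<open>Given solutions as regular functions, and their Frobenius coefficients\<close>

context brane
begin

lemma Bc_scale: "Bc (c * x) (c * y) (c * w) = c * Bc x y w"
  by (simp add: Bc_def algebra_simps)

lemma psol_isCont:
  assumes "psol \<omega> r a \<zeta> \<xi> a' \<zeta>' \<xi>'" "0 < z" "z < r"
  shows "isCont a z" "isCont \<zeta> z" "isCont \<xi> z"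
  using psol_D(1-3)[OF assms] has_vector_derivative_continuous by blast+

text \<open>Besides regularity, the value of \<open>M\<close> matters: it is attained as a sum of
  norms at a point \<open>y\<close>. Hence \<open>M\<close> can later be bounded from above by the
  values of the functions themselves.\<close>

lemma reg_of_psol:
  assumes om: "\<bar>\<omega>\<bar> \<le> 1" and ps: "psol \<omega> z0 a \<zeta> \<xi> a' \<zeta>' \<xi>'"
    and ing: "ingoing z0 F \<omega> a" "ingoing z0 F \<omega> \<zeta>" "ingoing z0 F \<omega> \<xi>"
    and src: "no_scalar_source \<zeta> \<xi>"
  obtains M A Z X y where "reg \<omega> M A Z X (dph \<omega> a a') (dph \<omega> \<zeta> \<zeta>') (dph \<omega> \<xi> \<xi>')"
    "\<And>z. 0 < z \<Longrightarrow> z < z0 \<Longrightarrow> A z = phase \<omega> z * a z \<and> Z z = phase \<omega> z * \<zeta> z \<and> X z = phase \<omega> z * \<xi> z"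
    "y \<in> {0..z0}" "M = norm (A y) + norm (Z y) + norm (X y)"
    "(a \<longlongrightarrow> A 0) (at_right 0)" "(\<zeta> \<longlongrightarrow> Z 0) (at_right 0)" "(\<xi> \<longlongrightarrow> X 0) (at_right 0)"
proof -
  obtain z1 where z1: "0 < z1" "z1 \<le> z0 / 2"
    and bdd0: "\<And>\<omega> r a \<zeta> \<xi> a' \<zeta>' \<xi>' H. \<bar>\<omega>\<bar> \<le> 1 \<Longrightarrow> z1 < r \<Longrightarrow> psol \<omega> r a \<zeta> \<xi> a' \<zeta>' \<xi>' \<Longrightarrow>
      (\<And>z. 0 < z \<Longrightarrow> z < z1 \<Longrightarrow> norm (\<zeta> z) \<le> H \<and> norm (\<xi> z) \<le> H) \<Longrightarrow>
      \<exists>D. \<forall>z. 0 < z \<longrightarrow> z < z1 \<longrightarrow> norm (a z) \<le> D \<and> norm (a' z) \<le> D \<and> norm (\<zeta>' z) \<le> D \<and> norm (\<xi>' z) \<le> D"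
    by (rule psol_bounded_near_0) blast
  have z1': "z1 < z0" using z1 z0 by simp
  note bdd = bdd0[OF om z1' ps]
  obtain K1 K2 where K1: "eventually (\<lambda>z. norm (\<zeta> z) \<le> K1) (at_right 0)" and K2: "eventually (\<lambda>z. norm (\<xi> z) \<le> K2) (at_right 0)"
    using src unfolding no_scalar_source_def Bfun_def by blast
  obtain H1 where H1: "\<And>z. 0 < z \<Longrightarrow> z \<le> z1 \<Longrightarrow> norm (\<zeta> z) \<le> H1"
    by (rule tendsto_bounded_initial_segment[OF psol_isCont(2)[OF ps] K1 z1(1) z1']) auto
  obtain H2 where H2: "\<And>z. 0 < z \<Longrightarrow> z \<le> z1 \<Longrightarrow> norm (\<xi> z) \<le> H2"
    by (rule tendsto_bounded_initial_segment[OF psol_isCont(3)[OF ps] K2 z1(1) z1']) auto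
  note H = H1 H2
  have "norm (\<zeta> z) \<le> max H1 H2 \<and> norm (\<xi> z) \<le> max H1 H2" if "0 < z" "z < z1" for z
    using H[of z] that by (auto simp: le_max_iff_disj)
  then obtain D0 where D0: "\<And>z. 0 < z \<Longrightarrow> z < z1 \<Longrightarrow> norm (a z) \<le> D0 \<and> norm (a' z) \<le> D0 \<and> norm (\<zeta>' z) \<le> D0 \<and> norm (\<xi>' z) \<le> D0"
    using bdd by blast
  define D where "D = max D0 (max H1 H2)"
  have D: "norm (a z) \<le> D \<and> norm (a' z) \<le> D" "norm (\<zeta> z) \<le> D \<and> norm (\<zeta>' z) \<le> D" "norm (\<xi> z) \<le> D \<and> norm (\<xi>' z) \<le> D"
    if "0 < z" "z < z1" for z
    using D0[OF that] H[of z] that by (auto simp: D_def le_max_iff_disj)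
  have comps: "comp \<omega> (\<lambda>z. 1 / z ^ N) (- \<i> * of_real q) (\<lambda>z. Bc (a z) (\<zeta> z) (\<xi> z)) z0 a a'"
    "comp \<omega> (\<lambda>z. z ^ (N + 3)) (of_real ga) (\<lambda>z. Bc (a z) (\<zeta> z) (\<xi> z)) z0 \<zeta> \<zeta>'"
    "comp \<omega> (\<lambda>z. z ^ (N + 2)) (of_real c1) (\<lambda>z. Bc (a z) (\<zeta> z) (\<xi> z)) z0 \<xi> \<xi>'"
    using ps unfolding psol_def by blast+
  have k: "isCont (\<lambda>z. 1 / z ^ N) z \<and> 1 / z ^ N \<noteq> 0" "isCont (\<lambda>z. z ^ j) z \<and> z ^ j \<noteq> 0" if "0 < z" for z :: real and j
    using that by (auto intro!: continuous_intros)
  obtain A KA where A: "continuous_on {0..z0} A" "\<And>z. 0 < z \<Longrightarrow> z < z0 \<Longrightarrow> A z = phase \<omega> z * a z"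
    "\<And>z. 0 < z \<Longrightarrow> z < z0 \<Longrightarrow> norm (dph \<omega> a a' z) \<le> KA"
    by (rule comp_phase_extends[OF comps(1) k(1) ing(1) z1(1) z1' D(1)]) auto
  obtain Z KZ where Z: "continuous_on {0..z0} Z" "\<And>z. 0 < z \<Longrightarrow> z < z0 \<Longrightarrow> Z z = phase \<omega> z * \<zeta> z"
    "\<And>z. 0 < z \<Longrightarrow> z < z0 \<Longrightarrow> norm (dph \<omega> \<zeta> \<zeta>' z) \<le> KZ"
    by (rule comp_phase_extends[OF comps(2) k(2) ing(2) z1(1) z1' D(2)]) auto
  obtain X KX where X: "continuous_on {0..z0} X" "\<And>z. 0 < z \<Longrightarrow> z < z0 \<Longrightarrow> X z = phase \<omega> z * \<xi> z"
    "\<And>z. 0 < z \<Longrightarrow> z < z0 \<Longrightarrow> norm (dph \<omega> \<xi> \<xi>' z) \<le> KX"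
    by (rule comp_phase_extends[OF comps(3) k(2) ing(3) z1(1) z1' D(3)]) auto
  have "\<exists>y\<in>{0..z0}. \<forall>t\<in>{0..z0}. norm (A t) + norm (Z t) + norm (X t) \<le> norm (A y) + norm (Z y) + norm (X y)"
    using z0 by (intro continuous_attains_sup continuous_intros A Z X) auto
  then obtain y where y: "y \<in> {0..z0}" "\<And>t. t \<in> {0..z0} \<Longrightarrow> norm (A t) + norm (Z t) + norm (X t) \<le> norm (A y) + norm (Z y) + norm (X y)"
    by blast
  define M where "M = norm (A y) + norm (Z y) + norm (X y)"
  have M: "norm (A t) \<le> M" "norm (Z t) \<le> M" "norm (X t) \<le> M" if "t \<in> {0..z0}" for t
    using y(2)[OF that] norm_ge_zero[of "A t"] norm_ge_zero[of "Z t"] norm_ge_zero[of "X t"] unfolding M_def by linarith+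
  have B: "Bc (A z) (Z z) (X z) = phase \<omega> z * Bc (a z) (\<zeta> z) (\<xi> z)" if "0 < z" "z < z0" for z
    using A(2) Z(2) X(2) that by (simp add: Bc_scale)
  have pd: "((\<lambda>z. z ^ (n + 1)) has_real_derivative real (n + 1) * z ^ n) (at z)" for n and z :: real
    by (rule power_derivative) simp
  have "reg \<omega> M A Z X (dph \<omega> a a') (dph \<omega> \<zeta> \<zeta>') (dph \<omega> \<xi> \<xi>')"
    unfolding reg_def
  proof (intro conjI)
    show "bnd M A (dph \<omega> a a')" "bnd M Z (dph \<omega> \<zeta> \<zeta>')" "bnd M X (dph \<omega> \<xi> \<xi>')"
      unfolding bnd_def using A Z X M by blast+
    show "rcomp \<omega> (\<lambda>z. 1 / z ^ N) (\<lambda>z. - real N / z ^ (N + 1)) (- \<i> * of_real q) (\<lambda>z. Bc (A z) (Z z) (X z)) A (dph \<omega> a a')"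
      by (rule rcomp_of_comp[OF comps(1) inverse_power_derivative A(2) B])
    show "rcomp \<omega> (\<lambda>z. z ^ (N + 3)) (\<lambda>z. real (N + 3) * z ^ (N + 2)) (of_real ga) (\<lambda>z. Bc (A z) (Z z) (X z)) Z (dph \<omega> \<zeta> \<zeta>')"
      by (rule rcomp_of_comp[OF comps(2) power_derivative Z(2) B]) auto
    show "rcomp \<omega> (\<lambda>z. z ^ (N + 2)) (\<lambda>z. real (N + 2) * z ^ (N + 1)) (of_real c1) (\<lambda>z. Bc (A z) (Z z) (X z)) X (dph \<omega> \<xi> \<xi>')"
      by (rule rcomp_of_comp[OF comps(3) power_derivative X(2) B]) auto
  qed
  note regular = this
  have lim: "(f \<longlongrightarrow> g 0) (at_right 0)" if g: "continuous_on {0..z0} g" "\<And>z. 0 < z \<Longrightarrow> z < z0 \<Longrightarrow> g z = phase \<omega> z * f z" for f g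
  proof (rule Lim_transform_eventually)
    have "(g \<longlongrightarrow> g 0) (at 0 within {0..z0})" using g(1) z0 by (auto simp: continuous_on_def)
    then have "(g \<longlongrightarrow> g 0) (at_right 0)" by (simp add: at_within_Icc_at_right z0)
    then have "((\<lambda>z. g z / phase \<omega> z) \<longlongrightarrow> g 0 / 1) (at_right 0)"
      by (intro tendsto_divide phase_tendsto_1) auto
    then show "((\<lambda>z. g z / phase \<omega> z) \<longlongrightarrow> g 0) (at_right 0)" by simp
    have "phase \<omega> z \<noteq> 0" for z by (simp add: phase_def)
    then show "\<forall>\<^sub>F z in at_right 0. g z / phase \<omega> z = f z"
      using g(2) z0 by (intro eventually_at_rightI[of 0 z0]) auto
  qed
  show ?thesis
  proof (rule that[OF regular _ y(1) M_def lim[OF A(1,2)] lim[OF Z(1,2)] lim[OF X(1,2)]])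
    show "A z = phase \<omega> z * a z \<and> Z z = phase \<omega> z * \<zeta> z \<and> X z = phase \<omega> z * \<xi> z" if "0 < z" "z < z0" for z
      using A(2) Z(2) X(2) that by blast
  qed
qed

text \<open>\<open>flux\<close> contains the phase term twice, while \<open>F\<close> times the
  original derivative produces it once; \<open>flux_const\<close> subtracts the surplus copy, and
  what remains is the conserved quantity of the original system times the phase.\<close>

lemma flux_const_phase:
  assumes r: "0 < r" "r < z0" and A: "A r = phase \<omega> r * a r" and X: "X r = phase \<omega> r * \<xi> r"
  shows "flux_const \<omega> A X (dph \<omega> a a') (dph \<omega> \<xi> \<xi>') r = phase \<omega> r * Pif a' \<xi>' r"
proof -
  have "flux \<omega> A (dph \<omega> a a') r - \<i> * of_real \<omega> * A r = phase \<omega> r * (of_real (F r) * a' r)"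
    unfolding flux_phase[of r A \<omega> a a', OF r A] A by (simp add: algebra_simps)
  moreover have "flux \<omega> X (dph \<omega> \<xi> \<xi>') r - \<i> * of_real \<omega> * X r = phase \<omega> r * (of_real (F r) * \<xi>' r)"
    unfolding flux_phase[of r X \<omega> \<xi> \<xi>', OF r X] X by (simp add: algebra_simps)
  ultimately have "flux_const \<omega> A X (dph \<omega> a a') (dph \<omega> \<xi> \<xi>') r =
      of_real (1 / r ^ N) * (phase \<omega> r * (of_real (F r) * a' r)) + rr * (of_real (r ^ (N + 2)) * (phase \<omega> r * (of_real (F r) * \<xi>' r)))"
    by (simp only: flux_const_def)
  also have "\<dots> = phase \<omega> r * Pif a' \<xi>' r" by (simp add: Pif_def algebra_simps)
  finally show ?thesis .
qed

lemma frobenius_expansion_of_ev: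
  assumes "conv_ge r V" "conv_ge r W" "0 < r0" "r0 \<le> r"
    and f: "\<And>z. 0 < z \<Longrightarrow> z < r0 \<Longrightarrow> f z = ev V z + of_real (ln z) * ev W z"
  shows "frobenius_coeff f n = fps_nth V n"
proof -
  define c where "c k = fps_nth (if k = 0 then V else W)" for k :: nat
  have "has_frobenius_expansion f c"
    unfolding has_frobenius_expansion_def
  proof (rule exI[of _ 1], rule exI[of _ r0], intro conjI ballI allI impI)
    fix z assume z: "z \<in> {0<..<r0}"
    have *: "ereal (norm (complex_of_real z)) < fps_conv_radius U" if "conv_ge r U" for U
      using that z assms(4) by (auto simp: conv_ge_def intro: less_le_trans[of _ "ereal r"])
    show "summable (\<lambda>n. c k n * of_real (z ^ n))" for k
      using summable_fps[OF *[OF assms(1)]] summable_fps[OF *[OF assms(2)]] by (simp add: c_def)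
    have "f z = ev V z + of_real (ln z) * ev W z" using z by (intro f) auto
    then show "f z = (\<Sum>k\<le>1. of_real (ln z ^ k) * (\<Sum>n. c k n * of_real (z ^ n)))"
      by (simp add: c_def ev_def eval_fps_def)
  qed (use assms in auto)
  then show ?thesis by (simp add: frobenius_coeff_eq c_def)
qed

text \<open>The given solution is compared with a combination of two series solutions, one carrying
  its boundary values with \<open>lam = 0\<close>, the other with zero boundary values and
  \<open>lam = 1\<close>. Matching \<open>Pif\<close> at one point makes the difference vanish by
  uniqueness, so the Frobenius expansion of the given \<open>a\<close> is that of the
  combination.\<close>

lemma frobenius_coeffs_via_flux:
  obtains r C where "0 < r" "r < z0" "0 \<le> C"
    "\<And>\<omega> a \<zeta> \<xi> a' \<zeta>' \<xi>' a0 \<zeta>0 \<xi>0. \<bar>\<omega>\<bar> \<le> 1 \<Longrightarrow> C * \<omega>\<^sup>2 \<le> 1 / 2 \<Longrightarrow> psol \<omega> z0 a \<zeta> \<xi> a' \<zeta>' \<xi>' \<Longrightarrow>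
      (a \<longlongrightarrow> a0) (at_right 0) \<Longrightarrow> (\<zeta> \<longlongrightarrow> \<zeta>0) (at_right 0) \<Longrightarrow> (\<xi> \<longlongrightarrow> \<xi>0) (at_right 0) \<Longrightarrow>
      frobenius_coeff a 0 = a0 \<and>
      norm (of_nat (N + 1) * frobenius_coeff a (N + 1) - Pif a' \<xi>' r) \<le> 4 * C * \<omega>\<^sup>2 * (norm a0 + norm \<zeta>0 + norm \<xi>0 + norm (Pif a' \<xi>' r))"
proof -
  obtain ru where ru: "0 < ru" "ru \<le> z0 / 2" and uniq: "\<And>\<omega> r0 r a \<zeta> \<xi> a' \<zeta>' \<xi>' S z. \<bar>\<omega>\<bar> \<le> 1 \<Longrightarrow> 0 < r0 \<Longrightarrow> r0 < r \<Longrightarrow> r \<le> ru \<Longrightarrow> psol \<omega> r a \<zeta> \<xi> a' \<zeta>' \<xi>' \<Longrightarrow>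
      (\<And>z. 0 < z \<Longrightarrow> z \<le> r0 \<Longrightarrow> norm (a z) \<le> S \<and> norm (\<zeta> z) \<le> S \<and> norm (\<xi> z) \<le> S) \<Longrightarrow>
      (a \<longlongrightarrow> 0) (at_right 0) \<Longrightarrow> (\<zeta> \<longlongrightarrow> 0) (at_right 0) \<Longrightarrow> (\<xi> \<longlongrightarrow> 0) (at_right 0) \<Longrightarrow>
      Pif a' \<xi>' r0 = 0 \<Longrightarrow> 0 < z \<Longrightarrow> z < r0 \<Longrightarrow> a z = 0"
    by (rule psol_unique_near_0) blast
  obtain r C where r: "0 < r" "r \<le> ru" "r \<le> z0 / 2" and C: "0 \<le> C" and ser: "\<And>\<omega> a0 \<zeta>0 \<xi>0 lam. \<bar>\<omega>\<bar> \<le> 1 \<Longrightarrow> \<exists>a \<zeta> \<xi> a' \<zeta>' \<xi>' V W. psol \<omega> r a \<zeta> \<xi> a' \<zeta>' \<xi>' \<and>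
      (a \<longlongrightarrow> a0) (at_right 0) \<and> (\<zeta> \<longlongrightarrow> \<zeta>0) (at_right 0) \<and> (\<xi> \<longlongrightarrow> \<xi>0) (at_right 0) \<and>
      conv_ge r V \<and> conv_ge r W \<and> (\<forall>z. 0 < z \<longrightarrow> z < r \<longrightarrow> a z = ev V z + of_real (ln z) * ev W z) \<and>
      fps_nth V 0 = a0 \<and>
      norm (of_nat (N + 1) * fps_nth V (N + 1) - lam) \<le> C * \<omega>\<^sup>2 * (norm a0 + norm \<zeta>0 + norm \<xi>0 + norm lam) \<and>
      norm (Pif a' \<xi>' (r / 2) - lam) \<le> C * \<omega>\<^sup>2 * (norm a0 + norm \<zeta>0 + norm \<xi>0 + norm lam)"
    by (rule series_solution[OF ru(1)]) blast
  define r0 where "r0 = r / 2"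
  have r0: "0 < r0" "r0 < r" "r0 < z0" using r z0 by (auto simp: r0_def)
  show ?thesis
  proof (rule that[OF r0(1,3) C])
    fix \<omega> a0 \<zeta>0 \<xi>0 and a \<zeta> \<xi> a' \<zeta>' \<xi>' :: "real \<Rightarrow> complex"
    assume om: "\<bar>\<omega>\<bar> \<le> 1" and Com: "C * \<omega>\<^sup>2 \<le> 1 / 2" and ps: "psol \<omega> z0 a \<zeta> \<xi> a' \<zeta>' \<xi>'"
      and lim: "(a \<longlongrightarrow> a0) (at_right 0)" "(\<zeta> \<longlongrightarrow> \<zeta>0) (at_right 0)" "(\<xi> \<longlongrightarrow> \<xi>0) (at_right 0)"
    define D where "D = norm a0 + norm \<zeta>0 + norm \<xi>0"
    obtain u v w u' v' w' V W where s1: "psol \<omega> r u v w u' v' w'"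
      and l1: "(u \<longlongrightarrow> a0) (at_right 0)" "(v \<longlongrightarrow> \<zeta>0) (at_right 0)" "(w \<longlongrightarrow> \<xi>0) (at_right 0)"
      and c1: "conv_ge r V" "conv_ge r W" and e1: "\<And>z. 0 < z \<Longrightarrow> z < r \<Longrightarrow> u z = ev V z + of_real (ln z) * ev W z"
      and V0: "fps_nth V 0 = a0"
      and Vn: "norm (of_nat (N + 1) * fps_nth V (N + 1) - 0) \<le> C * \<omega>\<^sup>2 * (norm a0 + norm \<zeta>0 + norm \<xi>0 + norm (0 :: complex))"
      and P1: "norm (Pif u' w' (r / 2) - 0) \<le> C * \<omega>\<^sup>2 * (norm a0 + norm \<zeta>0 + norm \<xi>0 + norm (0 :: complex))"
      using ser[OF om, of a0 \<zeta>0 \<xi>0 0] by blast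
    obtain u2 v2 w2 u2' v2' w2' V2 W2 where s2: "psol \<omega> r u2 v2 w2 u2' v2' w2'"
      and l2: "(u2 \<longlongrightarrow> 0) (at_right 0)" "(v2 \<longlongrightarrow> 0) (at_right 0)" "(w2 \<longlongrightarrow> 0) (at_right 0)"
      and c2: "conv_ge r V2" "conv_ge r W2" and e2: "\<And>z. 0 < z \<Longrightarrow> z < r \<Longrightarrow> u2 z = ev V2 z + of_real (ln z) * ev W2 z"
      and V20: "fps_nth V2 0 = 0"
      and V2n: "norm (of_nat (N + 1) * fps_nth V2 (N + 1) - 1) \<le> C * \<omega>\<^sup>2 * (norm (0 :: complex) + norm (0 :: complex) + norm (0 :: complex) + norm (1 :: complex))"
      and P2: "norm (Pif u2' w2' (r / 2) - 1) \<le> C * \<omega>\<^sup>2 * (norm (0 :: complex) + norm (0 :: complex) + norm (0 :: complex) + norm (1 :: complex))"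
      using ser[OF om, of 0 0 0 1] by blast
    have Vn': "norm (of_nat (N + 1) * fps_nth V (N + 1)) \<le> C * \<omega>\<^sup>2 * D" and P1': "norm (Pif u' w' r0) \<le> C * \<omega>\<^sup>2 * D"
      and V2n': "norm (of_nat (N + 1) * fps_nth V2 (N + 1) - 1) \<le> C * \<omega>\<^sup>2" and P2': "norm (Pif u2' w2' r0 - 1) \<le> C * \<omega>\<^sup>2"
      using Vn P1 V2n P2 by (simp_all add: D_def r0_def)
    define P where "P = Pif a' \<xi>' r0"
    have nz: "norm (Pif u2' w2' r0) \<ge> 1 / 2"
      using norm_triangle_ineq3[of "Pif u2' w2' r0" 1] P2' Com by simp
    then have nz0: "Pif u2' w2' r0 \<noteq> 0" by auto
    \<comment> \<open>The amount of the response mode that matches \<open>Pif\<close> at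
      \<open>r0\<close>. The denominator is within \<open>1 / 2\<close> of \<open>1\<close> by the
      smallness of \<open>C * \<omega>^2\<close>.\<close>
    define lam where "lam = (P - Pif u' w' r0) / Pif u2' w2' r0"
    have Plam: "P = Pif u' w' r0 + lam * Pif u2' w2' r0" using nz0 by (simp add: lam_def)
    have d: "psol \<omega> r (\<lambda>z. a z - 1 * u z - lam * u2 z) (\<lambda>z. \<zeta> z - 1 * v z - lam * v2 z) (\<lambda>z. \<xi> z - 1 * w z - lam * w2 z)
       (\<lambda>z. a' z - 1 * u' z - lam * u2' z) (\<lambda>z. \<zeta>' z - 1 * v' z - lam * v2' z) (\<lambda>z. \<xi>' z - 1 * w' z - lam * w2' z)"
      by (rule psol_lin[OF psol_lin[OF psol_mono[OF ps] s1] s2]) (use r z0 in auto)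
    have dl: "((\<lambda>z. a z - 1 * u z - lam * u2 z) \<longlongrightarrow> 0) (at_right 0)"
      "((\<lambda>z. \<zeta> z - 1 * v z - lam * v2 z) \<longlongrightarrow> 0) (at_right 0)"
      "((\<lambda>z. \<xi> z - 1 * w z - lam * w2 z) \<longlongrightarrow> 0) (at_right 0)"
      using tendsto_diff[OF tendsto_diff[OF lim(1) l1(1)] tendsto_mult_left[OF l2(1), of lam]]
        tendsto_diff[OF tendsto_diff[OF lim(2) l1(2)] tendsto_mult_left[OF l2(2), of lam]]
        tendsto_diff[OF tendsto_diff[OF lim(3) l1(3)] tendsto_mult_left[OF l2(3), of lam]] by simp_all
    have ev1: "eventually (\<lambda>z. norm (g z) \<le> 1) (at_right 0)" if "(g \<longlongrightarrow> 0) (at_right 0)" for g :: "real \<Rightarrow> complex"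
      using tendstoD[OF that, of 1] by (auto elim: eventually_mono)
    obtain S1 where S1: "\<And>z. 0 < z \<Longrightarrow> z \<le> r0 \<Longrightarrow> norm (a z - 1 * u z - lam * u2 z) \<le> S1"
      by (rule tendsto_bounded_initial_segment[OF psol_isCont(1)[OF d] ev1[OF dl(1)] r0(1,2)]) auto
    obtain S2 where S2: "\<And>z. 0 < z \<Longrightarrow> z \<le> r0 \<Longrightarrow> norm (\<zeta> z - 1 * v z - lam * v2 z) \<le> S2"
      by (rule tendsto_bounded_initial_segment[OF psol_isCont(2)[OF d] ev1[OF dl(2)] r0(1,2)]) auto
    obtain S3 where S3: "\<And>z. 0 < z \<Longrightarrow> z \<le> r0 \<Longrightarrow> norm (\<xi> z - 1 * w z - lam * w2 z) \<le> S3"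
      by (rule tendsto_bounded_initial_segment[OF psol_isCont(3)[OF d] ev1[OF dl(3)] r0(1,2)]) auto
    have S: "norm (a z - 1 * u z - lam * u2 z) \<le> max S1 (max S2 S3) \<and> norm (\<zeta> z - 1 * v z - lam * v2 z) \<le> max S1 (max S2 S3)
        \<and> norm (\<xi> z - 1 * w z - lam * w2 z) \<le> max S1 (max S2 S3)" if "0 < z" "z \<le> r0" for z
      using S1[OF that] S2[OF that] S3[OF that] by (simp add: le_max_iff_disj)
    have Pi0: "Pif (\<lambda>z. a' z - 1 * u' z - lam * u2' z) (\<lambda>z. \<xi>' z - 1 * w' z - lam * w2' z) r0 = 0"
      unfolding Pif_lin[of "\<lambda>z. a' z - 1 * u' z"] Pif_lin[of a' 1] using Plam by (simp add: P_def)
    have az: "a z = u z + lam * u2 z" if "0 < z" "z < r0" for z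
      using uniq[OF om r0(1,2) r(2) d S dl Pi0 that] by (simp add: algebra_simps)
    have "frobenius_coeff a n = fps_nth (V + fps_const lam * V2) n" for n
    proof (rule frobenius_expansion_of_ev[of r _ "W + fps_const lam * W2" r0])
      fix z assume z: "0 < z" "z < r0"
      then have z': "0 < z" "z < r" using r0 by auto
      show "a z = ev (V + fps_const lam * V2) z + of_real (ln z) * ev (W + fps_const lam * W2) z"
        unfolding az[OF z] e1[OF z'] e2[OF z'] using c1 c2 by (simp add: ev_simps[OF z'] algebra_simps)
    qed (use c1 c2 r0 in auto)
    then have an: "frobenius_coeff a n = fps_nth V n + lam * fps_nth V2 n" for n by simp
    have lam: "norm lam \<le> 2 * norm P + D"
    proof -
      have "norm lam = norm (P - Pif u' w' r0) / norm (Pif u2' w2' r0)" by (simp add: lam_def norm_divide)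
      also have "\<dots> \<le> (norm P + C * \<omega>\<^sup>2 * D) / (1 / 2)"
      proof (rule frac_le)
        show "norm (P - Pif u' w' r0) \<le> norm P + C * \<omega>\<^sup>2 * D"
          using P1' norm_triangle_ineq4[of P "Pif u' w' r0"] by linarith
        then show "0 \<le> norm P + C * \<omega>\<^sup>2 * D" using norm_ge_zero order_trans by blast
      qed (use nz in auto)
      also have "C * \<omega>\<^sup>2 * D \<le> 1 / 2 * D" using Com by (intro mult_right_mono) (auto simp: D_def)
      finally show ?thesis by simp
    qed
    have "of_nat (N + 1) * frobenius_coeff a (N + 1) - P
        = (of_nat (N + 1) * fps_nth V (N + 1) - Pif u' w' r0)
          + lam * ((of_nat (N + 1) * fps_nth V2 (N + 1) - 1) - (Pif u2' w2' r0 - 1))"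
      unfolding an Plam by (simp add: algebra_simps)
    also have "norm \<dots> \<le> (C * \<omega>\<^sup>2 * D + C * \<omega>\<^sup>2 * D) + norm lam * (C * \<omega>\<^sup>2 + C * \<omega>\<^sup>2)"
    proof (rule norm_triangle_mono)
      show "norm (of_nat (N + 1) * fps_nth V (N + 1) - Pif u' w' r0) \<le> C * \<omega>\<^sup>2 * D + C * \<omega>\<^sup>2 * D"
        by (rule order_trans[OF norm_triangle_ineq4 add_mono[OF Vn' P1']])
      show "norm (lam * ((of_nat (N + 1) * fps_nth V2 (N + 1) - 1) - (Pif u2' w2' r0 - 1))) \<le> norm lam * (C * \<omega>\<^sup>2 + C * \<omega>\<^sup>2)"
        unfolding norm_mult[of lam] by (intro mult_left_mono order_trans[OF norm_triangle_ineq4 add_mono[OF V2n' P2']]) simp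
    qed
    also have "\<dots> = 2 * C * \<omega>\<^sup>2 * (D + norm lam)" by (simp add: algebra_simps)
    also have "\<dots> \<le> 2 * C * \<omega>\<^sup>2 * (D + (2 * norm P + D))"
      using lam C by (intro mult_left_mono add_left_mono) auto
    also have "\<dots> = 4 * C * \<omega>\<^sup>2 * (D + norm P)" by (simp add: algebra_simps)
    finally have "norm (of_nat (N + 1) * frobenius_coeff a (N + 1) - P) \<le> 4 * C * \<omega>\<^sup>2 * (D + norm P)" .
    moreover have "frobenius_coeff a 0 = a0" by (simp add: an V0 V20)
    ultimately show "frobenius_coeff a 0 = a0 \<and>
      norm (of_nat (N + 1) * frobenius_coeff a (N + 1) - Pif a' \<xi>' r0) \<le> 4 * C * \<omega>\<^sup>2 * (norm a0 + norm \<zeta>0 + norm \<xi>0 + norm (Pif a' \<xi>' r0))"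
      by (simp add: D_def P_def)
  qed
qed

section \<open>The conductivity\<close>

definition Dn :: real where "Dn = al * ga + 2 * a1 * c1\<^sup>2 * z0"

text \<open>The limit in the form in which it arises: the direct term from the flux of
  \<open>a\<close> at the horizon, and the contribution of \<xi> there.\<close>

definition sigma0 :: real where "sigma0 = 1 / z0 ^ N + q\<^sup>2 * z0 ^ (N + 3) / Dn"

lemma Dn_pos: "Dn > 0"
  unfolding Dn_def using alga a1 z0 by (intro add_pos_nonneg) auto

text \<open>The exact relations \<open>Bc A Z X = 0\<close> and \<open>c1 * z0 * Z = ga * X\<close>
  form a linear system for \<open>Z\<close> and \<open>X\<close> with determinant \<open>Dn\<close>,
  up to sign; \<open>x0\<close> is the solution for \<open>X\<close> when \<open>A = 1\<close>.
  Inverting the system with errors on the right gives the two bounds.\<close>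

lemma horizon_relations:
  assumes B: "norm (Bc A Z X) \<le> b" and e: "norm (of_real (c1 * z0) * Z - of_real ga * X) \<le> b'"
  defines "x0 \<equiv> - \<i> * of_real (q * c1 * z0 / Dn)"
  shows "norm (X - x0 * A) \<le> (\<bar>c1\<bar> * z0 * b + \<bar>al\<bar> * b') / Dn"
    and "norm (Z - of_real (ga / (c1 * z0)) * (x0 * A)) \<le> (\<bar>ga\<bar> * ((\<bar>c1\<bar> * z0 * b + \<bar>al\<bar> * b') / Dn) + b') / (\<bar>c1\<bar> * z0)"
proof -
  define u where "u = of_real (c1 * z0) * Z - of_real ga * X"
  have Dn: "complex_of_real Dn \<noteq> 0" using Dn_pos by simp
  have cz: "complex_of_real (c1 * z0) \<noteq> 0" using c1 z0 by simp
  have eq: "of_real Dn * (X - x0 * A) = of_real (c1 * z0) * Bc A Z X - of_real al * u"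
  proof -
    have "of_real Dn * x0 = - \<i> * of_real (q * c1 * z0)" using Dn by (simp add: x0_def)
    then have "of_real Dn * (X - x0 * A) = of_real Dn * X + \<i> * of_real (q * c1 * z0) * A"
      by (simp add: right_diff_distrib mult.assoc[symmetric])
    also have "\<dots> = of_real (c1 * z0) * Bc A Z X - of_real al * u"
      by (simp add: Dn_def Bc_def u_def algebra_simps power2_eq_square)
    finally show ?thesis .
  qed
  have "Dn * norm (X - x0 * A) = norm (of_real (c1 * z0) * Bc A Z X - of_real al * u)"
    unfolding eq[symmetric] norm_mult norm_of_real using Dn_pos by simp
  also have "\<dots> \<le> \<bar>c1\<bar> * z0 * b + \<bar>al\<bar> * b'"
  proof (rule order_trans[OF norm_triangle_ineq4 add_mono])
    show "norm (of_real (c1 * z0) * Bc A Z X) \<le> \<bar>c1\<bar> * z0 * b"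
      unfolding norm_mult norm_of_real abs_mult using B z0 by (simp add: mult_left_mono)
    show "norm (of_real al * u) \<le> \<bar>al\<bar> * b'"
      unfolding norm_mult norm_of_real u_def using e by (simp add: mult_left_mono)
  qed
  finally show 1: "norm (X - x0 * A) \<le> (\<bar>c1\<bar> * z0 * b + \<bar>al\<bar> * b') / Dn"
    using Dn_pos by (simp add: pos_le_divide_eq mult.commute)
  have "of_real (c1 * z0) * (Z - of_real (ga / (c1 * z0)) * (x0 * A)) = of_real ga * (X - x0 * A) + u"
    using cz by (simp add: u_def algebra_simps)
  then have "norm (of_real (c1 * z0) * (Z - of_real (ga / (c1 * z0)) * (x0 * A))) \<le> norm (of_real ga * (X - x0 * A)) + norm u"
    by (simp only: norm_triangle_ineq)
  also have "\<dots> \<le> \<bar>ga\<bar> * ((\<bar>c1\<bar> * z0 * b + \<bar>al\<bar> * b') / Dn) + b'"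
    unfolding norm_mult norm_of_real u_def using 1 e by (intro add_mono mult_left_mono) auto
  finally have "\<bar>c1\<bar> * z0 * norm (Z - of_real (ga / (c1 * z0)) * (x0 * A)) \<le> \<bar>ga\<bar> * ((\<bar>c1\<bar> * z0 * b + \<bar>al\<bar> * b') / Dn) + b'"
    unfolding norm_mult norm_of_real abs_mult using z0 by simp
  then show "norm (Z - of_real (ga / (c1 * z0)) * (x0 * A)) \<le> (\<bar>ga\<bar> * ((\<bar>c1\<bar> * z0 * b + \<bar>al\<bar> * b') / Dn) + b') / (\<bar>c1\<bar> * z0)"
    using c1 z0 by (simp add: pos_le_divide_eq mult_ac)
qed

text \<open>All errors are first bounded by \<open>\<bar>\<omega>\<bar> * \<eta> * M\<close>. They
  become relative to the source because near constancy and the horizon relations bound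
  \<open>M\<close> by a multiple of the norm of \<open>a\<close> at the boundary; division by
  \<open>\<omega>\<close> and by the source is then harmless.\<close>

lemma conductivity_estimate:
  assumes "\<epsilon> > 0"
  shows "\<exists>\<delta>>0. \<forall>\<omega> a \<zeta> \<xi> a' \<zeta>' \<xi>'. \<omega> \<noteq> 0 \<longrightarrow> \<bar>\<omega>\<bar> < \<delta> \<longrightarrow> psol \<omega> z0 a \<zeta> \<xi> a' \<zeta>' \<xi>' \<longrightarrow>
    ingoing z0 F \<omega> a \<longrightarrow> ingoing z0 F \<omega> \<zeta> \<longrightarrow> ingoing z0 F \<omega> \<xi> \<longrightarrow> no_scalar_source \<zeta> \<xi> \<longrightarrow>
    frobenius_coeff a 0 \<noteq> 0 \<longrightarrow>
    norm (of_nat (N + 1) * frobenius_coeff a (N + 1) / (\<i> * of_real \<omega> * frobenius_coeff a 0) - of_real sigma0) \<le> \<epsilon>"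
proof -
  obtain r C where r: "0 < r" "r < z0" and C: "0 \<le> C" and frob: "\<And>\<omega> a \<zeta> \<xi> a' \<zeta>' \<xi>' a0 \<zeta>0 \<xi>0. \<bar>\<omega>\<bar> \<le> 1 \<Longrightarrow> C * \<omega>\<^sup>2 \<le> 1 / 2 \<Longrightarrow> psol \<omega> z0 a \<zeta> \<xi> a' \<zeta>' \<xi>' \<Longrightarrow>
      (a \<longlongrightarrow> a0) (at_right 0) \<Longrightarrow> (\<zeta> \<longlongrightarrow> \<zeta>0) (at_right 0) \<Longrightarrow> (\<xi> \<longlongrightarrow> \<xi>0) (at_right 0) \<Longrightarrow>
      frobenius_coeff a 0 = a0 \<and>
      norm (of_nat (N + 1) * frobenius_coeff a (N + 1) - Pif a' \<xi>' r) \<le> 4 * C * \<omega>\<^sup>2 * (norm a0 + norm \<zeta>0 + norm \<xi>0 + norm (Pif a' \<xi>' r))"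
    by (rule frobenius_coeffs_via_flux) blast
  \<comment> \<open>\<open>x0\<close> and \<open>y0\<close> are the limiting ratios of the horizon
    values of \<xi> and \<zeta> to that of \<open>a\<close>. \<open>K2\<close> to \<open>K4\<close>
    belong to the vanishing of \<open>Bc\<close>, the scalar relation and the conserved flux;
    \<open>K8\<close> and \<open>K9\<close> to the approximation of these ratios; \<open>K10\<close>
    to the comparison of \<open>M\<close> with the source; \<open>K11\<close> collects the total
    error.\<close>
  define x0 where "x0 = - \<i> * of_real (q * c1 * z0 / Dn)"
  define y0 where "y0 = of_real (ga / (c1 * z0)) * x0"
  define K2 where "K2 = real (N + 3) * (CQ / z0 ^ (N + 3) + KB)"
  define K3 where "K3 = \<bar>c1\<bar> * real (N + 3) * z0 + \<bar>ga\<bar> * real (N + 2)"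
  define K4 where "K4 = (real N / r ^ (N + 1) + norm rr * (real (N + 2) * z0 ^ (N + 1))) * z0 + 1 / r ^ N + norm rr * z0 ^ (N + 2)"
  define K6 where "K6 = 1 / z0 ^ N + norm rr * z0 ^ (N + 2)"
  define K7 where "K7 = 4 * C * (3 + (K6 + K4)) + \<bar>tort r\<bar> * (K6 + K4) + K4"
  define K8 where "K8 = (\<bar>c1\<bar> * z0 * K2 + \<bar>al\<bar> * K3) / Dn"
  define K9 where "K9 = (\<bar>ga\<bar> * K8 + K3) / (\<bar>c1\<bar> * z0)"
  define K10 where "K10 = 1 + norm y0 + norm x0"
  define K11 where "K11 = K7 + norm rr * z0 ^ (N + 2) * K8 + \<bar>sigma0\<bar>"
  have K: "0 \<le> K2" "0 \<le> K3" "0 \<le> K4" "0 \<le> K6" "0 \<le> K7" "0 \<le> K8" "0 \<le> K9" "1 \<le> K10" "0 \<le> K11"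
  proof -
    show 2: "0 \<le> K2" "0 \<le> K3" "0 \<le> K4" "0 \<le> K6"
      unfolding K2_def K3_def K4_def K6_def using consts_nonneg KB_nonneg z0 r by auto
    then show 7: "0 \<le> K7" "0 \<le> K8" unfolding K7_def K8_def using C Dn_pos z0 by auto
    then show "0 \<le> K9" "0 \<le> K11" "1 \<le> K10" unfolding K9_def K11_def K10_def using 2 z0 by auto
  qed
  \<comment> \<open>The second and third entries let multiples of \<open>\<eta> * M\<close> be
    absorbed when \<open>M\<close> is compared with the horizon value and then with the boundary
    value of \<open>a\<close>; the last one makes the final error at most
    \<open>\<epsilon>\<close>.\<close>
  define \<eta> where "\<eta> = min 1 (min (1 / (2 * (K8 + K9 + 3))) (min (1 / (4 * K10)) (\<epsilon> / (4 * K10 * K11 + 1))))"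
  have eta: "0 < \<eta>" "\<eta> \<le> 1" "(K8 + K9 + 3) * \<eta> \<le> 1 / 2" "4 * K10 * \<eta> \<le> 1" "4 * K10 * K11 * \<eta> \<le> \<epsilon>"
  proof -
    have p: "0 < K8 + K9 + 3" "0 < 4 * K10" "0 < 4 * K10 * K11 + 1" using K by (auto intro: add_nonneg_pos)
    then show \<eta>: "0 < \<eta>" "\<eta> \<le> 1" unfolding \<eta>_def using assms by auto
    have "\<eta> \<le> 1 / (2 * (K8 + K9 + 3))" "\<eta> \<le> 1 / (4 * K10)" "\<eta> \<le> \<epsilon> / (4 * K10 * K11 + 1)" by (simp_all add: \<eta>_def)
    then have "\<eta> * (2 * (K8 + K9 + 3)) \<le> 1" "\<eta> * (4 * K10) \<le> 1" "\<eta> * (4 * K10 * K11 + 1) \<le> \<epsilon>"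
      using p by (simp_all only: pos_le_divide_eq zero_less_mult_iff zero_less_numeral simp_thms)
    then show "(K8 + K9 + 3) * \<eta> \<le> 1 / 2" "4 * K10 * \<eta> \<le> 1" "4 * K10 * K11 * \<eta> \<le> \<epsilon>"
      using \<eta> by (auto simp: algebra_simps)
  qed
  obtain \<delta>1 where d1: "\<delta>1 > 0" and near: "\<And>\<omega> M A Z X A' Z' X' z. \<bar>\<omega>\<bar> \<le> \<delta>1 \<Longrightarrow> reg \<omega> M A Z X A' Z' X' \<Longrightarrow> z \<in> {0..z0} \<Longrightarrow>
    norm (A z - A z0) \<le> \<eta> * M \<and> norm (Z z - Z z0) \<le> \<eta> * M \<and> norm (X z - X z0) \<le> \<eta> * M"
    using reg_nearly_constant[OF eta(1)] by blast
  \<comment> \<open>\<open>\<bar>\<omega>\<bar> \<le> \<eta>\<close> turns errors of order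
    \<open>\<omega>^2\<close> into \<open>\<bar>\<omega>\<bar> * \<eta>\<close>; the last entry
    ensures \<open>C * \<omega>^2 \<le> 1 / 2\<close>.\<close>
  define \<delta> where "\<delta> = min \<delta>1 (min \<eta> (1 / (2 * C + 1)))"
  have \<delta>: "\<delta> > 0" using d1 eta(1) C by (simp add: \<delta>_def)
  {
    fix \<omega> and a \<zeta> \<xi> a' \<zeta>' \<xi>' :: "real \<Rightarrow> complex"
    assume om0: "\<omega> \<noteq> 0" and om: "\<bar>\<omega>\<bar> < \<delta>" and ps: "psol \<omega> z0 a \<zeta> \<xi> a' \<zeta>' \<xi>'"
      and ing: "ingoing z0 F \<omega> a" "ingoing z0 F \<omega> \<zeta>" "ingoing z0 F \<omega> \<xi>"
      and src: "no_scalar_source \<zeta> \<xi>" and a0nz: "frobenius_coeff a 0 \<noteq> 0"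
    have om': "\<bar>\<omega>\<bar> \<le> \<delta>1" "\<bar>\<omega>\<bar> \<le> \<eta>" "\<bar>\<omega>\<bar> \<le> 1" "\<bar>\<omega>\<bar> \<le> 1 / (2 * C + 1)"
      using om eta(2) by (auto simp: \<delta>_def)
    have om2: "\<omega>\<^sup>2 \<le> \<bar>\<omega>\<bar> * \<eta>" "C * \<omega>\<^sup>2 \<le> 1 / 2"
    proof -
      have w2: "\<omega>\<^sup>2 = \<bar>\<omega>\<bar> * \<bar>\<omega>\<bar>" by (simp add: power2_eq_square)
      show "\<omega>\<^sup>2 \<le> \<bar>\<omega>\<bar> * \<eta>" unfolding w2 using om' by (intro mult_left_mono) auto
      have "\<omega>\<^sup>2 \<le> \<bar>\<omega>\<bar> * 1" unfolding w2 using om' by (intro mult_left_mono) auto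
      then have "C * \<omega>\<^sup>2 \<le> C * (1 / (2 * C + 1))" using om' C by (intro mult_left_mono) auto
      also have "\<dots> \<le> 1 / 2" using C by (simp add: field_simps)
      finally show "C * \<omega>\<^sup>2 \<le> 1 / 2" .
    qed
    obtain M A Z X y where reg: "reg \<omega> M A Z X (dph \<omega> a a') (dph \<omega> \<zeta> \<zeta>') (dph \<omega> \<xi> \<xi>')"
      and AX: "\<And>z. 0 < z \<Longrightarrow> z < z0 \<Longrightarrow> A z = phase \<omega> z * a z \<and> Z z = phase \<omega> z * \<zeta> z \<and> X z = phase \<omega> z * \<xi> z"
      and y: "y \<in> {0..z0}" and M: "M = norm (A y) + norm (Z y) + norm (X y)"
      and lim: "(a \<longlongrightarrow> A 0) (at_right 0)" "(\<zeta> \<longlongrightarrow> Z 0) (at_right 0)" "(\<xi> \<longlongrightarrow> X 0) (at_right 0)"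
      by (rule reg_of_psol[OF om'(3) ps ing src]) blast
    note nr = near[OF om'(1) reg]
    have M0: "M \<ge> 0" by (rule reg_M[OF reg])
    have eM: "0 \<le> \<eta> * M" using eta(1) M0 by simp
    have le0: "norm (A 0) \<le> M" "norm (Z 0) \<le> M" "norm (X 0) \<le> M" using reg_le[OF reg, of 0] z0 by auto
    have leh: "norm (A z0) \<le> M" "norm (Z z0) \<le> M" "norm (X z0) \<le> M" using reg_le[OF reg, of z0] z0 by auto
    define an where "an = of_nat (N + 1) * frobenius_coeff a (N + 1)"
    define P where "P = Pif a' \<xi>' r"
    define s1 where "s1 = of_real (1 / z0 ^ N) * A z0 + rr * (of_real (z0 ^ (N + 2)) * X z0)"
    have f0: "frobenius_coeff a 0 = A 0" and an: "norm (an - P) \<le> 4 * C * \<omega>\<^sup>2 * (norm (A 0) + norm (Z 0) + norm (X 0) + norm P)"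
      using frob[OF om'(3) om2(2) ps lim] by (simp_all add: an_def P_def)
    have fc: "norm (phase \<omega> r * P - \<i> * of_real \<omega> * s1) \<le> K4 * (\<bar>\<omega>\<bar> * (\<eta> * M))"
      using near_flux_const[OF reg nr r] flux_const_phase[of r A \<omega> a X \<xi> a' \<xi>'] AX[OF r] r
      by (simp add: K4_def s1_def P_def)
    have s1: "norm s1 \<le> K6 * M"
    proof -
      have "norm s1 \<le> norm (of_real (1 / z0 ^ N) * A z0) + norm (rr * (of_real (z0 ^ (N + 2)) * X z0))"
        unfolding s1_def by (rule norm_triangle_ineq)
      also have "\<dots> = 1 / z0 ^ N * norm (A z0) + norm rr * (z0 ^ (N + 2) * norm (X z0))"
        unfolding norm_mult norm_of_real using z0 by (simp add: abs_mult)
      also have "\<dots> \<le> 1 / z0 ^ N * M + norm rr * (z0 ^ (N + 2) * M)"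
        using leh z0 by (intro add_mono mult_left_mono) auto
      finally show ?thesis by (simp add: K6_def algebra_simps)
    qed
    have w_abs: "norm (\<i> * of_real \<omega> * v) = \<bar>\<omega>\<bar> * norm v" for v by (simp add: norm_mult)
    have Pn: "norm P \<le> \<bar>\<omega>\<bar> * ((K6 + K4) * M)"
    proof -
      have "norm P = norm (phase \<omega> r * P)" by (simp add: norm_mult)
      also have "\<dots> \<le> norm (\<i> * of_real \<omega> * s1) + K4 * (\<bar>\<omega>\<bar> * (\<eta> * M))"
        using fc norm_triangle_ineq2[of "phase \<omega> r * P" "\<i> * of_real \<omega> * s1"] by linarith
      also have "\<dots> \<le> \<bar>\<omega>\<bar> * (K6 * M) + K4 * (\<bar>\<omega>\<bar> * (1 * M))"
        unfolding w_abs using s1 K eta M0 by (intro add_mono mult_left_mono mult_right_mono) auto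
      finally show ?thesis by (simp add: algebra_simps)
    qed
    \<comment> \<open>Three errors: from the response coefficient to \<open>P\<close>, from
      \<open>P\<close> to its phase-rotated value at the fixed point \<open>r\<close>, and from
      there to the horizon expression.\<close>
    have E1: "norm (an - \<i> * of_real \<omega> * s1) \<le> K7 * (\<bar>\<omega>\<bar> * (\<eta> * M))"
    proof -
      have "4 * C * \<omega>\<^sup>2 * (norm (A 0) + norm (Z 0) + norm (X 0) + norm P) \<le> 4 * C * (\<bar>\<omega>\<bar> * \<eta>) * (M + M + M + 1 * ((K6 + K4) * M))"
        using C om2 le0 K M0 om' eta Pn
        by (intro mult_mono mult_left_mono add_mono order_trans[OF Pn mult_right_mono]) auto
      then have 1: "norm (an - P) \<le> 4 * C * (\<bar>\<omega>\<bar> * \<eta>) * (M + M + M + 1 * ((K6 + K4) * M))" using an by linarith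
      have "norm ((1 - phase \<omega> r) * P) \<le> (\<bar>\<omega>\<bar> * \<bar>tort r\<bar>) * (\<eta> * ((K6 + K4) * M))"
        unfolding norm_mult using norm_phase_minus_1_le[of \<omega> r] om' K M0
        by (intro mult_mono order_trans[OF Pn mult_right_mono]) (auto simp: norm_minus_commute)
      then have "norm (an - \<i> * of_real \<omega> * s1) \<le> 4 * C * (\<bar>\<omega>\<bar> * \<eta>) * (M + M + M + 1 * ((K6 + K4) * M))
          + ((\<bar>\<omega>\<bar> * \<bar>tort r\<bar>) * (\<eta> * ((K6 + K4) * M)) + K4 * (\<bar>\<omega>\<bar> * (\<eta> * M)))"
      proof -
        assume 2: "norm ((1 - phase \<omega> r) * P) \<le> (\<bar>\<omega>\<bar> * \<bar>tort r\<bar>) * (\<eta> * ((K6 + K4) * M))"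
        have eq: "an - \<i> * of_real \<omega> * s1 = (an - P) + ((1 - phase \<omega> r) * P + (phase \<omega> r * P - \<i> * of_real \<omega> * s1))"
          by (simp add: algebra_simps)
        show ?thesis unfolding eq by (rule norm_triangle_mono[OF 1 norm_triangle_mono[OF 2 fc]])
      qed
      also have "\<dots> = K7 * (\<bar>\<omega>\<bar> * (\<eta> * M))" unfolding K7_def by (simp add: algebra_simps)
      finally show ?thesis .
    qed
    have B: "norm (Bc (A z0) (Z z0) (X z0)) \<le> K2 * (\<eta> * M)"
    proof -
      have "CQ / z0 ^ (N + 3) * \<bar>\<omega>\<bar> * M \<le> CQ / z0 ^ (N + 3) * \<eta> * M"
        using om' consts_nonneg z0 M0 by (intro mult_right_mono mult_left_mono) auto
      then have "real (N + 3) * (CQ / z0 ^ (N + 3) * \<bar>\<omega>\<bar> * M + KB * (\<eta> * M)) \<le> real (N + 3) * (CQ / z0 ^ (N + 3) * \<eta> * M + KB * (\<eta> * M))"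
        by (intro mult_left_mono add_right_mono) auto
      also have "\<dots> = K2 * (\<eta> * M)" unfolding K2_def by (simp only: ring_distribs mult_ac)
      finally show ?thesis using near_Bc[OF reg nr] by linarith
    qed
    have e3: "norm (of_real (c1 * z0) * Z z0 - of_real ga * X z0) \<le> K3 * (\<eta> * M)"
      unfolding K3_def by (rule near_axions[OF reg nr om0])
    have X: "norm (X z0 - x0 * A z0) \<le> K8 * (\<eta> * M)"
      using horizon_relations(1)[OF B e3] unfolding K8_def x0_def by (rule order_trans) (simp add: algebra_simps)
    have Z: "norm (Z z0 - y0 * A z0) \<le> K9 * (\<eta> * M)"
    proof -
      have "(\<bar>c1\<bar> * z0 * (K2 * (\<eta> * M)) + \<bar>al\<bar> * (K3 * (\<eta> * M))) / Dn = K8 * (\<eta> * M)"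
        unfolding K8_def by (simp add: algebra_simps)
      then have "norm (Z z0 - y0 * A z0) \<le> (\<bar>ga\<bar> * (K8 * (\<eta> * M)) + K3 * (\<eta> * M)) / (\<bar>c1\<bar> * z0)"
        using horizon_relations(2)[OF B e3] unfolding y0_def x0_def by (simp only: mult.assoc)
      also have "\<dots> = K9 * (\<eta> * M)" unfolding K9_def by (simp add: algebra_simps)
      finally show ?thesis .
    qed
    \<comment> \<open>At the point \<open>y\<close> where \<open>M\<close> is attained, all three
      functions are close to their horizon values, and those are close to multiples of
      \<open>A z0\<close>; the remainder is at most \<open>M / 2\<close>.\<close>
    have MA: "M \<le> 2 * K10 * norm (A z0)"
    proof -
      have t: "norm u \<le> norm v + b" if "norm (u - v) \<le> b" for u v :: complex and b
        using that norm_triangle_ineq2[of u v] by linarith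
      have "norm (X z0) \<le> norm (x0 * A z0) + K8 * (\<eta> * M)" "norm (Z z0) \<le> norm (y0 * A z0) + K9 * (\<eta> * M)"
        by (rule t, rule X, rule t, rule Z)
      moreover have "norm (A y) \<le> norm (A z0) + \<eta> * M" "norm (Z y) \<le> norm (Z z0) + \<eta> * M" "norm (X y) \<le> norm (X z0) + \<eta> * M"
        using nr[OF y] t by blast+
      ultimately have "M \<le> norm (A z0) + norm (x0 * A z0) + norm (y0 * A z0) + (K8 * (\<eta> * M) + K9 * (\<eta> * M) + 3 * (\<eta> * M))"
        unfolding M by linarith
      also have "\<dots> = K10 * norm (A z0) + (K8 + K9 + 3) * \<eta> * M"
        unfolding K10_def norm_mult by (simp add: algebra_simps)
      also have "\<dots> \<le> K10 * norm (A z0) + 1 / 2 * M"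
        using eta(3) M0 by (intro add_left_mono mult_right_mono) auto
      finally show ?thesis by simp
    qed
    have A0: "norm (A 0 - A z0) \<le> \<eta> * M" using nr[of 0] z0 by simp
    have MA0: "M \<le> 4 * K10 * norm (A 0)"
    proof -
      have "norm (A z0) \<le> norm (A 0) + \<eta> * M"
        using A0 norm_triangle_ineq2[of "A z0" "A 0"] by (simp add: norm_minus_commute)
      then have "2 * K10 * norm (A z0) \<le> 2 * K10 * (norm (A 0) + \<eta> * M)" using K by (intro mult_left_mono) auto
      then have "M \<le> 2 * K10 * norm (A 0) + 2 * K10 * \<eta> * M" using MA by (simp add: algebra_simps)
      moreover have "2 * K10 * \<eta> * M \<le> 1 / 2 * M" using eta(4) M0 by (intro mult_right_mono) auto
      ultimately show ?thesis by simp
    qed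
    have s1s: "norm (s1 - of_real sigma0 * A 0) \<le> (norm rr * z0 ^ (N + 2) * K8 + \<bar>sigma0\<bar>) * (\<eta> * M)"
    proof -
      \<comment> \<open>The factors \<open>\<i>\<close> of \<open>rr\<close> and
        \<open>- \<i>\<close> of \<open>x0\<close> multiply to \<open>1\<close>, so the scalars add
        a real nonnegative term to the conductivity.\<close>
      have "rr * of_real (z0 ^ (N + 2)) * x0 = of_real (q\<^sup>2 * z0 ^ (N + 3) / Dn)"
      proof -
        have "(\<i> * of_real s) * of_real w * (- \<i> * of_real t) = of_real (s * w * t)" for s w t :: real
          by (simp add: complex_eq_iff)
        then have "rr * of_real (z0 ^ (N + 2)) * x0 = of_real (q / c1 * z0 ^ (N + 2) * (q * c1 * z0 / Dn))"
          unfolding rr_def x0_def by blast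
        also have "q / c1 * z0 ^ (N + 2) * (q * c1 * z0 / Dn) = q\<^sup>2 * z0 ^ (N + 3) / Dn"
          using c1 by (simp add: power2_eq_square eval_nat_numeral)
        finally show ?thesis .
      qed
      then have sg: "of_real sigma0 = of_real (1 / z0 ^ N) + rr * of_real (z0 ^ (N + 2)) * x0"
        unfolding sigma0_def by simp
      have "s1 - of_real sigma0 * A 0 = rr * of_real (z0 ^ (N + 2)) * (X z0 - x0 * A z0) - of_real sigma0 * (A 0 - A z0)"
      proof -
        have "of_real sigma0 * A z0 = of_real (1 / z0 ^ N) * A z0 + rr * of_real (z0 ^ (N + 2)) * x0 * A z0"
          unfolding sg by (simp add: distrib_right)
        then show ?thesis unfolding s1_def by (simp add: algebra_simps)
      qed
      then have "norm (s1 - of_real sigma0 * A 0) \<le> norm (rr * of_real (z0 ^ (N + 2)) * (X z0 - x0 * A z0)) + norm (of_real sigma0 * (A 0 - A z0))"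
        by (simp only: norm_triangle_ineq4)
      also have "\<dots> \<le> norm rr * z0 ^ (N + 2) * (K8 * (\<eta> * M)) + \<bar>sigma0\<bar> * (\<eta> * M)"
      proof (rule add_mono)
        show "norm (rr * of_real (z0 ^ (N + 2)) * (X z0 - x0 * A z0)) \<le> norm rr * z0 ^ (N + 2) * (K8 * (\<eta> * M))"
          unfolding norm_mult norm_of_real using X z0 by (intro mult_mono) (auto simp: abs_mult)
        show "norm (of_real sigma0 * (A 0 - A z0)) \<le> \<bar>sigma0\<bar> * (\<eta> * M)"
          unfolding norm_mult norm_of_real using A0 by (intro mult_left_mono) auto
      qed
      finally show ?thesis by (simp add: algebra_simps)
    qed
    have "norm (an - \<i> * of_real \<omega> * (of_real sigma0 * A 0)) \<le> K7 * (\<bar>\<omega>\<bar> * (\<eta> * M)) + \<bar>\<omega>\<bar> * ((norm rr * z0 ^ (N + 2) * K8 + \<bar>sigma0\<bar>) * (\<eta> * M))"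
    proof -
      have eq: "an - \<i> * of_real \<omega> * (of_real sigma0 * A 0) = (an - \<i> * of_real \<omega> * s1) + \<i> * of_real \<omega> * (s1 - of_real sigma0 * A 0)"
        by (simp add: algebra_simps)
      have "norm (\<i> * of_real \<omega> * (s1 - of_real sigma0 * A 0)) \<le> \<bar>\<omega>\<bar> * ((norm rr * z0 ^ (N + 2) * K8 + \<bar>sigma0\<bar>) * (\<eta> * M))"
        unfolding w_abs using s1s by (intro mult_left_mono) auto
      then show ?thesis unfolding eq by (rule norm_triangle_mono[OF E1])
    qed
    also have "\<dots> = \<bar>\<omega>\<bar> * (K11 * \<eta> * M)" unfolding K11_def by (simp add: algebra_simps)
    also have "\<dots> \<le> \<bar>\<omega>\<bar> * (K11 * \<eta> * (4 * K10 * norm (A 0)))"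
      using MA0 K eta(1) by (intro mult_left_mono) auto
    also have "\<dots> = \<bar>\<omega>\<bar> * norm (A 0) * (4 * K10 * K11 * \<eta>)" by (simp add: algebra_simps)
    also have "\<dots> \<le> \<bar>\<omega>\<bar> * norm (A 0) * \<epsilon>" using eta(5) by (intro mult_left_mono) auto
    finally have fin: "norm (an - \<i> * of_real \<omega> * (of_real sigma0 * A 0)) \<le> \<bar>\<omega>\<bar> * norm (A 0) * \<epsilon>" .
    have Anz: "A 0 \<noteq> 0" using a0nz f0 by simp
    then have "an / (\<i> * of_real \<omega> * A 0) - of_real sigma0 = (an - \<i> * of_real \<omega> * (of_real sigma0 * A 0)) / (\<i> * of_real \<omega> * A 0)"
      using om0 by (simp add: field_simps)
    then have "norm (an / (\<i> * of_real \<omega> * A 0) - of_real sigma0) = norm (an - \<i> * of_real \<omega> * (of_real sigma0 * A 0)) / (\<bar>\<omega>\<bar> * norm (A 0))"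
      by (simp only: norm_divide w_abs)
    also have "\<dots> \<le> \<epsilon>" using fin Anz om0 by (simp add: pos_divide_le_eq mult_ac)
    finally have "norm (an / (\<i> * of_real \<omega> * A 0) - of_real sigma0) \<le> \<epsilon>" .
    then have "norm (of_nat (N + 1) * frobenius_coeff a (N + 1) / (\<i> * of_real \<omega> * frobenius_coeff a 0) - of_real sigma0) \<le> \<epsilon>"
      unfolding an_def f0 .
  }
  then show ?thesis using \<delta> by blast
qed

end

text \<open>\<open>F z / z\<close> is strictly decreasing up to the horizon, where it is
  \<open>0\<close>. Its derivative has the sign of \<open>G = z * F' - F\<close>, a combination in
  which the linear term of \<open>F\<close> cancels, and \<open>G\<close> is negative at
  \<open>z0\<close> because \<open>F'\<close> is.\<close>

lemma blackening_pos:
  fixes z0 b c m0 e :: real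
  assumes z0: "0 < z0" and c: "0 \<le> c" and e: "0 \<le> e"
    and F: "\<And>z. F z = 1 - m0 * z ^ (N + 3) + e * z ^ (2 * N + 4) - b * z - c * z\<^sup>2"
    and F0: "F z0 = 0" and F': "(F has_real_derivative D) (at z0)" "D < 0"
    and z: "0 \<le> z" "z < z0"
  shows "0 < F z"
proof (cases "z = 0")
  case True
  then show ?thesis by (simp add: F power_0_left)
next
  case False
  define G where "G z = - 1 - c * z\<^sup>2 - real (N + 2) * m0 * z ^ (N + 3) + real (2 * N + 3) * e * z ^ (2 * N + 4)" for z
  have Fd: "(F has_real_derivative - (m0 * (real (N + 3) * y ^ (N + 2))) + e * (real (2 * N + 4) * y ^ (2 * N + 3)) - b - c * (2 * y)) (at y)" for y
  proof -
    have "((\<lambda>z. 1 - m0 * z ^ (N + 3) + e * z ^ (2 * N + 4) - b * z - c * z\<^sup>2) has_real_derivative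
        0 - m0 * (real (N + 3) * y ^ (N + 2)) + e * (real (2 * N + 4) * y ^ (2 * N + 3)) - b * 1 - c * (real 2 * y ^ 1)) (at y)"
      by (intro DERIV_diff DERIV_add DERIV_const cmult_power_derivative DERIV_cmult DERIV_ident) auto
    then show ?thesis unfolding F[abs_def] by simp
  qed
  have FG: "y * (- (m0 * (real (N + 3) * y ^ (N + 2))) + e * (real (2 * N + 4) * y ^ (2 * N + 3)) - b - c * (2 * y)) - F y = G y" for y
  proof -
    have "y * y ^ (N + 2) = y ^ (N + 3)" "y * y ^ (2 * N + 3) = y ^ (2 * N + 4)" by (simp_all add: eval_nat_numeral)
    then have "y * (- (m0 * (real (N + 3) * y ^ (N + 2))) + e * (real (2 * N + 4) * y ^ (2 * N + 3)) - b - c * (2 * y))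
        = - (m0 * (real (N + 3) * y ^ (N + 3))) + e * (real (2 * N + 4) * y ^ (2 * N + 4)) - b * y - 2 * c * y\<^sup>2"
      by (simp only: right_diff_distrib distrib_left mult_minus_right mult.left_commute[of y] power2_eq_square) simp
    then show ?thesis unfolding F G_def by (simp add: algebra_simps)
  qed
  have D: "D = - (m0 * (real (N + 3) * z0 ^ (N + 2))) + e * (real (2 * N + 4) * z0 ^ (2 * N + 3)) - b - c * (2 * z0)"
    using F'(1) Fd DERIV_unique by blast
  have "G z0 = z0 * D" using FG[of z0] F0 D by simp
  then have G0: "G z0 < 0" using F'(2) z0 by (simp add: mult_pos_neg)
  have Gneg: "G y < 0" if y: "0 < y" "y \<le> z0" for y
  proof -
    \<comment> \<open>After division by \<open>t ^ (N + 3)\<close> the \<open>m0\<close> term is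
      constant and all the others are nondecreasing in \<open>t\<close>, so the sign of
      \<open>G\<close> at \<open>z0\<close> extends to all smaller points, whatever the sign of
      \<open>m0\<close>.\<close>
    have Gdiv: "G t / t ^ (N + 3) = - (1 / t ^ (N + 3)) - c * (1 / t ^ (N + 1)) - real (N + 2) * m0 + real (2 * N + 3) * e * t ^ (N + 1)" if "0 < t" for t
    proof -
      have 1: "t ^ (N + 3) = t\<^sup>2 * t ^ (N + 1)" "t ^ (2 * N + 4) = t ^ (N + 3) * t ^ (N + 1)"
        by (simp_all add: eval_nat_numeral mult_2 power_add)
      have "c * t\<^sup>2 / t ^ (N + 3) = c * (1 / t ^ (N + 1))" unfolding 1(1) using that by simp
      moreover have "real (2 * N + 3) * e * t ^ (2 * N + 4) / t ^ (N + 3) = real (2 * N + 3) * e * t ^ (N + 1)"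
        unfolding 1(2) using that by simp
      moreover have "real (N + 2) * m0 * t ^ (N + 3) / t ^ (N + 3) = real (N + 2) * m0" using that by simp
      ultimately show ?thesis unfolding G_def by (simp only: diff_divide_distrib add_divide_distrib minus_divide_left)
    qed
    have "G y / y ^ (N + 3) \<le> G z0 / z0 ^ (N + 3)"
      unfolding Gdiv[OF y(1)] Gdiv[OF z0] using y z0 c e
      by (intro add_mono diff_mono mult_left_mono le_imp_neg_le divide_left_mono power_mono order_refl) auto
    also have "\<dots> < 0" using G0 z0 by (simp add: divide_neg_pos)
    finally show ?thesis using y by (simp add: divide_less_0_iff)
  qed
  have "F z / z > F z0 / z0"
  proof (rule DERIV_neg_imp_decreasing[OF z(2)])
    fix y assume y: "z \<le> y" "y \<le> z0"
    then have yp: "0 < y" using z False by simp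
    let ?F' = "- (m0 * (real (N + 3) * y ^ (N + 2))) + e * (real (2 * N + 4) * y ^ (2 * N + 3)) - b - c * (2 * y)"
    have "((\<lambda>z. F z / z) has_real_derivative (?F' * y - F y * 1) / (y * y)) (at y)"
      using yp by (intro DERIV_divide Fd DERIV_ident) auto
    moreover have "?F' * y - F y * 1 = G y" using FG[of y] by (simp only: mult.commute mult_1_right)
    moreover have "G y / (y * y) < 0" using Gneg[OF yp y(2)] yp by (simp add: divide_neg_pos)
    ultimately show "\<exists>d. ((\<lambda>z. F z / z) has_real_derivative d) (at y) \<and> d < 0" by (metis)
  qed
  then show ?thesis using F0 z False by (simp add: zero_less_divide_iff)
qed

section \<open>Translation of the stated system, and the limit\<close>

theorem mainTheorem2:
  fixes d :: nat and z0 \<mu> a1 c1 ah ch m0 :: real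
    and F :: "real \<Rightarrow> real"
    and a \<zeta> \<xi> :: "real \<Rightarrow> real \<Rightarrow> complex"
  assumes "d \<ge> 3" and "z0 > 0" and "\<mu> \<noteq> 0"
    and "a1 > 0" and "c1 \<noteq> 0" and "ah * ch > 0"
    and F_def: "F = blackening d z0 \<mu> a1 c1 ah ch m0"
    and m0: "F z0 = 0"
    and temperature: "deriv F z0 < 0"
    and solutions: "\<forall>\<^sub>F \<omega> in at 0.
          perturbation_solution d z0 \<mu> a1 c1 ah ch F \<omega> (a \<omega>) (\<zeta> \<omega>) (\<xi> \<omega>) \<and>
          ingoing z0 F \<omega> (a \<omega>) \<and> ingoing z0 F \<omega> (\<zeta> \<omega>) \<and> ingoing z0 F \<omega> (\<xi> \<omega>) \<and>
          no_scalar_source (\<zeta> \<omega>) (\<xi> \<omega>) \<and>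
          frobenius_coeff (a \<omega>) 0 \<noteq> 0"
  shows "((\<lambda>\<omega>. conductivity d \<omega> (a \<omega>)) \<longlongrightarrow>
           complex_of_real (1 / z0 ^ (d - 3) *
             (1 + (real d - 2)\<^sup>2 * \<mu>\<^sup>2 / (2 * a1 * c1\<^sup>2 + ah * ch / z0)))) (at 0)"
proof -
  define N where "N = d - 3"
  have d: "d = N + 3" "d - 2 = N + 1" "d - 3 = N" "d - 1 = N + 2" "2 * (d - 1) = 2 * N + 4" using \<open>d \<ge> 3\<close> by (auto simp: N_def)
  have rd: "real d - 2 = real (N + 1)" "real d - 1 = real (N + 2)" using d by simp_all
  define q where "q = real (N + 1) * \<mu> / z0 ^ (N + 1)"
  \<comment> \<open>With these abbreviations \<open>F\<close> becomes a polynomial, whose value at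
    \<open>0\<close> and positivity before \<open>z0\<close> are checked for the interpretation of
    \<open>brane\<close>.\<close>
  define e where "e = real (N + 1) * \<mu>\<^sup>2 / (2 * real (N + 2) * z0 ^ (2 * (N + 1)))"
  define b where "b = ah * ch / real (N + 2)"
  define c where "c = a1 * c1\<^sup>2 / real (N + 1)"
  define p where "p = [:1, - b, - c:] - monom m0 (N + 3) + monom e (2 * N + 4)"
  have Fz: "F z = 1 - m0 * z ^ (N + 3) + e * z ^ (2 * N + 4) - b * z - c * z\<^sup>2" for z
    unfolding F_def blackening_def d(2,5) rd e_def b_def c_def by (simp only: d(1))
  have Fp: "F = poly p"
    by (rule ext) (simp add: Fz p_def poly_monom power2_eq_square algebra_simps)
  have dF: "(F has_real_derivative poly (pderiv p) z0) (at z0)" unfolding Fp by (rule poly_DERIV)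
  then have D: "poly (pderiv p) z0 < 0" using temperature DERIV_imp_deriv by fastforce
  interpret brane N z0 q ah ch a1 c1 p
  proof
    show "poly p 0 = 1" using Fz[of 0] unfolding Fp by (simp add: power_0_left)
    show "0 < poly p z" if "0 \<le> z" "z < z0" for z
      unfolding Fp[symmetric]
      by (rule blackening_pos[where F = F, OF \<open>z0 > 0\<close> _ _ Fz m0 dF D that]) (use \<open>a1 > 0\<close> \<open>z0 > 0\<close> in \<open>auto simp: c_def e_def\<close>)
  qed (use assms D in \<open>auto simp: Fp[symmetric]\<close>)
  have ps: "psol \<omega> z0 A Z X (ddz A) (ddz Z) (ddz X)"
    if "perturbation_solution d z0 \<mu> a1 c1 ah ch F \<omega> A Z X" for \<omega> A Z X
  proof -
    have dif: "g differentiable (at z)" "ddz g differentiable (at z)" if "twice_differentiable_on g {0<..<z0}" "0 < z" "z < z0" for g z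
      using that by (auto simp: twice_differentiable_on_def)
    have tA: "twice_differentiable_on A {0<..<z0}" and tZ: "twice_differentiable_on Z {0<..<z0}" and tX: "twice_differentiable_on X {0<..<z0}"
      using that by (auto simp: perturbation_solution_def)
    have Fne: "poly p z \<noteq> 0" if "0 < z" "z < z0" for z using ppos[of z] that by simp
    have flux: "((\<lambda>x. of_real (k x) * ddz g x) has_vector_derivative ddz (\<lambda>x. of_real (k x) * ddz g x) z) (at z)"
      if "twice_differentiable_on g {0<..<z0}" "0 < z" "z < z0" "k differentiable (at z)" for g z and k :: "real \<Rightarrow> real"
    proof -
      have "\<exists>k'. (k has_real_derivative k') (at z)" using that(4) by (simp add: real_differentiable_def)
      then obtain k' where "(k has_real_derivative k') (at z)" ..
      then have "((\<lambda>x. complex_of_real (k x)) has_vector_derivative of_real k') (at z)" by (rule has_vector_derivative_of_real)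
      moreover have "(ddz g has_vector_derivative ddz (ddz g) z) (at z)"
        using dif(2)[OF that(1-3)] by (simp add: vector_derivative_works)
      ultimately have "((\<lambda>x. of_real (k x) * ddz g x) has_vector_derivative of_real (k z) * ddz (ddz g) z + of_real k' * ddz g z) (at z)"
        by (rule has_vector_derivative_mult)
      then show ?thesis using vector_derivative_at by fastforce
    qed
    have kd: "(\<lambda>x. 1 / x ^ N * poly p x) differentiable (at z)" "(\<lambda>x. x ^ j * poly p x) differentiable (at z)" if "0 < z" for z :: real and j
    proof -
      have "(poly p has_real_derivative poly (pderiv p) z) (at z)" by (rule poly_DERIV)
      note 1 = DERIV_mult[OF inverse_power_derivative[OF that, of N] this] and 2 = DERIV_mult[OF DERIV_pow[of j z] this]
      show "(\<lambda>x. 1 / x ^ N * poly p x) differentiable (at z)" "(\<lambda>x. x ^ j * poly p x) differentiable (at z)"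
        using 1 2 real_differentiable_def by blast+
    qed
    show ?thesis
      unfolding psol_def comp_def
    proof (intro conjI allI impI)
      fix z assume z: "0 < z" "z < z0"
      let ?B = "Bc (A z) (Z z) (X z)"
      show "(A has_vector_derivative ddz A z) (at z)" "(Z has_vector_derivative ddz Z z) (at z)" "(X has_vector_derivative ddz X z) (at z)"
        using dif(1)[OF tA z] dif(1)[OF tZ z] dif(1)[OF tX z] by (simp_all add: vector_derivative_works)
      have Beq: "\<i> * of_real (real (N + 1) * \<mu> / z0 ^ (N + 1)) * A z + of_real ah * Z z + of_real (2 * a1 * c1) * X z = ?B"
        unfolding Bc_def by (simp only: q_def)
      have zn: "complex_of_real z \<noteq> 0" "complex_of_real (poly p z) \<noteq> 0" using z Fne[OF z] by auto
      show "((\<lambda>x. of_real (1 / x ^ N * poly p x) * ddz A x) has_vector_derivative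
          - of_real (\<omega>\<^sup>2 * (1 / z ^ N) / poly p z) * A z + - \<i> * of_real q * of_real (z ^ (N + 2)) * ?B) (at z)"
      proof (rule has_vector_derivative_eq_rhs[OF flux[OF tA z kd(1)[OF z(1)]]])
        have "of_real (z ^ N) * ddz (\<lambda>x. of_real (F x / x ^ N) * ddz A x) z + of_real (\<omega>\<^sup>2 / F z) * A z
          = of_real ((real (N + 1))\<^sup>2 * \<mu>\<^sup>2 * z ^ (2 * (N + 1)) / z0 ^ (2 * (N + 1))) * A z
            - \<i> * of_real (real (N + 1) * \<mu> * z ^ (2 * (N + 1)) / z0 ^ (N + 1)) * (of_real ah * Z z + of_real (2 * a1 * c1) * X z)"
          using that z unfolding perturbation_solution_def d(2-5) rd unfolding d(1) by auto
        \<comment> \<open>Because \<open>- \<i> * \<i> = 1\<close>, the mass term of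
          \<open>a\<close> joins the coupling to \<zeta> and \<xi>: all three equations share the
          source \<open>?B\<close>.\<close>
        also have "\<dots> = - \<i> * of_real (q * z ^ (2 * (N + 1))) * ?B"
        proof -
          have "(real (N + 1))\<^sup>2 * \<mu>\<^sup>2 * z ^ (2 * (N + 1)) / z0 ^ (2 * (N + 1)) = q * q * z ^ (2 * (N + 1))"
            unfolding q_def mult_2 power_add by (simp add: power2_eq_square field_simps)
          moreover have "real (N + 1) * \<mu> * z ^ (2 * (N + 1)) / z0 ^ (N + 1) = q * z ^ (2 * (N + 1))"
            unfolding q_def by simp
          moreover have "of_real (q * q * w) * u - \<i> * of_real (q * w) * (v + x) = - \<i> * of_real (q * w) * (\<i> * of_real q * u + v + x)"
            for w :: real and u v x :: complex by (simp add: algebra_simps)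
          ultimately show ?thesis unfolding Bc_def by (simp only:)
        qed
        finally have sum: "of_real (z ^ N) * ddz (\<lambda>x. of_real (F x / x ^ N) * ddz A x) z + of_real (\<omega>\<^sup>2 / F z) * A z = - \<i> * of_real (q * z ^ (2 * (N + 1))) * ?B" .
        have "x = - y - w" if "x + y = - w" for x y w :: complex using that by algebra
        from this[of _ "of_real (\<omega>\<^sup>2 / F z) * A z" "\<i> * of_real (q * z ^ (2 * (N + 1))) * ?B"] sum
        have eq: "of_real (z ^ N) * ddz (\<lambda>x. of_real (F x / x ^ N) * ddz A x) z = - (of_real (\<omega>\<^sup>2 / F z) * A z) - \<i> * of_real (q * z ^ (2 * (N + 1))) * ?B"
          unfolding mult_minus_left by blast
        have k: "(\<lambda>x. complex_of_real (1 / x ^ N * poly p x) * ddz A x) = (\<lambda>x. of_real (F x / x ^ N) * ddz A x)"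
          unfolding Fp by simp
        have p2: "z ^ (2 * (N + 1)) = z ^ N * z ^ (N + 2)" by (simp add: power_add[symmetric] mult_2)
        have "of_real (z ^ N) * ddz (\<lambda>x. of_real (1 / x ^ N * poly p x) * ddz A x) z
            = of_real (z ^ N) * (- of_real (\<omega>\<^sup>2 * (1 / z ^ N) / poly p z) * A z + - \<i> * of_real q * of_real (z ^ (N + 2)) * ?B)"
          unfolding k eq p2 unfolding Fp using zn by (simp add: field_simps)
        moreover have "complex_of_real (z ^ N) \<noteq> 0" using zn by simp
        ultimately show "ddz (\<lambda>x. of_real (1 / x ^ N * poly p x) * ddz A x) z
            = - of_real (\<omega>\<^sup>2 * (1 / z ^ N) / poly p z) * A z + - \<i> * of_real q * of_real (z ^ (N + 2)) * ?B"
          using mult_left_cancel by blast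
      qed
      show "((\<lambda>x. of_real (x ^ (N + 3) * poly p x) * ddz Z x) has_vector_derivative
          - of_real (\<omega>\<^sup>2 * z ^ (N + 3) / poly p z) * Z z + of_real ch * of_real (z ^ (N + 2)) * ?B) (at z)"
      proof (rule has_vector_derivative_eq_rhs[OF flux[OF tZ z kd(2)[OF z(1)]]])
        have "ddz (\<lambda>x. of_real (x ^ (N + 3) * F x) * ddz Z x) z / of_real (z ^ (N + 3)) + of_real (\<omega>\<^sup>2 / F z) * Z z
          = of_real (ch / z) * (\<i> * of_real (real (N + 1) * \<mu> / z0 ^ (N + 1)) * A z + of_real ah * Z z + of_real (2 * a1 * c1) * X z)"
          using that z unfolding perturbation_solution_def d(2-5) rd unfolding d(1) by auto
        then have "ddz (\<lambda>x. of_real (x ^ (N + 3) * F x) * ddz Z x) z / of_real (z ^ (N + 3)) = of_real (ch / z) * ?B - of_real (\<omega>\<^sup>2 / F z) * Z z"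
          unfolding Beq eq_diff_eq .
        then have "ddz (\<lambda>x. of_real (x ^ (N + 3) * F x) * ddz Z x) z = of_real (z ^ (N + 3)) * (of_real (ch / z) * ?B - of_real (\<omega>\<^sup>2 / F z) * Z z)"
          using zn by (simp add: field_simps)
        also have "\<dots> = - of_real (\<omega>\<^sup>2 * z ^ (N + 3) / poly p z) * Z z + of_real ch * of_real (z ^ (N + 2)) * ?B"
          unfolding Fp using zn by (simp add: field_simps eval_nat_numeral)
        finally show "ddz (\<lambda>x. of_real (x ^ (N + 3) * poly p x) * ddz Z x) z
            = - of_real (\<omega>\<^sup>2 * z ^ (N + 3) / poly p z) * Z z + of_real ch * of_real (z ^ (N + 2)) * ?B" unfolding Fp .
      qed
      show "((\<lambda>x. of_real (x ^ (N + 2) * poly p x) * ddz X x) has_vector_derivative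
          - of_real (\<omega>\<^sup>2 * z ^ (N + 2) / poly p z) * X z + of_real c1 * of_real (z ^ (N + 2)) * ?B) (at z)"
      proof (rule has_vector_derivative_eq_rhs[OF flux[OF tX z kd(2)[OF z(1)]]])
        have "ddz (\<lambda>x. of_real (x ^ (N + 2) * F x) * ddz X x) z / of_real (z ^ (N + 2)) + of_real (\<omega>\<^sup>2 / F z) * X z
          = of_real c1 * (\<i> * of_real (real (N + 1) * \<mu> / z0 ^ (N + 1)) * A z + of_real ah * Z z + of_real (2 * a1 * c1) * X z)"
          using that z unfolding perturbation_solution_def d(2-5) rd unfolding d(1) by auto
        then have "ddz (\<lambda>x. of_real (x ^ (N + 2) * F x) * ddz X x) z / of_real (z ^ (N + 2)) = of_real c1 * ?B - of_real (\<omega>\<^sup>2 / F z) * X z"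
          unfolding Beq eq_diff_eq .
        then have "ddz (\<lambda>x. of_real (x ^ (N + 2) * F x) * ddz X x) z = of_real (z ^ (N + 2)) * (of_real c1 * ?B - of_real (\<omega>\<^sup>2 / F z) * X z)"
          using zn by (simp add: field_simps)
        also have "\<dots> = - of_real (\<omega>\<^sup>2 * z ^ (N + 2) / poly p z) * X z + of_real c1 * of_real (z ^ (N + 2)) * ?B"
          unfolding Fp using zn by (simp add: field_simps)
        finally show "ddz (\<lambda>x. of_real (x ^ (N + 2) * poly p x) * ddz X x) z
            = - of_real (\<omega>\<^sup>2 * z ^ (N + 2) / poly p z) * X z + of_real c1 * of_real (z ^ (N + 2)) * ?B" unfolding Fp .
      qed
    qed
  qed
  have cond: "conductivity d \<omega> (a \<omega>) = of_nat (N + 1) * frobenius_coeff (a \<omega>) (N + 1) / (\<i> * of_real \<omega> * frobenius_coeff (a \<omega>) 0)" for \<omega>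
    unfolding conductivity_def d(2) rd by simp
  have limit_eq: "1 / z0 ^ (d - 3) * (1 + (real d - 2)\<^sup>2 * \<mu>\<^sup>2 / (2 * a1 * c1\<^sup>2 + ah * ch / z0)) = sigma0"
  proof -
    have D1: "2 * a1 * c1\<^sup>2 + ah * ch / z0 = Dn / z0" unfolding Dn_def using \<open>z0 > 0\<close> by (simp add: field_simps)
    \<comment> \<open>The power count that turns \<open>q^2 * z0 ^ (N + 3)\<close> into
      \<open>z0 / z0 ^ N\<close>; the spare factor \<open>z0\<close> turns \<open>Dn\<close> into
      the denominator of the stated formula.\<close>
    have "z0 ^ (N + 3) * z0 ^ N = z0 * (z0 ^ (N + 1))\<^sup>2" by (simp add: power2_eq_square eval_nat_numeral)
    then have "z0 ^ (N + 3) / (z0 ^ (N + 1))\<^sup>2 = z0 / z0 ^ N" using \<open>z0 > 0\<close> by (simp add: field_simps)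
    then have "q\<^sup>2 * z0 ^ (N + 3) = (real (N + 1))\<^sup>2 * \<mu>\<^sup>2 * (z0 / z0 ^ N)"
      unfolding q_def power_divide power_mult_distrib times_divide_eq_left by (simp only: times_divide_eq_right[symmetric])
    then show ?thesis unfolding sigma0_def d(3) rd D1 using Dn_pos \<open>z0 > 0\<close> by (simp add: distrib_left)
  qed
  show ?thesis
    unfolding limit_eq
  proof (rule tendstoI)
    fix \<epsilon> :: real assume "\<epsilon> > 0"
    then have "\<epsilon> / 2 > 0" by simp
    from conductivity_estimate[OF this] obtain \<delta> where \<delta>: "\<delta> > 0" and est: "\<And>\<omega> a \<zeta> \<xi> a' \<zeta>' \<xi>'. \<omega> \<noteq> 0 \<Longrightarrow> \<bar>\<omega>\<bar> < \<delta> \<Longrightarrow> psol \<omega> z0 a \<zeta> \<xi> a' \<zeta>' \<xi>' \<Longrightarrow>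
      ingoing z0 (poly p) \<omega> a \<Longrightarrow> ingoing z0 (poly p) \<omega> \<zeta> \<Longrightarrow> ingoing z0 (poly p) \<omega> \<xi> \<Longrightarrow> no_scalar_source \<zeta> \<xi> \<Longrightarrow>
      frobenius_coeff a 0 \<noteq> 0 \<Longrightarrow>
      norm (of_nat (N + 1) * frobenius_coeff a (N + 1) / (\<i> * of_real \<omega> * frobenius_coeff a 0) - of_real sigma0) \<le> \<epsilon> / 2"
      by blast
    have "\<forall>\<^sub>F \<omega> in at 0. \<omega> \<noteq> 0 \<and> \<bar>\<omega>\<bar> < \<delta>"
      unfolding eventually_at using \<delta> by (intro exI[of _ \<delta>]) (auto simp: dist_real_def)
    then show "\<forall>\<^sub>F \<omega> in at 0. dist (conductivity d \<omega> (a \<omega>)) (complex_of_real sigma0) < \<epsilon>"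
      using solutions
    proof eventually_elim
      case (elim \<omega>)
      then have "norm (of_nat (N + 1) * frobenius_coeff (a \<omega>) (N + 1) / (\<i> * of_real \<omega> * frobenius_coeff (a \<omega>) 0) - of_real sigma0) \<le> \<epsilon> / 2"
        using est[OF _ _ ps[of \<omega> "a \<omega>" "\<zeta> \<omega>" "\<xi> \<omega>"]] unfolding Fp by blast
      then show ?case using \<open>\<epsilon> > 0\<close> unfolding cond dist_norm by linarith
    qed
  qed
qed

end
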